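(* Let $\mathbb{X}$ be an exact Mal'tsev category, $n\geq 1$, and let $F$ be an $n$-fork in $\mathbb{X}$. Then the following conditions are equivalent: (i) $F$ is a $3^n$-diagram: all forks in the diagram $F$ in $\mathbb{X}$ are exact; (ii) $F=\mathrm{EqFork}^n(\mathrm{arr}^n(F))$ and $\mathrm{arr}^n(F)$ is an $n$-cubic extension; (iii) $F=\mathrm{CoeqFork}^n(\mathrm{grph}^n(F))$ and $\mathrm{grph}^n(F)$ is a distributive parallelistic $n$-fold equivalence relation; (iv) $F=\mathrm{EqFork}^n(\mathrm{arr}^n(F))$ and $F=\mathrm{CoeqFork}^n(\mathrm{grph}^n(F))$.
   Context: An exact Mal'tsev category is a Barr exact category in which every (internal) reflexive relation is an equivalence relation; in it every reflexive graph has a coequaliser, and equivalence relations on an object form a lattice with $R\vee S=RS=SR$. We write $n=\{0,\dots,n-1\}$. Forks: a (reflexive) fork $F$ in a category consists of arrows $d,c\colon F_2\rightrightarrows F_1$, $e\colon F_1\to F_2$, $f\colon F_1\to F_0$ with $fd=fc$ and $de=1_{F_1}=ce$; equivalently, it is a functor $(\mathsf{3}^+)^{\mathrm{op}}\to\mathbb{X}$ where $\mathsf{3}^+$ is the full subcategory of the category of finite ordinals and order-preserving maps on the objects $0,1,2$. The fork is exact when $(d,c)$ is the kernel pair of $f$ (with $e$ the diagonal) and $f$ is the coequaliser of $(d,c)$. $\mathsf{Fork}^n(\mathbb{X})=\mathsf{Fork}(\mathsf{Fork}^{n-1}(\mathbb{X}))\simeq \mathrm{Fun}(((\mathsf{3}^+)^{\mathrm{op}})^n,\mathbb{X})$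 is the category of $n$-forks. An $n$-fork is exact, also called a $3^n$-diagram, when for each of the $n$ directions and each choice of values in $\{0,1,2\}$ for the other coordinates, the resulting fork in $\mathbb{X}$ is exact. Functors: $\mathsf{Arr}^n(\mathbb{X})$ is the category of $n$-fold arrows (commutative $n$-cubes) and $\mathsf{RGrph}^n(\mathbb{X})$ the category of $n$-fold reflexive graphs, both obtained by iterating $\mathsf{Arr}$ and $\mathsf{RGrph}$. $\mathrm{arr}^n(F)$ (resp. $\mathrm{grph}^n(F)$) is the restriction of $F$ to the objects whose coordinates are all in $\{0,1\}$ (resp. $\{1,2\}$). $\mathrm{EqFork}^n$, the right adjoint of $\mathrm{arr}^n$, completes an $n$-fold arrow to an $n$-fork by taking kernel pairs successively in all directions: $\mathrm{EqFork}$ sends $f$ to the fork consisting of $f$ and its kernel pair, and $\mathrm{EqFork}^n=\mathrm{EqFork}\circ\mathsf{Arr}(\mathrm{EqFork}^{n-1})$. $\mathrm{CoeqFork}^n$, the left adjoint of $\mathrm{grph}^n$, completes an $n$-fold reflexive graph to an $n$-fork by taking coequalisers successively in all directions: $\mathrm{CoeqFork}$ sends $(d,c,e)$ to the fork obtained by adding the coequaliser of $d,c$, and $\mathrm{CoeqFork}^n=\mathsf{Fork}(\mathrm{CoeqFork}^{n-1})\circ\mathrm{CoeqFork}$. The equalities $F=\mathrm{EqFork}^n(\mathrm{arr}^n(F))$ and $F=\mathrm{CoeqFork}^n(\mathrm{grph}^n(F))$ are understood up to canonical isomorphism, i.e. the unit $F\to\mathrm{EqFork}^n(\mathrm{arr}^n(F))$,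 respectively the counit $\mathrm{CoeqFork}^n(\mathrm{grph}^n(F))\to F$, is an isomorphism. Cubic extensions: a $1$-cubic extension is a regular epimorphism in $\mathbb{X}$. For $n\geq 2$, an $n$-fold arrow, viewed as a commutative square in $\mathsf{Arr}^{n-2}(\mathbb{X})$, is an $n$-cubic extension when its four sides and the induced comparison from its initial corner to the pullback are all $(n-1)$-cubic extensions. Parallelistic: given equivalence relations $R_0,\dots,R_{n-1}$ on an object $X$, $\square_{i\in n}R_i$ denotes the largest $n$-fold equivalence relation on them (an $n$-fold equivalence relation being an object of $\mathsf{ERel}^n(\mathbb{X})=\mathsf{ERel}(\mathsf{ERel}^{n-1}(\mathbb{X}))\subseteq\mathsf{RGrph}^n(\mathbb{X})$); its top object is the subobject of $X^{2^n}$ of families $(x_a)_{a\in\{0,1\}^n}$ such that $x_aR_ix_b$ whenever $a$ and $b$ differ only in coordinate $i$. An $n$-fold equivalence relation is parallelistic when it is isomorphic to some $\square_{i\in n}R_i$. Distributive: a collection $(R_i)_{i\in n}$ of equivalence relations on $X$ is distributive when, for all $k\geq 1$ and all $J_0,J_1,\dots,J_k\subseteq n$ with $J_i\cap J_j=\emptyset$ for $i\neq j$, $$\Big(\bigwedge_{j\in J_0}R_j\Big)\wedge\bigvee_{i=1}^k\Big(\bigwedge_{j\in J_i}R_j\Big)=\bigvee_{i=1}^k\Big(\bigwedge_{j\in J_0\cup J_i}R_j\Big)$$ (an empty meet being the largest relation). $\square_{i\in n}R_i$ is distributive when $(R_i)_{i\in n}$ is. *)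

theory Defs
  imports Main
begin

section \<open>Categories\<close>

record ('o, 'm) cat =
  Obj :: "'o set"
  Mor :: "'m set"
  Dom :: "'m \<Rightarrow> 'o"
  Cod :: "'m \<Rightarrow> 'o"
  Id :: "'o \<Rightarrow> 'm"
  Comp :: "'m \<Rightarrow> 'm \<Rightarrow> 'm"  \<comment> \<open>\<open>Comp C g f\<close> is g after f; meaningful only for composable arrows\<close>

definition Hom :: "('o, 'm) cat \<Rightarrow> 'o \<Rightarrow> 'o \<Rightarrow> 'm set" where
  "Hom C a b = {f \<in> Mor C. Dom C f = a \<and> Cod C f = b}"

definition category :: "('o, 'm) cat \<Rightarrow> bool" where
  "category C \<longleftrightarrow>
    (\<forall>f \<in> Mor C. Dom C f \<in> Obj C \<and> Cod C f \<in> Obj C) \<and>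
    (\<forall>a \<in> Obj C. Id C a \<in> Hom C a a) \<and>
    (\<forall>f \<in> Mor C. \<forall>g \<in> Mor C. Cod C f = Dom C g \<longrightarrow> Comp C g f \<in> Hom C (Dom C f) (Cod C g)) \<and>
    (\<forall>f \<in> Mor C. Comp C f (Id C (Dom C f)) = f \<and> Comp C (Id C (Cod C f)) f = f) \<and>
    (\<forall>f \<in> Mor C. \<forall>g \<in> Mor C. \<forall>h \<in> Mor C. Cod C f = Dom C g \<and> Cod C g = Dom C h \<longrightarrow>
        Comp C h (Comp C g f) = Comp C (Comp C h g) f)"

definition iso :: "('o, 'm) cat \<Rightarrow> 'm \<Rightarrow> bool" where
  "iso C f \<longleftrightarrow> f \<in> Mor C \<and>
    (\<exists>g \<in> Hom C (Cod C f) (Dom C f).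
       Comp C g f = Id C (Dom C f) \<and> Comp C f g = Id C (Cod C f))"

definition isomorphic :: "('o, 'm) cat \<Rightarrow> 'o \<Rightarrow> 'o \<Rightarrow> bool" where
  "isomorphic C a b \<longleftrightarrow> (\<exists>f \<in> Hom C a b. iso C f)"

definition terminal :: "('o, 'm) cat \<Rightarrow> 'o \<Rightarrow> bool" where
  "terminal C t \<longleftrightarrow> t \<in> Obj C \<and> (\<forall>a \<in> Obj C. \<exists>!f. f \<in> Hom C a t)"

text \<open>\<open>is_pullback C f g p q\<close>: the square with f after p equal to g after q is a pullback.\<close>

definition is_pullback :: "('o, 'm) cat \<Rightarrow> 'm \<Rightarrow> 'm \<Rightarrow> 'm \<Rightarrow> 'm \<Rightarrow> bool" where
  "is_pullback C f g p q \<longleftrightarrow>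
    f \<in> Mor C \<and> g \<in> Mor C \<and> p \<in> Mor C \<and> q \<in> Mor C \<and>
    Cod C f = Cod C g \<and> Dom C p = Dom C q \<and> Cod C p = Dom C f \<and> Cod C q = Dom C g \<and>
    Comp C f p = Comp C g q \<and>
    (\<forall>u \<in> Mor C. \<forall>v \<in> Mor C.
       Dom C u = Dom C v \<and> Cod C u = Dom C f \<and> Cod C v = Dom C g \<and> Comp C f u = Comp C g v \<longrightarrow>
       (\<exists>!h. h \<in> Hom C (Dom C u) (Dom C p) \<and> Comp C p h = u \<and> Comp C q h = v))"

definition is_kernel_pair :: "('o, 'm) cat \<Rightarrow> 'm \<Rightarrow> 'm \<Rightarrow> 'm \<Rightarrow> bool" where
  "is_kernel_pair C f d c \<longleftrightarrow> is_pullback C f f d c"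

definition is_coequaliser :: "('o, 'm) cat \<Rightarrow> 'm \<Rightarrow> 'm \<Rightarrow> 'm \<Rightarrow> bool" where
  "is_coequaliser C d c q \<longleftrightarrow>
    d \<in> Mor C \<and> c \<in> Mor C \<and> q \<in> Mor C \<and>
    Dom C d = Dom C c \<and> Cod C d = Cod C c \<and> Dom C q = Cod C d \<and>
    Comp C q d = Comp C q c \<and>
    (\<forall>g \<in> Mor C. Dom C g = Cod C d \<and> Comp C g d = Comp C g c \<longrightarrow>
       (\<exists>!h. h \<in> Hom C (Cod C q) (Cod C g) \<and> Comp C h q = g))"

definition regular_epi :: "('o, 'm) cat \<Rightarrow> 'm \<Rightarrow> bool" where
  "regular_epi C f \<longleftrightarrow> (\<exists>d c. is_coequaliser C d c f)"

definition has_finite_limits :: "('o, 'm) cat \<Rightarrow> bool" where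
  "has_finite_limits C \<longleftrightarrow>
    (\<exists>t. terminal C t) \<and>
    (\<forall>f \<in> Mor C. \<forall>g \<in> Mor C. Cod C f = Cod C g \<longrightarrow> (\<exists>p q. is_pullback C f g p q))"

definition regular_category :: "('o, 'm) cat \<Rightarrow> bool" where
  "regular_category C \<longleftrightarrow> category C \<and> has_finite_limits C \<and>
    (\<forall>f d c. is_kernel_pair C f d c \<longrightarrow> (\<exists>q. is_coequaliser C d c q)) \<and>
    (\<forall>f g p q. is_pullback C f g p q \<and> regular_epi C f \<longrightarrow> regular_epi C q)"


section \<open>Internal relations\<close>

definition relation :: "('o, 'm) cat \<Rightarrow> 'm \<Rightarrow> 'm \<Rightarrow> bool" where
  "relation C d c \<longleftrightarrow>
    d \<in> Mor C \<and> c \<in> Mor C \<and> Dom C d = Dom C c \<and> Cod C d = Cod C c \<and>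
    (\<forall>u \<in> Mor C. \<forall>v \<in> Mor C. Dom C u = Dom C v \<and> Cod C u = Dom C d \<and> Cod C v = Dom C d \<and>
       Comp C d u = Comp C d v \<and> Comp C c u = Comp C c v \<longrightarrow> u = v)"

definition reflexive_relation :: "('o, 'm) cat \<Rightarrow> 'm \<Rightarrow> 'm \<Rightarrow> bool" where
  "reflexive_relation C d c \<longleftrightarrow> relation C d c \<and>
    (\<exists>e \<in> Hom C (Cod C d) (Dom C d). Comp C d e = Id C (Cod C d) \<and> Comp C c e = Id C (Cod C d))"

text \<open>Transitivity is expressed with generalised elements, which amounts to a factorisation
  from the pullback of c and d whenever that pullback exists.\<close>

definition equivalence_relation :: "('o, 'm) cat \<Rightarrow> 'm \<Rightarrow> 'm \<Rightarrow> bool" where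
  "equivalence_relation C d c \<longleftrightarrow> reflexive_relation C d c \<and>
    (\<exists>s \<in> Hom C (Dom C d) (Dom C d). Comp C d s = c \<and> Comp C c s = d) \<and>
    (\<forall>u \<in> Mor C. \<forall>v \<in> Mor C. Dom C u = Dom C v \<and> Cod C u = Dom C d \<and> Cod C v = Dom C d \<and>
       Comp C c u = Comp C d v \<longrightarrow>
       (\<exists>w \<in> Hom C (Dom C u) (Dom C d). Comp C d w = Comp C d u \<and> Comp C c w = Comp C c v))"

definition exact_category :: "('o, 'm) cat \<Rightarrow> bool" where
  "exact_category C \<longleftrightarrow> regular_category C \<and>
    (\<forall>d c. equivalence_relation C d c \<longrightarrow> (\<exists>f. is_kernel_pair C f d c))"

definition exact_Maltsev :: "('o, 'm) cat \<Rightarrow> bool" where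
  "exact_Maltsev C \<longleftrightarrow> exact_category C \<and>
    (\<forall>d c. reflexive_relation C d c \<longrightarrow> equivalence_relation C d c)"


section \<open>Arrows, reflexive graphs, forks\<close>

text \<open>A single type holding the objects and the arrows of all the categories obtained from
  a category with objects \<open>'o\<close> and arrows \<open>'m\<close> by iterating the constructions \<open>Arr\<close>,
  \<open>RGrph\<close>, \<open>ERel\<close>, \<open>Fork\<close>, so that these can be iterated a variable number of times.
  An object of \<open>Arr C\<close> is just an arrow of \<open>C\<close>. The constructors \<open>Sq\<close>, \<open>RgMor\<close>, \<open>FkMor\<close>
  are the arrows: they record domain, codomain and components, the components being indexed
  by the coordinates 2 (kernel pair or edge object), 1 and 0.\<close>

datatype ('o, 'm) cell =
    BOb (the_ob: 'o)
  | BMor (the_mor: 'm)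
  | Sq (sq_dom: "('o, 'm) cell") (sq_cod: "('o, 'm) cell")
       (sq1: "('o, 'm) cell") (sq0: "('o, 'm) cell")
  | Rg (rg_d: "('o, 'm) cell") (rg_c: "('o, 'm) cell") (rg_e: "('o, 'm) cell")
  | RgMor (rg_dom: "('o, 'm) cell") (rg_cod: "('o, 'm) cell")
       (rg2: "('o, 'm) cell") (rg1: "('o, 'm) cell")
  | Fk (fk_d: "('o, 'm) cell") (fk_c: "('o, 'm) cell")
       (fk_e: "('o, 'm) cell") (fk_f: "('o, 'm) cell")
  | FkMor (fk_dom: "('o, 'm) cell") (fk_cod: "('o, 'm) cell")
       (fk2: "('o, 'm) cell") (fk1: "('o, 'm) cell") (fk0: "('o, 'm) cell")

type_synonym ('o, 'm) ccat = "(('o, 'm) cell, ('o, 'm) cell) cat"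

definition base :: "('o, 'm) cat \<Rightarrow> ('o, 'm) ccat" where
  "base X = \<lparr>
    Obj = BOb ` Obj X,
    Mor = BMor ` Mor X,
    Dom = (\<lambda>f. BOb (Dom X (the_mor f))),
    Cod = (\<lambda>f. BOb (Cod X (the_mor f))),
    Id = (\<lambda>a. BMor (Id X (the_ob a))),
    Comp = (\<lambda>g f. BMor (Comp X (the_mor g) (the_mor f)))\<rparr>"

definition Arr :: "('o, 'm) ccat \<Rightarrow> ('o, 'm) ccat" where
  "Arr C = \<lparr>
    Obj = Mor C,
    Mor = {Sq f g x1 x0 | f g x1 x0.
             f \<in> Mor C \<and> g \<in> Mor C \<and>
             x1 \<in> Hom C (Dom C f) (Dom C g) \<and> x0 \<in> Hom C (Cod C f) (Cod C g) \<and>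
             Comp C g x1 = Comp C x0 f},
    Dom = sq_dom,
    Cod = sq_cod,
    Id = (\<lambda>f. Sq f f (Id C (Dom C f)) (Id C (Cod C f))),
    Comp = (\<lambda>y x. Sq (sq_dom x) (sq_cod y) (Comp C (sq1 y) (sq1 x)) (Comp C (sq0 y) (sq0 x)))\<rparr>"

definition is_rgraph :: "('o, 'm) cat \<Rightarrow> 'm \<Rightarrow> 'm \<Rightarrow> 'm \<Rightarrow> bool" where
  "is_rgraph C d c e \<longleftrightarrow>
    d \<in> Mor C \<and> c \<in> Hom C (Dom C d) (Cod C d) \<and> e \<in> Hom C (Cod C d) (Dom C d) \<and>
    Comp C d e = Id C (Cod C d) \<and> Comp C c e = Id C (Cod C d)"

definition RGrph :: "('o, 'm) ccat \<Rightarrow> ('o, 'm) ccat" where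
  "RGrph C = \<lparr>
    Obj = {Rg d c e | d c e. is_rgraph C d c e},
    Mor = {RgMor (Rg d c e) (Rg d' c' e') x2 x1 | d c e d' c' e' x2 x1.
             is_rgraph C d c e \<and> is_rgraph C d' c' e' \<and>
             x2 \<in> Hom C (Dom C d) (Dom C d') \<and> x1 \<in> Hom C (Cod C d) (Cod C d') \<and>
             Comp C d' x2 = Comp C x1 d \<and> Comp C c' x2 = Comp C x1 c \<and>
             Comp C e' x1 = Comp C x2 e},
    Dom = rg_dom,
    Cod = rg_cod,
    Id = (\<lambda>G. RgMor G G (Id C (Dom C (rg_d G))) (Id C (Cod C (rg_d G)))),
    Comp = (\<lambda>y x. RgMor (rg_dom x) (rg_cod y)
                    (Comp C (rg2 y) (rg2 x)) (Comp C (rg1 y) (rg1 x)))\<rparr>"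

definition ERel :: "('o, 'm) ccat \<Rightarrow> ('o, 'm) ccat" where
  "ERel C = (let E = {Rg d c e | d c e. is_rgraph C d c e \<and> equivalence_relation C d c}
     in (RGrph C)\<lparr>Obj := E, Mor := {x \<in> Mor (RGrph C). rg_dom x \<in> E \<and> rg_cod x \<in> E}\<rparr>)"

definition is_fork :: "('o, 'm) cat \<Rightarrow> 'm \<Rightarrow> 'm \<Rightarrow> 'm \<Rightarrow> 'm \<Rightarrow> bool" where
  "is_fork C d c e f \<longleftrightarrow>
    is_rgraph C d c e \<and> f \<in> Mor C \<and> Dom C f = Cod C d \<and> Comp C f d = Comp C f c"

definition Fork :: "('o, 'm) ccat \<Rightarrow> ('o, 'm) ccat" where
  "Fork C = \<lparr>
    Obj = {Fk d c e f | d c e f. is_fork C d c e f},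
    Mor = {FkMor (Fk d c e f) (Fk d' c' e' f') x2 x1 x0 | d c e f d' c' e' f' x2 x1 x0.
             is_fork C d c e f \<and> is_fork C d' c' e' f' \<and>
             x2 \<in> Hom C (Dom C d) (Dom C d') \<and> x1 \<in> Hom C (Cod C d) (Cod C d') \<and>
             x0 \<in> Hom C (Cod C f) (Cod C f') \<and>
             Comp C d' x2 = Comp C x1 d \<and> Comp C c' x2 = Comp C x1 c \<and>
             Comp C e' x1 = Comp C x2 e \<and> Comp C f' x1 = Comp C x0 f},
    Dom = fk_dom,
    Cod = fk_cod,
    Id = (\<lambda>F. FkMor F F (Id C (Dom C (fk_d F))) (Id C (Cod C (fk_d F))) (Id C (Cod C (fk_f F)))),
    Comp = (\<lambda>y x. FkMor (fk_dom x) (fk_cod y)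
              (Comp C (fk2 y) (fk2 x)) (Comp C (fk1 y) (fk1 x)) (Comp C (fk0 y) (fk0 x)))\<rparr>"

text \<open>The outermost iteration is direction 0.\<close>

definition Arr_n :: "('o, 'm) cat \<Rightarrow> nat \<Rightarrow> ('o, 'm) ccat" where
  "Arr_n X n = (Arr ^^ n) (base X)"

definition RGrph_n :: "('o, 'm) cat \<Rightarrow> nat \<Rightarrow> ('o, 'm) ccat" where
  "RGrph_n X n = (RGrph ^^ n) (base X)"

definition ERel_n :: "('o, 'm) cat \<Rightarrow> nat \<Rightarrow> ('o, 'm) ccat" where
  "ERel_n X n = (ERel ^^ n) (base X)"

definition Fork_n :: "('o, 'm) cat \<Rightarrow> nat \<Rightarrow> ('o, 'm) ccat" where
  "Fork_n X n = (Fork ^^ n) (base X)"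


section \<open>Functors\<close>

record 'c func =
  fob :: "'c \<Rightarrow> 'c"
  fmor :: "'c \<Rightarrow> 'c"

definition id_func :: "'c func" where
  "id_func = \<lparr>fob = (\<lambda>a. a), fmor = (\<lambda>x. x)\<rparr>"

definition comp_func :: "'c func \<Rightarrow> 'c func \<Rightarrow> 'c func" where
  "comp_func G F = \<lparr>fob = fob G \<circ> fob F, fmor = fmor G \<circ> fmor F\<rparr>"

definition Arr_map :: "('o, 'm) cell func \<Rightarrow> ('o, 'm) cell func" where
  "Arr_map P = \<lparr>
    fob = fmor P,
    fmor = (\<lambda>x. Sq (fmor P (sq_dom x)) (fmor P (sq_cod x)) (fmor P (sq1 x)) (fmor P (sq0 x)))\<rparr>"

definition RGrph_map :: "('o, 'm) cell func \<Rightarrow> ('o, 'm) cell func" where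
  "RGrph_map P = (let ob = (\<lambda>G. Rg (fmor P (rg_d G)) (fmor P (rg_c G)) (fmor P (rg_e G))) in \<lparr>
    fob = ob,
    fmor = (\<lambda>x. RgMor (ob (rg_dom x)) (ob (rg_cod x)) (fmor P (rg2 x)) (fmor P (rg1 x)))\<rparr>)"

definition Fork_map :: "('o, 'm) cell func \<Rightarrow> ('o, 'm) cell func" where
  "Fork_map P =
    (let ob = (\<lambda>F. Fk (fmor P (fk_d F)) (fmor P (fk_c F)) (fmor P (fk_e F)) (fmor P (fk_f F))) in \<lparr>
    fob = ob,
    fmor = (\<lambda>x. FkMor (ob (fk_dom x)) (ob (fk_cod x))
                  (fmor P (fk2 x)) (fmor P (fk1 x)) (fmor P (fk0 x)))\<rparr>)"

definition arr :: "('o, 'm) cell func" where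
  "arr = \<lparr>fob = fk_f,
    fmor = (\<lambda>x. Sq (fk_f (fk_dom x)) (fk_f (fk_cod x)) (fk1 x) (fk0 x))\<rparr>"

definition grph :: "('o, 'm) cell func" where
  "grph = (let ob = (\<lambda>F. Rg (fk_d F) (fk_c F) (fk_e F)) in
    \<lparr>fob = ob, fmor = (\<lambda>x. RgMor (ob (fk_dom x)) (ob (fk_cod x)) (fk2 x) (fk1 x))\<rparr>)"

primrec arr_n :: "nat \<Rightarrow> ('o, 'm) cell func" where
  "arr_n 0 = id_func"
| "arr_n (Suc n) = comp_func (Arr_map (arr_n n)) arr"

primrec grph_n :: "nat \<Rightarrow> ('o, 'm) cell func" where
  "grph_n 0 = id_func"
| "grph_n (Suc n) = comp_func (RGrph_map (grph_n n)) grph"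

definition EqFork :: "('o, 'm) ccat \<Rightarrow> ('o, 'm) cell func" where
  "EqFork C =
    (let ob = (\<lambda>f. SOME F. F \<in> Obj (Fork C) \<and> fk_f F = f \<and> is_kernel_pair C f (fk_d F) (fk_c F)) in \<lparr>
    fob = ob,
    fmor = (\<lambda>x. THE y. y \<in> Hom (Fork C) (ob (sq_dom x)) (ob (sq_cod x)) \<and>
                       fk1 y = sq1 x \<and> fk0 y = sq0 x)\<rparr>)"

definition CoeqFork :: "('o, 'm) ccat \<Rightarrow> ('o, 'm) cell func" where
  "CoeqFork C =
    (let ob = (\<lambda>G. SOME F. F \<in> Obj (Fork C) \<and> fob grph F = G \<and>
                          is_coequaliser C (rg_d G) (rg_c G) (fk_f F)) in \<lparr>
    fob = ob,
    fmor = (\<lambda>x. THE y. y \<in> Hom (Fork C) (ob (rg_dom x)) (ob (rg_cod x)) \<and>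
                       fk2 y = rg2 x \<and> fk1 y = rg1 x)\<rparr>)"

primrec EqFork_n :: "('o, 'm) cat \<Rightarrow> nat \<Rightarrow> ('o, 'm) cell func" where
  "EqFork_n X 0 = id_func"
| "EqFork_n X (Suc n) = comp_func (EqFork (Fork_n X n)) (Arr_map (EqFork_n X n))"

primrec CoeqFork_n :: "('o, 'm) cat \<Rightarrow> nat \<Rightarrow> ('o, 'm) cell func" where
  "CoeqFork_n X 0 = id_func"
| "CoeqFork_n X (Suc n) = comp_func (Fork_map (CoeqFork_n X n)) (CoeqFork (RGrph_n X n))"

text \<open>With the choices made in \<open>EqFork\<close> and \<open>CoeqFork\<close>, the counit
  from \<open>arr_n\<close> after \<open>EqFork_n\<close> to the identity and the unit from the identity to
  \<open>grph_n\<close> after \<open>CoeqFork_n\<close> are identities. By the triangle identities the unit at \<open>F\<close>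
  of the first adjunction (the counit at \<open>F\<close> of the second) is thus the unique arrow lying
  over the identity of \<open>arr_n F\<close> (of \<open>grph_n F\<close>).\<close>

definition EqFork_unit :: "('o, 'm) cat \<Rightarrow> nat \<Rightarrow> ('o, 'm) cell \<Rightarrow> ('o, 'm) cell \<Rightarrow> bool" where
  "EqFork_unit X n F u \<longleftrightarrow>
    u \<in> Hom (Fork_n X n) F (fob (EqFork_n X n) (fob (arr_n n) F)) \<and>
    fmor (arr_n n) u = Id (Arr_n X n) (fob (arr_n n) F)"

definition CoeqFork_counit :: "('o, 'm) cat \<Rightarrow> nat \<Rightarrow> ('o, 'm) cell \<Rightarrow> ('o, 'm) cell \<Rightarrow> bool" where
  "CoeqFork_counit X n F v \<longleftrightarrow>
    v \<in> Hom (Fork_n X n) (fob (CoeqFork_n X n) (fob (grph_n n) F)) F \<and>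
    fmor (grph_n n) v = Id (RGrph_n X n) (fob (grph_n n) F)"

definition is_EqFork_n :: "('o, 'm) cat \<Rightarrow> nat \<Rightarrow> ('o, 'm) cell \<Rightarrow> bool" where
  "is_EqFork_n X n F \<longleftrightarrow> (\<exists>u. EqFork_unit X n F u \<and> iso (Fork_n X n) u)"

definition is_CoeqFork_n :: "('o, 'm) cat \<Rightarrow> nat \<Rightarrow> ('o, 'm) cell \<Rightarrow> bool" where
  "is_CoeqFork_n X n F \<longleftrightarrow> (\<exists>v. CoeqFork_counit X n F v \<and> iso (Fork_n X n) v)"


section \<open>Exact n-forks\<close>

definition exact_fork :: "('o, 'm) ccat \<Rightarrow> ('o, 'm) cell \<Rightarrow> bool" where
  "exact_fork C F \<longleftrightarrow> F \<in> Obj (Fork C) \<and>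
    is_kernel_pair C (fk_f F) (fk_d F) (fk_c F) \<and> is_coequaliser C (fk_d F) (fk_c F) (fk_f F)"

definition fk_vertex :: "('o, 'm) ccat \<Rightarrow> nat \<Rightarrow> ('o, 'm) cell \<Rightarrow> ('o, 'm) cell" where
  "fk_vertex C k F =
    (if k = 0 then Cod C (fk_f F) else if k = 1 then Cod C (fk_d F) else Dom C (fk_d F))"

definition fk_component :: "nat \<Rightarrow> ('o, 'm) cell \<Rightarrow> ('o, 'm) cell" where
  "fk_component k x = (if k = 0 then fk0 x else if k = 1 then fk1 x else fk2 x)"

text \<open>The component at coordinates \<open>a 0, \<dots>, a (n - 1)\<close> of an arrow of n-forks.\<close>

primrec component_at :: "nat \<Rightarrow> (nat \<Rightarrow> nat) \<Rightarrow> ('o, 'm) cell \<Rightarrow> ('o, 'm) cell" where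
  "component_at 0 a x = x"
| "component_at (Suc n) a x = component_at n (\<lambda>j. a (Suc j)) (fk_component (a 0) x)"

text \<open>The fork in the base category that runs in direction \<open>i < n\<close> of an n-fork, the other
  coordinates being given by \<open>a\<close> (the value \<open>a i\<close> is not used).\<close>

primrec fork_in_direction ::
  "('o, 'm) cat \<Rightarrow> nat \<Rightarrow> nat \<Rightarrow> (nat \<Rightarrow> nat) \<Rightarrow> ('o, 'm) cell \<Rightarrow> ('o, 'm) cell" where
  "fork_in_direction X 0 i a F = F"
| "fork_in_direction X (Suc n) i a F =
    (let a' = (\<lambda>j. a (Suc j)) in
     case i of
       0 \<Rightarrow> Fk (component_at n a' (fk_d F)) (component_at n a' (fk_c F))
               (component_at n a' (fk_e F)) (component_at n a' (fk_f F))
     | Suc i' \<Rightarrow> fork_in_direction X n i' a' (fk_vertex (Fork_n X n) (a 0) F))"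

definition exact_n_fork :: "('o, 'm) cat \<Rightarrow> nat \<Rightarrow> ('o, 'm) cell \<Rightarrow> bool" where
  "exact_n_fork X n F \<longleftrightarrow> F \<in> Obj (Fork_n X n) \<and>
    (\<forall>i<n. \<forall>a. (\<forall>j. a j \<in> {0, 1, 2}) \<longrightarrow> exact_fork (base X) (fork_in_direction X n i a F))"


section \<open>Cubic extensions\<close>

text \<open>An object \<open>Sq f g x1 x0\<close> of \<open>Arr_n X (n + 2)\<close> is a commutative square in \<open>Arr_n X n\<close>,
  with initial corner \<open>Dom f\<close>, in which g after x1 equals x0 after f.
  The value at n = 0 plays no role.\<close>

fun cubic_extension :: "('o, 'm) cat \<Rightarrow> nat \<Rightarrow> ('o, 'm) cell \<Rightarrow> bool" where
  "cubic_extension X 0 A = False"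
| "cubic_extension X (Suc 0) A = (A \<in> Mor (base X) \<and> regular_epi X (the_mor A))"
| "cubic_extension X (Suc (Suc n)) A =
    (A \<in> Obj (Arr_n X (Suc (Suc n))) \<and>
     cubic_extension X (Suc n) (sq_dom A) \<and> cubic_extension X (Suc n) (sq_cod A) \<and>
     cubic_extension X (Suc n) (sq1 A) \<and> cubic_extension X (Suc n) (sq0 A) \<and>
     (\<exists>p q k. is_pullback (Arr_n X n) (sq_cod A) (sq0 A) p q \<and>
        k \<in> Hom (Arr_n X n) (Dom (Arr_n X n) (sq_dom A)) (Dom (Arr_n X n) p) \<and>
        Comp (Arr_n X n) p k = sq1 A \<and> Comp (Arr_n X n) q k = sq_dom A \<and>
        cubic_extension X (Suc n) k))"


section \<open>Distributive parallelistic n-fold equivalence relations\<close>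

definition ERel_on :: "('o, 'm) ccat \<Rightarrow> ('o, 'm) cell \<Rightarrow> ('o, 'm) cell set" where
  "ERel_on C x = {R \<in> Obj (ERel C). Cod C (rg_d R) = x}"

definition er_le :: "('o, 'm) ccat \<Rightarrow> ('o, 'm) cell \<Rightarrow> ('o, 'm) cell \<Rightarrow> bool" where
  "er_le C R S \<longleftrightarrow> (\<exists>h \<in> Hom C (Dom C (rg_d R)) (Dom C (rg_d S)).
     Comp C (rg_d S) h = rg_d R \<and> Comp C (rg_c S) h = rg_c R)"

definition er_eq :: "('o, 'm) ccat \<Rightarrow> ('o, 'm) cell \<Rightarrow> ('o, 'm) cell \<Rightarrow> bool" where
  "er_eq C R S \<longleftrightarrow> er_le C R S \<and> er_le C S R"

text \<open>Meets and joins in the preordered set of equivalence relations on \<open>x\<close>, determined up to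
  \<open>er_eq\<close>. The meet of the empty set is the largest relation.\<close>

definition er_Meet :: "('o, 'm) ccat \<Rightarrow> ('o, 'm) cell \<Rightarrow> ('o, 'm) cell set \<Rightarrow> ('o, 'm) cell" where
  "er_Meet C x A = (SOME M. M \<in> ERel_on C x \<and> (\<forall>S \<in> A. er_le C M S) \<and>
     (\<forall>T \<in> ERel_on C x. (\<forall>S \<in> A. er_le C T S) \<longrightarrow> er_le C T M))"

definition er_Join :: "('o, 'm) ccat \<Rightarrow> ('o, 'm) cell \<Rightarrow> ('o, 'm) cell set \<Rightarrow> ('o, 'm) cell" where
  "er_Join C x A = (SOME M. M \<in> ERel_on C x \<and> (\<forall>S \<in> A. er_le C S M) \<and>
     (\<forall>T \<in> ERel_on C x. (\<forall>S \<in> A. er_le C S T) \<longrightarrow> er_le C M T))"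

definition distributive ::
  "('o, 'm) ccat \<Rightarrow> ('o, 'm) cell \<Rightarrow> nat \<Rightarrow> (nat \<Rightarrow> ('o, 'm) cell) \<Rightarrow> bool" where
  "distributive C x n R \<longleftrightarrow> (\<forall>k\<ge>1. \<forall>J :: nat \<Rightarrow> nat set.
     (\<forall>i\<le>k. J i \<subseteq> {..<n}) \<and> (\<forall>i\<le>k. \<forall>j\<le>k. i \<noteq> j \<longrightarrow> J i \<inter> J j = {}) \<longrightarrow>
     er_eq C
       (er_Meet C x {er_Meet C x (R ` J 0), er_Join C x ((\<lambda>i. er_Meet C x (R ` J i)) ` {1..k})})
       (er_Join C x ((\<lambda>i. er_Meet C x (R ` (J 0 \<union> J i))) ` {1..k})))"

text \<open>Restriction of (arrows of) n-fold reflexive graphs to the vertex all of whose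
  coordinates are 1, and the reflexive graph in direction \<open>i < n\<close> on that vertex.\<close>

primrec rg_base_mor :: "nat \<Rightarrow> ('o, 'm) cell \<Rightarrow> ('o, 'm) cell" where
  "rg_base_mor 0 x = x"
| "rg_base_mor (Suc n) x = rg_base_mor n (rg1 x)"

primrec rg_edge :: "('o, 'm) cat \<Rightarrow> nat \<Rightarrow> nat \<Rightarrow> ('o, 'm) cell \<Rightarrow> ('o, 'm) cell" where
  "rg_edge X 0 i G = G"
| "rg_edge X (Suc n) i G =
    (case i of
       0 \<Rightarrow> Rg (rg_base_mor n (rg_d G)) (rg_base_mor n (rg_c G)) (rg_base_mor n (rg_e G))
     | Suc i' \<Rightarrow> rg_edge X n i' (Cod (RGrph_n X n) (rg_d G)))"

definition n_fold_erel_on ::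
  "('o, 'm) cat \<Rightarrow> nat \<Rightarrow> (nat \<Rightarrow> ('o, 'm) cell) \<Rightarrow> ('o, 'm) cell set" where
  "n_fold_erel_on X n R = {E \<in> Obj (ERel_n X n). \<forall>i<n. rg_edge X n i E = R i}"

text \<open>\<open>B\<close> is the largest n-fold equivalence relation on \<open>R 0, \<dots>, R (n - 1)\<close>: every other one
  is included in it, by an arrow that is the identity on the underlying object \<open>x\<close>.\<close>

definition is_box ::
  "('o, 'm) cat \<Rightarrow> ('o, 'm) cell \<Rightarrow> nat \<Rightarrow> (nat \<Rightarrow> ('o, 'm) cell) \<Rightarrow> ('o, 'm) cell \<Rightarrow> bool" where
  "is_box X x n R B \<longleftrightarrow> (\<forall>i<n. R i \<in> ERel_on (base X) x) \<and> B \<in> n_fold_erel_on X n R \<and>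
    (\<forall>E \<in> n_fold_erel_on X n R. \<exists>h \<in> Hom (ERel_n X n) E B. rg_base_mor n h = Id (base X) x)"

definition distributive_parallelistic :: "('o, 'm) cat \<Rightarrow> nat \<Rightarrow> ('o, 'm) cell \<Rightarrow> bool" where
  "distributive_parallelistic X n G \<longleftrightarrow> G \<in> Obj (ERel_n X n) \<and>
    (\<exists>x \<in> Obj (base X). \<exists>R B. is_box X x n R B \<and> distributive (base X) x n R \<and>
       isomorphic (ERel_n X n) G B)"

end

theory Submission
  imports Defs
begin

text \<open>All four conditions are compared through one lifting property of the fork: for a set \<open>S\<close> of directions
 starting at a vertex with coordinates in {0, 1}, every compatible family of generalised elements of the
 neighbouring vertices comes, after a regular epimorphism, from an element of that vertex.
 If all forks are left exact, induction on \<open>S\<close> and permutability of equivalence relations show that the lifting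
 property means that all arrows \<open>f\<close> are regular epimorphisms, i.e. that the forks are exact. Unfolding pullbacks,
 the same property says that the cube is a cubic extension. If all forks are right exact, applied at the vertex
 with all coordinates 1 it says that joins of the kernel relations of the \<open>f\<close> distribute over their
 meets; in a modular lattice this is equivalent to distributivity of the relations. A right exact fork whose
 relations are distributive is then compared with the left exact fork on the same cube, and the two
 agree because boxes are determined by their relations.\<close>

abbreviation (input) eqv (infixr "<->" 25) where "P <-> Q \<equiv> (P :: bool) = Q"
abbreviation "re \<equiv> regular_epi"
abbreviation "coeq \<equiv> is_coequaliser"
abbreviation "kp \<equiv> is_kernel_pair"
abbreviation "pb \<equiv> is_pullback"

section \<open>Generalised elements and covers\<close>

definition is_product :: "('o, 'm) cat => 'o => 'o => 'm => 'm => bool" where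
 "is_product C a b p q <-> p : Mor C & q : Mor C & Dom C p = Dom C q & Cod C p = a & Cod C q = b &
  (ALL u v. u : Mor C & v : Mor C & Dom C u = Dom C v & Cod C u = a & Cod C v = b -->
    (EX h:Mor C. Dom C h = Dom C u & Cod C h = Dom C p & Comp C p h = u & Comp C q h = v)) &
  (ALL u v. u : Mor C & v : Mor C & Dom C u = Dom C v & Cod C u = Dom C p & Cod C v = Dom C p &
    Comp C p u = Comp C p v & Comp C q u = Comp C q v --> u = v)"

definition monic :: "('o, 'm) cat => 'm => bool" where
 "monic C m <-> (ALL u v. u : Mor C & v : Mor C & Dom C u = Dom C v & Cod C u = Dom C m & Cod C v = Dom C m &
    Comp C m u = Comp C m v --> u = v)"

lemma monicD: "[|monic C m; u : Mor C; v : Mor C; Dom C u = Dom C v; Cod C u = Dom C m; Cod C v = Dom C m;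
  Comp C m u = Comp C m v|] ==> u = v"
 unfolding monic_def by blast

lemma is_productD:
 assumes "is_product C a b p q"
 shows "p : Mor C" "q : Mor C" "Dom C p = Dom C q" "Cod C p = a" "Cod C q = b"
  and "!!u v. [|u : Mor C; v : Mor C; Dom C u = Dom C v; Cod C u = a; Cod C v = b|] ==>
    EX h:Mor C. Dom C h = Dom C u & Cod C h = Dom C p & Comp C p h = u & Comp C q h = v"
  and "!!u v. [|u : Mor C; v : Mor C; Dom C u = Dom C v; Cod C u = Dom C p; Cod C v = Dom C p;
    Comp C p u = Comp C p v; Comp C q u = Comp C q v|] ==> u = v"
 using assms unfolding is_product_def by blast+

locale Cat =
 fixes C :: "('o, 'm) cat"
 assumes cat: "category C"
begin

abbreviation cmp (infixr "**" 70) where "g ** f \<equiv> Comp C g f"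

lemma Dom_obj [simp]: "f : Mor C ==> Dom C f : Obj C"
 and Cod_obj [simp]: "f : Mor C ==> Cod C f : Obj C"
 using cat unfolding category_def by blast+

lemma Id_mor [simp]: "a : Obj C ==> Id C a : Mor C"
 and Dom_Id [simp]: "a : Obj C ==> Dom C (Id C a) = a"
 and Cod_Id [simp]: "a : Obj C ==> Cod C (Id C a) = a"
 using cat unfolding category_def Hom_def by blast+

lemma cmp_mor [simp]: "[|f : Mor C; g : Mor C; Cod C f = Dom C g|] ==> g ** f : Mor C"
 and Dom_cmp [simp]: "[|f : Mor C; g : Mor C; Cod C f = Dom C g|] ==> Dom C (g ** f) = Dom C f"
 and Cod_cmp [simp]: "[|f : Mor C; g : Mor C; Cod C f = Dom C g|] ==> Cod C (g ** f) = Cod C g"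
 using cat unfolding category_def Hom_def by blast+

lemma cmp_Id [simp]: "[|f : Mor C; Dom C f = a|] ==> f ** Id C a = f"
 and Id_cmp [simp]: "[|f : Mor C; Cod C f = a|] ==> Id C a ** f = f"
 using cat unfolding category_def by blast+

lemma assoc: "[|f : Mor C; g : Mor C; h : Mor C; Cod C f = Dom C g; Cod C g = Dom C h|]
  ==> (h ** g) ** f = h ** (g ** f)"
 using cat unfolding category_def by metis

lemma cmp_ext: "[|g ** f = g' ** f'; h : Mor C; f : Mor C; g : Mor C; f' : Mor C; g' : Mor C;
  Cod C h = Dom C f; Cod C f = Dom C g; Dom C f' = Dom C f; Cod C f' = Dom C g'|]
  ==> g ** (f ** h) = g' ** (f' ** h)"
 by (metis assoc)

lemma cmp_ext1: "[|g ** f = k; h : Mor C; f : Mor C; g : Mor C;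
  Cod C h = Dom C f; Cod C f = Dom C g|]
  ==> g ** (f ** h) = k ** h"
 by (metis assoc)

lemma pbD: assumes "pb C f g p q"
 shows "f : Mor C" "g : Mor C" "p : Mor C" "q : Mor C" "Cod C f = Cod C g"
  "Dom C q = Dom C p" "Cod C p = Dom C f" "Cod C q = Dom C g" "f ** p = g ** q"
 using assms unfolding is_pullback_def by auto

lemma pb_ex: assumes "pb C f g p q" "u : Mor C" "v : Mor C" "Dom C u = Dom C v"
  "Cod C u = Dom C f" "Cod C v = Dom C g" "f ** u = g ** v"
 obtains h where "h : Mor C" "Dom C h = Dom C u" "Cod C h = Dom C p" "p ** h = u" "q ** h = v"
proof -
 have "EX! h. h : Hom C (Dom C u) (Dom C p) & p ** h = u & q ** h = v"
  using assms unfolding is_pullback_def by blast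
 then show ?thesis using that unfolding Hom_def by blast
qed

lemma pb_unique: assumes "pb C f g p q" "u : Mor C" "v : Mor C" "Dom C u = Dom C v"
  "Cod C u = Dom C p" "Cod C v = Dom C p" "p ** u = p ** v" "q ** u = q ** v"
 shows "u = v"
proof -
 note D = pbD[OF assms(1)]
 have "f ** (p ** u) = g ** (q ** u)"
  using D assms by (intro cmp_ext) auto
 moreover have "p ** u : Mor C" "q ** u : Mor C" "Dom C (p ** u) = Dom C (q ** u)"
  "Cod C (p ** u) = Dom C f" "Cod C (q ** u) = Dom C g" using D assms(2-6) by auto
 ultimately have "EX! h. h : Hom C (Dom C (p ** u)) (Dom C p) & p ** h = p ** u & q ** h = q ** u"
  using assms(1) unfolding is_pullback_def by blast
 moreover have "u : Hom C (Dom C (p ** u)) (Dom C p)" "v : Hom C (Dom C (p ** u)) (Dom C p)"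
  using D assms(2-) by (auto simp: Hom_def)
 ultimately show ?thesis using assms by metis
qed

lemma pbI: assumes "f : Mor C" "g : Mor C" "p : Mor C" "q : Mor C" "Cod C f = Cod C g"
  "Dom C q = Dom C p" "Cod C p = Dom C f" "Cod C q = Dom C g" "f ** p = g ** q"
  and ex: "!!u v. [|u : Mor C; v : Mor C; Dom C u = Dom C v; Cod C u = Dom C f; Cod C v = Dom C g;
    f ** u = g ** v|] ==> EX h:Mor C. Dom C h = Dom C u & Cod C h = Dom C p & p ** h = u & q ** h = v"
  and un: "!!u v. [|u : Mor C; v : Mor C; Dom C u = Dom C v; Cod C u = Dom C p; Cod C v = Dom C p;
    p ** u = p ** v; q ** u = q ** v|] ==> u = v"
 shows "pb C f g p q"
 unfolding is_pullback_def
proof (intro conjI ballI impI)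
 fix u v assume uv: "u : Mor C" "v : Mor C"
  "Dom C u = Dom C v & Cod C u = Dom C f & Cod C v = Dom C g & f ** u = g ** v"
 then obtain h where "h : Mor C" "Dom C h = Dom C u" "Cod C h = Dom C p" "p ** h = u" "q ** h = v"
  using ex by blast
 then show "EX! h. h : Hom C (Dom C u) (Dom C p) & p ** h = u & q ** h = v"
  by (intro ex1I[of _ h]) (auto simp: Hom_def intro: un)
qed (use assms in auto)

lemma coD: assumes "coeq C d c q"
 shows "d : Mor C" "c : Mor C" "q : Mor C" "Dom C c = Dom C d" "Cod C c = Cod C d"
  "Dom C q = Cod C d" "q ** d = q ** c"
 using assms unfolding is_coequaliser_def by auto

lemma co_ex: assumes "coeq C d c q" "g : Mor C" "Dom C g = Cod C d" "g ** d = g ** c"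
 obtains h where "h : Mor C" "Dom C h = Cod C q" "Cod C h = Cod C g" "h ** q = g"
proof -
 have "EX! h. h : Hom C (Cod C q) (Cod C g) & h ** q = g"
  using assms unfolding is_coequaliser_def by blast
 then show ?thesis using that unfolding Hom_def by blast
qed

lemma co_unique: assumes "coeq C d c q" "u : Mor C" "v : Mor C" "Dom C u = Cod C q"
  "Dom C v = Cod C q" "u ** q = v ** q"
 shows "u = v"
proof -
 note D = coD[OF assms(1)]
 have c: "Cod C u = Cod C v" using D assms(2-) by (metis Cod_cmp)
 have "u ** (q ** d) = u ** (q ** c)" using D by simp
 then have "(u ** q) ** d = (u ** q) ** c" using D assms(2-) by (simp add: assoc)
 moreover have "u ** q : Mor C" "Dom C (u ** q) = Cod C d" using D assms(2-) by auto
 ultimately have "EX! h. h : Hom C (Cod C q) (Cod C (u ** q)) & h ** q = u ** q"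
  using assms(1) unfolding is_coequaliser_def by blast
 moreover have "u : Hom C (Cod C q) (Cod C (u ** q))" "v : Hom C (Cod C q) (Cod C (u ** q))"
  using D assms(2-) c by (auto simp: Hom_def)
 ultimately show ?thesis using assms(6) by metis
qed

lemma coI: assumes "d : Mor C" "c : Mor C" "q : Mor C" "Dom C c = Dom C d" "Cod C c = Cod C d"
  "Dom C q = Cod C d" "q ** d = q ** c"
  and ex: "!!g. [|g : Mor C; Dom C g = Cod C d; g ** d = g ** c|] ==>
    EX h:Mor C. Dom C h = Cod C q & Cod C h = Cod C g & h ** q = g"
  and un: "!!u v. [|u : Mor C; v : Mor C; Dom C u = Cod C q; Dom C v = Cod C q; Cod C u = Cod C v;
    u ** q = v ** q|] ==> u = v"
 shows "coeq C d c q"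
 unfolding is_coequaliser_def
proof (intro conjI ballI impI)
 fix g assume g: "g : Mor C" "Dom C g = Cod C d & g ** d = g ** c"
 then obtain h where "h : Mor C" "Dom C h = Cod C q" "Cod C h = Cod C g" "h ** q = g"
  using ex by blast
 then show "EX! h. h : Hom C (Cod C q) (Cod C g) & h ** q = g"
  by (intro ex1I[of _ h]) (auto simp: Hom_def intro: un)
qed (use assms in auto)

lemma re_mor: "re C f ==> f : Mor C"
 unfolding regular_epi_def is_coequaliser_def by blast

lemma re_epi: "[|re C f; u : Mor C; v : Mor C; Dom C u = Cod C f; Dom C v = Cod C f; u ** f = v ** f|] ==> u = v"
 unfolding regular_epi_def using co_unique by blast

lemma re_Id: assumes "a : Obj C" shows "re C (Id C a)"
 unfolding regular_epi_def
 by (intro exI[of _ "Id C a"], rule coI) (use assms in auto)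

lemma kp_coeq:
 assumes "kp C f d c" "re C f"
 shows "coeq C d c f"
proof -
 obtain k1 k2 where k: "coeq C k1 k2 f" using assms(2) unfolding regular_epi_def by blast
 note kD = coD[OF k] and pD = pbD[OF assms(1)[unfolded is_kernel_pair_def]]
 obtain h where h: "h : Mor C" "Dom C h = Dom C k1" "Cod C h = Dom C d" "d ** h = k1" "c ** h = k2"
  using pb_ex[OF assms(1)[unfolded is_kernel_pair_def], of k1 k2] kD by auto
 show ?thesis
 proof (rule coI)
  fix g assume g: "g : Mor C" "Dom C g = Cod C d" "g ** d = g ** c"
  have "g ** (d ** h) = g ** (c ** h)" using g pD h by (intro cmp_ext) auto
  then have "g ** k1 = g ** k2" using h by simp
  then show "EX h:Mor C. Dom C h = Cod C f & Cod C h = Cod C g & h ** f = g"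
   using co_ex[OF k, of g] g pD kD by metis
 qed (use pD co_unique[OF k] in auto)
qed

lemma isoD: assumes "iso C u"
 obtains v where "u : Mor C" "v : Mor C" "Dom C v = Cod C u" "Cod C v = Dom C u"
  "v ** u = Id C (Dom C u)" "u ** v = Id C (Cod C u)"
 using assms unfolding iso_def Hom_def by blast

lemma isoI: "[|u : Mor C; v : Mor C; Dom C v = Cod C u; Cod C v = Dom C u;
  v ** u = Id C (Dom C u); u ** v = Id C (Cod C u)|] ==> iso C u"
 unfolding iso_def Hom_def by blast

end

locale Reg = Cat C for C :: "('o, 'm) cat" +
 assumes reg: "regular_category C"
begin

lemma pullbacks: "[|f : Mor C; g : Mor C; Cod C f = Cod C g|] ==> EX p q. pb C f g p q"
 using reg unfolding regular_category_def has_finite_limits_def by blast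

lemma re_lift: assumes "re C f" "g : Mor C" "Cod C g = Cod C f"
 obtains p q where "re C q" "p : Mor C" "q : Mor C" "Cod C q = Dom C g" "Cod C p = Dom C f"
   "Dom C p = Dom C q" "f ** p = g ** q"
proof -
 obtain p q where pq: "pb C f g p q"
  using pullbacks[of f g] assms re_mor by metis
 moreover have "re C q" using reg pq assms unfolding regular_category_def by blast
 ultimately show ?thesis using that pbD[OF pq] by metis
qed

lemma prod_ex: assumes "a : Obj C" "b : Obj C" shows "EX p q. is_product C a b p q"
proof -
 obtain t where "terminal C t"
  using reg unfolding regular_category_def has_finite_limits_def by blast
 then have t: "t : Obj C" "!!a. a : Obj C ==> EX! f. f : Hom C a t"
  unfolding terminal_def by blast+
 obtain f g where fg: "f : Mor C" "Dom C f = a" "Cod C f = t" "g : Mor C" "Dom C g = b" "Cod C g = t"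
  using t(2)[OF assms(1)] t(2)[OF assms(2)] unfolding Hom_def by blast
 obtain p q where pq: "pb C f g p q" using pullbacks[of f g] fg by auto
 note D = pbD[OF pq]
 have ex: "EX h:Mor C. Dom C h = Dom C u & Cod C h = Dom C p & p ** h = u & q ** h = v"
  if uv: "u : Mor C" "v : Mor C" "Dom C u = Dom C v" "Cod C u = a" "Cod C v = b" for u v
 proof -
  have "f ** u : Hom C (Dom C u) t" "g ** v : Hom C (Dom C u) t"
   using uv fg by (auto simp: Hom_def)
  then have "f ** u = g ** v" using t(2)[of "Dom C u"] uv by auto
  then show ?thesis using pb_ex[OF pq, of u v] uv fg by metis
 qed
 show ?thesis unfolding is_product_def
  by (intro exI[of _ p] exI[of _ q] conjI allI impI)
   (use D fg ex in simp_all, elim conjE, rule pb_unique[OF pq])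
qed

text \<open>The regular image of \<open>f\<close> is the coequaliser of its kernel pair; that its second factor is
 monic is checked on generalised elements, lifted along the first one.\<close>

lemma image: assumes "f : Mor C"
 obtains e m where "re C e" "m : Mor C" "e : Mor C" "Dom C e = Dom C f" "Cod C e = Dom C m" "Cod C m = Cod C f"
  "m ** e = f" "monic C m"
proof -
 obtain d c where k: "pb C f f d c" using pullbacks[of f f] assms by auto
 then obtain e where e: "coeq C d c e"
  using reg unfolding regular_category_def is_kernel_pair_def by blast
 note kD = pbD[OF k] and eD = coD[OF e]
 have re: "re C e" using e unfolding regular_epi_def by blast
 obtain m where m: "m : Mor C" "Dom C m = Cod C e" "Cod C m = Cod C f" "m ** e = f"
  using co_ex[OF e, of f] kD by auto
 have mono: "u = v" if uv: "u : Mor C" "v : Mor C" "Dom C u = Dom C v" "Cod C u = Dom C m" "Cod C v = Dom C m"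
    "m ** u = m ** v" for u v
 proof -
  obtain a p where p: "re C p" "a : Mor C" "p : Mor C" "Cod C p = Dom C u" "Cod C a = Dom C e"
   "Dom C a = Dom C p" "e ** a = u ** p" by (rule re_lift[OF re, of u]) (use uv m in auto)
  obtain b q where q: "re C q" "b : Mor C" "q : Mor C" "Cod C q = Dom C p" "Cod C b = Dom C e"
   "Dom C b = Dom C q" "e ** b = (v ** p) ** q" by (rule re_lift[OF re, of "v ** p"]) (use uv p m in auto)
  have "f ** (a ** q) = m ** (e ** (a ** q))"
   using m p q kD eD by (metis assoc cmp_mor Cod_cmp)
  also have "... = m ** (u ** (p ** q))" using p q uv eD kD by (metis assoc)
  also have "... = m ** (v ** (p ** q))" using p q uv m eD kD by (intro cmp_ext[OF uv(6)]) auto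
  also have "... = m ** (e ** b)" using p q uv(1-5) m eD kD by (simp add: assoc)
  also have "... = f ** b" using m p q kD eD by (metis assoc)
  finally have "f ** (a ** q) = f ** b" .
  then obtain h where h: "h : Mor C" "Dom C h = Dom C q" "Cod C h = Dom C d" "d ** h = a ** q" "c ** h = b"
   using pb_ex[OF k, of "a ** q" b] p q kD eD by auto
  have "e ** (d ** h) = e ** (c ** h)" using h eD kD by (intro cmp_ext) auto
  then have "e ** (a ** q) = e ** b" using h by simp
  then have "(u ** p) ** q = (v ** p) ** q" using p q eD kD by (metis assoc)
  then have "u ** p = v ** p" by (intro re_epi[OF q(1), of "u ** p" "v ** p"]) (use p q uv in simp_all)
  then show "u = v" by (intro re_epi[OF p(1) uv(1,2)]) (simp_all add: p(4) uv(3))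
 qed
 have "monic C m" unfolding monic_def using mono by blast
 then show ?thesis by (intro that[of e m]) (use re m eD(3,6) kD(1-7) in simp_all)
qed

lemma split_mono_re: assumes e: "re C e" and m: "m : Mor C" "Dom C m = Cod C e"
 and mono: "monic C m"
 and k: "k : Mor C" "Dom C k = Cod C m" "Cod C k = Dom C m" "m ** k = Id C (Cod C m)"
 shows "re C (m ** e)"
proof -
 obtain d c where e': "coeq C d c e" using e unfolding regular_epi_def by blast
 note eD = coD[OF e']
 have obj: "Dom C m : Obj C" "Cod C m : Obj C" using Dom_obj[OF m(1)] Cod_obj[OF m(1)] by auto
 have km: "k ** m = Id C (Dom C m)"
 proof (rule monicD[OF mono])
  show "m ** k ** m = m ** Id C (Dom C m)" using cmp_ext1[OF k(4), of m] k m by simp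
 qed (use k m obj in auto)
 have "coeq C d c (m ** e)"
 proof (rule coI)
  show "(m ** e) ** d = (m ** e) ** c" using eD m by (simp add: assoc)
  fix g assume g: "g : Mor C" "Dom C g = Cod C d" "g ** d = g ** c"
  then obtain h where h: "h : Mor C" "Dom C h = Cod C e" "Cod C h = Cod C g" "h ** e = g"
   using co_ex[OF e', of g] by auto
  have "k ** m ** e = e" using cmp_ext1[OF km, of e] m k eD by auto
  then have "(h ** k) ** (m ** e) = g" using h m k eD by (simp add: assoc)
  then show "EX h:Mor C. Dom C h = Cod C (m ** e) & Cod C h = Cod C g & h ** (m ** e) = g"
   using h m k eD by (intro bexI[of _ "h ** k"]) auto
 next
  fix u v assume uv: "u : Mor C" "v : Mor C" "Dom C u = Cod C (m ** e)" "Dom C v = Cod C (m ** e)"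
   "u ** m ** e = v ** m ** e"
  then have "(u ** m) ** e = (v ** m) ** e" using m eD by (simp add: assoc)
  then have "u ** m = v ** m" by (intro re_epi[OF e, of "u ** m" "v ** m"]) (use uv(1-4) m eD in simp_all)
  then have "(u ** m) ** k = (v ** m) ** k" by simp
  then show "u = v" using uv m k eD by (simp add: assoc)
 qed (use eD m in auto)
 then show ?thesis unfolding regular_epi_def by blast
qed

lemma re_cancel: assumes gf: "re C (g ** f)" and "f : Mor C" "g : Mor C" "Cod C f = Dom C g"
 shows "re C g"
proof -
 obtain e m where em: "re C e" "m : Mor C" "e : Mor C" "Dom C e = Dom C g" "Cod C e = Dom C m" "Cod C m = Cod C g"
  "m ** e = g" and mono: "monic C m" using image[OF assms(3)] by blast
 obtain d c where co: "coeq C d c (g ** f)" using gf unfolding regular_epi_def by blast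
 note D = coD[OF co]
 have eq: "m ** e ** f = g ** f" using em assms by (intro cmp_ext1) auto
 have "m ** ((e ** f) ** d) = m ** ((e ** f) ** c)"
 proof -
  have "m ** ((e ** f) ** d) = (g ** f) ** d" using D(1-6) em assms by (intro cmp_ext1[OF eq]) auto
  moreover have "m ** ((e ** f) ** c) = (g ** f) ** c" using D(1-6) em assms by (intro cmp_ext1[OF eq]) auto
  ultimately show ?thesis using D(7) by simp
 qed
 then have "(e ** f) ** d = (e ** f) ** c" by (intro monicD[OF mono, of "(e ** f) ** d" "(e ** f) ** c"]) (use D(1-6) em assms in simp_all)
 then obtain k where k: "k : Mor C" "Dom C k = Cod C (g ** f)" "Cod C k = Cod C (e ** f)" "k ** g ** f = e ** f"
  using co_ex[OF co, of "e ** f"] D em assms by auto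
 have "m ** k = Id C (Cod C m)"
 proof (rule re_epi[OF gf])
  show "(m ** k) ** g ** f = Id C (Cod C m) ** g ** f" using k D em assms eq by (simp add: assoc)
 qed (use k D em assms in auto)
 then have "re C (m ** e)" using em k assms mono by (intro split_mono_re[of e m k]) auto
 then show ?thesis using em by simp
qed

lemma re_cmp: assumes f: "re C f" and g: "re C g" and "Cod C f = Dom C g"
 shows "re C (g ** f)"
proof -
 note fg = re_mor[OF f] re_mor[OF g] assms(3)
 obtain e m where em: "re C e" "m : Mor C" "e : Mor C" "Dom C e = Dom C f" "Cod C e = Dom C m" "Cod C m = Cod C g"
  "m ** e = g ** f" and mono: "monic C m" using image[of "g ** f"] fg by auto
 obtain d c where co: "coeq C d c f" using f unfolding regular_epi_def by blast
 note D = coD[OF co]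
 have "m ** (e ** d) = m ** (e ** c)"
 proof -
  have "m ** (e ** d) = g ** (f ** d)" using D(1-6) em fg by (intro cmp_ext[OF em(7)]) auto
  moreover have "m ** (e ** c) = g ** (f ** c)" using D(1-6) em fg by (intro cmp_ext[OF em(7)]) auto
  ultimately show ?thesis using D(7) by simp
 qed
 then have "e ** d = e ** c" by (intro monicD[OF mono, of "e ** d" "e ** c"]) (use D(1-6) em fg in simp_all)
 then obtain h where h: "h : Mor C" "Dom C h = Cod C f" "Cod C h = Cod C e" "h ** f = e"
  using co_ex[OF co, of e] D em fg by auto
 have mh: "m ** h = g"
 proof (rule re_epi[OF f])
  show "(m ** h) ** f = g ** f" using h em fg by (simp add: assoc)
 qed (use h em fg in auto)
 obtain d' c' where co': "coeq C d' c' g" using g unfolding regular_epi_def by blast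
 note D' = coD[OF co']
 have "m ** (h ** d') = m ** (h ** c')"
  using cmp_ext1[OF mh, of d'] cmp_ext1[OF mh, of c'] D' em fg h by auto
 then have "h ** d' = h ** c'" by (intro monicD[OF mono, of "h ** d'" "h ** c'"]) (use D' em fg h in simp_all)
 then obtain k where k: "k : Mor C" "Dom C k = Cod C g" "Cod C k = Cod C h" "k ** g = h"
  using co_ex[OF co', of h] D' em fg h by auto
 have "m ** k = Id C (Cod C m)"
 proof (rule re_epi[OF g])
  show "(m ** k) ** g = Id C (Cod C m) ** g" using k h em fg mh by (simp add: assoc)
 qed (use k h em fg in auto)
 then have "re C (m ** e)" using em k fg h mono by (intro split_mono_re[of e m k]) auto
 then show ?thesis using em by simp
qed

lemma re_local: assumes "f : Mor C" "re C p" "Cod C p = Cod C f" "a : Mor C" "Dom C a = Dom C p" "Cod C a = Dom C f" "f ** a = p"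
 shows "re C f"
 using re_cancel[of f a] assms by auto

end

section \<open>The lattice of equivalence relations\<close>

definition ext :: "('o, 'm) cat => 'm => 'm => ('m \<times> 'm) set" where
 "ext C d c = {(Comp C d h, Comp C c h) | h. h : Mor C & Cod C h = Dom C d}"

definition pairs :: "('o, 'm) cat => 'o => ('m \<times> 'm) set" where
 "pairs C x = {(u, v). u : Mor C & v : Mor C & Dom C u = Dom C v & Cod C u = x & Cod C v = x}"

definition Rels :: "('o, 'm) cat => 'o => ('m \<times> 'm) set set" where
 "Rels C x = {ext C d c | d c. equivalence_relation C d c & Cod C d = x}"

definition ker :: "('o, 'm) cat => 'm => ('m \<times> 'm) set" where
 "ker C f = {(u, v) : pairs C (Dom C f). Comp C f u = Comp C f v}"

definition rcomp :: "('o, 'm) cat => 'o => ('m \<times> 'm) set => ('m \<times> 'm) set => ('m \<times> 'm) set" where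
 "rcomp C x a b = {(u, v) : pairs C x. EX p w. re C p & Cod C p = Dom C u &
   (Comp C u p, w) : a & (w, Comp C v p) : b}"

definition gen_rel :: "('o, 'm) cat => 'm => 'm => ('m \<times> 'm) set" where
 "gen_rel C d c = {(u, v) : pairs C (Cod C d). EX p h. re C p & Cod C p = Dom C u &
   h : Mor C & Dom C h = Dom C p & Cod C h = Dom C d & Comp C d h = Comp C u p & Comp C c h = Comp C v p}"

context Cat begin

lemma relI: assumes "d : Mor C" "c : Mor C" "Dom C d = Dom C c" "Cod C d = Cod C c"
 "!!u v. [|u : Mor C; v : Mor C; Dom C u = Dom C v; Cod C u = Dom C d; Cod C v = Dom C d;
   d ** u = d ** v; c ** u = c ** v|] ==> u = v"
 shows "relation C d c"
 using assms unfolding relation_def by blast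

lemma eqrelD: assumes "equivalence_relation C d c"
 shows "d : Mor C" "c : Mor C" "Dom C c = Dom C d" "Cod C c = Cod C d"
  "!!u v. [|u : Mor C; v : Mor C; Dom C u = Dom C v; Cod C u = Dom C d; Cod C v = Dom C d;
   d ** u = d ** v; c ** u = c ** v|] ==> u = v"
  "EX e:Mor C. Dom C e = Cod C d & Cod C e = Dom C d & d ** e = Id C (Cod C d) & c ** e = Id C (Cod C d)"
  "EX s:Mor C. Dom C s = Dom C d & Cod C s = Dom C d & d ** s = c & c ** s = d"
  "!!u v. [|u : Mor C; v : Mor C; Dom C u = Dom C v; Cod C u = Dom C d; Cod C v = Dom C d; c ** u = d ** v|]
   ==> EX w:Mor C. Dom C w = Dom C u & Cod C w = Dom C d & d ** w = d ** u & c ** w = c ** v"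
proof -
 note A = assms[unfolded equivalence_relation_def reflexive_relation_def relation_def Hom_def]
 show "d : Mor C" "c : Mor C" "Dom C c = Dom C d" "Cod C c = Cod C d" using A by auto
 show "!!u v. [|u : Mor C; v : Mor C; Dom C u = Dom C v; Cod C u = Dom C d; Cod C v = Dom C d;
   d ** u = d ** v; c ** u = c ** v|] ==> u = v" using A by blast
 show "EX e:Mor C. Dom C e = Cod C d & Cod C e = Dom C d & d ** e = Id C (Cod C d) & c ** e = Id C (Cod C d)"
  using A by blast
 show "EX s:Mor C. Dom C s = Dom C d & Cod C s = Dom C d & d ** s = c & c ** s = d" using A by blast
 show "!!u v. [|u : Mor C; v : Mor C; Dom C u = Dom C v; Cod C u = Dom C d; Cod C v = Dom C d; c ** u = d ** v|]
   ==> EX w:Mor C. Dom C w = Dom C u & Cod C w = Dom C d & d ** w = d ** u & c ** w = c ** v"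
  using A by blast
qed

lemma kp_eqrel: assumes "kp C f d c"
 shows "equivalence_relation C d c"
proof -
 note k = assms[unfolded is_kernel_pair_def]
 note D = pbD[OF k]
 have obj: "Cod C d : Obj C" using D by auto
 obtain e where "e : Mor C" "Dom C e = Dom C (Id C (Cod C d))" "Cod C e = Dom C d" "d ** e = Id C (Cod C d)" "c ** e = Id C (Cod C d)"
  by (rule pb_ex[OF k, of "Id C (Cod C d)" "Id C (Cod C d)"]) (use D obj in simp_all)
 moreover obtain s where "s : Mor C" "Dom C s = Dom C c" "Cod C s = Dom C d" "d ** s = c" "c ** s = d"
  by (rule pb_ex[OF k, of c d]) (use D in simp_all)
 moreover have "relation C d c" by (rule relI) (use D in simp_all, rule pb_unique[OF k])
 moreover have "EX w:Hom C (Dom C u) (Dom C d). d ** w = d ** u & c ** w = c ** v"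
  if uv: "u : Mor C" "v : Mor C" "Dom C u = Dom C v" "Cod C u = Dom C d" "Cod C v = Dom C d" "c ** u = d ** v" for u v
 proof -
  have "f ** (d ** u) = f ** (c ** u)" using D uv by (intro cmp_ext) auto
  also have "... = f ** (c ** v)" unfolding uv(6) using D uv by (intro cmp_ext) auto
  finally have "f ** (d ** u) = f ** (c ** v)" .
  then obtain w where "w : Mor C" "Dom C w = Dom C (d ** u)" "Cod C w = Dom C d" "d ** w = d ** u" "c ** w = c ** v"
   by (elim pb_ex[OF k, of "d ** u" "c ** v", rotated -2]) (use D uv(1-5) in simp_all)
  then show ?thesis using D uv by (auto simp: Hom_def)
 qed
 ultimately show ?thesis
  unfolding equivalence_relation_def reflexive_relation_def Hom_def using D by auto
qed

lemma pairs_iff: "(u, v) : pairs C x <-> u : Mor C & v : Mor C & Dom C u = Dom C v & Cod C u = x & Cod C v = x"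
 unfolding pairs_def by auto

lemma ext_pairs: "equivalence_relation C d c ==> ext C d c <= pairs C (Cod C d)"
 unfolding ext_def pairs_def using eqrelD(1-4) by auto

lemma ext_cong: "equivalence_relation C d c ==> (u, v) : ext C d c ==> h : Mor C ==> Cod C h = Dom C u
  ==> (u ** h, v ** h) : ext C d c"
proof -
 assume E: "equivalence_relation C d c" and "(u, v) : ext C d c" and h: "h : Mor C" "Cod C h = Dom C u"
 then obtain k where k: "k : Mor C" "Cod C k = Dom C d" "u = d ** k" "v = c ** k" unfolding ext_def by auto
 then show ?thesis unfolding ext_def using h eqrelD(1-4)[OF E]
  by (intro CollectI exI[of _ "k ** h"]) (auto simp: assoc)
qed

lemma ext_self: "equivalence_relation C d c ==> (d, c) : ext C d c"
 unfolding ext_def using eqrelD(1-4)[of d c] by (auto intro!: exI[of _ "Id C (Dom C d)"])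

lemma RelsD: assumes "a : Rels C x"
 shows Rels_pairs: "a <= pairs C x"
  and Rels_refl: "!!u. u : Mor C ==> Cod C u = x ==> (u, u) : a"
  and Rels_sym: "!!u v. (u, v) : a ==> (v, u) : a"
  and Rels_trans: "!!u v w. (u, v) : a ==> (v, w) : a ==> (u, w) : a"
  and Rels_cong: "!!u v h. (u, v) : a ==> h : Mor C ==> Cod C h = Dom C u ==> (u ** h, v ** h) : a"
  and Rels_local: "!!u v p. (u, v) : pairs C x ==> re C p ==> Cod C p = Dom C u ==>
     (u ** p, v ** p) : a ==> (u, v) : a"
proof -
 obtain d c where a: "a = ext C d c" "equivalence_relation C d c" "Cod C d = x"
  using assms unfolding Rels_def by blast
 note D = eqrelD[OF a(2)]
 show "a <= pairs C x" using ext_pairs[OF a(2)] a by simp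
 show "(u ** h, v ** h) : a" if "(u, v) : a" "h : Mor C" "Cod C h = Dom C u" for u v h
  using ext_cong[OF a(2)] that a by simp
 show "(u, u) : a" if u: "u : Mor C" "Cod C u = x" for u
 proof -
  obtain e where "e : Mor C" "Dom C e = Cod C d" "Cod C e = Dom C d" "d ** e = Id C (Cod C d)" "c ** e = Id C (Cod C d)"
   using D(6) by auto
  then have "d ** (e ** u) = u" "c ** (e ** u) = u" using cmp_ext1[of d e _ u] cmp_ext1[of c e _ u] D u a by auto
  then show ?thesis unfolding a ext_def using \<open>e : Mor C\<close> \<open>Dom C e = _\<close> \<open>Cod C e = _\<close> u a
   by (auto intro!: exI[of _ "e ** u"])
 qed
 show "(v, u) : a" if uv: "(u, v) : a" for u v
 proof -
  obtain h where h: "h : Mor C" "Cod C h = Dom C d" "u = d ** h" "v = c ** h"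
   using uv unfolding a ext_def by auto
  obtain s where s: "s : Mor C" "Dom C s = Dom C d" "Cod C s = Dom C d" "d ** s = c" "c ** s = d"
   using D(7) by auto
  have "d ** (s ** h) = v" "c ** (s ** h) = u"
   using cmp_ext1[OF s(4), of h] cmp_ext1[OF s(5), of h] D h s by auto
  then show ?thesis unfolding a ext_def using h s
   by (auto intro!: exI[of _ "s ** h"])
 qed
 show "(u, w) : a" if uv: "(u, v) : a" and vw: "(v, w) : a" for u v w
 proof -
  obtain h where h: "h : Mor C" "Cod C h = Dom C d" "u = d ** h" "v = c ** h"
   using uv unfolding a ext_def by auto
  obtain k where k: "k : Mor C" "Cod C k = Dom C d" "v = d ** k" "w = c ** k"
   using vw unfolding a ext_def by auto
  have "Dom C h = Dom C k" using h k D(1-4) by (metis Dom_cmp)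
  then obtain l where "l : Mor C" "Dom C l = Dom C h" "Cod C l = Dom C d" "d ** l = u" "c ** l = w"
   using D(8)[of h k] h k by auto
  then show ?thesis unfolding a ext_def by (auto intro!: exI[of _ l])
 qed
 show "(u, v) : a" if uv: "(u, v) : pairs C x" and p: "re C p" "Cod C p = Dom C u" "(u ** p, v ** p) : a" for u v p
 proof -
  have uv': "u : Mor C" "v : Mor C" "Dom C v = Dom C u" "Cod C u = x" "Cod C v = x"
   using uv unfolding pairs_iff by auto
  obtain h where h: "h : Mor C" "Cod C h = Dom C d" "u ** p = d ** h" "v ** p = c ** h"
   using p unfolding a ext_def by auto
  obtain k l where kl: "coeq C k l p" using p unfolding regular_epi_def by blast
  note K = coD[OF kl]
  have dh: "Dom C h = Dom C p" using arg_cong[OF h(3), of "Dom C"] h(1,2) D(1-4) uv' p(2) K(1-6) by simp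
  have "h ** k = h ** l"
  proof (rule D(5))
   have 1: "d ** (h ** r) = u ** (p ** r)" "c ** (h ** r) = v ** (p ** r)" if "r : Mor C" "Cod C r = Dom C p" for r
    by (rule cmp_ext[OF h(3)[symmetric]], use that K(3) uv' h(1,2) dh D(1-4) p(2) in simp_all)
     (rule cmp_ext[OF h(4)[symmetric]], use that K(3) uv' h(1,2) dh D(1-4) p(2) in simp_all)
   show "d ** h ** k = d ** h ** l" "c ** h ** k = c ** h ** l" using 1[of k] 1[of l] K by simp_all
  qed (use K dh h D in simp_all)
  then obtain m where m: "m : Mor C" "Dom C m = Cod C p" "Cod C m = Cod C h" "m ** p = h"
   using co_ex[OF kl h(1)] K dh by metis
  have "d ** m = u"
  proof (rule re_epi[OF p(1)])
   have "(d ** m) ** p = d ** m ** p" by (rule assoc) (use D m h K in simp_all)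
   then show "(d ** m) ** p = u ** p" using m h by simp
  qed (use D m uv' h p in simp_all)
  moreover have "c ** m = v"
  proof (rule re_epi[OF p(1)])
   have "(c ** m) ** p = c ** m ** p" by (rule assoc) (use D m h K in simp_all)
   then show "(c ** m) ** p = v ** p" using m h by simp
  qed (use D m uv' h p in simp_all)
  ultimately show ?thesis unfolding a ext_def using m h by (auto intro!: exI[of _ m])
 qed
qed

lemma kp_ker: assumes "kp C f d c"
 shows "ext C d c = ker C f"
proof -
 note k = assms[unfolded is_kernel_pair_def]
 note D = pbD[OF k]
 show ?thesis
 proof (intro equalityI subrelI)
  fix u v assume "(u, v) : ext C d c"
  then obtain h where h: "h : Mor C" "Cod C h = Dom C d" "u = d ** h" "v = c ** h" unfolding ext_def by auto
  have "f ** d ** h = f ** c ** h" using D h by (intro cmp_ext) auto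
  then show "(u, v) : ker C f" unfolding ker_def pairs_def using D h by auto
 next
  fix u v assume "(u, v) : ker C f"
  then have uv: "u : Mor C" "v : Mor C" "Dom C u = Dom C v" "Cod C u = Dom C f" "Cod C v = Dom C f" "f ** u = f ** v"
   unfolding ker_def pairs_def by auto
  obtain h where "h : Mor C" "Dom C h = Dom C u" "Cod C h = Dom C d" "d ** h = u" "c ** h = v"
   by (rule pb_ex[OF k uv])
  then show "(u, v) : ext C d c" unfolding ext_def by auto
 qed
qed

end

locale EM = Reg C for C :: "('o, 'm) cat" +
 assumes em: "exact_Maltsev C"
begin

lemma maltsev: "reflexive_relation C d c ==> equivalence_relation C d c"
 and effective: "equivalence_relation C d c ==> EX f. kp C f d c"
 using em unfolding exact_Maltsev_def exact_category_def by blast+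

lemma ker_Rels: assumes "f : Mor C" shows "ker C f : Rels C (Dom C f)"
proof -
 obtain d c where k: "kp C f d c"
  using pullbacks[of f f] assms unfolding is_kernel_pair_def by auto
 then show ?thesis using kp_ker[OF k] kp_eqrel[OF k] pbD[OF k[unfolded is_kernel_pair_def]]
  unfolding Rels_def by force
qed

lemma eqrelI: assumes "d : Mor C" "c : Mor C" "Dom C d = Dom C c" "Cod C d = Cod C c"
 "!!u v. [|u : Mor C; v : Mor C; Dom C u = Dom C v; Cod C u = Dom C d; Cod C v = Dom C d;
   d ** u = d ** v; c ** u = c ** v|] ==> u = v"
 "e : Mor C" "Dom C e = Cod C d" "Cod C e = Dom C d" "d ** e = Id C (Cod C d)" "c ** e = Id C (Cod C d)"
 shows "equivalence_relation C d c"
proof (rule maltsev)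
 have "relation C d c" by (rule relI[OF assms(1-5)])
 moreover have "e : Hom C (Cod C d) (Dom C d)" using assms(6-8) by (simp add: Hom_def)
 ultimately show "reflexive_relation C d c" unfolding reflexive_relation_def using assms(9,10) assms(4) by auto
qed

text \<open>The regular image of a reflexive graph is a reflexive, hence an equivalence relation.\<close>

lemma pair_image: assumes "d : Mor C" "c : Mor C" "Dom C d = Dom C c" "Cod C d = Cod C c"
 "e : Mor C" "Dom C e = Cod C d" "Cod C e = Dom C d" "d ** e = Id C (Cod C d)" "c ** e = Id C (Cod C d)"
 obtains q d' c' where "re C q" "q : Mor C" "Dom C q = Dom C d" "Cod C q = Dom C d'"
  "d' ** q = d" "c' ** q = c" "equivalence_relation C d' c'" "Cod C d' = Cod C d" "ext C d' c' = gen_rel C d c"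
proof -
 have x: "Cod C d : Obj C" using assms by auto
 obtain p1 p2 where "is_product C (Cod C d) (Cod C d) p1 p2" using prod_ex[OF x x] by blast
 note PP = is_productD[OF this]
 note P = PP(1-5) and Pex = PP(6) and Pun = PP(7)
 obtain h where h: "h : Mor C" "Dom C h = Dom C d" "Cod C h = Dom C p1" "p1 ** h = d" "p2 ** h = c"
  using Pex[of d c] assms(1-4) by metis
 obtain q m where qm: "re C q" "m : Mor C" "q : Mor C" "Dom C q = Dom C h" "Cod C q = Dom C m" "Cod C m = Cod C h"
  "m ** q = h" and mono: "monic C m" using image[OF h(1)] by metis
 define d' c' where "d' = p1 ** m" and "c' = p2 ** m"
 have T: "d' : Mor C" "c' : Mor C" "Dom C d' = Dom C m" "Dom C c' = Dom C m" "Cod C d' = Cod C d" "Cod C c' = Cod C d"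
  unfolding d'_def c'_def using P h qm by auto
 have dq: "d' ** q = d" "c' ** q = c" unfolding d'_def c'_def using P h qm by (simp_all add: assoc)
 have un: "u = v" if uv: "u : Mor C" "v : Mor C" "Dom C u = Dom C v" "Cod C u = Dom C d'" "Cod C v = Dom C d'"
   "d' ** u = d' ** v" "c' ** u = c' ** v" for u v
 proof -
  have "m ** u = m ** v" by (rule Pun) (use uv T P qm h in \<open>simp_all add: d'_def c'_def assoc\<close>)
  then show ?thesis by (intro monicD[OF mono, of u v]) (use uv T in simp_all)
 qed
 have E: "equivalence_relation C d' c'"
 proof (rule eqrelI[where e = "q ** e"])
  show "d' ** q ** e = Id C (Cod C d')" "c' ** q ** e = Id C (Cod C d')"
   using cmp_ext1[OF dq(1), of e] cmp_ext1[OF dq(2), of e] assms qm h T by auto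
 qed (use T un assms qm h in simp_all)
 have "ext C d' c' = gen_rel C d c"
 proof (intro equalityI subrelI)
  fix u v assume "(u, v) : ext C d' c'"
  then obtain k where k: "k : Mor C" "Cod C k = Dom C m" "u = d' ** k" "v = c' ** k" unfolding ext_def using T by auto
  obtain l p where lp: "re C p" "l : Mor C" "p : Mor C" "Cod C p = Dom C k" "Cod C l = Dom C q"
   "Dom C l = Dom C p" "q ** l = k ** p" by (rule re_lift[OF qm(1) k(1)]) (use qm k in auto)
  have "d ** l = d' ** q ** l" "c ** l = c' ** q ** l"
   using cmp_ext1[OF dq(1), of l] cmp_ext1[OF dq(2), of l] T qm h lp by auto
  then have "d ** l = u ** p" "c ** l = v ** p" using lp k T by (simp_all add: assoc)
  then show "(u, v) : gen_rel C d c" unfolding gen_rel_def pairs_def using k T lp qm h by auto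
 next
  fix u v assume "(u, v) : gen_rel C d c"
  then obtain p l where uv: "(u, v) : pairs C (Cod C d)" and l: "re C p" "Cod C p = Dom C u"
   "l : Mor C" "Dom C l = Dom C p" "Cod C l = Dom C d" "d ** l = u ** p" "c ** l = v ** p"
   unfolding gen_rel_def by auto
  have "d' ** q ** l = u ** p" "c' ** q ** l = v ** p"
   using cmp_ext1[OF dq(1), of l] cmp_ext1[OF dq(2), of l] T qm h l by auto
  then have "(u ** p, v ** p) : ext C d' c'" unfolding ext_def using qm l h T by (auto intro!: exI[of _ "q ** l"])
  moreover have "ext C d' c' : Rels C (Cod C d)" unfolding Rels_def using E T by auto
  ultimately show "(u, v) : ext C d' c'" using Rels_local[of _ _ u v p] uv l by blast
 qed
 then show ?thesis using that[of q d' c'] qm h T dq E by simp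
qed

lemma gen_rel_Rels: assumes "is_rgraph C d c e" shows "gen_rel C d c : Rels C (Cod C d)"
proof -
 have "d : Mor C" "c : Mor C" "Dom C d = Dom C c" "Cod C d = Cod C c"
 "e : Mor C" "Dom C e = Cod C d" "Cod C e = Dom C d" "d ** e = Id C (Cod C d)" "c ** e = Id C (Cod C d)"
  using assms unfolding is_rgraph_def Hom_def by auto
 then obtain q d' c' where "equivalence_relation C d' c'" "Cod C d' = Cod C d" "ext C d' c' = gen_rel C d c"
  by (rule pair_image)
 then show ?thesis unfolding Rels_def by force
qed

lemma rgraph_coeq: assumes "is_rgraph C d c e"
 shows "EX q. coeq C d c q"
  and "coeq C d c q ==> ker C q = gen_rel C d c"
proof -
 have D: "d : Mor C" "c : Mor C" "Dom C d = Dom C c" "Cod C d = Cod C c"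
 "e : Mor C" "Dom C e = Cod C d" "Cod C e = Dom C d" "d ** e = Id C (Cod C d)" "c ** e = Id C (Cod C d)"
  using assms unfolding is_rgraph_def Hom_def by auto
 obtain r d' c' where r: "re C r" "r : Mor C" "Dom C r = Dom C d" "Cod C r = Dom C d'"
  "d' ** r = d" "c' ** r = c" "equivalence_relation C d' c'" "Cod C d' = Cod C d" and g: "ext C d' c' = gen_rel C d c"
  by (rule pair_image[OF D])
 note R = eqrelD[OF r(7)]
 obtain f where f: "kp C f d' c'" using effective[OF r(7)] by blast
 then obtain q0 where q: "coeq C d' c' q0" using reg unfolding regular_category_def by blast
 note Q = coD[OF q]
 have "coeq C d c q0"
 proof (rule coI)
  have "q0 ** d' ** r = q0 ** c' ** r" using R(1-4) r Q by (intro cmp_ext) auto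
  then show "q0 ** d = q0 ** c" using r by simp
  fix h assume h: "h : Mor C" "Dom C h = Cod C d" "h ** d = h ** c"
  have "h ** d' = h ** c'"
  proof (rule re_epi[OF r(1)])
   show "(h ** d') ** r = (h ** c') ** r" using h r R(1-4) by (simp add: assoc)
  qed (use h r R(1-4) in simp_all)
  then show "EX k:Mor C. Dom C k = Cod C q0 & Cod C k = Cod C h & k ** q0 = h"
   using co_ex[OF q, of h] h r by metis
 next
  fix u v assume "u : Mor C" "v : Mor C" "Dom C u = Cod C q0" "Dom C v = Cod C q0" "u ** q0 = v ** q0"
  then show "u = v" by (rule co_unique[OF q])
 qed (use D Q r in simp_all)
 then show "EX q. coeq C d c q" by blast
 show "ker C q = gen_rel C d c" if co: "coeq C d c q"
 proof
  note K = coD[OF co]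
  note F = pbD[OF f[unfolded is_kernel_pair_def]]
  have "f ** d = f ** c" using cmp_ext[OF F(9), of r] F r by auto
  then obtain g where gg: "g : Mor C" "Dom C g = Cod C q" "Cod C g = Cod C f" "g ** q = f"
   using co_ex[OF co F(1)] F r by metis
  show "ker C q <= gen_rel C d c"
  proof (intro subrelI)
   fix u v assume "(u, v) : ker C q"
   then have uv: "(u, v) : pairs C (Dom C q)" "q ** u = q ** v" unfolding ker_def by auto
   then have uv': "u : Mor C" "v : Mor C" "Dom C u = Dom C v" "Cod C u = Dom C q" "Cod C v = Dom C q" by (auto simp: pairs_iff)
   have "f ** u = g ** q ** u" using cmp_ext1[OF gg(4), of u] gg uv' K by simp
   also have "... = f ** v" unfolding uv(2) using cmp_ext1[OF gg(4), of v] gg uv' K by simp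
   finally have "(u, v) : ker C f" using uv F K r unfolding ker_def by auto
   then show "(u, v) : gen_rel C d c" using kp_ker[OF f] g by simp
  qed
  show "gen_rel C d c <= ker C q"
  proof (intro subrelI)
   fix u v assume "(u, v) : gen_rel C d c"
   then obtain p l where uv: "(u, v) : pairs C (Cod C d)" and l: "re C p" "Cod C p = Dom C u"
    "l : Mor C" "Dom C l = Dom C p" "Cod C l = Dom C d" "d ** l = u ** p" "c ** l = v ** p"
    unfolding gen_rel_def by auto
   have uv': "u : Mor C" "v : Mor C" "Dom C u = Dom C v" "Cod C u = Cod C d" "Cod C v = Cod C d" using uv by (auto simp: pairs_iff)
   have "q ** d ** l = q ** c ** l" by (rule cmp_ext) (use K D l in simp_all)
   then have "q ** u ** p = q ** v ** p" using l by simp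
   then have "(q ** u) ** p = (q ** v) ** p" using uv' l K re_mor[OF l(1)] by (simp add: assoc)
   then have "q ** u = q ** v" by (intro re_epi[OF l(1), of "q ** u"]) (use uv' l K in simp_all)
   then show "(u, v) : ker C q" unfolding ker_def using uv K by auto
  qed
 qed
qed

lemma meet_Rels: assumes a: "a : Rels C x" and b: "b : Rels C x"
 shows "a Int b : Rels C x"
proof -
 obtain d c where a: "a = ext C d c" "equivalence_relation C d c" "Cod C d = x" using a unfolding Rels_def by blast
 obtain d' c' where b: "b = ext C d' c'" "equivalence_relation C d' c'" "Cod C d' = x" using b unfolding Rels_def by blast
 note A = eqrelD[OF a(2)] and B = eqrelD[OF b(2)]
 have x: "x : Obj C" using a A by auto
 obtain p1 p2 where "is_product C x x p1 p2" using prod_ex[OF x x] by blast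
 note PP = is_productD[OF this]
 note P = PP(1-5) and Pex = PP(6) and Pun = PP(7)
 obtain h where h: "h : Mor C" "Dom C h = Dom C d" "Cod C h = Dom C p1" "p1 ** h = d" "p2 ** h = c"
  using Pex[of d c] A(1-4) a by metis
 obtain h' where h': "h' : Mor C" "Dom C h' = Dom C d'" "Cod C h' = Dom C p1" "p1 ** h' = d'" "p2 ** h' = c'"
  using Pex[of d' c'] B(1-4) b by metis
 obtain s t where st: "pb C h h' s t" using pullbacks[of h h'] h h' by auto
 note S = pbD[OF st]
 have ds: "d ** s = d' ** t" "c ** s = c' ** t"
  using cmp_ext1[OF h(4), of s] cmp_ext1[OF h'(4), of t] cmp_ext1[OF h(5), of s] cmp_ext1[OF h'(5), of t] h h' S P by auto
 have un: "u = v" if uv: "u : Mor C" "v : Mor C" "Dom C u = Dom C v" "Cod C u = Dom C s" "Cod C v = Dom C s"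
   "(d ** s) ** u = (d ** s) ** v" "(c ** s) ** u = (c ** s) ** v" for u v
 proof (rule pb_unique[OF st uv(1-5)])
  show "s ** u = s ** v"
   by (rule A(5)) (use uv A(1-4) S h in \<open>simp_all add: assoc\<close>)
  show "t ** u = t ** v"
   by (rule B(5)) (use uv(1-5) uv(6,7)[unfolded ds] B(1-4) S h' in \<open>simp_all add: assoc\<close>)
 qed
 have sub: "EX k:Mor C. Dom C k = Dom C u & Cod C k = Dom C s & (d ** s) ** k = u & (c ** s) ** k = v" if uv: "(u, v) : a Int b" for u v
 proof -
  obtain k where k: "k : Mor C" "Cod C k = Dom C d" "u = d ** k" "v = c ** k" using uv unfolding a ext_def by auto
  obtain k' where k': "k' : Mor C" "Cod C k' = Dom C d'" "u = d' ** k'" "v = c' ** k'" using uv unfolding b ext_def by auto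
  have dk: "Dom C k' = Dom C k" "Dom C k = Dom C u" using k k' A(1-4) B(1-4) by (metis Dom_cmp)+
  have "h ** k = h' ** k'"
  proof (rule Pun)
   show "p1 ** h ** k = p1 ** h' ** k'" using cmp_ext1[OF h(4), of k] cmp_ext1[OF h'(4), of k'] h h' k k' P by simp
   show "p2 ** h ** k = p2 ** h' ** k'" using cmp_ext1[OF h(5), of k] cmp_ext1[OF h'(5), of k'] h h' k k' P by simp
  qed (use h h' k(1,2) k'(1,2) dk in simp_all)
  then obtain l where l: "l : Mor C" "Dom C l = Dom C k" "Cod C l = Dom C s" "s ** l = k" "t ** l = k'"
   using pb_ex[OF st, of k k'] k k' dk h h' by metis
  have "(d ** s) ** l = d ** s ** l" "(c ** s) ** l = c ** s ** l" by (rule assoc; use l S h A(1-4) in simp)+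
  then show ?thesis using l k dk by auto
 qed
 have E: "equivalence_relation C (d ** s) (c ** s)"
 proof -
  have "(Id C x, Id C x) : a" by (rule Rels_refl[of a x]) (use a x in \<open>auto simp: Rels_def\<close>)
  moreover have "(Id C x, Id C x) : b" by (rule Rels_refl[of b x]) (use b x in \<open>auto simp: Rels_def\<close>)
  ultimately obtain k where k: "k : Mor C" "Dom C k = x" "Cod C k = Dom C s" "(d ** s) ** k = Id C x" "(c ** s) ** k = Id C x"
   using sub[of "Id C x" "Id C x"] x by auto
  show ?thesis by (rule eqrelI[where e = k]) (use A(1-4) S h a k un in simp_all)
 qed
 have "ext C (d ** s) (c ** s) = a Int b"
 proof (intro equalityI subrelI)
  fix u v assume "(u, v) : ext C (d ** s) (c ** s)"
  then obtain k where k: "k : Mor C" "Cod C k = Dom C s" "u = (d ** s) ** k" "v = (c ** s) ** k" unfolding ext_def using A S h by auto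
  have "u = d ** s ** k" "v = c ** s ** k" using k A S h by (simp_all add: assoc)
  then have "(u, v) : a" unfolding a ext_def using S k h by (auto intro!: exI[of _ "s ** k"])
  moreover have "u = d' ** t ** k" "v = c' ** t ** k" using k B S h' by (simp_all add: assoc ds)
  then have "(u, v) : b" unfolding b ext_def using S k h' by (auto intro!: exI[of _ "t ** k"])
  ultimately show "(u, v) : a Int b" by blast
 next
  fix u v assume "(u, v) : a Int b"
  from sub[OF this] show "(u, v) : ext C (d ** s) (c ** s)" unfolding ext_def using A S h by auto
 qed
 then show ?thesis unfolding Rels_def
  by (intro CollectI exI[of _ "d ** s"] exI[of _ "c ** s"]) (use E A(1-4) S h a(3) in simp)
qed

lemma top_Rels: assumes x: "x : Obj C" shows "pairs C x : Rels C x"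
proof -
 obtain p1 p2 where "is_product C x x p1 p2" using prod_ex[OF x x] by blast
 note PP = is_productD[OF this]
 note P = PP(1-5) and Pex = PP(6) and Pun = PP(7)
 obtain e where e: "e : Mor C" "Dom C e = x" "Cod C e = Dom C p1" "p1 ** e = Id C x" "p2 ** e = Id C x"
  using Pex[of "Id C x" "Id C x"] x by auto
 have "equivalence_relation C p1 p2"
 proof (rule eqrelI[where e = e])
  fix u v assume "u : Mor C" "v : Mor C" "Dom C u = Dom C v" "Cod C u = Dom C p1" "Cod C v = Dom C p1"
   "p1 ** u = p1 ** v" "p2 ** u = p2 ** v"
  then show "u = v" by (rule Pun)
 qed (use P e in simp_all)
 moreover have "ext C p1 p2 = pairs C x"
 proof (intro equalityI subrelI)
  fix u v assume "(u, v) : pairs C x"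
  then obtain h where "h : Mor C" "Cod C h = Dom C p1" "p1 ** h = u" "p2 ** h = v"
   using Pex[of u v] unfolding pairs_iff by blast
  then show "(u, v) : ext C p1 p2" unfolding ext_def by auto
 qed (use P in \<open>auto simp: ext_def pairs_def\<close>)
 ultimately show ?thesis unfolding Rels_def using P(4) by force
qed

lemma bot_Rels: assumes x: "x : Obj C" shows "{(u, u) | u. u : Mor C & Cod C u = x} : Rels C x"
proof -
 have "equivalence_relation C (Id C x) (Id C x)"
  by (rule eqrelI[where e = "Id C x"]) (use x in simp_all)
 moreover have "ext C (Id C x) (Id C x) = {(u, u) | u. u : Mor C & Cod C u = x}"
  unfolding ext_def using x by (auto, metis Id_cmp)
 ultimately show ?thesis unfolding Rels_def using x by force
qed

lemma rcomp_Rels: assumes a: "a : Rels C x" and b: "b : Rels C x"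
 shows "rcomp C x a b : Rels C x"
proof -
 obtain d c where a': "a = ext C d c" "equivalence_relation C d c" "Cod C d = x" using a unfolding Rels_def by blast
 obtain d' c' where b': "b = ext C d' c'" "equivalence_relation C d' c'" "Cod C d' = x" using b unfolding Rels_def by blast
 note A = eqrelD[OF a'(2)] and B = eqrelD[OF b'(2)]
 have x: "x : Obj C" using a' A by auto
 obtain s t where st: "pb C c d' s t" using pullbacks[of c d'] A B a' b' by auto
 note S = pbD[OF st]
 have sub: "EX k:Mor C. Dom C k = Dom C u & Cod C k = Dom C s & (d ** s) ** k = u & (c' ** t) ** k = v"
  if uv: "(u, w) : a" "(w, v) : b" for u v w
 proof -
  obtain k where k: "k : Mor C" "Cod C k = Dom C d" "u = d ** k" "w = c ** k" using uv unfolding a' ext_def by auto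
  obtain k' where k': "k' : Mor C" "Cod C k' = Dom C d'" "w = d' ** k'" "v = c' ** k'" using uv unfolding b' ext_def by auto
  have dk: "Dom C k' = Dom C k" "Dom C k = Dom C u" using k k' A(1-4) B(1-4) by (metis Dom_cmp)+
  have ww: "c ** k = d' ** k'" using k(4) k'(3) by simp
  obtain l where l: "l : Mor C" "Dom C l = Dom C k" "Cod C l = Dom C s" "s ** l = k" "t ** l = k'"
   by (rule pb_ex[OF st k(1) k'(1) dk(1)[symmetric] _ _ ww]) (auto simp: k(2) k'(2) A(3))
  have "(d ** s) ** l = d ** s ** l" "(c' ** t) ** l = c' ** t ** l" by (rule assoc; use l S A(1-4) B(1-4) in simp)+
  then show ?thesis using l k k' dk by auto
 qed
 obtain k where k: "k : Mor C" "Dom C k = x" "Cod C k = Dom C s" "(d ** s) ** k = Id C x" "(c' ** t) ** k = Id C x"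
 proof -
  have "(Id C x, Id C x) : a" "(Id C x, Id C x) : b" using Rels_refl[OF a] Rels_refl[OF b] x by simp_all
  from sub[OF this] show ?thesis using that x by auto
 qed
 have "is_rgraph C (d ** s) (c' ** t) k"
  unfolding is_rgraph_def Hom_def using A(1-4) B(1-4) S k a' b' by simp
 from gen_rel_Rels[OF this] have "gen_rel C (d ** s) (c' ** t) : Rels C x" using A S a' by simp
 moreover have "gen_rel C (d ** s) (c' ** t) = rcomp C x a b"
 proof (intro equalityI subrelI)
  fix u v assume "(u, v) : gen_rel C (d ** s) (c' ** t)"
  then obtain p h where uv: "(u, v) : pairs C x" and h: "re C p" "Cod C p = Dom C u"
   "h : Mor C" "Dom C h = Dom C p" "Cod C h = Dom C s" "(d ** s) ** h = u ** p" "(c' ** t) ** h = v ** p"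
   unfolding gen_rel_def using A S a' by auto
  have 1: "c ** (s ** h) = d' ** (t ** h)" using S h by (intro cmp_ext) auto
  have 2: "u ** p = d ** s ** h" "v ** p = c' ** t ** h" 
  proof -
   have "(d ** s) ** h = d ** s ** h" "(c' ** t) ** h = c' ** t ** h" by (rule assoc; use h S A(1-4) B(1-4) in simp)+
   then show "u ** p = d ** s ** h" "v ** p = c' ** t ** h" using h(6,7) by simp_all
  qed
  have "(u ** p, c ** (s ** h)) : a" unfolding 2 a' ext_def using h S A(1-4) by auto
  moreover have "(c ** (s ** h), v ** p) : b" unfolding 1 2 b' ext_def using h S B(1-4) by auto
  ultimately show "(u, v) : rcomp C x a b" unfolding rcomp_def using uv h by auto
 next
  fix u v assume "(u, v) : rcomp C x a b"
  then obtain p w where uv: "(u, v) : pairs C x" "re C p" "Cod C p = Dom C u" "(u ** p, w) : a" "(w, v ** p) : b"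
   unfolding rcomp_def by auto
  show "(u, v) : gen_rel C (d ** s) (c' ** t)"
   using sub[OF uv(4,5)] uv(1-3) A(1-4) S a' re_mor[OF uv(2)] unfolding gen_rel_def by (auto simp: pairs_iff)
 qed
 ultimately show ?thesis by simp
qed

text \<open>By the Mal'tsev axiom the composite is symmetric.\<close>

lemma rcomp_comm: assumes a: "a : Rels C x" and b: "b : Rels C x"
 shows "rcomp C x a b = rcomp C x b a"
proof -
 have "rcomp C x a b <= rcomp C x b a" if a: "a : Rels C x" and b: "b : Rels C x" for a b
 proof (intro subrelI)
  fix u v assume "(u, v) : rcomp C x a b"
  from Rels_sym[OF rcomp_Rels[OF a b] this]
  obtain p w where *: "(v, u) : pairs C x" "re C p" "Cod C p = Dom C v" "(v ** p, w) : a" "(w, u ** p) : b"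
   unfolding rcomp_def by auto
  have "(u ** p, w) : b" "(w, v ** p) : a" "Cod C p = Dom C u" "(u, v) : pairs C x"
   using Rels_sym[OF b *(5)] Rels_sym[OF a *(4)] *(1,3) by (auto simp: pairs_iff)
  then show "(u, v) : rcomp C x b a" unfolding rcomp_def using *(2) by blast
 qed
 then show ?thesis using a b by blast
qed

lemma rcomp_upper: assumes a: "a : Rels C x" and b: "b : Rels C x"
 shows "a <= rcomp C x a b" "b <= rcomp C x a b"
proof -
 have *: "(u, v) : rcomp C x a b" if uv: "(u, v) : pairs C x" "(u, w) : a" "(w, v) : b" for u v w
 proof -
  have "re C (Id C (Dom C u))" "Cod C (Id C (Dom C u)) = Dom C u" using uv by (auto simp: pairs_iff intro: re_Id)
  moreover have "(u ** Id C (Dom C u), w) : a" "(w, v ** Id C (Dom C u)) : b" using uv by (auto simp: pairs_iff)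
  ultimately show ?thesis unfolding rcomp_def using uv by blast
 qed
 show "a <= rcomp C x a b"
 proof (intro subrelI)
  fix u v assume uv: "(u, v) : a"
  then have "(u, v) : pairs C x" using Rels_pairs[OF a] by blast
  then show "(u, v) : rcomp C x a b" using *[OF _ uv, of v] Rels_refl[OF b, of v] by (simp add: pairs_iff)
 qed
 show "b <= rcomp C x a b"
 proof (intro subrelI)
  fix u v assume uv: "(u, v) : b"
  then have "(u, v) : pairs C x" using Rels_pairs[OF b] by blast
  then show "(u, v) : rcomp C x a b" using *[OF _ _ uv] Rels_refl[OF a, of u] by (simp add: pairs_iff)
 qed
qed

lemma rcomp_least: assumes "r : Rels C x" "a <= r" "b <= r"
 shows "rcomp C x a b <= r"
 unfolding rcomp_def using assms Rels_trans[OF assms(1)] Rels_local[OF assms(1)] by blast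

end

lemma EM_I: "exact_Maltsev C ==> EM C"
 unfolding EM_def EM_axioms_def Reg_def Reg_axioms_def Cat_def exact_Maltsev_def exact_category_def
  regular_category_def by blast

section \<open>Distributive families in a modular lattice\<close>

locale modlat =
 fixes M :: "'a set set" and T B :: "'a set" and J :: "'a set => 'a set => 'a set"
 assumes T_in [simp]: "T : M" and T_upper: "a : M ==> a <= T"
  and B_in [simp]: "B : M" and B_lower: "a : M ==> B <= a"
  and meet_in [simp]: "a : M ==> b : M ==> a Int b : M"
  and J_in [simp]: "a : M ==> b : M ==> J a b : M"
  and J_ub1: "a : M ==> b : M ==> a <= J a b"
  and J_ub2: "a : M ==> b : M ==> b <= J a b"
  and J_lub: "c : M ==> a <= c ==> b <= c ==> J a b <= c"
  and modular: "a : M ==> b : M ==> c : M ==> a <= c ==> J a b Int c <= J a (b Int c)"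
begin

lemma J_least_iff: "[|a : M; b : M; c : M|] ==> J a b <= c <-> a <= c & b <= c"
 using J_lub J_ub1 J_ub2 by (meson order_trans)

lemma J_le1: "[|x <= a; a : M; b : M|] ==> x <= J a b"
 and J_le2: "[|x <= b; a : M; b : M|] ==> x <= J a b"
 using J_ub1 J_ub2 by (meson order_trans)+

lemma J_mono: "[|a <= a'; b <= b'; a' : M; b' : M|] ==> J a b <= J a' b'"
 by (intro J_lub J_le1 J_le2) auto

text \<open>In a modular lattice, one distributive identity for a triple implies all the others.\<close>

lemma distr1: assumes M: "a : M" "b : M" "c : M" and d: "J c a Int J c b <= J c (a Int b)"
 shows "a Int J b c <= J (a Int b) (a Int c)"
proof -
 have "a Int J b c <= J c a Int J c b"
  using M J_ub2[of c a] J_mono[of b "J c b" c "J c b"] J_lub[of "J c b" b c] J_ub1[of c b] J_ub2[of c b] by auto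
 also have "... <= J c (a Int b)" by (rule d)
 also have "... <= J (a Int b) c" using M by (intro J_lub J_le1 J_le2) auto
 finally have "a Int J b c <= J (a Int b) c Int a" by blast
 also have "... <= J (a Int b) (c Int a)" using M by (intro modular) auto
 finally show ?thesis by (simp add: Int_commute)
qed

lemma distr2: assumes M: "a : M" "b : M" "c : M" and d: "J c a Int J c b <= J c (a Int b)"
 shows "J b a Int J b c <= J b (a Int c)"
proof -
 have "J b a Int J b c <= J b (a Int J b c)" using M by (intro modular J_ub1) auto
 also have "... <= J b (J (a Int b) (a Int c))" using M by (intro J_mono distr1 d) auto
 also have "... <= J b (a Int c)" using M by (intro J_lub J_mono J_ub1 J_ub2 J_le1 J_le2) auto
 finally show ?thesis .
qed

definition mt :: "('i => 'a set) => 'i set => 'a set" where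
 "mt R P = T Int (\<Inter>i\<in>P. R i)"

lemma mt_in [simp]: "finite P ==> (!!i. i : P ==> R i : M) ==> mt R P : M"
proof (induction P rule: finite_induct)
 case (insert i P)
 have "mt R (insert i P) = R i Int mt R P" by (auto simp: mt_def)
 then show ?case using insert by simp
qed (simp add: mt_def)

lemma mt_le: "i : P ==> mt R P <= R i"
 by (auto simp: mt_def)

definition jn :: "('i => 'a set) => 'i set => 'a set" where
 "jn R P = \<Inter>{c : M. ALL i:P. R i <= c}"

lemma jn_insert: assumes "!!i. i : insert z P ==> R i : M" "jn R P : M"
 shows "jn R (insert z P) = J (R z) (jn R P)"
proof
 have ub: "ALL i:P. R i <= jn R P" by (auto simp: jn_def)
 show "jn R (insert z P) <= J (R z) (jn R P)"
 proof -
  have "R z <= J (R z) (jn R P)" "jn R P <= J (R z) (jn R P)" using assms J_ub1 J_ub2 by auto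
  then have "J (R z) (jn R P) : {c : M. ALL i:insert z P. R i <= c}" using assms ub by (auto 4 4)
  then show ?thesis unfolding jn_def[of R "insert z P"] by (rule Inter_lower)
 qed
 show "J (R z) (jn R P) <= jn R (insert z P)"
  unfolding jn_def[of R "insert z P"]
 proof (rule Inter_greatest)
  fix c assume "c : {c : M. ALL i:insert z P. R i <= c}"
  then show "J (R z) (jn R P) <= c" by (intro J_lub) (auto simp: jn_def)
 qed
qed

lemma jn_in [simp]: "finite P ==> (!!i. i : P ==> R i : M) ==> jn R P : M"
proof (induction P rule: finite_induct)
 case empty
 have "jn R {} = B" using B_lower by (auto simp: jn_def)
 then show ?case by simp
next
 case (insert z P)
 then have "jn R (insert z P) = J (R z) (jn R P)" by (intro jn_insert) auto
 then show ?case using insert by simp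
qed

lemma jn_empty: "jn R {} = B"
 using B_lower by (auto simp: jn_def)

lemma jn_ub: "i : P ==> R i <= jn R P"
 by (auto simp: jn_def)

lemma jn_lub: "c : M ==> (!!i. i : P ==> R i <= c) ==> jn R P <= c"
 by (auto simp: jn_def)

text \<open>The reverse inclusion holds in any lattice.\<close>

definition codistr :: "('i => 'a set) => 'i set => bool" where
 "codistr R I <-> (ALL Z P. Z <= I & P <= I & Z Int P = {} -->
   T Int (\<Inter>i\<in>P. J (jn R Z) (R i)) <= J (jn R Z) (mt R P))"

fun apart :: "'i set => 'i set list => 'i set => bool" where
 "apart I [] U = True"
| "apart I (K # Ks) U = (K <= I & K Int U = {} & apart I Ks (U Un K))"

lemma apart_mono: "apart I Ks U ==> V <= U ==> apart I Ks V"
proof (induction Ks arbitrary: U V)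
 case (Cons K Ks)
 then have "apart I Ks (V Un K)" using Cons.IH[of "U Un K" "V Un K"] by auto
 then show ?case using Cons by auto
qed simp

lemma apart_sub: "apart I Ks U ==> K : set Ks ==> K <= I"
 by (induction Ks arbitrary: U) auto

definition jm :: "('i => 'a set) => 'i set list => 'i set => 'a set" where
 "jm R Ks Z = foldr (%K a. J (mt R K) a) Ks (jn R Z)"

lemma jm_simps [simp]: "jm R [] Z = jn R Z" "jm R (K # Ks) Z = J (mt R K) (jm R Ks Z)"
 by (simp_all add: jm_def)

context
 fixes R :: "'i => 'a set" and I :: "'i set"
 assumes R_in [simp]: "!!i. i : I ==> R i : M" and fin: "finite I"
begin

lemma finI: "P <= I ==> finite P"
 using fin by (rule finite_subset[rotated])

lemma mtI [simp]: "P <= I ==> mt R P : M"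
 by (intro mt_in finI) auto

lemma jnI [simp]: "P <= I ==> jn R P : M"
 by (intro jn_in finI) auto

lemma jm_in: "(!!K. K : set Ks ==> K <= I) ==> Z <= I ==> jm R Ks Z : M"
 by (induction Ks) auto

lemma jm_insert: assumes "!!K. K : set Ks ==> K <= I" "Z <= I" "i : I"
 shows "jm R Ks (insert i Z) <= J (jm R Ks Z) (R i)" "J (jm R Ks Z) (R i) <= jm R Ks (insert i Z)"
proof -
 have *: "jm R Ks (insert i Z) <= c <-> J (jm R Ks Z) (R i) <= c" if c: "c : M" for c
  using assms(1)
 proof (induction Ks)
  case Nil
  have "jn R (insert i Z) = J (R i) (jn R Z)" using assms(2,3) by (intro jn_insert) auto
  then show ?case using assms c by (auto simp: J_least_iff)
 next
  case (Cons K Ks)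
  have m: "jm R Ks Z : M" "jm R Ks (insert i Z) : M" "mt R K : M" using Cons.prems assms by (auto intro!: jm_in)
  then show ?case using Cons c assms by (auto simp: J_least_iff)
 qed
 have m: "jm R Ks Z : M" "jm R Ks (insert i Z) : M" using assms by (auto intro!: jm_in)
 then show "jm R Ks (insert i Z) <= J (jm R Ks Z) (R i)" "J (jm R Ks Z) (R i) <= jm R Ks (insert i Z)"
  using *[of "J (jm R Ks Z) (R i)"] *[of "jm R Ks (insert i Z)"] assms by auto
qed

lemma codistr_list:
 assumes D: "codistr R I"
 shows "[|apart I Ks (Z Un P); Z <= I; P <= I; Z Int P = {}|] ==>
  T Int (\<Inter>i\<in>P. J (jm R Ks Z) (R i)) <= J (jm R Ks Z) (mt R P)"
proof (induction Ks arbitrary: Z P)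
 case Nil
 then show ?case using D by (auto simp: codistr_def)
next
 case (Cons K Ks)
 have ap: "apart I Ks (Z Un P Un K)" "K <= I" "K Int (Z Un P) = {}" using Cons.prems by auto
 have sub: "!!L. L : set Ks ==> L <= I" using apart_sub[OF ap(1)] .
 define c where "c = jm R Ks Z"
 define b where "b = J c (mt R P)"
 have [simp]: "c : M" unfolding c_def using sub Cons.prems by (intro jm_in)
 have [simp]: "b : M" unfolding b_def using Cons.prems by auto
 have Kin [simp]: "!!j. j : K ==> R j : M" "!!j. j : P ==> R j : M" using ap Cons.prems by auto
 have Pm [simp]: "mt R P : M" "mt R K : M" using Cons.prems ap by auto
 have IH1: "T Int (\<Inter>i\<in>Q. J (J c (R j)) (R i)) <= J (J c (R j)) (mt R Q)"
  if j: "j : K" and Q: "Q <= P Un K" "j ~: Q" for j Q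
 proof -
  have QI: "Q <= I" "insert j Z <= I" using that Cons.prems ap by auto
  have e1: "jm R Ks (insert j Z) <= J c (R j)" "J c (R j) <= jm R Ks (insert j Z)"
   unfolding c_def using sub QI by (auto intro!: jm_insert[THEN subsetD])
  then have e: "jm R Ks (insert j Z) = J c (R j)" by blast
  have "T Int (\<Inter>i\<in>Q. J (jm R Ks (insert j Z)) (R i)) <= J (jm R Ks (insert j Z)) (mt R Q)"
  proof (rule Cons.IH)
   show "apart I Ks (insert j Z Un Q)" by (rule apart_mono[OF ap(1)]) (use Q j in auto)
  qed (use QI Q j ap Cons.prems in auto)
  then show ?thesis unfolding e .
 qed
 have IH0: "T Int (\<Inter>i\<in>Q. J c (R i)) <= J c (mt R Q)" if Q: "Q <= K" for Q
  unfolding c_def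
 proof (rule Cons.IH)
  show "apart I Ks (Z Un Q)" by (rule apart_mono[OF ap(1)]) (use Q in auto)
 qed (use Q ap Cons.prems in auto)
 have step: "T Int (\<Inter>j\<in>Q. J b (R j)) <= J b (mt R Q)" if "Q <= K" for Q
 proof -
  have "finite Q" using that ap finI by auto
  then show ?thesis using that
  proof (induction Q rule: finite_induct)
   case empty
   show ?case by (simp add: mt_def J_ub2)
  next
   case (insert j Q)
   have jQ: "j : K" "Q <= K" "j ~: Q" using insert by auto
   have QI: "Q <= I" "insert j Q <= I" using jQ ap by auto
   define m where "m = J c (mt R Q)"
   define r where "r = J c (R j)"
   have [simp]: "m : M" "r : M" "mt R Q : M" unfolding m_def r_def using QI jQ by auto
   have d: "J r m Int J r b <= J r (m Int b)"
   proof -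
    have 1: "J r m <= J r (R i)" if "i : Q" for i
    proof -
     have "R i : M" using that jQ by auto
     moreover have "m <= J r (R i)" unfolding m_def r_def using that jQ \<open>R i : M\<close>
      by (intro J_lub J_le1[of c "J c (R j)" "R i"] J_le2[of "mt R Q"] mt_le J_ub1) auto
     ultimately show ?thesis by (intro J_lub J_ub1) auto
    qed
    have 2: "J r b <= J r (R i)" if "i : P" for i
    proof -
     have "R i : M" using that by auto
     moreover have "b <= J r (R i)" unfolding b_def r_def using that jQ \<open>R i : M\<close>
      by (intro J_lub J_le1[of c "J c (R j)" "R i"] J_le2[of "mt R P"] mt_le J_ub1) auto
     ultimately show ?thesis by (intro J_lub J_ub1) auto
    qed
    have "J r m Int J r b <= T Int (\<Inter>i\<in>P Un Q. J r (R i))"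
     using 1 2 T_upper[of "J r m"] by auto
    also have "... <= J r (mt R (P Un Q))" unfolding r_def by (rule IH1) (use jQ ap in auto)
    also have "... <= J r (m Int b)"
    proof (rule J_mono)
     have PQ: "mt R (P Un Q) <= mt R P" "mt R (P Un Q) <= mt R Q" by (auto simp: mt_def)
     then show "mt R (P Un Q) <= m Int b"
      unfolding m_def b_def by (intro Int_greatest J_le2) auto
    qed auto
    finally show ?thesis .
   qed
   have "T Int (\<Inter>k\<in>insert j Q. J b (R k)) <= J b (mt R Q) Int J b (R j)"
    using insert.IH jQ by auto
   also have "... <= J b m Int J b r"
    using jQ by (intro Int_mono J_mono) (auto simp: m_def r_def J_ub2)
   also have "... <= J b (m Int r)" by (rule distr2[OF _ _ _ d]) auto
   also have "... <= J b (mt R (insert j Q))"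
   proof (rule J_lub)
    have "m Int r <= T Int (\<Inter>i\<in>insert j Q. J c (R i))"
    proof -
     have "m <= J c (R i)" if "i : Q" for i
      unfolding m_def using that jQ by (intro J_mono mt_le) auto
     then show ?thesis using T_upper[of m] by (auto simp: r_def)
    qed
    also have "... <= J c (mt R (insert j Q))" by (rule IH0) (use jQ in auto)
    also have "... <= J b (mt R (insert j Q))"
     using QI by (intro J_mono) (auto simp: b_def J_ub1)
    finally show "m Int r <= J b (mt R (insert j Q))" .
   qed (use QI J_ub1 in auto)
   finally show ?case .
  qed
 qed
 define a where "a = J (mt R K) c"
 have [simp]: "a : M" unfolding a_def by auto
 have "T Int (\<Inter>i\<in>P. J a (R i)) <= T Int (\<Inter>j\<in>K. J b (R j))"
 proof -
  have "T Int (\<Inter>i\<in>P. J a (R i)) <= J b (R j)" if j: "j : K" for j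
  proof -
   have "J a (R i) <= J (J c (R j)) (R i)" if "i : P" for i
   proof -
    have "R i : M" "R j : M" using that j by auto
    moreover have "a <= J c (R j)" unfolding a_def using j by (intro J_lub J_le2 J_ub1 mt_le) auto
    ultimately show ?thesis by (intro J_mono) auto
   qed
   then have "T Int (\<Inter>i\<in>P. J a (R i)) <= T Int (\<Inter>i\<in>P. J (J c (R j)) (R i))" by blast
   also have "... <= J (J c (R j)) (mt R P)" by (rule IH1) (use j ap in auto)
   also have "... <= J b (R j)" unfolding b_def using j
    by (intro J_lub J_le1[of c "J c (mt R P)" "R j"] J_le1[of "mt R P" "J c (mt R P)" "R j"] J_ub1 J_ub2) auto
   finally show ?thesis .
  qed
  then show ?thesis by blast
 qed
 also have "... <= J b (mt R K)" by (rule step) simp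
 also have "... <= J a (mt R P)" unfolding b_def a_def
  by (intro J_lub J_le1[of c "J (mt R K) c"] J_le1[of "mt R K" "J (mt R K) c"] J_ub1 J_ub2) auto
 finally show ?case by (simp add: a_def c_def)
qed

lemma codistr_imp_distr:
 assumes D: "codistr R I" and Q: "Q <= I"
 shows "apart I Ks Q ==> c : M ==> (!!K. K : set Ks ==> mt R (Q Un K) <= c) ==> mt R Q Int jm R Ks {} <= c"
proof (induction Ks)
 case Nil
 then show ?case using B_lower by (auto simp: jn_empty)
next
 case (Cons K Ks)
 have ap: "apart I Ks (Q Un K)" "K <= I" "K Int Q = {}" using Cons.prems by auto
 have sub: "!!L. L : set Ks ==> L <= I" using apart_sub[OF ap(1)] .
 define e where "e = jm R Ks {}"
 have [simp]: "e : M" unfolding e_def using sub by (intro jm_in) auto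
 have [simp]: "mt R Q : M" "mt R K : M" using Q ap by auto
 have mono: "J e (mt R S) <= J e (R i)" if "i : S" "S <= I" for i S
  using that by (intro J_mono mt_le) auto
 have "J e (mt R Q) Int J e (mt R K) <= T Int (\<Inter>i\<in>Q Un K. J e (R i))"
  using mono[of _ Q] mono[of _ K] Q ap T_upper[of "J e (mt R Q)"] by auto
 also have "... <= J e (mt R (Q Un K))"
  unfolding e_def by (rule codistr_list[OF D]) (use ap Q in auto)
 also have "mt R (Q Un K) = mt R Q Int mt R K" by (auto simp: mt_def)
 finally have "J e (mt R Q) Int J e (mt R K) <= J e (mt R Q Int mt R K)" .
 then have "mt R Q Int J (mt R K) e <= J (mt R Q Int mt R K) (mt R Q Int e)"
  by (rule distr1[rotated 3]) auto
 also have "... <= c"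
 proof (rule J_lub)
  have "apart I Ks Q" using ap(1) by (rule apart_mono) auto
  then show "mt R Q Int e <= c" unfolding e_def using Cons by auto
  have "mt R Q Int mt R K = mt R (Q Un K)" by (auto simp: mt_def)
  then show "mt R Q Int mt R K <= c" using Cons.prems by auto
 qed (use Cons.prems in auto)
 finally show ?case by (simp add: e_def)
qed

lemma distr_imp_codistr:
 assumes H: "!!Q Ks c. [|Q <= I; Ks ~= []; apart I Ks Q; c : M; !!K. K : set Ks ==> mt R (Q Un K) <= c|]
   ==> mt R Q Int jm R Ks {} <= c"
 shows "codistr R I"
 unfolding codistr_def
proof (intro allI impI, elim conjE)
 fix Z P assume Z: "Z <= I" "P <= I" "Z Int P = {}"
 have "finite P" using Z finI by auto
 then show "T Int (\<Inter>i\<in>P. J (jn R Z) (R i)) <= J (jn R Z) (mt R P)" using Z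
 proof (induction P rule: finite_induct)
  case empty
  then show ?case by (simp add: mt_def J_ub2)
 next
  case (insert t P)
  define k where "k = jn R Z"
  have [simp]: "k : M" "R t : M" "mt R P : M" "mt R (insert t P) : M" unfolding k_def using insert by auto
  obtain zs where zs: "set zs = Z" "distinct zs" using finite_distinct_list[OF finI[OF insert.prems(1)]] by blast
  define Ks where "Ks = {t} # map (%z. {z}) zs"
  have ap: "apart I (map (%z. {z}) ys) U" if "set ys <= I" "set ys Int U = {}" "distinct ys" for ys U
   using that
  proof (induction ys arbitrary: U)
   case (Cons y ys)
   have "apart I (map (%z. {z}) ys) (U Un {y})" using Cons.prems by (intro Cons.IH) auto
   then show ?case using Cons.prems by auto
  qed simp
  have apK: "apart I Ks P" unfolding Ks_def using insert zs by (auto intro!: ap)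
  have "R z <= jm R (map (%z. {z}) ys) {}" if "z : set ys" "set ys <= I" for z ys
   using that
  proof (induction ys)
   case (Cons y ys)
   have m: "jm R (map (%z. {z}) ys) {} : M" "mt R {y} : M" using Cons.prems by (auto intro!: jm_in)
   have "R y <= mt R {y}" using T_upper[of "R y"] Cons.prems by (auto simp: mt_def)
   then show ?case using Cons m by (auto intro!: J_le1 J_le2 dest: subsetD[OF J_ub2[OF m(2,1)]] subsetD[OF J_ub1[OF m(2,1)]])
  qed simp
  then have kle: "k <= jm R (map (%z. {z}) zs) {}"
   unfolding k_def using zs insert.prems by (intro jn_lub jm_in) auto
  have jt: "jm R Ks {} : M" unfolding Ks_def using zs insert.prems by (intro jm_in) auto
  have tin: "R t <= mt R {t}" using T_upper[of "R t"] by (auto simp: mt_def)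
  have mm: "jm R (map (%z. {z}) zs) {} : M" "mt R {t} : M" using zs insert.prems by (auto intro!: jm_in)
  have "J k (R t) <= jm R Ks {}"
   unfolding Ks_def using kle tin mm jt by (intro J_lub) (auto simp: Ks_def dest!: subsetD[OF J_ub2[OF mm(2,1)]] intro: subsetD[OF J_ub1[OF mm(2,1)]] subsetD[OF J_ub2[OF mm(2,1)]])
  moreover have "mt R P Int jm R Ks {} <= J (mt R (insert t P)) k"
  proof (rule H)
   fix K assume "K : set Ks"
   then consider "K = {t}" | z where "z : Z" "K = {z}" unfolding Ks_def using zs by auto
   then show "mt R (P Un K) <= J (mt R (insert t P)) k"
   proof cases
    case 1
    then show ?thesis using J_ub1[of "mt R (insert t P)" k] by simp
   next
    case 2
    then have "mt R (P Un K) <= k" unfolding k_def using jn_ub[of z Z R] by (auto simp: mt_def)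
    then show ?thesis by (intro J_le2) auto
   qed
  qed (use insert.prems apK in \<open>auto simp: Ks_def\<close>)
  ultimately have 1: "mt R P Int J k (R t) <= J (mt R (insert t P)) k" by blast
  have "T Int (\<Inter>i\<in>insert t P. J k (R i)) <= J k (mt R P) Int J k (R t)"
   using insert.IH insert.prems by (auto simp: k_def)
  also have "... <= J k (mt R P Int J k (R t))" by (intro modular J_ub1) auto
  also have "... <= J k (J (mt R (insert t P)) k)" using 1 by (intro J_mono) auto
  also have "... <= J k (mt R (insert t P))" by (intro J_lub J_ub1 J_ub2) auto
  finally show ?case by (simp add: k_def)
 qed
qed

end

end

section \<open>Lifting compatible families\<close>

definition liftable :: "('o, 'm) cat => 'o => 'i set => ('i => 'm) => ('i => 'i => 'm) => bool" where
 "liftable C W I f g <-> (ALL U x. U : Obj C & (ALL i:I. x i : Mor C & Dom C (x i) = U & Cod C (x i) = Cod C (f i)) &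
   (ALL i:I. ALL j:I. i ~= j --> Comp C (g i j) (x i) = Comp C (g j i) (x j)) -->
   (EX p w. re C p & Cod C p = U & w : Mor C & Dom C w = Dom C p & Cod C w = W &
    (ALL i:I. Comp C (f i) w = Comp C (x i) p)))"

lemma liftableI:
 assumes "!!U x. [|U : Obj C; !!i. i : I ==> x i : Mor C; !!i. i : I ==> Dom C (x i) = U;
   !!i. i : I ==> Cod C (x i) = Cod C (f i);
   !!i j. [|i : I; j : I; i ~= j|] ==> Comp C (g i j) (x i) = Comp C (g j i) (x j)|] ==>
   EX p w. re C p & Cod C p = U & w : Mor C & Dom C w = Dom C p & Cod C w = W &
    (ALL i:I. Comp C (f i) w = Comp C (x i) p)"
 shows "liftable C W I f g"
 unfolding liftable_def using assms by blast

lemma liftableD: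
 assumes "liftable C W I f g" "U : Obj C" "!!i. i : I ==> x i : Mor C" "!!i. i : I ==> Dom C (x i) = U"
   "!!i. i : I ==> Cod C (x i) = Cod C (f i)"
   "!!i j. [|i : I; j : I; i ~= j|] ==> Comp C (g i j) (x i) = Comp C (g j i) (x j)"
  obtains p w where "re C p" "Cod C p = U" "w : Mor C" "Dom C w = Dom C p" "Cod C w = W"
    "!!i. i : I ==> Comp C (f i) w = Comp C (x i) p"
proof -
 have "EX p w. re C p & Cod C p = U & w : Mor C & Dom C w = Dom C p & Cod C w = W &
    (ALL i:I. Comp C (f i) w = Comp C (x i) p)"
  using assms unfolding liftable_def by blast
 then show ?thesis using that by blast
qed

context EM begin

lemma Rels_modlat: assumes "x : Obj C"
 shows "modlat (Rels C x) (pairs C x) {(u, u) | u. u : Mor C & Cod C u = x} (rcomp C x)"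
proof
 fix a b c assume m: "a : Rels C x" "b : Rels C x" "c : Rels C x" "a <= c"
 show "rcomp C x a b Int c <= rcomp C x a (b Int c)"
 proof (intro subrelI)
  fix u v assume "(u, v) : rcomp C x a b Int c"
  then obtain p w where p: "(u, v) : pairs C x" "re C p" "Cod C p = Dom C u" "(u ** p, w) : a" "(w, v ** p) : b" "(u, v) : c"
   unfolding rcomp_def by auto
  have "(u ** p, v ** p) : c" by (rule Rels_cong[OF m(3) p(6) re_mor[OF p(2)] p(3)])
  then have "(w, v ** p) : c" using Rels_trans[OF m(3)] Rels_sym[OF m(3)] p(4) m(4) by blast
  then show "(u, v) : rcomp C x a (b Int c)" unfolding rcomp_def using p by blast
 qed
next
 fix a assume "a : Rels C x"
 then show "a <= pairs C x" "{(u, u) |u. u : Mor C & Cod C u = x} <= a"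
  using Rels_pairs Rels_refl by blast+
qed (use assms top_Rels bot_Rels meet_Rels rcomp_Rels rcomp_upper rcomp_least in auto)

lemma Rels_finite_meet: assumes "x : Obj C" "finite S" "!!s. s : S ==> R s : Rels C x"
 shows "pairs C x Int (\<Inter>s\<in>S. R s) : Rels C x"
 using modlat.mt_in[OF Rels_modlat[OF assms(1)] assms(2), of R] assms(3) modlat.mt_def[OF Rels_modlat[OF assms(1)], of R S] by simp

end

definition pos :: "(nat => nat) => bool" where
 "pos a <-> (ALL j. a j : {0, 1, 2})"

lemma pos_upd [simp]: "pos a ==> k : {0, 1, 2} ==> pos (a(i := k))"
 by (auto simp: pos_def)

locale nfork = EM C for C :: "('o, 'm) cat" +
 fixes n :: nat and V :: "(nat => nat) => 'o" and fm dm cm em :: "nat => (nat => nat) => 'm"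
 assumes indep: "!!a b i. (!!j. j < n ==> a j = b j) ==>
   V a = V b & fm i a = fm i b & dm i a = dm i b & cm i a = cm i b"
  and upd_fm [simp]: "!!a i k. i < n ==> fm i (a(i := k)) = fm i a"
  and upd_dm [simp]: "!!a i k. i < n ==> dm i (a(i := k)) = dm i a"
  and upd_cm [simp]: "!!a i k. i < n ==> cm i (a(i := k)) = cm i a"
  and fork: "!!a i. i < n ==> pos a ==> is_fork C (dm i a) (cm i a) (em i a) (fm i a)"
  and Dom_fm [simp]: "!!a i. i < n ==> pos a ==> Dom C (fm i a) = V (a(i := 1))"
  and Cod_fm [simp]: "!!a i. i < n ==> pos a ==> Cod C (fm i a) = V (a(i := 0))"
  and Dom_dm [simp]: "!!a i. i < n ==> pos a ==> Dom C (dm i a) = V (a(i := 2))"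
  and sq_f: "!!a i j. [|i < n; j < n; i ~= j; pos a|] ==> fm j (a(i := 0)) ** fm i (a(j := 1)) = fm i (a(j := 0)) ** fm j (a(i := 1))"
  and sq_d: "!!a i j. [|i < n; j < n; i ~= j; pos a|] ==> dm i (a(j := 0)) ** fm j (a(i := 2)) = fm j (a(i := 1)) ** dm i (a(j := 1))"
  and sq_c: "!!a i j. [|i < n; j < n; i ~= j; pos a|] ==> cm i (a(j := 0)) ** fm j (a(i := 2)) = fm j (a(i := 1)) ** cm i (a(j := 1))"
begin

lemma rgraph: "i < n ==> pos a ==> is_rgraph C (dm i a) (cm i a) (em i a)"
 using fork unfolding is_fork_def by blast

lemma mors [simp]: assumes "i < n" "pos a"
 shows "fm i a : Mor C" "dm i a : Mor C" "cm i a : Mor C"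
  "Cod C (dm i a) = V (a(i := 1))" "Dom C (cm i a) = V (a(i := 2))" "Cod C (cm i a) = V (a(i := 1))"
 using fork[OF assms] Dom_fm[OF assms] Dom_dm[OF assms] unfolding is_fork_def is_rgraph_def Hom_def by auto

lemma f_dc: "i < n ==> pos a ==> fm i a ** dm i a = fm i a ** cm i a"
 using fork unfolding is_fork_def by blast

lemma el_f: assumes "i < n" "j < n" "i ~= j" "pos a" "a i = 1" "a j = 1" "h : Mor C" "Cod C h = V a"
 shows "fm j (a(i := 0)) ** fm i a ** h = fm i (a(j := 0)) ** fm j a ** h"
proof (rule cmp_ext)
 show "fm j (a(i := 0)) ** fm i a = fm i (a(j := 0)) ** fm j a"
  using sq_f[OF assms(1-4)] assms(5,6) by (simp add: fun_upd_idem)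
qed (use assms in \<open>auto simp: fun_upd_idem fun_upd_twist\<close>)

lemma el_d: assumes "i < n" "j < n" "i ~= j" "pos a" "a i = 1" "a j = 1" "h : Mor C" "Cod C h = V (a(i := 2))"
 shows "dm i (a(j := 0)) ** fm j (a(i := 2)) ** h = fm j a ** dm i a ** h"
proof (rule cmp_ext)
 show "dm i (a(j := 0)) ** fm j (a(i := 2)) = fm j a ** dm i a"
  using sq_d[OF assms(1-4)] assms(5,6) by (simp add: fun_upd_idem)
qed (use assms in \<open>auto simp: fun_upd_idem fun_upd_twist\<close>)

lemma el_c: assumes "i < n" "j < n" "i ~= j" "pos a" "a i = 1" "a j = 1" "h : Mor C" "Cod C h = V (a(i := 2))"
 shows "cm i (a(j := 0)) ** fm j (a(i := 2)) ** h = fm j a ** cm i a ** h"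
proof (rule cmp_ext)
 show "cm i (a(j := 0)) ** fm j (a(i := 2)) = fm j a ** cm i a"
  using sq_c[OF assms(1-4)] assms(5,6) by (simp add: fun_upd_idem)
qed (use assms in \<open>auto simp: fun_upd_idem fun_upd_twist\<close>)

definition LE :: bool where
 "LE <-> (ALL i<n. ALL a. pos a --> kp C (fm i a) (dm i a) (cm i a))"

definition RE :: bool where
 "RE <-> (ALL i<n. ALL a. pos a --> coeq C (dm i a) (cm i a) (fm i a))"

definition epis :: bool where
 "epis <-> (ALL i<n. ALL a. pos a --> re C (fm i a))"

definition lifts :: "nat set => (nat => nat) => bool" where
 "lifts S a <-> liftable C (V a) S (%t. fm t a) (%t s. fm s (a(t := 0)))"

definition CRT :: bool where
 "CRT <-> (ALL S a. S <= {..<n} & S ~= {} & (ALL j. a j : {0, 1}) & (ALL t:S. a t = 1) --> lifts S a)"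

lemma RE_epis: "RE ==> epis"
 unfolding RE_def epis_def regular_epi_def by blast

lemma LE_epis_RE: "LE ==> epis ==> RE"
 unfolding LE_def RE_def epis_def using kp_coeq by blast

lemma pairing: assumes LE "i < n" "pos a" "u : Mor C" "v : Mor C" "Dom C u = Dom C v" "Cod C u = V (a(i := 1))" "Cod C v = V (a(i := 1))"
  "fm i a ** u = fm i a ** v"
 obtains h where "h : Mor C" "Dom C h = Dom C u" "Cod C h = V (a(i := 2))" "dm i a ** h = u" "cm i a ** h = v"
proof -
 have k: "pb C (fm i a) (fm i a) (dm i a) (cm i a)"
  using assms(1-3) unfolding LE_def is_kernel_pair_def by blast
 show ?thesis by (rule pb_ex[OF k assms(4-6)]) (use assms that in auto)
qed

lemma jointly_monic: assumes LE "i < n" "pos a" "u : Mor C" "v : Mor C" "Dom C u = Dom C v" "Cod C u = V (a(i := 2))" "Cod C v = V (a(i := 2))"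
  "dm i a ** u = dm i a ** v" "cm i a ** u = cm i a ** v"
 shows "u = v"
proof -
 have k: "pb C (fm i a) (fm i a) (dm i a) (cm i a)"
  using assms(1-3) unfolding LE_def is_kernel_pair_def by blast
 show ?thesis by (rule pb_unique[OF k assms(4-6)]) (use assms in auto)
qed

lemma pair_family: assumes LE "t < n" "pos a" "a t = 1" "S <= {..<n}" "t ~: S" "!!s. s : S ==> a s = 1"
  and y: "!!s. s : S ==> y s : Mor C" "!!s. s : S ==> Dom C (y s) = U" "!!s. s : S ==> Cod C (y s) = V (a(t := 2, s := 0))"
  and d: "!!s r. [|s : S; r : S; s ~= r|] ==> fm r (a(s := 0)) ** dm t (a(s := 0)) ** y s = fm s (a(r := 0)) ** dm t (a(r := 0)) ** y r"
  and c: "!!s r. [|s : S; r : S; s ~= r|] ==> fm r (a(s := 0)) ** cm t (a(s := 0)) ** y s = fm s (a(r := 0)) ** cm t (a(r := 0)) ** y r"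
  and sr: "s : S" "r : S" "s ~= r"
 shows "fm r (a(t := 2, s := 0)) ** y s = fm s (a(t := 2, r := 0)) ** y r"
proof -
 have *: "t ~= s" "t ~= r" "s < n" "r < n" "a s = 1" "a r = 1" using assms(5-7) sr by auto
 note S = assms(2-4) * sr(3)
 have tw: "a(t := 2, s := 0) = a(s := 0, t := 2)" "a(t := 2, r := 0) = a(r := 0, t := 2)"
   "a(s := 0, r := 0) = a(r := 0, s := 0)"
  using S by (auto simp: fun_upd_twist)
 have y': "Cod C (y s) = V (a(s := 0, t := 2))" "Cod C (y r) = V (a(r := 0, t := 2))" using y(3) sr tw by auto
 have ds: "dm t (a(s := 0, r := 0)) ** fm r (a(s := 0, t := 2)) ** y s = fm r (a(s := 0)) ** dm t (a(s := 0)) ** y s"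
  by (rule el_d) (use S y y' sr in auto)
 have dr: "dm t (a(r := 0, s := 0)) ** fm s (a(r := 0, t := 2)) ** y r = fm s (a(r := 0)) ** dm t (a(r := 0)) ** y r"
  by (rule el_d) (use S y y' sr in auto)
 have cs: "cm t (a(s := 0, r := 0)) ** fm r (a(s := 0, t := 2)) ** y s = fm r (a(s := 0)) ** cm t (a(s := 0)) ** y s"
  by (rule el_c) (use S y y' sr in auto)
 have cr: "cm t (a(r := 0, s := 0)) ** fm s (a(r := 0, t := 2)) ** y r = fm s (a(r := 0)) ** cm t (a(r := 0)) ** y r"
  by (rule el_c) (use S y y' sr in auto)
 have t4: "a(s := 0, t := 2, r := Suc 0) = a(s := 0, t := 2)" "a(r := 0, t := 2, s := Suc 0) = a(r := 0, t := 2)"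
   "a(s := 0, t := 2, r := 0) = a(s := 0, r := 0, t := 2)" "a(r := 0, t := 2, s := 0) = a(s := 0, r := 0, t := 2)" using S by (auto simp: fun_eq_iff)
 show ?thesis unfolding tw(1,2)
 proof (rule jointly_monic[OF assms(1), of t "a(s := 0, r := 0)"])
  show "dm t (a(s := 0, r := 0)) ** fm r (a(s := 0, t := 2)) ** y s = dm t (a(s := 0, r := 0)) ** fm s (a(r := 0, t := 2)) ** y r"
   unfolding ds using dr d[OF sr] by (simp add: tw)
  show "cm t (a(s := 0, r := 0)) ** fm r (a(s := 0, t := 2)) ** y s = cm t (a(s := 0, r := 0)) ** fm s (a(r := 0, t := 2)) ** y r"
   unfolding cs using cr c[OF sr] by (simp add: tw)
 qed (use S y y' sr t4 in simp_all)
qed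

text \<open>The Mal'tsev condition enters through permutability of the kernel relation in the new
 direction with the intersection of the kernel relations in the old directions.\<close>

lemma epis_lifts:
 assumes LE epis
 shows "[|finite S; S ~= {}; S <= {..<n}; pos a; !!t. t : S ==> a t = 1|] ==> lifts S a"
proof (induction S arbitrary: a rule: finite_ne_induct)
 case (singleton t)
 have t: "t < n" "a t = 1" "a(t := 1) = a" using singleton by auto
 show ?case unfolding lifts_def
 proof (rule liftableI)
  fix U x assume x: "U : Obj C" "!!i. i : {t} ==> x i : Mor C" "!!i. i : {t} ==> Dom C (x i) = U"
   "!!i. i : {t} ==> Cod C (x i) = Cod C (fm i a)"
  have "re C (fm t a)" using assms(2) t singleton unfolding epis_def by auto
  then obtain w p where "re C p" "w : Mor C" "p : Mor C" "Cod C p = Dom C (x t)" "Cod C w = Dom C (fm t a)"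
   "Dom C w = Dom C p" "fm t a ** w = x t ** p" by (rule re_lift[of _ "x t"]) (use x in auto)
  then show "EX p w. re C p & Cod C p = U & w : Mor C & Dom C w = Dom C p & Cod C w = V a &
    (ALL i:{t}. fm i a ** w = x i ** p)" using x t singleton by auto
 qed
next
 case (insert t S)
 have t: "t < n" "a t = 1" "t ~: S" "pos a" and upd: "a(t := 1) = a" using insert by auto
 have S: "!!s. s : S ==> s < n & a s = 1 & s ~= t & t ~= s" using insert by auto
 show ?case unfolding lifts_def
 proof (rule liftableI)
  fix U x assume U: "U : Obj C" and x: "!!i. i : insert t S ==> x i : Mor C" "!!i. i : insert t S ==> Dom C (x i) = U"
   "!!i. i : insert t S ==> Cod C (x i) = Cod C (fm i a)"
   and co: "!!i j. [|i : insert t S; j : insert t S; i ~= j|] ==> fm j (a(i := 0)) ** x i = fm i (a(j := 0)) ** x j"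
  have xt: "x t : Mor C" "Dom C (x t) = U" "Cod C (x t) = V (a(t := 0))" using x[of t] t by auto
  have xs: "x s : Mor C" "Dom C (x s) = U" "Cod C (x s) = V (a(s := 0))" if "s : S" for s using x[of s] S[OF that] t that by auto
  have "re C (fm t a)" using assms(2) t insert unfolding epis_def by auto
  then obtain x' p1 where p1: "re C p1" "x' : Mor C" "p1 : Mor C" "Cod C p1 = Dom C (x t)" "Cod C x' = Dom C (fm t a)"
   "Dom C x' = Dom C p1" "fm t a ** x' = x t ** p1" by (rule re_lift[of _ "x t"]) (use xt t in auto)
  have x': "Cod C x' = V a" "Cod C p1 = U" using p1 t upd xt by auto
  have "EX y. y : Mor C & Dom C y = Dom C p1 & Cod C y = V (a(t := 2, s := 0)) &
    dm t (a(s := 0)) ** y = fm s a ** x' & cm t (a(s := 0)) ** y = x s ** p1" if s: "s : S" for s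
  proof -
   note ss = S[OF s] xs[OF s]
   have u1: "a(s := 0, t := 1) = a(s := 0)" "a(s := 1) = a" "a(s := 0, t := Suc 0) = a(s := 0)" "a(s := Suc 0) = a" using t ss by (auto simp: fun_eq_iff)
   have "fm t (a(s := 0)) ** fm s a ** x' = fm s (a(t := 0)) ** fm t a ** x'"
    by (rule el_f) (use t ss p1 x' in auto)
   also have "... = fm s (a(t := 0)) ** x t ** p1" using p1 by simp
   also have "... = fm t (a(s := 0)) ** x s ** p1"
   proof (rule cmp_ext[OF co])
    have "a(t := 0, s := Suc 0) = a(t := 0)" using ss by auto
    then show "Cod C (x t) = Dom C (fm s (a(t := 0)))" using xt ss t by simp
   qed (use s xt ss t u1 p1 in simp_all)
   finally have e: "fm t (a(s := 0)) ** fm s a ** x' = fm t (a(s := 0)) ** x s ** p1" .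
   obtain y where "y : Mor C" "Dom C y = Dom C (fm s a ** x')" "Cod C y = V (a(s := 0, t := 2))"
     "dm t (a(s := 0)) ** y = fm s a ** x'" "cm t (a(s := 0)) ** y = x s ** p1"
    by (rule pairing[OF assms(1), of t "a(s := 0)" "fm s a ** x'" "x s ** p1"]) (use t ss u1 p1 x' e in simp_all)
   moreover have "a(s := 0, t := 2) = a(t := 2, s := 0)" using ss by (auto simp: fun_upd_twist)
   ultimately show ?thesis using t ss u1 p1 x' by auto
  qed
  then obtain y where y: "!!s. s : S ==> y s : Mor C" "!!s. s : S ==> Dom C (y s) = Dom C p1"
    "!!s. s : S ==> Cod C (y s) = V (a(t := 2, s := 0))"
    "!!s. s : S ==> dm t (a(s := 0)) ** y s = fm s a ** x'" "!!s. s : S ==> cm t (a(s := 0)) ** y s = x s ** p1"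
   by metis
  have "lifts S (a(t := 2))"
  proof (rule insert.IH)
   show "pos (a(t := 2))" using t(4) by simp
   show "S <= {..<n}" using insert.prems(1) by simp
   fix s assume "s : S"
   then show "(a(t := 2)) s = 1" using S by simp
  qed
  then obtain p2 z where p2: "re C p2" "Cod C p2 = Dom C p1" "z : Mor C" "Dom C z = Dom C p2" "Cod C z = V (a(t := 2))"
    and z: "!!s. s : S ==> fm s (a(t := 2)) ** z = y s ** p2"
   unfolding lifts_def
  proof (rule liftableD[where x = y and U = "Dom C p1"])
   show "Dom C p1 : Obj C" using p1 by auto
   show "Cod C (y s) = Cod C (fm s (a(t := 2)))" if "s : S" for s using y(3)[OF that] S[OF that] t by simp
   show "fm r (a(t := 2, s := 0)) ** y s = fm s (a(t := 2, r := 0)) ** y r" if sr: "s : S" "r : S" "s ~= r" for s r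
   proof (rule pair_family[OF assms(1) t(1) t(4) t(2), of S y])
    fix s r assume sr: "s : S" "r : S" "s ~= r"
    show "fm r (a(s := 0)) ** dm t (a(s := 0)) ** y s = fm s (a(r := 0)) ** dm t (a(r := 0)) ** y r"
     unfolding y(4)[OF sr(1)] y(4)[OF sr(2)] by (rule el_f) (use S sr t p1 x' in auto)
    show "fm r (a(s := 0)) ** cm t (a(s := 0)) ** y s = fm s (a(r := 0)) ** cm t (a(r := 0)) ** y r"
     unfolding y(5)[OF sr(1)] y(5)[OF sr(2)]
    proof (rule cmp_ext[OF co])
     have "a(s := 0, r := Suc 0) = a(s := 0)" "a(r := 0, s := Suc 0) = a(r := 0)" using S sr by (auto simp: fun_eq_iff)
     then show "Cod C (x s) = Dom C (fm r (a(s := 0)))" "Cod C (x r) = Dom C (fm s (a(r := 0)))" using xs sr S t by simp_all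
    qed (use sr xs S t p1 x' in simp_all)
   qed (use S t y sr in auto)
  qed (use y in auto)
  define u v where "u = dm t a ** z" and "v = cm t a ** z"
  have p2m: "p2 : Mor C" using re_mor[OF p2(1)] .
  have u: "u : Mor C" "Dom C u = Dom C p2" "Cod C u = V a" and v: "v : Mor C" "Dom C v = Dom C p2" "Cod C v = V a"
   unfolding u_def v_def using p2 t upd by auto
  have fu: "fm s a ** u = fm s a ** x' ** p2" and fv: "fm s a ** v = x s ** p1 ** p2" if s: "s : S" for s
  proof -
   note ss = S[OF s] xs[OF s]
   have tw: "a(s := 0, t := 2) = a(t := 2, s := 0)" "a(s := 0, t := Suc 0) = a(s := 0)" "a(s := Suc 0) = a" using ss t by (auto simp: fun_eq_iff)
   have "fm s a ** u = dm t (a(s := 0)) ** fm s (a(t := 2)) ** z"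
    unfolding u_def by (rule el_d[symmetric]) (use t ss p2 in auto)
   also have "... = (fm s a ** x') ** p2" unfolding z[OF s]
    by (rule cmp_ext1[OF y(4)[OF s]]) (use t ss p2 p2m y s tw in auto)
   also have "... = fm s a ** x' ** p2" by (rule assoc) (use t ss p2 p2m p1 x' tw in auto)
   finally show "fm s a ** u = fm s a ** x' ** p2" .
   have "fm s a ** v = cm t (a(s := 0)) ** fm s (a(t := 2)) ** z"
    unfolding v_def by (rule el_c[symmetric]) (use t ss p2 in auto)
   also have "... = (x s ** p1) ** p2" unfolding z[OF s]
    by (rule cmp_ext1[OF y(5)[OF s]]) (use t ss p2 p2m y s tw in auto)
   also have "... = x s ** p1 ** p2" by (rule assoc) (use t ss p2 p2m p1 x' tw in auto)
   finally show "fm s a ** v = x s ** p1 ** p2" .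
  qed
  have fuv: "fm t a ** u = fm t a ** v" unfolding u_def v_def
   by (rule cmp_ext[OF f_dc]) (use t p2 in auto)
  define m where "m = pairs C (V a) Int (\<Inter>s\<in>S. ker C (fm s a))"
  define k where "k = ker C (fm t a)"
  have Va: "V a : Obj C" using Dom_obj[OF mors(1)[OF t(1,4)]] t upd by simp
  have us: "a(s := Suc 0) = a" if "s : S" for s using S[OF that] by auto
  have ut: "a(t := Suc 0) = a" using t by auto
  have mR: "m : Rels C (V a)" unfolding m_def
  proof (rule Rels_finite_meet[OF Va insert.hyps(1)])
   fix s assume s: "s : S"
   show "ker C (fm s a) : Rels C (V a)" using ker_Rels[OF mors(1), of s a] S[OF s] t us[OF s] by simp
  qed
  have kR: "k : Rels C (V a)" unfolding k_def using ker_Rels[OF mors(1), of t a] t ut by simp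
  define x2 where "x2 = x' ** p2"
  have x2: "x2 : Mor C" "Dom C x2 = Dom C p2" "Cod C x2 = V a" unfolding x2_def using p1 x' p2 p2m by auto
  have "(x2, u) : m" unfolding m_def ker_def using x2 u fu S us t by (auto simp: pairs_iff x2_def)
  moreover have "(u, v) : k" unfolding k_def ker_def using u v fuv t ut by (auto simp: pairs_iff)
  moreover have "(x2, v) : pairs C (V a)" using x2 v by (simp add: pairs_iff)
  moreover have "x2 ** Id C (Dom C x2) = x2" "v ** Id C (Dom C x2) = v" using x2 v by auto
  moreover have "re C (Id C (Dom C x2))" "Cod C (Id C (Dom C x2)) = Dom C x2" using Dom_obj[OF x2(1)] re_Id Cod_Id by blast+
  ultimately have "(x2, v) : rcomp C (V a) m k" unfolding rcomp_def by force
  then have "(x2, v) : rcomp C (V a) k m" using rcomp_comm[OF mR kR] by simp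
  then obtain p3 w where p3: "re C p3" "Cod C p3 = Dom C p2" "(x2 ** p3, w) : k" "(w, v ** p3) : m"
   unfolding rcomp_def using x2 by auto
  have p3m: "p3 : Mor C" using re_mor[OF p3(1)] .
  have w: "w : Mor C" "Dom C w = Dom C p3" "Cod C w = V a" using p3(4) v p3 p3m unfolding m_def by (auto simp: pairs_iff)
  define p where "p = p1 ** p2 ** p3"
  have p: "re C p" "Cod C p = U" "Dom C p = Dom C p3" unfolding p_def
   using p1 p2 p3 p2m p3m x' by (auto intro!: re_cmp)
  have "fm t a ** w = x t ** p"
  proof -
   have "fm t a ** w = fm t a ** x' ** (p2 ** p3)" using p3(3) unfolding k_def ker_def x2_def using p1 p2 p3 x' p2m p3m by (auto simp: assoc)
   also have "... = (x t ** p1) ** (p2 ** p3)" by (rule cmp_ext1[OF p1(7)]) (use t p1 p2 p3 x' p2m p3m in auto)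
   also have "... = x t ** p" unfolding p_def by (rule assoc) (use xt p1 p2 p3 x' p2m p3m in auto)
   finally show ?thesis .
  qed
  moreover have "fm s a ** w = x s ** p" if s: "s : S" for s
  proof -
   have "fm s a ** w = fm s a ** v ** p3" using p3(4) s unfolding m_def ker_def by auto
   also have "... = (x s ** p1 ** p2) ** p3" by (rule cmp_ext1[OF fv[OF s]]) (use t S[OF s] us[OF s] v p2m p3m p3 in auto)
   also have "... = x s ** p" unfolding p_def using xs[OF s] p1 p2 p3 x' p2m p3m by (simp add: assoc)
   finally show ?thesis .
  qed
  ultimately show "EX p w. re C p & Cod C p = U & w : Mor C & Dom C w = Dom C p & Cod C w = V a &
    (ALL i:insert t S. fm i a ** w = x i ** p)" using p w by (intro exI[of _ p] exI[of _ w]) auto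
 qed
qed

lemma CRT_lifts:
 assumes LE CRT
 shows "[|finite S; S ~= {}; S <= {..<n}; pos a; !!t. t : S ==> a t = 1|] ==> lifts S a"
proof (induction "card {j. j < n & a j = 2}" arbitrary: S a)
 case 0
 then have c: "!!j. j < n ==> a j ~= 2" by auto
 define b where "b = (%j. if j < n then a j else 1)"
 have "b j : {0, 1}" for j using c[of j] 0(5) unfolding b_def pos_def by (auto split: if_splits)
 moreover have "ALL t:S. b t = 1" using 0 unfolding b_def by auto
 ultimately have "lifts S b" using assms(2) 0(3,4) unfolding CRT_def by blast
 moreover have "V b = V a" "fm i b = fm i a" "fm i (b(j := 0)) = fm i (a(j := 0))" for i j
  using indep[of b a] indep[of "b(j := 0)" "a(j := 0)"] by (auto simp: b_def)
 ultimately show ?case unfolding lifts_def by simp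
next
 case (Suc m)
 have "{j. j < n & a j = 2} ~= {}" using Suc(2) by (metis card.empty nat.distinct(1))
 then obtain t where t: "t < n" "a t = 2" by blast
 define b where "b = a(t := 1)"
 have at: "a = b(t := 2)" "a(t := 2) = a" using t by (auto simp: b_def)
 have posb: "pos b" "b t = 1" using Suc.prems by (auto simp: b_def)
 have ut: "b(t := Suc 0) = b" using posb by auto
 have tS: "t ~: S" using Suc.prems(5) t by force
 have S: "!!s. s : S ==> s < n & b s = 1 & s ~= t & t ~= s" using Suc.prems tS by (auto simp: b_def)
 have "{j. j < n & b j = 2} = {j. j < n & a j = 2} - {t}" by (auto simp: b_def)
 then have "m = card {j. j < n & b j = 2}" using Suc(2) t by simp
 note IH = Suc.hyps(1)[OF this]
 show ?case unfolding lifts_def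
 proof (rule liftableI)
  fix U x assume U: "U : Obj C" and x: "!!i. i : S ==> x i : Mor C" "!!i. i : S ==> Dom C (x i) = U"
   "!!i. i : S ==> Cod C (x i) = Cod C (fm i a)"
   and co: "!!i j. [|i : S; j : S; i ~= j|] ==> fm j (a(i := 0)) ** x i = fm i (a(j := 0)) ** x j"
  have xs: "x s : Mor C" "Dom C (x s) = U" "Cod C (x s) = V (b(s := 0, t := 2))" if "s : S" for s
   using x[of s] S[OF that] t posb that at by (auto simp: fun_upd_twist)
  have u1: "b(s := 0, t := Suc 0) = b(s := 0)" "b(t := 2, s := 0) = b(s := 0, t := 2)" if "s : S" for s
   using S[OF that] posb by (auto simp: fun_eq_iff)
  have u2: "b(s := 0, r := Suc 0) = b(s := 0)" "b(s := 0, t := 2, r := Suc 0) = b(s := 0, t := 2)" if "s : S" "r : S" "s ~= r" for s r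
   using S[OF that(1)] S[OF that(2)] that by (auto simp: fun_eq_iff)
  have D: "fm r (b(s := 0)) ** dm t (b(s := 0)) ** x s = dm t (b(s := 0, r := 0)) ** fm r (b(s := 0, t := 2)) ** x s"
    and Cc: "fm r (b(s := 0)) ** cm t (b(s := 0)) ** x s = cm t (b(s := 0, r := 0)) ** fm r (b(s := 0, t := 2)) ** x s"
   if sr: "s : S" "r : S" "s ~= r" for s r
   by (rule el_d[symmetric], use S[OF sr(1)] S[OF sr(2)] sr(3) t posb xs[OF sr(1)] in auto)
     (rule el_c[symmetric], use S[OF sr(1)] S[OF sr(2)] sr(3) t posb xs[OF sr(1)] in auto)
  have coo: "fm r (b(s := 0, t := 2)) ** x s = fm s (b(r := 0, t := 2)) ** x r" if sr: "s : S" "r : S" "s ~= r" for s r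
   using co[OF sr] u1 sr unfolding at(1) by simp
  have "lifts S b" by (rule IH) (use Suc.prems posb S in auto)
  then obtain p1 w1 where p1: "re C p1" "Cod C p1 = U" "w1 : Mor C" "Dom C w1 = Dom C p1" "Cod C w1 = V b"
    and w1: "!!s. s : S ==> fm s b ** w1 = (dm t (b(s := 0)) ** x s) ** p1"
   unfolding lifts_def
  proof (rule liftableD[where x = "%s. dm t (b(s := 0)) ** x s" and U = U])
   show "fm r (b(s := 0)) ** dm t (b(s := 0)) ** x s = fm s (b(r := 0)) ** dm t (b(r := 0)) ** x r" if sr: "s : S" "r : S" "s ~= r" for s r
    unfolding D[OF sr] D[OF sr(2,1) sr(3)[symmetric]] coo[OF sr] using sr by (simp add: fun_upd_twist)
  qed (use U xs S t posb u1 in auto)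
  have p1m: "p1 : Mor C" using re_mor[OF p1(1)] .
  define Y where "Y = (%s. if s = t then fm t b ** w1 else (cm t (b(s := 0)) ** x s) ** p1)"
  have Ys: "Y s = cm t (b(s := 0)) ** x s ** p1" "Y s : Mor C" "Dom C (Y s) = Dom C p1" "Cod C (Y s) = V (b(s := 0))" if s: "s : S" for s
   unfolding Y_def using S[OF s] xs[OF s] t posb u1[OF s] p1 p1m by (auto simp: assoc)
  have Yt: "Y t = fm t b ** w1" "Y t : Mor C" "Dom C (Y t) = Dom C p1" "Cod C (Y t) = V (b(t := 0))"
   unfolding Y_def using t posb ut p1 by auto
  have Yst: "fm t (b(s := 0)) ** Y s = fm s (b(t := 0)) ** Y t" if s: "s : S" for s
  proof -
   note ss = S[OF s] xs[OF s]
   have us: "b(s := Suc 0) = b" using ss by auto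
   have "fm t (b(s := 0)) ** Y s = fm t (b(s := 0)) ** dm t (b(s := 0)) ** (x s ** p1)"
    unfolding Ys(1)[OF s] by (rule cmp_ext[OF f_dc[symmetric]]) (use ss t posb u1[OF s] p1 p1m in auto)
   also have "dm t (b(s := 0)) ** (x s ** p1) = fm s b ** w1" unfolding w1[OF s]
    by (rule assoc[symmetric]) (use ss t posb u1[OF s] p1 p1m in auto)
   also have "fm t (b(s := 0)) ** fm s b ** w1 = fm s (b(t := 0)) ** Y t" unfolding Yt(1)
    by (rule el_f) (use ss t posb p1 in auto)
   finally show ?thesis .
  qed
  have Yss: "fm r (b(s := 0)) ** Y s = fm s (b(r := 0)) ** Y r" if sr: "s : S" "r : S" "s ~= r" for s r
  proof -
   note ss = S[OF sr(1)] xs[OF sr(1)] S[OF sr(2)] xs[OF sr(2)]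
   have e: "fm r (b(s := 0)) ** (cm t (b(s := 0)) ** x s) = fm s (b(r := 0)) ** (cm t (b(r := 0)) ** x r)"
    unfolding Cc[OF sr] Cc[OF sr(2,1) sr(3)[symmetric]] coo[OF sr] using sr by (simp add: fun_upd_twist)
   have "Y s = (cm t (b(s := 0)) ** x s) ** p1" "Y r = (cm t (b(r := 0)) ** x r) ** p1" unfolding Y_def using ss by auto
   then show ?thesis using u2[OF sr] u2[OF sr(2,1)] sr(3) ss t posb u1 sr p1 p1m by (auto intro!: cmp_ext[OF e])
  qed
  have "lifts (insert t S) b" by (rule IH) (use Suc.prems posb S t in auto)
  then obtain p2 w2 where p2: "re C p2" "Cod C p2 = Dom C p1" "w2 : Mor C" "Dom C w2 = Dom C p2" "Cod C w2 = V b"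
    and w2: "!!s. s : insert t S ==> fm s b ** w2 = Y s ** p2"
   unfolding lifts_def
  proof (rule liftableD[where x = Y and U = "Dom C p1"])
   show "fm r (b(s := 0)) ** Y s = fm s (b(r := 0)) ** Y r" if "s : insert t S" "r : insert t S" "s ~= r" for s r
    using that Yst Yss by (metis insertE)
  qed (use p1 p1m Ys Yt S t posb in auto)
  have p2m: "p2 : Mor C" using re_mor[OF p2(1)] .
  have e: "fm t b ** w1 ** p2 = fm t b ** w2"
  proof -
   have "fm t b ** w2 = (fm t b ** w1) ** p2" using w2[of t] Yt(1) by simp
   also have "... = fm t b ** w1 ** p2" by (rule assoc) (use t posb ut p1 p2 p2m in auto)
   finally show ?thesis by simp
  qed
  obtain z where z: "z : Mor C" "Dom C z = Dom C p2" "Cod C z = V (b(t := 2))" "dm t b ** z = w1 ** p2" "cm t b ** z = w2"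
  proof (rule pairing[OF assms(1), of t b "w1 ** p2" w2])
   fix h assume "h : Mor C" "Dom C h = Dom C (w1 ** p2)" "Cod C h = V (b(t := 2))" "dm t b ** h = w1 ** p2" "cm t b ** h = w2"
   then show thesis using that[of h] p1 p2 p2m by auto
  qed (use t posb ut p1 p2 p2m e in auto)
  define p where "p = p1 ** p2"
  have p: "re C p" "Cod C p = U" "Dom C p = Dom C p2" "p : Mor C" unfolding p_def
   using p1 p2 p2m p1m by (auto intro!: re_cmp)
  have "fm s a ** z = x s ** p" if s: "s : S" for s
  proof (rule jointly_monic[OF assms(1), of t "b(s := 0)"])
   note ss = S[OF s] xs[OF s]
   have us: "b(s := Suc 0) = b" "b(t := 2, s := Suc 0) = b(t := 2)" using ss by (auto simp: fun_eq_iff)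
   show "fm s a ** z : Mor C" "x s ** p : Mor C" "Dom C (fm s a ** z) = Dom C (x s ** p)"
     "Cod C (fm s a ** z) = V (b(s := 0, t := 2))" "Cod C (x s ** p) = V (b(s := 0, t := 2))"
    unfolding at(1) using ss us t posb z p u1[OF s] by auto
   have "dm t (b(s := 0)) ** fm s a ** z = fm s b ** dm t b ** z" unfolding at(1) by (rule el_d) (use ss t posb z in auto)
   also have "... = fm s b ** w1 ** p2" using z by simp
   also have "... = (fm s b ** w1) ** p2" by (rule assoc[symmetric]) (use ss us t posb p1 p2 p2m in auto)
   also have "... = dm t (b(s := 0)) ** x s ** p" unfolding w1[OF s] p_def using ss t posb p1 p1m p2 p2m u1[OF s] by (simp add: assoc)
   finally show "dm t (b(s := 0)) ** fm s a ** z = dm t (b(s := 0)) ** x s ** p" .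
   have "cm t (b(s := 0)) ** fm s a ** z = fm s b ** cm t b ** z" unfolding at(1) by (rule el_c) (use ss t posb z in auto)
   also have "... = Y s ** p2" using z w2[of s] s by simp
   also have "... = cm t (b(s := 0)) ** x s ** p" unfolding Ys(1)[OF s] p_def using ss t posb p1 p1m p2 p2m u1[OF s] by (simp add: assoc)
   finally show "cm t (b(s := 0)) ** fm s a ** z = cm t (b(s := 0)) ** x s ** p" .
  qed (use t posb in auto)
  then show "EX p w. re C p & Cod C p = U & w : Mor C & Dom C w = Dom C p & Cod C w = V a &
    (ALL i:S. fm i a ** w = x i ** p)" using p z at by (intro exI[of _ p] exI[of _ z]) auto
 qed
qed

lemma epis_CRT: assumes LE epis shows CRT
 unfolding CRT_def
proof (intro allI impI, elim conjE)
 fix S a assume "S <= {..<n}" "S ~= {}" "ALL j. a j : {0, 1 :: nat}" "ALL t:S. a t = 1"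
 moreover from this have "pos a" unfolding pos_def by blast
 ultimately show "lifts S a" using finite_subset[of S "{..<n}"] by (intro epis_lifts[OF assms]) simp_all
qed

lemma CRT_epis: assumes LE CRT shows epis
 unfolding epis_def
proof (intro allI impI)
 fix i a assume i: "i < n" and a: "pos a"
 have "lifts {i} (a(i := 1))" by (rule CRT_lifts[OF assms]) (use i a in auto)
 then obtain p w where "re C p" "Cod C p = V (a(i := 0))" "w : Mor C" "Dom C w = Dom C p" "Cod C w = V (a(i := 1))"
    "fm i a ** w = Id C (V (a(i := 0))) ** p"
  unfolding lifts_def
 proof (rule liftableD[where x = "%_. Id C (V (a(i := 0)))" and U = "V (a(i := 0))"], goal_cases)
  have "V (a(i := 0)) : Obj C" using Cod_obj[OF mors(1)[OF i a]] i a by simp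
  then show "V (a(i := 0)) : Obj C" "!!j. j : {i} ==> Id C (V (a(i := 0))) : Mor C"
    "!!j. j : {i} ==> Dom C (Id C (V (a(i := 0)))) = V (a(i := 0))"
    "!!j. j : {i} ==> Cod C (Id C (V (a(i := 0)))) = Cod C (fm j (a(i := 1)))" using i a by auto
 qed (use i in auto)
 then show "re C (fm i a)" using i a re_mor[of p] by (intro re_local[of "fm i a" p w]) auto
qed

end

definition zero_on :: "(nat => nat) => nat set => nat => nat" where
 "zero_on a Z = (%j. if j : Z then 0 else a j)"

lemma zero_on_insert: "zero_on a (insert i Z) = (zero_on a Z)(i := 0)"
 and zero_on_upd: "i ~: Z ==> zero_on (a(i := k)) Z = (zero_on a Z)(i := k)"
 and zero_on_empty [simp]: "zero_on a {} = a"
 and zero_on_notin [simp]: "i ~: Z ==> zero_on a Z i = a i"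
 and pos_zero_on [simp]: "pos a ==> pos (zero_on a Z)"
 by (auto simp: zero_on_def pos_def fun_eq_iff)

context nfork begin

fun path :: "(nat => nat) => nat set => nat => 'm" where
 "path a Z 0 = Id C (V a)"
| "path a Z (Suc m) = (if m : Z then fm m (zero_on a (Z Int {..<m})) ** path a Z m else path a Z m)"

lemma V_obj: "n ~= 0 ==> pos a ==> V a : Obj C"
 using indep[of "a(0 := a 0)" a] Dom_obj[OF mors(1)[of 0 a]] Cod_obj[OF mors(1)[of 0 a]] Dom_obj[OF mors(2)[of 0 a]]
 by (cases "a 0 = 0"; cases "a 0 = 1"; auto simp: pos_def fun_upd_idem; metis fun_upd_triv numeral_2_eq_2)

lemma path_typed: assumes "m <= n" "pos a" "!!i. i : Z ==> a i = 1" "n ~= 0"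
 shows "path a Z m : Mor C & Dom C (path a Z m) = V a & Cod C (path a Z m) = V (zero_on a (Z Int {..<m}))"
 using assms(1)
proof (induction m)
 case 0
 then show ?case using V_obj assms by simp
next
 case (Suc m)
 let ?b = "zero_on a (Z Int {..<m})"
 show ?case
 proof (cases "m : Z")
  case True
  then have "?b m = 1" using assms by simp
  then have b1: "?b(m := 1) = ?b" by (simp add: fun_upd_idem)
  have Zm: "Z Int {..<Suc m} = insert m (Z Int {..<m})" using True by auto
  have mp: "m < n" "pos ?b" using Suc assms by simp_all
  have T: "fm m ?b : Mor C" "Dom C (fm m ?b) = V ?b" "Cod C (fm m ?b) = V (?b(m := 0))"
   using mors(1)[OF mp] Dom_fm[OF mp] Cod_fm[OF mp] unfolding b1 by auto
  have e: "zero_on a (Z Int {..<Suc m}) = ?b(m := 0)" unfolding Zm by (rule zero_on_insert)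
  have "path a Z m : Mor C" "Dom C (path a Z m) = V a" "Cod C (path a Z m) = V ?b" using Suc by simp_all
  then show ?thesis unfolding path.simps if_P[OF True] e using T by (metis cmp_mor Dom_cmp Cod_cmp)
 next
  case False
  then have "Z Int {..<Suc m} = Z Int {..<m}" using less_Suc_eq by auto
  then show ?thesis using Suc False by simp
 qed
qed

lemma path_insert: assumes "m <= n" "pos a" "!!j. j : Z ==> a j = 1" "a i = 1" "i ~: Z" "i < n"
 shows "path a (insert i Z) m = (if i < m then fm i (zero_on a (Z Int {..<m})) ** path a Z m else path a Z m)"
 using assms(1)
proof (induction m)
 case 0
 then show ?case by simp
next
 case (Suc m)
 let ?b = "zero_on a (Z Int {..<m})"
 have T: "path a Z m : Mor C" "Cod C (path a Z m) = V ?b" using path_typed[of m a Z] assms Suc by auto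
 have bi: "?b i = 1" using assms by simp
 consider "m = i" | "m ~= i" "m : Z" "i < m" | "m ~= i" "m : Z" "\<not> i < m" | "m ~= i" "m ~: Z" by blast
 then show ?case
 proof cases
  case 1
  have "insert i Z Int {..<m} = Z Int {..<m}" "Z Int {..<Suc m} = Z Int {..<m}" using 1 assms(5) less_Suc_eq by auto
  then show ?thesis using 1 Suc assms by simp
 next
  case 2
  have e: "insert i Z Int {..<m} = insert i (Z Int {..<m})" "Z Int {..<Suc m} = insert m (Z Int {..<m})" using 2 by auto
  have bm: "?b m = 1" using assms 2 by simp
  have "fm m (?b(i := 0)) ** fm i ?b ** path a Z m = fm i (?b(m := 0)) ** fm m ?b ** path a Z m"
   by (rule el_f) (use 2 Suc assms T bi bm in auto)
  then show ?thesis using 2 Suc assms e by (simp add: zero_on_insert)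
 next
  case 3
  then have "insert i Z Int {..<m} = Z Int {..<m}" by auto
  then show ?thesis using 3 Suc by simp
 next
  case 4
  then have "Z Int {..<Suc m} = Z Int {..<m}" using less_Suc_eq by auto
  then show ?thesis using 4 Suc by auto
 qed
qed

abbreviation proj :: "(nat => nat) => nat set => 'm" where
 "proj a Z \<equiv> path a Z n"

lemma proj_typed: assumes "pos a" "!!i. i : Z ==> a i = 1" "Z <= {..<n}" "n ~= 0"
 shows "proj a Z : Mor C" "Dom C (proj a Z) = V a" "Cod C (proj a Z) = V (zero_on a Z)"
 using path_typed[of n a Z] assms by (auto simp: Int_absorb2)

lemma proj_insert: assumes "pos a" "!!j. j : Z ==> a j = 1" "a i = 1" "i ~: Z" "i < n" "Z <= {..<n}"
 shows "proj a (insert i Z) = fm i (zero_on a Z) ** proj a Z"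
 using path_insert[of n a Z i] assms by (auto simp: Int_absorb2)

lemma proj_empty: "n ~= 0 ==> proj a {} = Id C (V a)"
proof -
 have "path a {} m = Id C (V a)" for m by (induction m) auto
 then show ?thesis by simp
qed

lemma proj_epi: assumes epis "pos a" "!!i. i : Z ==> a i = 1" "Z <= {..<n}" "n ~= 0"
 shows "re C (proj a Z)"
proof -
 have "finite Z" using assms(4) finite_subset by blast
 then show ?thesis using assms(3,4)
 proof (induction Z rule: finite_induct)
  case empty
  then show ?case using proj_empty V_obj assms re_Id by simp
 next
  case (insert i Z)
  have "proj a (insert i Z) = fm i (zero_on a Z) ** proj a Z" using insert assms by (intro proj_insert) auto
  moreover have "(zero_on a Z)(i := Suc 0) = zero_on a Z" using insert by (simp add: fun_upd_idem)
  moreover have "re C (fm i (zero_on a Z))" using assms insert unfolding epis_def by auto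
  ultimately show ?case using insert assms proj_typed[of a Z] by (auto intro!: re_cmp)
 qed
qed

lemma proj_d: assumes "pos a" "!!j. j : Z ==> a j = 1" "a i = 1" "i ~: Z" "i < n" "Z <= {..<n}"
 shows "dm i (zero_on a Z) ** proj (a(i := 2)) Z = proj a Z ** dm i a"
  "cm i (zero_on a Z) ** proj (a(i := 2)) Z = proj a Z ** cm i a"
proof -
 have "finite Z" using assms(6) finite_subset by blast
 then have "dm i (zero_on a Z) ** proj (a(i := 2)) Z = proj a Z ** dm i a & cm i (zero_on a Z) ** proj (a(i := 2)) Z = proj a Z ** cm i a"
  using assms(2,4,6)
 proof (induction Z rule: finite_induct)
  case empty
  have a1: "a(i := 1) = a" using assms(3) by auto
  have n0: "n ~= 0" using assms(5) by auto
  show ?case unfolding proj_empty[OF n0] zero_on_empty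
   using mors[OF assms(5,1)] Dom_dm[OF assms(5,1)] unfolding a1 by simp
 next
  case (insert j Z)
  note ij = insert.prems insert.hyps
  have a1: "a(i := Suc 0) = a" using assms by auto
  let ?b = "zero_on a Z"
  have b: "?b i = 1" "?b j = 1" "i ~= j" "j < n" "pos ?b" using assms ij by auto
  have b1: "?b(j := Suc 0) = ?b" "?b(i := Suc 0) = ?b" using b by auto
  have T: "proj (a(i := 2)) Z : Mor C" "Dom C (proj (a(i := 2)) Z) = V (a(i := 2))" "Cod C (proj (a(i := 2)) Z) = V (?b(i := 2))"
    "proj a Z : Mor C" "Dom C (proj a Z) = V a" "Cod C (proj a Z) = V ?b"
  proof -
   have o: "(a(i := 2)) k = 1" if "k : Z" for k using that ij by auto
   have Zn: "Z <= {..<n}" "n ~= 0" "i ~: Z" using ij assms by auto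
   show "proj (a(i := 2)) Z : Mor C" "Dom C (proj (a(i := 2)) Z) = V (a(i := 2))" "Cod C (proj (a(i := 2)) Z) = V (?b(i := 2))"
    using proj_typed[of "a(i := 2)" Z, OF _ o Zn(1,2)] pos_upd[OF assms(1), of 2 i] unfolding zero_on_upd[OF Zn(3)] by blast+
   show "proj a Z : Mor C" "Dom C (proj a Z) = V a" "Cod C (proj a Z) = V ?b"
    using proj_typed[of a Z] assms(1) ij Zn by auto
  qed
  have p2: "proj (a(i := 2)) (insert j Z) = fm j (?b(i := 2)) ** proj (a(i := 2)) Z"
  proof -
   have o: "(a(i := 2)) k = 1" if "k : Z" for k using that ij by auto
   have "(a(i := 2)) j = 1" "j ~: Z" "j < n" "Z <= {..<n}" "i ~: Z" using ij b by auto
   then show ?thesis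
    using proj_insert[of "a(i := 2)" Z j, OF pos_upd[OF assms(1)] o] zero_on_upd[of i Z a 2] by simp
  qed
  have p1: "proj a (insert j Z) = fm j ?b ** proj a Z"
   using proj_insert[of a Z j] assms ij b by auto
  have "dm i ?b ** proj (a(i := 2)) Z = proj a Z ** dm i a & cm i ?b ** proj (a(i := 2)) Z = proj a Z ** cm i a"
   by (rule insert.IH) (use ij in auto)
  then have IH: "dm i ?b ** proj (a(i := 2)) Z = proj a Z ** dm i a" "cm i ?b ** proj (a(i := 2)) Z = proj a Z ** cm i a"
   by blast+
  have "dm i (?b(j := 0)) ** fm j (?b(i := 2)) ** proj (a(i := 2)) Z = fm j ?b ** dm i ?b ** proj (a(i := 2)) Z"
   by (rule el_d) (use assms b T in auto)
  also have "... = (fm j ?b ** proj a Z) ** dm i a" unfolding IH by (rule assoc[symmetric]) (use assms b T b1 a1 in auto)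
  finally have 1: "dm i (?b(j := 0)) ** fm j (?b(i := 2)) ** proj (a(i := 2)) Z = (fm j ?b ** proj a Z) ** dm i a" .
  have "cm i (?b(j := 0)) ** fm j (?b(i := 2)) ** proj (a(i := 2)) Z = fm j ?b ** cm i ?b ** proj (a(i := 2)) Z"
   by (rule el_c) (use assms b T in auto)
  also have "... = (fm j ?b ** proj a Z) ** cm i a" unfolding IH by (rule assoc[symmetric]) (use assms b T b1 a1 in auto)
  finally have 2: "cm i (?b(j := 0)) ** fm j (?b(i := 2)) ** proj (a(i := 2)) Z = (fm j ?b ** proj a Z) ** cm i a" .
  show ?case unfolding p1 p2 zero_on_insert by (rule conjI[OF 1 2])
 qed
 then show "dm i (zero_on a Z) ** proj (a(i := 2)) Z = proj a Z ** dm i a"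
  "cm i (zero_on a Z) ** proj (a(i := 2)) Z = proj a Z ** cm i a" by auto
qed

definition ones :: "nat => nat" where "ones = (%_. 1)"

lemma ones [simp]: "pos ones" "ones j = 1"
 by (auto simp: ones_def pos_def)

abbreviation K :: "nat set => ('m \<times> 'm) set" where
 "K Z \<equiv> ker C (proj ones Z)"

abbreviation R :: "nat => ('m \<times> 'm) set" where
 "R i \<equiv> ker C (fm i ones)"

abbreviation bottom :: "('m \<times> 'm) set" where
 "bottom \<equiv> {(u, u) | u. u : Mor C & Cod C u = V ones}"

context
 assumes n0: "n ~= 0" and re: RE
begin

lemma pt: "Z <= {..<n} ==> proj ones Z : Mor C" "Z <= {..<n} ==> Dom C (proj ones Z) = V ones"
  "Z <= {..<n} ==> Cod C (proj ones Z) = V (zero_on ones Z)"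
 using proj_typed[of ones Z] n0 by auto

lemma pins: "Z <= {..<n} ==> i < n ==> i ~: Z ==> proj ones (insert i Z) = fm i (zero_on ones Z) ** proj ones Z"
 using proj_insert[of ones Z i] by auto

lemma zo1: "i ~: Z ==> (zero_on ones Z)(i := Suc 0) = zero_on ones Z"
 by (simp add: fun_upd_idem)

lemma pins_el: assumes "Z <= {..<n}" "i < n" "i ~: Z" "u : Mor C" "Cod C u = V ones"
 shows "proj ones (insert i Z) ** u = fm i (zero_on ones Z) ** proj ones Z ** u"
 unfolding pins[OF assms(1-3)] by (rule assoc) (use assms pt zo1 in auto)

lemma x0: "V ones : Obj C" using V_obj n0 by simp

interpretation L: modlat "Rels C (V ones)" "pairs C (V ones)" bottom "rcomp C (V ones)"
 by (rule Rels_modlat[OF x0])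

lemma ep: epis by (rule RE_epis[OF re])

lemma K_in: "Z <= {..<n} ==> K Z : Rels C (V ones)"
 using ker_Rels[OF pt(1)] pt(2) by metis

lemma K_iff: "Z <= {..<n} ==> (u, v) : K Z <-> (u, v) : pairs C (V ones) & proj ones Z ** u = proj ones Z ** v"
 unfolding ker_def using pt by auto

lemma R_in: "i < n ==> R i : Rels C (V ones)"
 using ker_Rels[OF mors(1), of i ones] fun_upd_idem[of ones i 1] by simp

lemma K_single: "i < n ==> K {i} = R i"
 using pins[of "{}" i] proj_empty[of ones] n0 fun_upd_idem[of ones i 1] by simp

lemma K_step: assumes "Z <= {..<n}" "i < n" "i ~: Z" shows "K Z <= K (insert i Z)"
proof (intro subrelI)
 fix u v assume uv: "(u, v) : K Z"
 then show "(u, v) : K (insert i Z)"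
  using assms pins_el[OF assms, of u] pins_el[OF assms, of v] by (simp add: K_iff pairs_iff)
qed

lemma R_le_K: assumes "Z <= {..<n}" "i : Z" shows "R i <= K Z"
proof -
 have main: "finite Y ==> Y <= {..<n} - {i} ==> R i <= K (insert i Y)" for Y
  proof (induction Y rule: finite_induct)
   case empty
   have "i < n" using assms by blast
   then show ?case using K_single[of i] by blast
  next
   case (insert j Y)
   have "K (insert i Y) <= K (insert j (insert i Y))" by (rule K_step) (use insert assms in auto)
   moreover have "R i <= K (insert i Y)" using insert by blast
   ultimately show ?case unfolding insert_commute[of i j] by (rule subset_trans[rotated])
  qed
 have "finite (Z - {i})" "insert i (Z - {i}) = Z" using assms finite_subset by auto
 then show ?thesis using main[of "Z - {i}"] assms(1) by (metis Diff_mono order_refl)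
qed

text \<open>The kernel pair of the coequaliser \<open>fm i\<close> is the image of the reflexive graph, and that
 graph is covered by its counterpart over the vertex with all coordinates 1.\<close>

lemma K_insert_lub: assumes Z: "Z <= {..<n}" "i < n" "i ~: Z"
 and r: "r : Rels C (V ones)" "K Z <= r" "R i <= r"
 shows "K (insert i Z) <= r"
proof (intro subrelI)
 fix u v assume "(u, v) : K (insert i Z)"
 then have uv: "(u, v) : pairs C (V ones)" "proj ones (insert i Z) ** u = proj ones (insert i Z) ** v"
  using K_iff[of "insert i Z"] Z by auto
 then have uv': "u : Mor C" "v : Mor C" "Dom C u = Dom C v" "Cod C u = V ones" "Cod C v = V ones" by (auto simp: pairs_iff)
 let ?b = "zero_on ones Z"
 note b1 = zo1[OF Z(3)]
 note T = pt[OF Z(1)]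
 have "(proj ones Z ** u, proj ones Z ** v) : ker C (fm i ?b)"
  unfolding ker_def using uv(2) pins_el[OF Z, of u] pins_el[OF Z, of v] uv' T Z b1 by (auto simp: pairs_iff)
 also have "ker C (fm i ?b) = gen_rel C (dm i ?b) (cm i ?b)"
  by (rule rgraph_coeq(2)[OF rgraph]) (use re Z in \<open>auto simp: RE_def\<close>)
 finally obtain p h where p0: "re C p" "Cod C p = Dom C (proj ones Z ** u)" and h0: "h : Mor C" "Dom C h = Dom C p" "Cod C h = Dom C (dm i ?b)"
  "dm i ?b ** h = (proj ones Z ** u) ** p" "cm i ?b ** h = (proj ones Z ** v) ** p"
  unfolding gen_rel_def by blast
 have "Dom C (proj ones Z ** u) = Dom C u" by (rule Dom_cmp) (use uv' T in simp_all)
 moreover have "Dom C (dm i ?b) = V (?b(i := 2))" by (rule Dom_dm) (use Z in simp_all)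
 ultimately have p: "re C p" "Cod C p = Dom C u" and h: "h : Mor C" "Dom C h = Dom C p" "Cod C h = V (?b(i := 2))"
  "dm i ?b ** h = (proj ones Z ** u) ** p" "cm i ?b ** h = (proj ones Z ** v) ** p"
  using p0 h0 by simp_all
 have pm: "p : Mor C" using re_mor[OF p(1)] .
 let ?o = "ones(i := 2)"
 have o: "!!j. j : Z ==> ?o j = 1" "pos ?o" using Z by auto
 have s: "re C (proj ?o Z)" by (rule proj_epi[OF ep]) (use o Z n0 in auto)
 have S: "proj ?o Z : Mor C" "Dom C (proj ?o Z) = V ?o" "Cod C (proj ?o Z) = V (?b(i := 2))"
  using proj_typed[of ?o Z] o Z n0 zero_on_upd[OF Z(3)] by auto
 obtain h' p' where p': "re C p'" "h' : Mor C" "p' : Mor C" "Cod C p' = Dom C h" "Cod C h' = Dom C (proj ?o Z)"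
   "Dom C h' = Dom C p'" "proj ?o Z ** h' = h ** p'" by (rule re_lift[OF s, of h]) (use h S in auto)
 have o1: "ones(i := Suc 0) = ones" by auto
 have D: "dm i ?b ** proj ?o Z = proj ones Z ** dm i ones" "cm i ?b ** proj ?o Z = proj ones Z ** cm i ones"
  using proj_d[of ones Z i] Z by auto
 define u' v' where "u' = dm i ones ** h'" and "v' = cm i ones ** h'"
 have T': "u' : Mor C" "Dom C u' = Dom C p'" "Cod C u' = V ones" "v' : Mor C" "Dom C v' = Dom C p'" "Cod C v' = V ones"
  unfolding u'_def v'_def using Z p' S o1 by auto
 define q where "q = p ** p'"
 have q: "re C q" "q : Mor C" "Dom C q = Dom C p'" "Cod C q = Dom C u" unfolding q_def using p p' pm h by (auto intro!: re_cmp)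
 have e1: "proj ones Z ** u' = proj ones Z ** u ** q"
 proof -
  have "proj ones Z ** u' = dm i ?b ** proj ?o Z ** h'"
   unfolding u'_def by (rule cmp_ext[OF D(1)[symmetric]]) (use Z p' S T o1 b1 in auto)
  also have "... = ((proj ones Z ** u) ** p) ** p'" unfolding p'(7)
   by (rule cmp_ext1[OF h(4)]) (use Z h p' in auto)
  also have "... = proj ones Z ** u ** q" unfolding q_def using T uv' p pm p' h by (simp add: assoc)
  finally show ?thesis .
 qed
 have e2: "proj ones Z ** v' = proj ones Z ** v ** q"
 proof -
  have "proj ones Z ** v' = cm i ?b ** proj ?o Z ** h'"
   unfolding v'_def by (rule cmp_ext[OF D(2)[symmetric]]) (use Z p' S T o1 b1 in auto)
  also have "... = ((proj ones Z ** v) ** p) ** p'" unfolding p'(7)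
   by (rule cmp_ext1[OF h(5)]) (use Z h p' in auto)
  also have "... = proj ones Z ** v ** q" unfolding q_def using T uv' p pm p' h by (simp add: assoc)
  finally show ?thesis .
 qed
 have "(u ** q, u') : r" using r(2) e1 T' uv' q by (auto simp: K_iff[OF Z(1)] pairs_iff)
 moreover have "(u', v') : r"
 proof -
  have "fm i ones ** u' = fm i ones ** v'" unfolding u'_def v'_def
   by (rule cmp_ext[OF f_dc]) (use Z p' S o1 in auto)
  then have "(u', v') : R i" unfolding ker_def using T' Z o1 by (auto simp: pairs_iff)
  then show ?thesis using r by blast
 qed
 moreover have "(v', v ** q) : r" using r(2) e2 T' uv' q by (auto simp: K_iff[OF Z(1)] pairs_iff)
 ultimately have "(u ** q, v ** q) : r" using Rels_trans[OF r(1)] by blast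
 then show "(u, v) : r" using Rels_local[OF r(1) uv(1) q(1)] q uv' by blast
qed

lemma K_insert: assumes Z: "Z <= {..<n}" "i < n" "i ~: Z"
 shows "K (insert i Z) = rcomp C (V ones) (K Z) (R i)"
proof
 show "K (insert i Z) <= rcomp C (V ones) (K Z) (R i)"
  using Z by (intro K_insert_lub rcomp_Rels K_in R_in rcomp_upper) auto
 show "rcomp C (V ones) (K Z) (R i) <= K (insert i Z)"
  using Z by (intro rcomp_least K_in K_step R_le_K) auto
qed

lemma K_jn: assumes "Z <= {..<n}" shows "K Z = L.jn R Z"
proof -
 have "finite Z" using assms finite_subset by auto
 then show ?thesis using assms
 proof (induction Z rule: finite_induct)
  case empty
  have "K {} = bottom" unfolding proj_empty[OF n0] ker_def using x0 by (auto simp: pairs_iff)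
  then show ?case unfolding L.jn_empty .
 next
  case (insert i Z)
  have Z: "Z <= {..<n}" "i < n" using insert.prems by auto
  have IH: "K Z = L.jn R Z" by (rule insert.IH[OF Z(1)])
  have "R j : Rels C (V ones)" if "j : insert i Z" for j using R_in that insert.prems by blast
  moreover have "L.jn R Z : Rels C (V ones)" using K_in[OF Z(1)] unfolding IH .
  ultimately have "L.jn R (insert i Z) = rcomp C (V ones) (R i) (L.jn R Z)"
   by (rule L.jn_insert)
  also have "... = rcomp C (V ones) (K Z) (R i)" unfolding IH[symmetric]
   by (rule rcomp_comm[OF R_in[OF Z(2)] K_in[OF Z(1)]])
  also have "... = K (insert i Z)" by (rule K_insert[OF Z insert.hyps(2), symmetric])
  finally show ?case by (rule sym)
 qed
qed

lemma CRT_codistr: assumes CRT shows "L.codistr R {..<n}"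
 unfolding L.codistr_def
proof (intro allI impI, elim conjE)
 fix Z P assume ZP: "Z <= {..<n}" "P <= {..<n}" "Z Int P = {}"
 have finP: "finite P" using ZP(2) finite_subset by auto
 have mP: "L.mt R P : Rels C (V ones)" using finP ZP R_in by (intro L.mt_in) auto
 have "finite Z" using ZP(1) finite_subset by auto
 then have "pairs C (V ones) Int (\<Inter>i\<in>P. K (insert i Z)) <= rcomp C (V ones) (K Z) (L.mt R P)" using ZP
 proof (induction Z rule: finite_induct)
  case empty
  have "K {i} = R i" if "i : P" for i using K_single that ZP(2) by blast
  then have "pairs C (V ones) Int (\<Inter>i\<in>P. K {i}) = L.mt R P" unfolding L.mt_def by blast
  moreover have "L.mt R P <= rcomp C (V ones) (K {}) (L.mt R P)" by (rule rcomp_upper(2)[OF K_in mP]) simp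
  ultimately show ?case by (rule ord_eq_le_trans)
 next
  case (insert z Z)
  have Z: "Z <= {..<n}" "z < n" "z ~: Z" "z ~: P" "Z Int P = {}" and zZ: "insert z Z <= {..<n}" using insert by auto
  have IH: "pairs C (V ones) Int (\<Inter>i\<in>P. K (insert i Z)) <= rcomp C (V ones) (K Z) (L.mt R P)"
   by (rule insert.IH) (use Z ZP in auto)
  have t: "!!t. t : P ==> t < n & t ~: Z & t ~= z & insert t Z <= {..<n} & t ~: insert z Z & z ~: insert t Z" using ZP Z by auto
  let ?b = "zero_on ones Z"
  show ?case
  proof (intro subrelI)
   fix u v assume "(u, v) : pairs C (V ones) Int (\<Inter>i\<in>P. K (insert i (insert z Z)))"
   then have uv: "(u, v) : pairs C (V ones)" and e: "!!t. t : P ==> proj ones (insert t (insert z Z)) ** u = proj ones (insert t (insert z Z)) ** v"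
    using K_iff t zZ by auto
   then have uv': "u : Mor C" "v : Mor C" "Dom C u = Dom C v" "Cod C u = V ones" "Cod C v = V ones" by (auto simp: pairs_iff)
   define y where "y = (%t. if t = z then proj ones (insert z Z) ** v else proj ones (insert t Z) ** u)"
   have tt: "!!t. t : insert z P ==> t < n & t ~: Z & insert t Z <= {..<n}" using t Z by auto
   have yT: "y t : Mor C" "Dom C (y t) = Dom C u" "Cod C (y t) = V (?b(t := 0))" if "t : insert z P" for t
    unfolding y_def using tt[OF that] pt[of "insert t Z"] pt[of "insert z Z"] uv' Z zero_on_insert[of ones t Z] by auto
   have two: "fm s (?b(t := 0)) ** proj ones (insert t Z) ** x = proj ones (insert s (insert t Z)) ** x"
    if "s : insert z P" "t : insert z P" "s ~= t" "x : Mor C" "Cod C x = V ones" for s t x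
    using pins_el[of "insert t Z" s x] that tt[of s] tt[of t] by (simp add: zero_on_insert)
   have co: "fm s (?b(t := 0)) ** y t = fm t (?b(s := 0)) ** y s" if st: "t : insert z P" "s : insert z P" "t ~= s" for s t
   proof -
    have *: "fm s (?b(z := 0)) ** y z = fm z (?b(s := 0)) ** y s" if "s : P" for s
    proof -
     have "s ~= z" using that Z by auto
     then show ?thesis unfolding y_def using two[of s z v] two[of z s u] that uv' e[OF that] by (simp add: insert_commute)
    qed
    consider "t = z" "s : P" | "s = z" "t : P" | "s : P" "t : P" using st by auto
    then show ?thesis
    proof cases
     case 3
     then have "s ~= z" "t ~= z" using Z by auto
     then show ?thesis unfolding y_def using two[of s t u] two[of t s u] st uv' by (simp add: insert_commute)
    qed (use * in auto)
   qed
   have "ALL j. ?b j : {0, 1}" by (auto simp: zero_on_def)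
   moreover have "ALL t:insert z P. ?b t = 1" "insert z P <= {..<n}" using tt by auto
   ultimately have "lifts (insert z P) ?b"
    using assms unfolding CRT_def by blast
   then obtain p w0 where p: "re C p" "Cod C p = Dom C u" and w0: "w0 : Mor C" "Dom C w0 = Dom C p" "Cod C w0 = V ?b"
    and w0y: "!!s. s : insert z P ==> fm s ?b ** w0 = y s ** p"
    unfolding lifts_def
   proof (rule liftableD[where x = y and U = "Dom C u"])
    show "Cod C (y t) = Cod C (fm t ?b)" if "t : insert z P" for t using yT[OF that] tt[OF that] by simp
   qed (use uv' yT co in auto)
   have pm: "p : Mor C" using re_mor[OF p(1)] .
   have pe: "re C (proj ones Z)" by (rule proj_epi[OF ep]) (use Z n0 in auto)
   obtain w p' where p': "re C p'" "w : Mor C" "p' : Mor C" "Cod C p' = Dom C w0" "Cod C w = Dom C (proj ones Z)"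
     "Dom C w = Dom C p'" "proj ones Z ** w = w0 ** p'" by (rule re_lift[OF pe, of w0]) (use w0 pt Z in auto)
   define q where "q = p ** p'"
   have q: "re C q" "q : Mor C" "Dom C q = Dom C p'" "Cod C q = Dom C u" unfolding q_def using p p' pm w0 by (auto intro!: re_cmp)
   have w: "Cod C w = V ones" using p' pt Z by simp
   have we: "proj ones (insert t Z) ** w = y t ** q" if "t : insert z P" for t
   proof -
    have "proj ones (insert t Z) ** w = fm t ?b ** w0 ** p'"
     using pins_el[of Z t w] tt[OF that] Z p' w by simp
    also have "... = (y t ** p) ** p'" by (rule cmp_ext1[OF w0y[OF that]]) (use w0 p' zo1 tt[OF that] in auto)
    also have "... = y t ** q" unfolding q_def using yT[OF that] p pm p' w0 by (simp add: assoc)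
    finally show ?thesis .
   qed
   have "(w, u ** q) : pairs C (V ones) Int (\<Inter>i\<in>P. K (insert i Z))"
   proof -
    have "proj ones (insert t Z) ** w = proj ones (insert t Z) ** u ** q" if "t : P" for t
    proof -
     have "t ~= z" using that Z by auto
     then show ?thesis using we[of t] that t[OF that] pt[of "insert t Z"] uv' q by (simp add: y_def assoc)
    qed
    then show ?thesis using p' w uv' q t by (auto simp: K_iff pairs_iff)
   qed
   then have 1: "(w, u ** q) : rcomp C (V ones) (K Z) (L.mt R P)" using IH by blast
   have "proj ones (insert z Z) ** w = proj ones (insert z Z) ** v ** q"
    using we[of z] pt[OF zZ] uv' q by (simp add: y_def assoc)
   then have 2: "(w, v ** q) : K (insert z Z)" using p' w uv' q zZ by (auto simp: K_iff pairs_iff)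
   let ?r = "rcomp C (V ones) (K (insert z Z)) (L.mt R P)"
   have r: "?r : Rels C (V ones)" using K_in[OF zZ] mP by (rule rcomp_Rels)
   have "K Z <= ?r" using K_step[OF Z(1-3)] rcomp_upper(1)[OF K_in[OF zZ] mP] by blast
   then have "rcomp C (V ones) (K Z) (L.mt R P) <= ?r"
    using rcomp_upper(2)[OF K_in[OF zZ] mP] r by (intro rcomp_least) auto
   then have "(w, u ** q) : ?r" using 1 by blast
   moreover have "(w, v ** q) : ?r" using 2 rcomp_upper(1)[OF K_in[OF zZ] mP] by blast
   ultimately have "(u ** q, v ** q) : ?r" using Rels_trans[OF r] Rels_sym[OF r] by blast
   then show "(u, v) : ?r" using Rels_local[OF r uv q(1)] q uv' by blast
  qed
 qed
 moreover have "rcomp C (V ones) (L.jn R Z) (R i) = K (insert i Z)" if "i : P" for i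
  using K_insert[of Z i] K_jn[of Z] that ZP by auto
 ultimately show "pairs C (V ones) Int (\<Inter>i\<in>P. rcomp C (V ones) (L.jn R Z) (R i)) <= rcomp C (V ones) (L.jn R Z) (L.mt R P)"
  using K_jn[OF ZP(1)] by auto
qed

lemma codistr_lift:
 assumes D: "L.codistr R {..<n}" and Z: "Z <= {..<n}"
 shows "[|finite S; S ~= {}; S <= {..<n}; S Int Z = {}; U : Obj C; !!t. t : S ==> x t : Mor C; !!t. t : S ==> Dom C (x t) = U;
   !!t. t : S ==> Cod C (x t) = V ((zero_on ones Z)(t := 0));
   !!s t. [|t : S; s : S; t ~= s|] ==> fm s ((zero_on ones Z)(t := 0)) ** x t = fm t ((zero_on ones Z)(s := 0)) ** x s|] ==>
   EX p w. re C p & Cod C p = U & w : Mor C & Dom C w = Dom C p & Cod C w = V ones &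
    (ALL t:S. proj ones (insert t Z) ** w = x t ** p)"
proof (induction S rule: finite_ne_induct)
 case (singleton t)
 have t: "insert t Z <= {..<n}" using singleton Z by auto
 have xt: "x t : Mor C" "Dom C (x t) = U" "Cod C (x t) = V ((zero_on ones Z)(t := 0))"
  by (rule singleton.prems(4-6), simp)+
 have pe: "re C (proj ones (insert t Z))" by (rule proj_epi[OF ep]) (use t n0 in auto)
 obtain w p where "re C p" "w : Mor C" "p : Mor C" "Cod C p = Dom C (x t)" "Cod C w = Dom C (proj ones (insert t Z))"
   "Dom C w = Dom C p" "proj ones (insert t Z) ** w = x t ** p"
  by (rule re_lift[OF pe, of "x t"]) (use xt pt[OF t] in \<open>auto simp: zero_on_insert\<close>)
 then have "re C p & Cod C p = U & w : Mor C & Dom C w = Dom C p & Cod C w = V ones &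
   (ALL s:{t}. proj ones (insert s Z) ** w = x s ** p)" using xt pt[OF t] by auto
 then show ?case by blast
next
 case (insert m S)
 let ?b = "zero_on ones Z"
 have m: "m < n" "m ~: Z" "m ~: S" "insert m Z <= {..<n}" using insert Z by auto
 have s: "!!t. t : S ==> t < n & t ~: Z & t ~= m & insert t Z <= {..<n}" using insert Z by auto
 have "EX p w. re C p & Cod C p = U & w : Mor C & Dom C w = Dom C p & Cod C w = V ones &
    (ALL t:S. proj ones (insert t Z) ** w = x t ** p)"
 proof (rule insert.IH)
  show "U : Obj C" by (rule insert.prems(3))
  show "S <= {..<n}" "S Int Z = {}" using insert.prems(1,2) by auto
  show "x t : Mor C" "Dom C (x t) = U" "Cod C (x t) = V (?b(t := 0))" if "t : S" for t
   by (rule insert.prems(4-6), simp add: that)+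
  show "fm s (?b(t := 0)) ** x t = fm t (?b(s := 0)) ** x s" if "t : S" "s : S" "t ~= s" for s t
   by (rule insert.prems(7)) (use that in simp_all)
 qed
 then obtain p1 w1 where p1: "re C p1" "Cod C p1 = U" "w1 : Mor C" "Dom C w1 = Dom C p1" "Cod C w1 = V ones"
  and w1: "!!t. t : S ==> proj ones (insert t Z) ** w1 = x t ** p1" by blast
 have p1m: "p1 : Mor C" using re_mor[OF p1(1)] .
 have xm: "x m : Mor C" "Dom C (x m) = U" "Cod C (x m) = V (?b(m := 0))" by (rule insert.prems(4-6), simp)+
 have xt: "x t : Mor C" "Dom C (x t) = U" "Cod C (x t) = V (?b(t := 0))" if "t : S" for t by (rule insert.prems(4-6), simp add: that)+
 have pe: "re C (proj ones (insert m Z))" by (rule proj_epi[OF ep]) (use m n0 in auto)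
 obtain y p2 where p2: "re C p2" "y : Mor C" "p2 : Mor C" "Cod C p2 = Dom C (x m ** p1)" "Cod C y = Dom C (proj ones (insert m Z))"
   "Dom C y = Dom C p2" "proj ones (insert m Z) ** y = (x m ** p1) ** p2"
  by (rule re_lift[OF pe, of "x m ** p1"]) (use xm p1 p1m pt[OF m(4)] in \<open>auto simp: zero_on_insert\<close>)
 have p2d: "Cod C p2 = Dom C p1" "Cod C y = V ones" using p2 xm p1 p1m pt[OF m(4)] by auto
 define w where "w = w1 ** p2"
 have w: "w : Mor C" "Dom C w = Dom C p2" "Cod C w = V ones" unfolding w_def using p1 p2 p2d by auto
 have we: "proj ones (insert t Z) ** w = x t ** p1 ** p2" if t: "t : S" for t
 proof -
  have "proj ones (insert t Z) ** w = (x t ** p1) ** p2" unfolding w_def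
   by (rule cmp_ext1[OF w1[OF t]]) (use p1 p2 p2d pt[of "insert t Z"] s[OF t] in auto)
  then show ?thesis using xt[OF t] p1 p1m p2 p2d by (simp add: assoc)
 qed
 have ye: "proj ones (insert m Z) ** y = x m ** p1 ** p2" using p2(7) xm p1 p1m p2(3) p2d by (simp add: assoc)
 have two: "fm i (?b(j := 0)) ** proj ones (insert j Z) ** h = proj ones (insert i (insert j Z)) ** h"
  if "i : insert m S" "j : insert m S" "i ~= j" "h : Mor C" "Cod C h = V ones" for i j h
  using pins_el[of "insert j Z" i h] that s[of i] s[of j] m by (auto simp: zero_on_insert)
 let ?r = "L.mt R S"
 have wy: "(w, y) : pairs C (V ones)" using w p2 p2d by (simp add: pairs_iff)
 have in1: "(w, y) : rcomp C (V ones) (K (insert m Z)) (R t)" if t: "t : S" for t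
 proof -
  note ts = s[OF t] xt[OF t]
  have "proj ones (insert m (insert t Z)) ** w = fm m (?b(t := 0)) ** x t ** (p1 ** p2)"
   using two[of m t w] t ts w we[OF t] by simp
  moreover have co: "fm m (?b(t := 0)) ** x t = fm t (?b(m := 0)) ** x m"
   by (rule insert.prems(7)) (use t m in auto)
  moreover have "fm m (?b(t := 0)) ** x t ** (p1 ** p2) = fm t (?b(m := 0)) ** x m ** (p1 ** p2)"
  proof (rule cmp_ext[OF co])
   have "?b(t := 0, m := Suc 0) = ?b(t := 0)" "?b(m := 0, t := Suc 0) = ?b(m := 0)" using ts m by (auto simp: fun_eq_iff)
   then show "Cod C (x t) = Dom C (fm m (?b(t := 0)))" "Cod C (x m) = Dom C (fm t (?b(m := 0)))" using ts m xm by simp_all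
  qed (use ts m xm t p1 p1m p2 p2d in auto)
  moreover have "fm t (?b(m := 0)) ** x m ** (p1 ** p2) = proj ones (insert t (insert m Z)) ** y"
   using two[of t m y] t ts p2 p2d ye by simp
  ultimately have "proj ones (insert m (insert t Z)) ** w = proj ones (insert t (insert m Z)) ** y" by metis
  then have "(w, y) : K (insert t (insert m Z))" using K_iff[of "insert t (insert m Z)"] ts m wy by (simp add: insert_commute)
  then show ?thesis using K_insert[of "insert m Z" t] ts m by simp
 qed
 have "pairs C (V ones) Int (\<Inter>t\<in>S. rcomp C (V ones) (L.jn R (insert m Z)) (R t)) <= rcomp C (V ones) (L.jn R (insert m Z)) ?r"
 proof -
  have "insert m Z <= {..<n}" "S <= {..<n}" "insert m Z Int S = {}" using m s by auto
  then show ?thesis using D[unfolded L.codistr_def, rule_format, of "insert m Z" S] by blast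
 qed
 then have "(w, y) : rcomp C (V ones) (K (insert m Z)) ?r" using in1 wy K_jn[OF m(4)] by auto
 moreover have rR: "?r : Rels C (V ones)" using insert.hyps(1) R_in s by (intro L.mt_in) auto
 ultimately have "(w, y) : rcomp C (V ones) ?r (K (insert m Z))" using rcomp_comm[OF K_in[OF m(4)] rR] by simp
 then obtain p3 w3 where p3: "re C p3" "Cod C p3 = Dom C w" "(w ** p3, w3) : ?r" "(w3, y ** p3) : K (insert m Z)"
  unfolding rcomp_def by auto
 have p3m: "p3 : Mor C" using re_mor[OF p3(1)] .
 have w3: "w3 : Mor C" "Dom C w3 = Dom C p3" "Cod C w3 = V ones" using p3(3) Rels_pairs[OF rR] w p3 p3m by (auto simp: pairs_iff dest!: subsetD)
 define p where "p = p1 ** p2 ** p3"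
 have p: "re C p" "Cod C p = U" "Dom C p = Dom C p3" unfolding p_def
  using p1 p1m p2 p2d p3 p3m w by (auto intro!: re_cmp)
 have "proj ones (insert t Z) ** w3 = x t ** p" if t: "t : S" for t
 proof -
  have "(w ** p3, w3) : K (insert t Z)"
   using p3(3) L.mt_le[OF t, of R] R_le_K[of "insert t Z" t] s[OF t] by blast
  then have "proj ones (insert t Z) ** w3 = proj ones (insert t Z) ** w ** p3" using K_iff s[OF t] by simp
  also have "... = (x t ** p1 ** p2) ** p3" by (rule cmp_ext1[OF we[OF t]]) (use w p3 p3m pt[of "insert t Z"] s[OF t] in auto)
  also have "... = x t ** p" unfolding p_def using xt[OF t] p1 p1m p2 p2d p3 p3m w by (simp add: assoc)
  finally show ?thesis .
 qed
 moreover have "proj ones (insert m Z) ** w3 = x m ** p"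
 proof -
  have "proj ones (insert m Z) ** w3 = proj ones (insert m Z) ** y ** p3" using p3(4) K_iff[OF m(4)] by simp
  also have "... = (x m ** p1 ** p2) ** p3" by (rule cmp_ext1[OF ye]) (use w p2 p2d p3 p3m pt[OF m(4)] in auto)
  also have "... = x m ** p" unfolding p_def using xm p1 p1m p2 p2d p3 p3m w by (simp add: assoc)
  finally show ?thesis .
 qed
 ultimately have "re C p & Cod C p = U & w3 : Mor C & Dom C w3 = Dom C p & Cod C w3 = V ones &
   (ALL t:insert m S. proj ones (insert t Z) ** w3 = x t ** p)" using p w3 by auto
 then show ?case by blast
qed

lemma codistr_CRT: assumes D: "L.codistr R {..<n}" shows CRT
 unfolding CRT_def
proof (intro allI impI, elim conjE)
 fix S a assume S: "S <= {..<n}" "S ~= {}" "ALL j. a j : {0, 1 :: nat}" "ALL t:S. a t = 1"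
 define Z where "Z = {j. j < n & a j = 0}"
 let ?b = "zero_on ones Z"
 have Z: "Z <= {..<n}" "S Int Z = {}" using S by (auto simp: Z_def)
 have t: "!!t. t : S ==> t < n & t ~: Z" using S Z by auto
 have "lifts S ?b" unfolding lifts_def
 proof (rule liftableI)
  fix U x assume x: "U : Obj C" "!!i. i : S ==> x i : Mor C" "!!i. i : S ==> Dom C (x i) = U"
   "!!i. i : S ==> Cod C (x i) = Cod C (fm i ?b)"
   and co: "!!i j. [|i : S; j : S; i ~= j|] ==> fm j (?b(i := 0)) ** x i = fm i (?b(j := 0)) ** x j"
  have "EX p w. re C p & Cod C p = U & w : Mor C & Dom C w = Dom C p & Cod C w = V ones &
    (ALL t:S. proj ones (insert t Z) ** w = x t ** p)"
  proof (rule codistr_lift[OF D Z(1)])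
   show "finite S" using S(1) by (rule finite_subset) simp
   show "Cod C (x i) = V (?b(i := 0))" if "i : S" for i using x(4)[OF that] t[OF that] by simp
  qed (use S Z x co in auto)
  then obtain p w where p: "re C p" "Cod C p = U" "w : Mor C" "Dom C w = Dom C p" "Cod C w = V ones"
    "!!t. t : S ==> proj ones (insert t Z) ** w = x t ** p" by blast
  then show "EX p w. re C p & Cod C p = U & w : Mor C & Dom C w = Dom C p & Cod C w = V ?b &
    (ALL i:S. fm i ?b ** w = x i ** p)"
   using pt[OF Z(1)] pins_el[OF Z(1), of _ w] t by (intro exI[of _ p] exI[of _ "proj ones Z ** w"]) auto
 qed
 moreover have "?b j = a j" if "j < n" for j using S(3)[rule_format, of j] that by (auto simp: zero_on_def Z_def)
 then have "V ?b = V a" "fm i ?b = fm i a" "fm i (?b(j := 0)) = fm i (a(j := 0))" for i j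
  using indep[of ?b a] indep[of "?b(j := 0)" "a(j := 0)"] by auto
 ultimately show "lifts S a" unfolding lifts_def by simp
qed

end

end

section \<open>Diagram categories\<close>

text \<open>The categories \<open>Arr C\<close>, \<open>RGrph C\<close> and \<open>Fork C\<close> all have vertices among 2, 1, 0 and structural
 arrows among d, c, e, f, numbered 0 to 3. Limits and colimits in them are computed vertexwise.\<close>

definition src :: "nat => nat" where "src a = (if a = 0 \<or> a = 1 then 2 else 1)"
definition tgt :: "nat => nat" where "tgt a = (if a = 0 \<or> a = 1 then 1 else if a = 2 then 2 else 0)"

definition has_pb :: "('o, 'm) cat => bool" where
 "has_pb C <-> (ALL f : Mor C. ALL g : Mor C. Cod C f = Cod C g --> (EX p q. pb C f g p q))"

definition has_rcoeq :: "('o, 'm) cat => bool" where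
 "has_rcoeq C <-> (ALL d c e. is_rgraph C d c e --> (EX q. coeq C d c q))"

context Cat begin

lemma HomD: "f : Hom C a b ==> f : Mor C" "f : Hom C a b ==> Dom C f = a" "f : Hom C a b ==> Cod C f = b"
 by (simp_all add: Hom_def)

lemma HomI: "f : Mor C ==> Dom C f = a ==> Cod C f = b ==> f : Hom C a b"
 by (simp add: Hom_def)

lemma Hom_obj: "f : Hom C a b ==> a : Obj C" "f : Hom C a b ==> b : Obj C"
 by (auto simp: Hom_def)

lemma Hom_cmp: "f : Hom C a b ==> g : Hom C b c ==> g ** f : Hom C a c"
 by (auto simp: Hom_def)

lemma Hom_Id: "a : Obj C ==> Id C a : Hom C a a"
 by (auto simp: Hom_def)

lemma Hom_assoc: "f : Hom C a b ==> g : Hom C b c ==> h : Hom C c d ==> (h ** g) ** f = h ** (g ** f)"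
 by (auto simp: Hom_def intro: assoc)

lemma Hom_unit: "f : Hom C a b ==> f ** Id C a = f" "f : Hom C a b ==> Id C b ** f = f"
 by (auto simp: Hom_def)

lemma pb_Hom: assumes "pb C f g p q"
 shows "f : Hom C (Dom C f) (Cod C f)" "g : Hom C (Dom C g) (Cod C f)"
  "p : Hom C (Dom C p) (Dom C f)" "q : Hom C (Dom C p) (Dom C g)" "f ** p = g ** q"
 using pbD[OF assms] by (auto simp: Hom_def)

lemma pb_exH: assumes "pb C f g p q" "u : Hom C a (Dom C f)" "v : Hom C a (Dom C g)" "f ** u = g ** v"
 shows "EX h:Hom C a (Dom C p). p ** h = u & q ** h = v"
proof -
 obtain h where "h : Mor C" "Dom C h = Dom C u" "Cod C h = Dom C p" "p ** h = u" "q ** h = v"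
  by (rule pb_ex[OF assms(1)]) (use assms in \<open>auto simp: Hom_def\<close>)
 then show ?thesis using assms(2) by (auto simp: Hom_def)
qed

lemma pb_uniqueH: assumes "pb C f g p q" "u : Hom C a (Dom C p)" "v : Hom C a (Dom C p)"
  "p ** u = p ** v" "q ** u = q ** v"
 shows "u = v"
 by (rule pb_unique[OF assms(1)]) (use assms in \<open>auto simp: Hom_def\<close>)

lemma co_Hom: assumes "coeq C d c q"
 shows "d : Hom C (Dom C d) (Cod C d)" "c : Hom C (Dom C d) (Cod C d)" "q : Hom C (Cod C d) (Cod C q)" "q ** d = q ** c"
 using coD[OF assms] by (auto simp: Hom_def)

lemma co_exH: assumes "coeq C d c q" "g : Hom C (Cod C d) b" "g ** d = g ** c"
 shows "EX h:Hom C (Cod C q) b. h ** q = g"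
proof -
 obtain h where "h : Mor C" "Dom C h = Cod C q" "Cod C h = Cod C g" "h ** q = g"
  by (rule co_ex[OF assms(1)]) (use assms in \<open>auto simp: Hom_def\<close>)
 then show ?thesis using assms(2) by (auto simp: Hom_def)
qed

lemma co_uniqueH: assumes "coeq C d c q" "u : Hom C (Cod C q) b" "v : Hom C (Cod C q) b" "u ** q = v ** q"
 shows "u = v"
 by (rule co_unique[OF assms(1)]) (use assms in \<open>auto simp: Hom_def\<close>)

lemma pb_iso: assumes "pb C f g p q" "iso C u" "Cod C u = Dom C p"
 shows "pb C f g (p ** u) (q ** u)"
proof -
 obtain v where v: "u : Mor C" "v : Mor C" "Dom C v = Cod C u" "Cod C v = Dom C u"
  "v ** u = Id C (Dom C u)" "u ** v = Id C (Cod C u)" using isoD[OF assms(2)] by metis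
 note D = pbD[OF assms(1)]
 have T: "p : Mor C" "q : Mor C" "Cod C u = Dom C p" "Dom C q = Dom C p" using D assms by auto
 have pu: "(p ** u) ** h = p ** (u ** h)" "(q ** u) ** h = q ** (u ** h)" if "h : Mor C" "Cod C h = Dom C u" for h
  using assoc[of h u p] assoc[of h u q] that v T by auto
 have vu: "u ** v ** h = h" if "h : Mor C" "Cod C h = Dom C p" for h
  using cmp_ext1[OF v(6), of h] that v T by simp
 have uv: "v ** u ** h = h" if "h : Mor C" "Cod C h = Dom C u" for h
  using cmp_ext1[OF v(5), of h] that v T by simp
 show ?thesis
 proof (rule pbI)
  show "f ** p ** u = g ** q ** u" by (rule cmp_ext[OF D(9)]) (use D v T in auto)
  fix h k assume hk: "h : Mor C" "k : Mor C" "Dom C h = Dom C k" "Cod C h = Dom C f" "Cod C k = Dom C g" "f ** h = g ** k"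
  obtain l where l: "l : Mor C" "Dom C l = Dom C h" "Cod C l = Dom C p" "p ** l = h" "q ** l = k"
   by (rule pb_ex[OF assms(1) hk])
  have "(p ** u) ** (v ** l) = h" "(q ** u) ** (v ** l) = k"
   using pu[of "v ** l"] vu[of l] l v T by auto
  then show "EX h':Mor C. Dom C h' = Dom C h & Cod C h' = Dom C (p ** u) & (p ** u) ** h' = h & (q ** u) ** h' = k"
   using l v T by (intro bexI[of _ "v ** l"]) auto
 next
  fix h k assume hk: "h : Mor C" "k : Mor C" "Dom C h = Dom C k" "Cod C h = Dom C (p ** u)" "Cod C k = Dom C (p ** u)"
    "(p ** u) ** h = (p ** u) ** k" "(q ** u) ** h = (q ** u) ** k"
  then have c: "Cod C h = Dom C u" "Cod C k = Dom C u" using v T by auto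
  have "u ** h = u ** k"
   by (rule pb_unique[OF assms(1)]) (use hk(1-3,6,7) c v T pu in auto)
  then have "v ** u ** h = v ** u ** k" by simp
  then show "h = k" using uv hk c by simp
 qed (use D v T in auto)
qed

lemma co_iso: assumes "coeq C d c q" "iso C u" "Dom C u = Cod C q"
 shows "coeq C d c (u ** q)"
proof -
 obtain v where v: "u : Mor C" "v : Mor C" "Dom C v = Cod C u" "Cod C v = Dom C u"
  "v ** u = Id C (Dom C u)" "u ** v = Id C (Cod C u)" using isoD[OF assms(2)] by metis
 note D = coD[OF assms(1)]
 show ?thesis
 proof (rule coI)
  show "(u ** q) ** d = (u ** q) ** c" using D v assms(3) by (simp add: assoc)
  fix g assume g: "g : Mor C" "Dom C g = Cod C d" "g ** d = g ** c"
  obtain h where h: "h : Mor C" "Dom C h = Cod C q" "Cod C h = Cod C g" "h ** q = g"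
   by (rule co_ex[OF assms(1) g])
  have "v ** u ** q = q" using cmp_ext1[OF v(5), of q] v D assms(3) by auto
  then have "(h ** v) ** u ** q = g" using assoc[of "u ** q" v h] h v D assms(3) by auto
  then show "EX h:Mor C. Dom C h = Cod C (u ** q) & Cod C h = Cod C g & h ** u ** q = g"
   using h v D assms(3) by (intro bexI[of _ "h ** v"]) auto
 next
  fix h k assume hk: "h : Mor C" "k : Mor C" "Dom C h = Cod C (u ** q)" "Dom C k = Cod C (u ** q)" "Cod C h = Cod C k"
    "h ** u ** q = k ** u ** q"
  have c: "Dom C h = Cod C u" "Dom C k = Cod C u" using hk v D assms(3) by auto
  have "(h ** u) ** q = (k ** u) ** q" using hk c v D assms(3) assoc[of q u h] assoc[of q u k] by auto
  then have "h ** u = k ** u" by (intro co_unique[OF assms(1), of "h ** u" "k ** u"]) (use hk(1,2) c v D assms(3) in auto)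
  then have "(h ** u) ** v = (k ** u) ** v" by simp
  then show "h = k" using hk(1,2) c v assoc[of v u h] assoc[of v u k] by auto
 qed (use D v assms(3) in auto)
qed

lemma pb_compare: assumes "pb C f g p q" "pb C f g p' q'"
 obtains u where "iso C u" "u : Hom C (Dom C p) (Dom C p')" "p' ** u = p" "q' ** u = q"
proof -
 note H = pb_Hom[OF assms(1)] and H' = pb_Hom[OF assms(2)]
 obtain u where u: "u : Hom C (Dom C p) (Dom C p')" "p' ** u = p" "q' ** u = q"
  using pb_exH[OF assms(2) H(3,4,5)] by blast
 obtain v where v: "v : Hom C (Dom C p') (Dom C p)" "p ** v = p'" "q ** v = q'"
  using pb_exH[OF assms(1) H'(3,4,5)] by blast
 have "v ** u = Id C (Dom C p)"
 proof (rule pb_uniqueH[OF assms(1)])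
  show "p ** v ** u = p ** Id C (Dom C p)" "q ** v ** u = q ** Id C (Dom C p)"
   using Hom_assoc[OF u(1) v(1) H(3)] Hom_assoc[OF u(1) v(1) H(4)] u v Hom_unit[OF H(3)] Hom_unit[OF H(4)] by auto
 qed (use u v H in \<open>auto intro: Hom_cmp Hom_Id Hom_obj\<close>)
 moreover have "u ** v = Id C (Dom C p')"
 proof (rule pb_uniqueH[OF assms(2)])
  show "p' ** u ** v = p' ** Id C (Dom C p')" "q' ** u ** v = q' ** Id C (Dom C p')"
   using Hom_assoc[OF v(1) u(1) H'(3)] Hom_assoc[OF v(1) u(1) H'(4)] u v Hom_unit[OF H'(3)] Hom_unit[OF H'(4)] by auto
 qed (use u v H' in \<open>auto intro: Hom_cmp Hom_Id Hom_obj\<close>)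
 ultimately have "iso C u" using u v by (intro isoI[of u v]) (auto simp: Hom_def)
 then show ?thesis using that u by blast
qed

lemma co_compare: assumes "coeq C d c q" "coeq C d c q'"
 obtains u where "iso C u" "u : Hom C (Cod C q) (Cod C q')" "u ** q = q'"
proof -
 note H = co_Hom[OF assms(1)] and H' = co_Hom[OF assms(2)]
 obtain u where u: "u : Hom C (Cod C q) (Cod C q')" "u ** q = q'"
  using co_exH[OF assms(1) H'(3,4)] by blast
 obtain v where v: "v : Hom C (Cod C q') (Cod C q)" "v ** q' = q"
  using co_exH[OF assms(2) H(3,4)] by blast
 have "v ** u = Id C (Cod C q)"
  by (rule co_uniqueH[OF assms(1)]) (use u v H Hom_assoc[OF H(3) u(1) v(1)] Hom_unit[OF H(3)] in \<open>auto intro: Hom_cmp Hom_Id Hom_obj\<close>)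
 moreover have "u ** v = Id C (Cod C q')"
  by (rule co_uniqueH[OF assms(2)]) (use u v H' Hom_assoc[OF H'(3) v(1) u(1)] Hom_unit[OF H'(3)] in \<open>auto intro: Hom_cmp Hom_Id Hom_obj\<close>)
 ultimately have "iso C u" using u v by (intro isoI[of u v]) (auto simp: Hom_def)
 then show ?thesis using that u by blast
qed

end

locale diag = Cat C for C :: "('o, 'm) cat" +
 fixes D :: "('p, 'q) cat" and I A :: "nat set" and vert :: "nat => 'p => 'o" and arrow :: "nat => 'p => 'm"
  and comp_at :: "nat => 'q => 'm"
 assumes lab: "!!a. a : A ==> src a : I" "!!a. a : A ==> tgt a : I"
  and vert_obj: "!!F i. F : Obj D ==> i : I ==> vert i F : Obj C"
  and arrow_Hom: "!!F a. F : Obj D ==> a : A ==> arrow a F : Hom C (vert (src a) F) (vert (tgt a) F)"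
  and Dom_D: "!!x. x : Mor D ==> Dom D x : Obj D" and Cod_D: "!!x. x : Mor D ==> Cod D x : Obj D"
  and comp_Hom: "!!x i. x : Mor D ==> i : I ==> comp_at i x : Hom C (vert i (Dom D x)) (vert i (Cod D x))"
  and natural: "!!x a. x : Mor D ==> a : A ==>
    comp_at (tgt a) x ** arrow a (Dom D x) = arrow a (Cod D x) ** comp_at (src a) x"
  and make: "!!F G y. [|F : Obj D; G : Obj D; !!i. i : I ==> y i : Hom C (vert i F) (vert i G);
    !!a. a : A ==> y (tgt a) ** arrow a F = arrow a G ** y (src a)|] ==>
    EX x:Hom D F G. ALL i:I. comp_at i x = y i"
  and mor_eq: "!!x y. [|x : Mor D; y : Mor D; Dom D x = Dom D y; Cod D x = Cod D y; !!i. i : I ==> comp_at i x = comp_at i y|] ==> x = y"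
  and Comp_D: "!!x y. [|x : Mor D; y : Mor D; Cod D x = Dom D y|] ==>
    Comp D y x : Hom D (Dom D x) (Cod D y) & (ALL i:I. comp_at i (Comp D y x) = comp_at i y ** comp_at i x)"
  and Id_D: "!!F. F : Obj D ==> Id D F : Hom D F F & (ALL i:I. comp_at i (Id D F) = Id C (vert i F))"
  and obj_sub: "!!G H P f p q. [|G : Obj D; H : Obj D; !!a. a : A ==> f a : Hom C (P (src a)) (P (tgt a));
    !!i. i : I ==> p i : Hom C (P i) (vert i G); !!i. i : I ==> q i : Hom C (P i) (vert i H);
    !!a. a : A ==> p (tgt a) ** f a = arrow a G ** p (src a);
    !!a. a : A ==> q (tgt a) ** f a = arrow a H ** q (src a);
    !!i b u v. [|i : I; u : Hom C b (P i); v : Hom C b (P i); p i ** u = p i ** v; q i ** u = q i ** v|] ==> u = v|] ==>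
    EX F:Obj D. (ALL i:I. vert i F = P i) & (ALL a:A. arrow a F = f a)"
  and obj_quot: "!!G P f q. [|G : Obj D; !!a. a : A ==> f a : Hom C (P (src a)) (P (tgt a));
    !!i. i : I ==> q i : Hom C (vert i G) (P i);
    !!a. a : A ==> q (tgt a) ** arrow a G = f a ** q (src a);
    !!i b u v. [|i : I; u : Hom C (P i) b; v : Hom C (P i) b; u ** q i = v ** q i|] ==> u = v|] ==>
    EX F:Obj D. (ALL i:I. vert i F = P i) & (ALL a:A. arrow a F = f a)"
begin

lemma D_category: "category D"
 unfolding category_def
proof (intro conjI ballI impI)
 fix f g h assume m: "f : Mor D" "g : Mor D" "h : Mor D" "Cod D f = Dom D g & Cod D g = Dom D h"
 note gf = Comp_D[of f g] and hg = Comp_D[of g h]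
 have T: "Comp D g f : Mor D" "Dom D (Comp D g f) = Dom D f" "Cod D (Comp D g f) = Cod D g"
   "Comp D h g : Mor D" "Dom D (Comp D h g) = Dom D g" "Cod D (Comp D h g) = Cod D h"
  using gf hg m by (auto simp: Hom_def)
 note 1 = Comp_D[of "Comp D g f" h] and 2 = Comp_D[of f "Comp D h g"]
 show "Comp D h (Comp D g f) = Comp D (Comp D h g) f"
 proof (rule mor_eq)
  fix i assume i: "i : I"
  have H: "comp_at i f : Hom C (vert i (Dom D f)) (vert i (Dom D g))" "comp_at i g : Hom C (vert i (Dom D g)) (vert i (Dom D h))"
    "comp_at i h : Hom C (vert i (Dom D h)) (vert i (Cod D h))"
   using comp_Hom[of f i] comp_Hom[of g i] comp_Hom[of h i] m i by auto
  show "comp_at i (Comp D h (Comp D g f)) = comp_at i (Comp D (Comp D h g) f)"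
   using 1 2 gf hg m T i Hom_assoc[OF H] by auto
 qed (use 1 2 m T in \<open>auto simp: Hom_def\<close>)
next
 fix f assume f: "f : Mor D"
 note o = Dom_D[OF f] Cod_D[OF f]
 note i1 = Id_D[OF o(1)] and i2 = Id_D[OF o(2)]
 have 1: "Comp D f (Id D (Dom D f)) : Hom D (Dom D f) (Cod D f) & (ALL i:I. comp_at i (Comp D f (Id D (Dom D f))) = comp_at i f ** comp_at i (Id D (Dom D f)))"
  using Comp_D[of "Id D (Dom D f)" f] i1 f by (auto simp: Hom_def)
 have 2: "Comp D (Id D (Cod D f)) f : Hom D (Dom D f) (Cod D f) & (ALL i:I. comp_at i (Comp D (Id D (Cod D f)) f) = comp_at i (Id D (Cod D f)) ** comp_at i f)"
  using Comp_D[of f "Id D (Cod D f)"] i2 f by (auto simp: Hom_def)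
 show "Comp D f (Id D (Dom D f)) = f"
  by (rule mor_eq) (use 1 i1 f Hom_unit[OF comp_Hom[OF f]] in \<open>auto simp: Hom_def\<close>)
 show "Comp D (Id D (Cod D f)) f = f"
  by (rule mor_eq) (use 2 i2 f Hom_unit[OF comp_Hom[OF f]] in \<open>auto simp: Hom_def\<close>)
qed (use Dom_D Cod_D Id_D Comp_D in auto)

sublocale D: Cat D by (unfold_locales, rule D_category)

lemma comp_cmp: "[|x : Mor D; y : Mor D; Cod D x = Dom D y; i : I|] ==> comp_at i (Comp D y x) = comp_at i y ** comp_at i x"
 using Comp_D by blast

lemma comp_Id: "F : Obj D ==> i : I ==> comp_at i (Id D F) = Id C (vert i F)"
 using Id_D by blast

lemma comp_iso: assumes "iso D u" "i : I" shows "iso C (comp_at i u)"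
proof -
 obtain v where v: "u : Mor D" "v : Mor D" "Dom D v = Cod D u" "Cod D v = Dom D u"
  "Comp D v u = Id D (Dom D u)" "Comp D u v = Id D (Cod D u)" using D.isoD[OF assms(1)] by metis
 have H: "comp_at i u : Hom C (vert i (Dom D u)) (vert i (Cod D u))" "comp_at i v : Hom C (vert i (Cod D u)) (vert i (Dom D u))"
  using comp_Hom[of u i] comp_Hom[of v i] v assms by auto
 have "comp_at i v ** comp_at i u = Id C (vert i (Dom D u))" "comp_at i u ** comp_at i v = Id C (vert i (Cod D u))"
  using comp_cmp[of u v i] comp_cmp[of v u i] comp_Id[of "Dom D u" i] comp_Id[of "Cod D u" i] v assms by auto
 then show ?thesis using H by (intro isoI[of "comp_at i u" "comp_at i v"]) (auto simp: Hom_def)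
qed

lemma iso_reflect: assumes u: "u : Mor D" and i: "!!i. i : I ==> iso C (comp_at i u)" shows "iso D u"
proof -
 have "EX v. v : Hom C (vert i (Cod D u)) (vert i (Dom D u)) & v ** comp_at i u = Id C (vert i (Dom D u)) & comp_at i u ** v = Id C (vert i (Cod D u))"
  if "i : I" for i
 proof (rule isoD[OF i[OF that]])
  fix v assume "v : Mor C" "Dom C v = Cod C (comp_at i u)" "Cod C v = Dom C (comp_at i u)"
   "v ** comp_at i u = Id C (Dom C (comp_at i u))" "comp_at i u ** v = Id C (Cod C (comp_at i u))"
  then show ?thesis using comp_Hom[OF u that] by (intro exI[of _ v]) (auto simp: Hom_def)
 qed
 then obtain v where v: "!!i. i : I ==> v i : Hom C (vert i (Cod D u)) (vert i (Dom D u))"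
   "!!i. i : I ==> v i ** comp_at i u = Id C (vert i (Dom D u))" "!!i. i : I ==> comp_at i u ** v i = Id C (vert i (Cod D u))" by metis
 have "EX w:Hom D (Cod D u) (Dom D u). ALL i:I. comp_at i w = v i"
 proof (rule make)
  fix a assume a: "a : A"
  note st = lab[OF a]
  note aD = arrow_Hom[OF Dom_D[OF u] a] and aC = arrow_Hom[OF Cod_D[OF u] a]
  note us = comp_Hom[OF u st(1)] and ut = comp_Hom[OF u st(2)] and vs = v(1)[OF st(1)] and vt = v(1)[OF st(2)]
  have "v (tgt a) ** arrow a (Cod D u) = v (tgt a) ** arrow a (Cod D u) ** comp_at (src a) u ** v (src a)"
   using v(3)[OF st(1)] Hom_unit[OF aC] by simp
  also have "... = v (tgt a) ** (arrow a (Cod D u) ** comp_at (src a) u) ** v (src a)"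
   using Hom_assoc[OF vs us aC] by simp
  also have "... = v (tgt a) ** comp_at (tgt a) u ** arrow a (Dom D u) ** v (src a)"
   unfolding natural[OF u a, symmetric] using Hom_assoc[OF vs aD ut] by simp
  also have "... = arrow a (Dom D u) ** v (src a)"
   using Hom_assoc[OF Hom_cmp[OF vs aD] ut vt] v(2)[OF st(2)] Hom_unit[OF Hom_cmp[OF vs aD]] by simp
  finally show "v (tgt a) ** arrow a (Cod D u) = arrow a (Dom D u) ** v (src a)" .
 qed (use Dom_D Cod_D u v in auto)
 then obtain w where w: "w : Hom D (Cod D u) (Dom D u)" "!!i. i : I ==> comp_at i w = v i" by blast
 note w' = D.HomD[OF w(1)]
 show ?thesis
 proof (rule D.isoI[OF u w'])
  show "Comp D w u = Id D (Dom D u)"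
   by (rule mor_eq) (use u w w' v Dom_D[OF u] in \<open>auto simp: comp_cmp comp_Id\<close>)
  show "Comp D u w = Id D (Cod D u)"
   by (rule mor_eq) (use u w w' v Cod_D[OF u] in \<open>auto simp: comp_cmp comp_Id\<close>)
 qed
qed

lemma pb_reflect: assumes "f : Mor D" "g : Mor D" "p : Mor D" "q : Mor D" "Cod D f = Cod D g"
  "Dom D q = Dom D p" "Cod D p = Dom D f" "Cod D q = Dom D g"
  and pw: "!!i. i : I ==> pb C (comp_at i f) (comp_at i g) (comp_at i p) (comp_at i q)"
 shows "pb D f g p q"
proof (rule D.pbI)
 show "Comp D f p = Comp D g q"
  by (rule mor_eq) (use assms(1-8) pbD(9)[OF pw] in \<open>auto simp: comp_cmp\<close>)
 fix u v assume uv: "u : Mor D" "v : Mor D" "Dom D u = Dom D v" "Cod D u = Dom D f" "Cod D v = Dom D g" "Comp D f u = Comp D g v"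
 have ch: "!!i. i : I ==> comp_at i p : Hom C (vert i (Dom D p)) (vert i (Dom D f))" "!!i. i : I ==> comp_at i q : Hom C (vert i (Dom D p)) (vert i (Dom D g))"
  "!!i. i : I ==> comp_at i f : Hom C (vert i (Dom D f)) (vert i (Cod D f))" "!!i. i : I ==> comp_at i g : Hom C (vert i (Dom D g)) (vert i (Cod D f))"
  "!!i. i : I ==> comp_at i u : Hom C (vert i (Dom D u)) (vert i (Dom D f))" "!!i. i : I ==> comp_at i v : Hom C (vert i (Dom D u)) (vert i (Dom D g))"
  using comp_Hom[of p] comp_Hom[of q] comp_Hom[of f] comp_Hom[of g] comp_Hom[of u] comp_Hom[of v] assms uv by auto
 have "EX h:Hom C (vert i (Dom D u)) (vert i (Dom D p)). comp_at i p ** h = comp_at i u & comp_at i q ** h = comp_at i v" if i: "i : I" for i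
 proof -
  have "comp_at i f ** comp_at i u = comp_at i g ** comp_at i v"
   using comp_cmp[of u f i] comp_cmp[of v g i] uv assms i by simp
  then show ?thesis using pb_exH[OF pw[OF i], of "comp_at i u" "vert i (Dom D u)" "comp_at i v"] ch[OF i] by (auto simp: Hom_def)
 qed
 then obtain h where h: "!!i. i : I ==> h i : Hom C (vert i (Dom D u)) (vert i (Dom D p))" "!!i. i : I ==> comp_at i p ** h i = comp_at i u"
   "!!i. i : I ==> comp_at i q ** h i = comp_at i v" by metis
 have op: "Dom D p : Obj D" "Dom D u : Obj D" "Dom D f : Obj D" "Dom D g : Obj D" using Dom_D assms uv by auto
 have "EX w:Hom D (Dom D u) (Dom D p). ALL i:I. comp_at i w = h i"
 proof (rule make)
  fix a assume a: "a : A"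
  note st = lab[OF a]
  note au = arrow_Hom[OF op(2) a] and ap = arrow_Hom[OF op(1) a] and af = arrow_Hom[OF op(3) a] and ag = arrow_Hom[OF op(4) a]
  note hs = h(1)[OF st(1)] and ht = h(1)[OF st(2)]
  show "h (tgt a) ** arrow a (Dom D u) = arrow a (Dom D p) ** h (src a)"
  proof (rule pb_uniqueH[OF pw[OF st(2)]])
   show "h (tgt a) ** arrow a (Dom D u) : Hom C (vert (src a) (Dom D u)) (Dom C (comp_at (tgt a) p))"
    "arrow a (Dom D p) ** h (src a) : Hom C (vert (src a) (Dom D u)) (Dom C (comp_at (tgt a) p))"
    using Hom_cmp[OF au ht] Hom_cmp[OF hs ap] ch(1)[OF st(2)] by (auto simp: Hom_def)
   have "comp_at (tgt a) p ** h (tgt a) ** arrow a (Dom D u) = comp_at (tgt a) u ** arrow a (Dom D u)"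
    using Hom_assoc[OF au ht ch(1)[OF st(2)]] h(2)[OF st(2)] by simp
   also have "... = arrow a (Dom D f) ** comp_at (src a) p ** h (src a)" using natural[OF uv(1) a] uv(4) h(2)[OF st(1)] by simp
   also have "... = comp_at (tgt a) p ** arrow a (Dom D p) ** h (src a)"
    using Hom_assoc[OF hs ch(1)[OF st(1)] af] natural[OF assms(3) a] assms(7) Hom_assoc[OF hs ap ch(1)[OF st(2)]] by simp
   finally show "comp_at (tgt a) p ** h (tgt a) ** arrow a (Dom D u) = comp_at (tgt a) p ** arrow a (Dom D p) ** h (src a)" .
   have "comp_at (tgt a) q ** h (tgt a) ** arrow a (Dom D u) = comp_at (tgt a) v ** arrow a (Dom D u)"
    using Hom_assoc[OF au ht ch(2)[OF st(2)]] h(3)[OF st(2)] by simp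
   also have "... = arrow a (Dom D g) ** comp_at (src a) q ** h (src a)" using natural[OF uv(2) a] uv(3,5) h(3)[OF st(1)] by simp
   also have "... = comp_at (tgt a) q ** arrow a (Dom D p) ** h (src a)"
    using Hom_assoc[OF hs ch(2)[OF st(1)] ag] natural[OF assms(4) a] assms(6,8) Hom_assoc[OF hs ap ch(2)[OF st(2)]] by simp
   finally show "comp_at (tgt a) q ** h (tgt a) ** arrow a (Dom D u) = comp_at (tgt a) q ** arrow a (Dom D p) ** h (src a)" .
  qed
 qed (use op h in auto)
 then obtain w where w: "w : Hom D (Dom D u) (Dom D p)" "!!i. i : I ==> comp_at i w = h i" by blast
 note w' = D.HomD[OF w(1)]
 have "Comp D p w = u"
  by (rule mor_eq) (use w w' h assms(1-8) uv in \<open>auto simp: comp_cmp\<close>)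
 moreover have "Comp D q w = v"
  by (rule mor_eq) (use w w' h assms(1-8) uv in \<open>auto simp: comp_cmp\<close>)
 ultimately show "EX h:Mor D. Dom D h = Dom D u & Cod D h = Dom D p & Comp D p h = u & Comp D q h = v" using w' by auto
next
 fix u v assume uv: "u : Mor D" "v : Mor D" "Dom D u = Dom D v" "Cod D u = Dom D p" "Cod D v = Dom D p" "Comp D p u = Comp D p v" "Comp D q u = Comp D q v"
 show "u = v"
 proof (rule mor_eq)
  fix i assume i: "i : I"
  show "comp_at i u = comp_at i v"
  proof (rule pb_uniqueH[OF pw[OF i]])
   show "comp_at i u : Hom C (vert i (Dom D u)) (Dom C (comp_at i p))" "comp_at i v : Hom C (vert i (Dom D u)) (Dom C (comp_at i p))"
    using comp_Hom[of u i] comp_Hom[of v i] comp_Hom[of p i] uv assms i by (auto simp: Hom_def)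
   show "comp_at i p ** comp_at i u = comp_at i p ** comp_at i v" "comp_at i q ** comp_at i u = comp_at i q ** comp_at i v"
    using comp_cmp[of u p i] comp_cmp[of v p i] comp_cmp[of u q i] comp_cmp[of v q i] uv assms i by auto
  qed
 qed (use uv in auto)
qed (use assms in auto)

lemma pb_exist: assumes fg: "f : Mor D" "g : Mor D" "Cod D f = Cod D g"
  and ex: "!!i. i : I ==> EX p q. pb C (comp_at i f) (comp_at i g) p q"
 obtains p q where "pb D f g p q" "!!i. i : I ==> pb C (comp_at i f) (comp_at i g) (comp_at i p) (comp_at i q)"
proof -
 obtain p q where pq: "!!i. i : I ==> pb C (comp_at i f) (comp_at i g) (p i) (q i)" using ex by metis
 define P where "P = (%i. Dom C (p i))"
 have ch: "!!i. i : I ==> comp_at i f : Hom C (vert i (Dom D f)) (vert i (Cod D f))" "!!i. i : I ==> comp_at i g : Hom C (vert i (Dom D g)) (vert i (Cod D f))"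
  using comp_Hom[of f] comp_Hom[of g] fg by auto
 have ph: "!!i. i : I ==> p i : Hom C (P i) (vert i (Dom D f))" "!!i. i : I ==> q i : Hom C (P i) (vert i (Dom D g))"
   "!!i. i : I ==> comp_at i f ** p i = comp_at i g ** q i"
  using pb_Hom[OF pq] ch unfolding P_def by (auto simp: Hom_def)
 have op: "Dom D f : Obj D" "Dom D g : Obj D" "Cod D f : Obj D" using Dom_D Cod_D fg by auto
 have "EX r:Hom C (P (src a)) (P (tgt a)). p (tgt a) ** r = arrow a (Dom D f) ** p (src a) & q (tgt a) ** r = arrow a (Dom D g) ** q (src a)"
  if a: "a : A" for a
 proof -
  note st = lab[OF a]
  note af = arrow_Hom[OF op(1) a] and ag = arrow_Hom[OF op(2) a] and ac = arrow_Hom[OF op(3) a]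
  have "comp_at (tgt a) f ** arrow a (Dom D f) ** p (src a) = arrow a (Cod D f) ** comp_at (src a) f ** p (src a)"
   using Hom_assoc[OF ph(1)[OF st(1)] af ch(1)[OF st(2)]] natural[OF fg(1) a] Hom_assoc[OF ph(1)[OF st(1)] ch(1)[OF st(1)] ac] by simp
  also have "... = arrow a (Cod D f) ** comp_at (src a) g ** q (src a)" using ph(3)[OF st(1)] by simp
  also have "... = comp_at (tgt a) g ** arrow a (Dom D g) ** q (src a)"
   using Hom_assoc[OF ph(2)[OF st(1)] ag ch(2)[OF st(2)]] natural[OF fg(2) a] Hom_assoc[OF ph(2)[OF st(1)] ch(2)[OF st(1)] ac] fg(3) by simp
  finally show ?thesis
   using pb_exH[OF pq[OF st(2)], of "arrow a (Dom D f) ** p (src a)" "P (src a)" "arrow a (Dom D g) ** q (src a)"]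
    Hom_cmp[OF ph(1)[OF st(1)] af] Hom_cmp[OF ph(2)[OF st(1)] ag] ch[OF st(2)] P_def by (auto simp: Hom_def)
 qed
 then obtain r where r: "!!a. a : A ==> r a : Hom C (P (src a)) (P (tgt a))" "!!a. a : A ==> p (tgt a) ** r a = arrow a (Dom D f) ** p (src a)"
   "!!a. a : A ==> q (tgt a) ** r a = arrow a (Dom D g) ** q (src a)" by metis
 have "EX F:Obj D. (ALL i:I. vert i F = P i) & (ALL a:A. arrow a F = r a)"
 proof (rule obj_sub[where p = p and q = q, OF op(1,2) r(1) ph(1,2) r(2,3)])
  fix i b u v assume "i : I" "u : Hom C b (P i)" "v : Hom C b (P i)" "p i ** u = p i ** v" "q i ** u = q i ** v"
  then show "u = v" using pb_uniqueH[OF pq, of i u b v] unfolding P_def by blast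
 qed auto
 then obtain F where F: "F : Obj D" "!!i. i : I ==> vert i F = P i" "!!a. a : A ==> arrow a F = r a" by blast
 obtain p' where p': "p' : Hom D F (Dom D f)" "!!i. i : I ==> comp_at i p' = p i"
  using make[of F "Dom D f" p] F op ph r by auto
 obtain q' where q': "q' : Hom D F (Dom D g)" "!!i. i : I ==> comp_at i q' = q i"
  using make[of F "Dom D g" q] F op ph r by auto
 have pw: "pb C (comp_at i f) (comp_at i g) (comp_at i p') (comp_at i q')" if "i : I" for i
  using pq[OF that] p' q' that by simp
 moreover have "pb D f g p' q'"
  by (rule pb_reflect[OF fg(1,2) _ _ fg(3)]) (use pw p' q' in \<open>auto simp: Hom_def\<close>)
 ultimately show ?thesis using that by blast
qed

lemma has_pb_D: assumes "has_pb C" shows "has_pb D"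
 unfolding has_pb_def
proof (intro ballI impI)
 fix f g assume fg: "f : Mor D" "g : Mor D" "Cod D f = Cod D g"
 have "EX p q. pb C (comp_at i f) (comp_at i g) p q" if "i : I" for i
  using assms comp_Hom[of f i] comp_Hom[of g i] fg that unfolding has_pb_def Hom_def by auto
 then show "EX p q. pb D f g p q" using pb_exist[OF fg] by metis
qed

lemma pb_pointwise: assumes h: "has_pb C" and pb: "pb D f g p q" and i: "i : I"
 shows "pb C (comp_at i f) (comp_at i g) (comp_at i p) (comp_at i q)"
proof -
 note fg = D.pbD[OF pb]
 have "EX p q. pb C (comp_at i f) (comp_at i g) p q" if "i : I" for i
  using h comp_Hom[of f i] comp_Hom[of g i] fg that unfolding has_pb_def Hom_def by auto
 then obtain p' q' where 1: "pb D f g p' q'" "!!i. i : I ==> pb C (comp_at i f) (comp_at i g) (comp_at i p') (comp_at i q')"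
  using pb_exist[OF fg(1,2,5)] by metis
 obtain u where u: "iso D u" "u : Hom D (Dom D p) (Dom D p')" "Comp D p' u = p" "Comp D q' u = q"
  using D.pb_compare[OF pb 1(1)] by metis
 note u' = D.HomD[OF u(2)] and p' = D.pbD[OF 1(1)]
 have "comp_at i p = comp_at i p' ** comp_at i u" "comp_at i q = comp_at i q' ** comp_at i u"
  using comp_cmp[of u p' i] comp_cmp[of u q' i] u u' p' i by auto
 moreover have "Cod C (comp_at i u) = Dom C (comp_at i p')"
  using comp_Hom[of u i] comp_Hom[of p' i] u' p' i by (auto simp: Hom_def)
 ultimately show ?thesis using pb_iso[OF 1(2)[OF i] comp_iso[OF u(1) i]] by simp
qed

lemma co_reflect: assumes dc: "d : Mor D" "c : Mor D" "q : Mor D" "Dom D c = Dom D d" "Cod D c = Cod D d" "Dom D q = Cod D d"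
  and pw: "!!i. i : I ==> coeq C (comp_at i d) (comp_at i c) (comp_at i q)"
 shows "coeq D d c q"
proof (rule D.coI)
 show "Comp D q d = Comp D q c"
  by (rule mor_eq) (use dc coD(7)[OF pw] in \<open>auto simp: comp_cmp\<close>)
 fix g assume g: "g : Mor D" "Dom D g = Cod D d" "Comp D g d = Comp D g c"
 have ch: "!!i. i : I ==> comp_at i q : Hom C (vert i (Cod D d)) (vert i (Cod D q))" "!!i. i : I ==> comp_at i d : Hom C (vert i (Dom D d)) (vert i (Cod D d))"
  "!!i. i : I ==> comp_at i g : Hom C (vert i (Cod D d)) (vert i (Cod D g))"
  using comp_Hom[of q] comp_Hom[of d] comp_Hom[of g] dc g by auto
 have "EX h:Hom C (vert i (Cod D q)) (vert i (Cod D g)). h ** comp_at i q = comp_at i g" if i: "i : I" for i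
 proof -
  have "comp_at i g ** comp_at i d = comp_at i g ** comp_at i c"
   using comp_cmp[of d g i] comp_cmp[of c g i] dc g i by simp
  then show ?thesis using co_exH[OF pw[OF i], of "comp_at i g" "vert i (Cod D g)"] ch[OF i] by (auto simp: Hom_def)
 qed
 then obtain h where h: "!!i. i : I ==> h i : Hom C (vert i (Cod D q)) (vert i (Cod D g))" "!!i. i : I ==> h i ** comp_at i q = comp_at i g" by metis
 have op: "Cod D q : Obj D" "Cod D g : Obj D" "Cod D d : Obj D" using Cod_D dc g by auto
 have "EX w:Hom D (Cod D q) (Cod D g). ALL i:I. comp_at i w = h i"
 proof (rule make)
  fix a assume a: "a : A"
  note st = lab[OF a]
  note aq = arrow_Hom[OF op(1) a] and ag = arrow_Hom[OF op(2) a] and ad = arrow_Hom[OF op(3) a]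
  note hs = h(1)[OF st(1)] and ht = h(1)[OF st(2)]
  show "h (tgt a) ** arrow a (Cod D q) = arrow a (Cod D g) ** h (src a)"
  proof (rule co_uniqueH[OF pw[OF st(1)]])
   show "h (tgt a) ** arrow a (Cod D q) : Hom C (Cod C (comp_at (src a) q)) (vert (tgt a) (Cod D g))"
    "arrow a (Cod D g) ** h (src a) : Hom C (Cod C (comp_at (src a) q)) (vert (tgt a) (Cod D g))"
    using Hom_cmp[OF aq ht] Hom_cmp[OF hs ag] ch(1)[OF st(1)] by (auto simp: Hom_def)
   have "(h (tgt a) ** arrow a (Cod D q)) ** comp_at (src a) q = h (tgt a) ** comp_at (tgt a) q ** arrow a (Cod D d)"
    using Hom_assoc[OF ch(1)[OF st(1)] aq ht] natural[OF dc(3) a] dc(6) by simp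
   also have "... = comp_at (tgt a) g ** arrow a (Cod D d)" using Hom_assoc[OF ad ch(1)[OF st(2)] ht] h(2)[OF st(2)] by simp
   also have "... = arrow a (Cod D g) ** h (src a) ** comp_at (src a) q" using natural[OF g(1) a] g(2) h(2)[OF st(1)] by simp
   also have "... = (arrow a (Cod D g) ** h (src a)) ** comp_at (src a) q" using Hom_assoc[OF ch(1)[OF st(1)] hs ag] by simp
   finally show "(h (tgt a) ** arrow a (Cod D q)) ** comp_at (src a) q = (arrow a (Cod D g) ** h (src a)) ** comp_at (src a) q" .
  qed
 qed (use op h in auto)
 then obtain w where w: "w : Hom D (Cod D q) (Cod D g)" "!!i. i : I ==> comp_at i w = h i" by blast
 note w' = D.HomD[OF w(1)]
 have "Comp D w q = g"
  by (rule mor_eq) (use w w' h dc g in \<open>auto simp: comp_cmp\<close>)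
 then show "EX h:Mor D. Dom D h = Cod D q & Cod D h = Cod D g & Comp D h q = g" using w' by auto
next
 fix u v assume uv: "u : Mor D" "v : Mor D" "Dom D u = Cod D q" "Dom D v = Cod D q" "Cod D u = Cod D v" "Comp D u q = Comp D v q"
 show "u = v"
 proof (rule mor_eq)
  fix i assume i: "i : I"
  show "comp_at i u = comp_at i v"
  proof (rule co_uniqueH[OF pw[OF i]])
   show "comp_at i u : Hom C (Cod C (comp_at i q)) (vert i (Cod D u))" "comp_at i v : Hom C (Cod C (comp_at i q)) (vert i (Cod D u))"
    using comp_Hom[of u i] comp_Hom[of v i] comp_Hom[of q i] uv dc i by (auto simp: Hom_def)
   show "comp_at i u ** comp_at i q = comp_at i v ** comp_at i q"
    using comp_cmp[of q u i] comp_cmp[of q v i] uv dc i by auto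
  qed
 qed (use uv in auto)
qed (use dc in auto)

lemma co_exist: assumes dc: "d : Mor D" "c : Mor D" "Dom D c = Dom D d" "Cod D c = Cod D d"
  and ex: "!!i. i : I ==> EX q. coeq C (comp_at i d) (comp_at i c) q"
 obtains q where "coeq D d c q" "!!i. i : I ==> coeq C (comp_at i d) (comp_at i c) (comp_at i q)"
proof -
 obtain q where q: "!!i. i : I ==> coeq C (comp_at i d) (comp_at i c) (q i)" using ex by metis
 define P where "P = (%i. Cod C (q i))"
 have ch: "!!i. i : I ==> comp_at i d : Hom C (vert i (Dom D d)) (vert i (Cod D d))" "!!i. i : I ==> comp_at i c : Hom C (vert i (Dom D d)) (vert i (Cod D d))"
  using comp_Hom[of d] comp_Hom[of c] dc by auto
 have qh: "!!i. i : I ==> q i : Hom C (vert i (Cod D d)) (P i)" "!!i. i : I ==> q i ** comp_at i d = q i ** comp_at i c"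
  using co_Hom[OF q] ch unfolding P_def by (auto simp: Hom_def)
 have op: "Dom D d : Obj D" "Cod D d : Obj D" using Dom_D Cod_D dc by auto
 have "EX r:Hom C (P (src a)) (P (tgt a)). r ** q (src a) = q (tgt a) ** arrow a (Cod D d)" if a: "a : A" for a
 proof -
  note st = lab[OF a]
  note a1 = arrow_Hom[OF op(1) a] and a2 = arrow_Hom[OF op(2) a]
  have "(q (tgt a) ** arrow a (Cod D d)) ** comp_at (src a) d = q (tgt a) ** comp_at (tgt a) d ** arrow a (Dom D d)"
   using Hom_assoc[OF ch(1)[OF st(1)] a2 qh(1)[OF st(2)]] natural[OF dc(1) a] by simp
  also have "... = q (tgt a) ** comp_at (tgt a) c ** arrow a (Dom D d)"
   using Hom_assoc[OF a1 ch(1)[OF st(2)] qh(1)[OF st(2)]] Hom_assoc[OF a1 ch(2)[OF st(2)] qh(1)[OF st(2)]] qh(2)[OF st(2)] by simp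
  also have "... = (q (tgt a) ** arrow a (Cod D d)) ** comp_at (src a) c"
   using Hom_assoc[OF ch(2)[OF st(1)] a2 qh(1)[OF st(2)]] natural[OF dc(2) a] dc(3,4) by simp
  finally show ?thesis
   using co_exH[OF q[OF st(1)], of "q (tgt a) ** arrow a (Cod D d)" "P (tgt a)"] Hom_cmp[OF a2 qh(1)[OF st(2)]] ch[OF st(1)]
   unfolding P_def by (auto simp: Hom_def)
 qed
 then obtain r where r: "!!a. a : A ==> r a : Hom C (P (src a)) (P (tgt a))" "!!a. a : A ==> r a ** q (src a) = q (tgt a) ** arrow a (Cod D d)" by metis
 have "EX F:Obj D. (ALL i:I. vert i F = P i) & (ALL a:A. arrow a F = r a)"
 proof (rule obj_quot[where q = q, OF op(2) r(1) qh(1) r(2)[symmetric]])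
  fix i b u v assume "i : I" "u : Hom C (P i) b" "v : Hom C (P i) b" "u ** q i = v ** q i"
  then show "u = v" using co_uniqueH[OF q, of i u b v] unfolding P_def by blast
 qed auto
 then obtain F where F: "F : Obj D" "!!i. i : I ==> vert i F = P i" "!!a. a : A ==> arrow a F = r a" by blast
 obtain q' where q': "q' : Hom D (Cod D d) F" "!!i. i : I ==> comp_at i q' = q i"
  using make[of "Cod D d" F q] F op qh r by auto
 have pw: "coeq C (comp_at i d) (comp_at i c) (comp_at i q')" if "i : I" for i
  using q[OF that] q' that by simp
 moreover have "coeq D d c q'"
  by (rule co_reflect[OF dc(1,2) _ dc(3,4)]) (use pw q' in \<open>auto simp: Hom_def\<close>)
 ultimately show ?thesis using that by blast
qed

lemma comp_rgraph: assumes "is_rgraph D d c e" "i : I"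
 shows "is_rgraph C (comp_at i d) (comp_at i c) (comp_at i e)"
proof -
 have m: "d : Mor D" "c : Mor D" "e : Mor D" "Dom D c = Dom D d" "Cod D c = Cod D d" "Dom D e = Cod D d" "Cod D e = Dom D d"
   "Comp D d e = Id D (Cod D d)" "Comp D c e = Id D (Cod D d)" using assms unfolding is_rgraph_def Hom_def by auto
 have "comp_at i d ** comp_at i e = Id C (vert i (Cod D d))" "comp_at i c ** comp_at i e = Id C (vert i (Cod D d))"
  using comp_cmp[of e d i] comp_cmp[of e c i] comp_Id[of "Cod D d" i] m assms Cod_D[OF m(1)] by auto
 then show ?thesis using comp_Hom[of d i] comp_Hom[of c i] comp_Hom[of e i] m assms unfolding is_rgraph_def Hom_def by auto
qed

lemma rco_exist: assumes h: "has_rcoeq C" and r: "is_rgraph D d c e"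
 obtains q where "coeq D d c q" "!!i. i : I ==> coeq C (comp_at i d) (comp_at i c) (comp_at i q)"
proof -
 have m: "d : Mor D" "c : Mor D" "Dom D c = Dom D d" "Cod D c = Cod D d" using r unfolding is_rgraph_def Hom_def by auto
 have "EX q. coeq C (comp_at i d) (comp_at i c) q" if "i : I" for i
  using comp_rgraph[OF r that] h unfolding has_rcoeq_def by blast
 then show ?thesis using co_exist[OF m] that by metis
qed

lemma has_rcoeq_D: assumes "has_rcoeq C" shows "has_rcoeq D"
 unfolding has_rcoeq_def using rco_exist[OF assms] by metis

lemma co_pointwise: assumes h: "has_rcoeq C" and r: "is_rgraph D d c e" and co: "coeq D d c q" and i: "i : I"
 shows "coeq C (comp_at i d) (comp_at i c) (comp_at i q)"
proof -
 obtain q' where 1: "coeq D d c q'" "!!i. i : I ==> coeq C (comp_at i d) (comp_at i c) (comp_at i q')"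
  using rco_exist[OF h r] by metis
 obtain u where u: "iso D u" "u : Hom D (Cod D q') (Cod D q)" "Comp D u q' = q"
  using D.co_compare[OF 1(1) co] by metis
 note u' = D.HomD[OF u(2)] and q' = D.coD[OF 1(1)]
 have "comp_at i q = comp_at i u ** comp_at i q'"
  using comp_cmp[of q' u i] u u' q' i by auto
 moreover have "Dom C (comp_at i u) = Cod C (comp_at i q')"
  using comp_Hom[of u i] comp_Hom[of q' i] u' q' i by (auto simp: Hom_def)
 ultimately show ?thesis using co_iso[OF 1(2)[OF i] comp_iso[OF u(1) i]] by simp
qed

end

definition fk_arrow :: "nat => ('o, 'm) cell => ('o, 'm) cell" where
 "fk_arrow a F = (if a = 0 then fk_d F else if a = 1 then fk_c F else if a = 2 then fk_e F else fk_f F)"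

definition rg_arrow :: "nat => ('o, 'm) cell => ('o, 'm) cell" where
 "rg_arrow a G = (if a = 0 then rg_d G else if a = 1 then rg_c G else rg_e G)"

definition rg_vertex :: "('o, 'm) ccat => nat => ('o, 'm) cell => ('o, 'm) cell" where
 "rg_vertex C k G = (if k = 1 then Cod C (rg_d G) else Dom C (rg_d G))"

definition rg_component :: "nat => ('o, 'm) cell => ('o, 'm) cell" where
 "rg_component k x = (if k = 1 then rg1 x else rg2 x)"

definition sq_vertex :: "('o, 'm) ccat => nat => ('o, 'm) cell => ('o, 'm) cell" where
 "sq_vertex C k f = (if k = 0 then Cod C f else Dom C f)"

definition sq_component :: "nat => ('o, 'm) cell => ('o, 'm) cell" where
 "sq_component k x = (if k = 0 then sq0 x else sq1 x)"

lemma Arr_sel [simp]: "Obj (Arr C) = Mor C" "Dom (Arr C) = sq_dom" "Cod (Arr C) = sq_cod"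
  "Id (Arr C) f = Sq f f (Id C (Dom C f)) (Id C (Cod C f))"
  "Comp (Arr C) y x = Sq (sq_dom x) (sq_cod y) (Comp C (sq1 y) (sq1 x)) (Comp C (sq0 y) (sq0 x))"
 by (simp_all add: Arr_def)

lemma RGrph_sel [simp]: "Dom (RGrph C) = rg_dom" "Cod (RGrph C) = rg_cod"
  "Id (RGrph C) G = RgMor G G (Id C (Dom C (rg_d G))) (Id C (Cod C (rg_d G)))"
  "Comp (RGrph C) y x = RgMor (rg_dom x) (rg_cod y) (Comp C (rg2 y) (rg2 x)) (Comp C (rg1 y) (rg1 x))"
 by (simp_all add: RGrph_def)

lemma Fork_sel [simp]: "Dom (Fork C) = fk_dom" "Cod (Fork C) = fk_cod"
  "Id (Fork C) F = FkMor F F (Id C (Dom C (fk_d F))) (Id C (Cod C (fk_d F))) (Id C (Cod C (fk_f F)))"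
  "Comp (Fork C) y x = FkMor (fk_dom x) (fk_cod y)
       (Comp C (fk2 y) (fk2 x)) (Comp C (fk1 y) (fk1 x)) (Comp C (fk0 y) (fk0 x))"
 by (simp_all add: Fork_def)

lemma Arr_Mor: "x : Mor (Arr C) <-> (EX f g x1 x0. x = Sq f g x1 x0 & f : Mor C & g : Mor C &
   x1 : Hom C (Dom C f) (Dom C g) & x0 : Hom C (Cod C f) (Cod C g) & Comp C g x1 = Comp C x0 f)"
 by (auto simp: Arr_def)

lemma RGrph_Obj: "G : Obj (RGrph C) <-> (EX d c e. G = Rg d c e & is_rgraph C d c e)"
 by (auto simp: RGrph_def)

lemma RGrph_Mor: "x : Mor (RGrph C) <-> (EX F G x2 x1. x = RgMor F G x2 x1 & F : Obj (RGrph C) & G : Obj (RGrph C) &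
  x2 : Hom C (Dom C (rg_d F)) (Dom C (rg_d G)) & x1 : Hom C (Cod C (rg_d F)) (Cod C (rg_d G)) &
  Comp C (rg_d G) x2 = Comp C x1 (rg_d F) & Comp C (rg_c G) x2 = Comp C x1 (rg_c F) &
  Comp C (rg_e G) x1 = Comp C x2 (rg_e F))"
 by (fastforce simp: RGrph_def)

lemma Fork_Obj: "F : Obj (Fork C) <-> (EX d c e f. F = Fk d c e f & is_fork C d c e f)"
 by (auto simp: Fork_def)

lemma Fork_Mor: "x : Mor (Fork C) <-> (EX F G x2 x1 x0. x = FkMor F G x2 x1 x0 & F : Obj (Fork C) & G : Obj (Fork C) &
  x2 : Hom C (Dom C (fk_d F)) (Dom C (fk_d G)) & x1 : Hom C (Cod C (fk_d F)) (Cod C (fk_d G)) &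
  x0 : Hom C (Cod C (fk_f F)) (Cod C (fk_f G)) &
  Comp C (fk_d G) x2 = Comp C x1 (fk_d F) & Comp C (fk_c G) x2 = Comp C x1 (fk_c F) &
  Comp C (fk_e G) x1 = Comp C x2 (fk_e F) & Comp C (fk_f G) x1 = Comp C x0 (fk_f F))"
 by (fastforce simp: Fork_def)

context Cat begin

lemma is_rgraph_Hom: "is_rgraph C d c e <-> (EX v2 v1. d : Hom C v2 v1 & c : Hom C v2 v1 & e : Hom C v1 v2 &
  d ** e = Id C v1 & c ** e = Id C v1)"
 unfolding is_rgraph_def Hom_def by auto

lemma is_fork_Hom: "is_fork C d c e f <-> (EX v2 v1 v0. d : Hom C v2 v1 & c : Hom C v2 v1 & e : Hom C v1 v2 & f : Hom C v1 v0 &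
  d ** e = Id C v1 & c ** e = Id C v1 & f ** d = f ** c)"
 unfolding is_fork_def is_rgraph_def Hom_def by auto

lemma path2: assumes "p0 : Hom C P0 G0" "p1 : Hom C P1 G1" "p2 : Hom C P2 G2" "a : Hom C P0 P1" "b : Hom C P1 P2"
   "a' : Hom C G0 G1" "b' : Hom C G1 G2" "p1 ** a = a' ** p0" "p2 ** b = b' ** p1"
  shows "p2 ** (b ** a) = (b' ** a') ** p0"
proof -
 have "p2 ** (b ** a) = (p2 ** b) ** a" using Hom_assoc[OF assms(4,5,3)] by simp
 also have "... = b' ** p1 ** a" unfolding assms(9) by (rule Hom_assoc[OF assms(4,2,7)])
 also have "... = (b' ** a') ** p0" unfolding assms(8) using Hom_assoc[OF assms(1,6,7)] by simp
 finally show ?thesis .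
qed

end

locale CCat = Cat C for C :: "('o, 'm) ccat"
begin

lemma Fork_diag: "diag C (Fork C) {0, 1, 2} {0, 1, 2, 3} (fk_vertex C) fk_arrow fk_component"
proof (unfold_locales, goal_cases)
 case (1 a) then show ?case by (auto simp: src_def)
next
 case (2 a) then show ?case by (auto simp: tgt_def)
next
 case (3 F i) then show ?case by (auto simp: Fork_Obj is_fork_def is_rgraph_def Hom_def fk_vertex_def)
next
 case (4 F a) then show ?case by (auto simp: Fork_Obj is_fork_def is_rgraph_def Hom_def fk_vertex_def fk_arrow_def src_def tgt_def)
next
 case (5 x) then show ?case by (auto simp: Fork_Mor)
next
 case (6 x) then show ?case by (auto simp: Fork_Mor)
next
 case (7 x i) then show ?case by (auto simp: Fork_Mor fk_vertex_def fk_component_def)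
next
 case (8 x a) then show ?case by (auto simp: Fork_Mor fk_component_def fk_arrow_def src_def tgt_def)
next
 case (9 F G y)
 have "FkMor F G (y 2) (y 1) (y 0) : Mor (Fork C)"
  unfolding Fork_Mor using 9(1,2) 9(3)[of 0] 9(3)[of 1] 9(3)[of 2] 9(4)[of 0] 9(4)[of 1] 9(4)[of 2] 9(4)[of 3]
  by (simp add: fk_vertex_def fk_arrow_def src_def tgt_def)
 then show ?case by (intro bexI[of _ "FkMor F G (y 2) (y 1) (y 0)"]) (auto simp: Hom_def fk_component_def)
next
 case (10 x y)
 show ?case using 10(1-4) 10(5)[of 0] 10(5)[of 1] 10(5)[of 2] by (auto simp: Fork_Mor fk_component_def)
next
 case (11 x y)
 then obtain F G x2 x1 x0 H y2 y1 y0 where xy: "x = FkMor F G x2 x1 x0" "y = FkMor G H y2 y1 y0" unfolding Fork_Mor by auto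
 have O: "F : Obj (Fork C)" "G : Obj (Fork C)" "H : Obj (Fork C)" using 11 by (auto simp: Fork_Mor xy)
 have HH: "fk_d K : Hom C (Dom C (fk_d K)) (Cod C (fk_d K))" "fk_c K : Hom C (Dom C (fk_d K)) (Cod C (fk_d K))"
   "fk_e K : Hom C (Cod C (fk_d K)) (Dom C (fk_d K))" "fk_f K : Hom C (Cod C (fk_d K)) (Cod C (fk_f K))" if "K : Obj (Fork C)" for K
  using that by (auto simp: Fork_Obj is_fork_def is_rgraph_def Hom_def)
 note F = HH[OF O(1)] and G = HH[OF O(2)] and H = HH[OF O(3)]
 have X: "x2 : Hom C (Dom C (fk_d F)) (Dom C (fk_d G))" "x1 : Hom C (Cod C (fk_d F)) (Cod C (fk_d G))" "x0 : Hom C (Cod C (fk_f F)) (Cod C (fk_f G))"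
  "x1 ** fk_d F = fk_d G ** x2" "x1 ** fk_c F = fk_c G ** x2" "x2 ** fk_e F = fk_e G ** x1" "x0 ** fk_f F = fk_f G ** x1"
  using 11(1) by (auto simp: Fork_Mor xy)
 have Y: "y2 : Hom C (Dom C (fk_d G)) (Dom C (fk_d H))" "y1 : Hom C (Cod C (fk_d G)) (Cod C (fk_d H))" "y0 : Hom C (Cod C (fk_f G)) (Cod C (fk_f H))"
  "y1 ** fk_d G = fk_d H ** y2" "y1 ** fk_c G = fk_c H ** y2" "y2 ** fk_e G = fk_e H ** y1" "y0 ** fk_f G = fk_f H ** y1"
  using 11(2) by (auto simp: Fork_Mor xy)
 have N: "fk_d H ** y2 ** x2 = (y1 ** x1) ** fk_d F"
  "fk_c H ** y2 ** x2 = (y1 ** x1) ** fk_c F" "fk_e H ** y1 ** x1 = (y2 ** x2) ** fk_e F" "fk_f H ** y1 ** x1 = (y0 ** x0) ** fk_f F"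
  using path2[OF F(1) G(1) H(1) X(1) Y(1) X(2) Y(2) X(4)[symmetric] Y(4)[symmetric]]
   path2[OF F(2) G(2) H(2) X(1) Y(1) X(2) Y(2) X(5)[symmetric] Y(5)[symmetric]]
   path2[OF F(3) G(3) H(3) X(2) Y(2) X(1) Y(1) X(6)[symmetric] Y(6)[symmetric]]
   path2[OF F(4) G(4) H(4) X(2) Y(2) X(3) Y(3) X(7)[symmetric] Y(7)[symmetric]] by auto
 have "FkMor F H (y2 ** x2) (y1 ** x1) (y0 ** x0) : Mor (Fork C)"
  unfolding Fork_Mor using O N Hom_cmp[OF X(1) Y(1)] Hom_cmp[OF X(2) Y(2)] Hom_cmp[OF X(3) Y(3)] by auto
 then show ?case by (auto simp: xy Hom_def fk_component_def)
next
 case (12 F)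
 then obtain d c e f v2 v1 v0 where F: "F = Fk d c e f" "d : Hom C v2 v1" "c : Hom C v2 v1" "e : Hom C v1 v2" "f : Hom C v1 v0"
  unfolding Fork_Obj is_fork_Hom by blast
 have "Id (Fork C) F : Mor (Fork C)" unfolding Fork_Mor
  using 12 F Hom_Id[OF Hom_obj(1)[OF F(2)]] Hom_Id[OF Hom_obj(2)[OF F(2)]] Hom_Id[OF Hom_obj(2)[OF F(5)]] by (simp add: Hom_def)
 then show ?case by (auto simp: Hom_def fk_component_def fk_vertex_def)
next
 case (13 G H P f p q)
 have f: "f 0 : Hom C (P 2) (P 1)" "f 1 : Hom C (P 2) (P 1)" "f 2 : Hom C (P 1) (P 2)" "f 3 : Hom C (P 1) (P 0)"
  using 13(3)[of 0] 13(3)[of 1] 13(3)[of 2] 13(3)[of 3] by (auto simp: src_def tgt_def)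
 have rel: "f 0 ** f 2 = Id C (P 1) & f 1 ** f 2 = Id C (P 1) & f 3 ** f 0 = f 3 ** f 1"
 proof -
  have *: "r 1 ** f 0 ** f 2 = r 1 ** Id C (P 1) & r 1 ** f 1 ** f 2 = r 1 ** Id C (P 1) & r 0 ** f 3 ** f 0 = r 0 ** f 3 ** f 1"
   if K: "K : Obj (Fork C)" and r: "!!i. i : {0, 1, 2} ==> r i : Hom C (P i) (fk_vertex C i K)"
    and n: "!!a. a : {0, 1, 2, 3} ==> r (tgt a) ** f a = fk_arrow a K ** r (src a)" for K r
  proof -
   obtain d c e g v2 v1 v0 where k: "K = Fk d c e g" "d : Hom C v2 v1" "c : Hom C v2 v1" "e : Hom C v1 v2" "g : Hom C v1 v0"
    "d ** e = Id C v1" "c ** e = Id C v1" "g ** d = g ** c"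
    using K unfolding Fork_Obj is_fork_Hom by blast
   have v: "fk_vertex C 2 K = v2" "fk_vertex C 1 K = v1" "fk_vertex C 0 K = v0" using k by (auto simp: fk_vertex_def Hom_def)
   have r': "r 2 : Hom C (P 2) v2" "r 1 : Hom C (P 1) v1" "r 0 : Hom C (P 0) v0" using r[of 0] r[of 1] r[of 2] v by auto
   have n': "r 1 ** f 0 = d ** r 2" "r 1 ** f 1 = c ** r 2" "r 2 ** f 2 = e ** r 1" "r 0 ** f 3 = g ** r 1"
    using n[of 0] n[of 1] n[of 2] n[of 3] k(1) by (auto simp: src_def tgt_def fk_arrow_def)
   show ?thesis
    using path2[OF r'(2) r'(1) r'(2) f(3) f(1) k(4) k(2) n'(3) n'(1)] path2[OF r'(2) r'(1) r'(2) f(3) f(2) k(4) k(3) n'(3) n'(2)]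
     path2[OF r'(1) r'(2) r'(3) f(1) f(4) k(2) k(5) n'(1) n'(4)] path2[OF r'(1) r'(2) r'(3) f(2) f(4) k(3) k(5) n'(2) n'(4)]
     k(6-8) Hom_unit[OF r'(2)] by simp
  qed
  note a = *[OF 13(1) 13(4) 13(6)] and b = *[OF 13(2) 13(5) 13(7)]
  have o: "Id C (P 1) : Hom C (P 1) (P 1)" using Hom_Id Hom_obj f(3) by blast
  have "f 0 ** f 2 = Id C (P 1)" by (rule 13(8)[of 1]) (use a b o Hom_cmp[OF f(3) f(1)] in auto)
  moreover have "f 1 ** f 2 = Id C (P 1)" by (rule 13(8)[of 1]) (use a b o Hom_cmp[OF f(3) f(2)] in auto)
  moreover have "f 3 ** f 0 = f 3 ** f 1" by (rule 13(8)[of 0]) (use a b Hom_cmp[OF f(1) f(4)] Hom_cmp[OF f(2) f(4)] in auto)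
  ultimately show ?thesis by blast
 qed
 show ?case
  by (rule bexI[of _ "Fk (f 0) (f 1) (f 2) (f 3)"])
   (use f rel in \<open>auto simp: Fork_Obj is_fork_Hom fk_vertex_def fk_arrow_def Hom_def\<close>)
next
 case (14 G P f q)
 have f: "f 0 : Hom C (P 2) (P 1)" "f 1 : Hom C (P 2) (P 1)" "f 2 : Hom C (P 1) (P 2)" "f 3 : Hom C (P 1) (P 0)"
  using 14(2)[of 0] 14(2)[of 1] 14(2)[of 2] 14(2)[of 3] by (auto simp: src_def tgt_def)
 obtain d c e g v2 v1 v0 where k: "G = Fk d c e g" "d : Hom C v2 v1" "c : Hom C v2 v1" "e : Hom C v1 v2" "g : Hom C v1 v0"
  "d ** e = Id C v1" "c ** e = Id C v1" "g ** d = g ** c"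
  using 14(1) unfolding Fork_Obj is_fork_Hom by blast
 have v: "fk_vertex C 2 G = v2" "fk_vertex C 1 G = v1" "fk_vertex C 0 G = v0" using k by (auto simp: fk_vertex_def Hom_def)
 have r': "q 2 : Hom C v2 (P 2)" "q 1 : Hom C v1 (P 1)" "q 0 : Hom C v0 (P 0)" using 14(3)[of 0] 14(3)[of 1] 14(3)[of 2] v by auto
 have n': "q 1 ** d = f 0 ** q 2" "q 1 ** c = f 1 ** q 2" "q 2 ** e = f 2 ** q 1" "q 0 ** g = f 3 ** q 1"
  using 14(4)[of 0] 14(4)[of 1] 14(4)[of 2] 14(4)[of 3] k(1) by (auto simp: src_def tgt_def fk_arrow_def)
 have a: "(f 0 ** f 2) ** q 1 = Id C (P 1) ** q 1" "(f 1 ** f 2) ** q 1 = Id C (P 1) ** q 1" "(f 3 ** f 0) ** q 2 = (f 3 ** f 1) ** q 2"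
  using path2[OF r'(2) r'(1) r'(2) k(4) k(2) f(3) f(1) n'(3) n'(1)] path2[OF r'(2) r'(1) r'(2) k(4) k(3) f(3) f(2) n'(3) n'(2)]
   path2[OF r'(1) r'(2) r'(3) k(2) k(5) f(1) f(4) n'(1) n'(4)] path2[OF r'(1) r'(2) r'(3) k(3) k(5) f(2) f(4) n'(2) n'(4)]
   k(6-8) Hom_unit[OF r'(2)] by auto
 have o: "Id C (P 1) : Hom C (P 1) (P 1)" using Hom_Id Hom_obj f(3) by blast
 have "f 0 ** f 2 = Id C (P 1)" by (rule 14(5)[of 1]) (use a o Hom_cmp[OF f(3) f(1)] in auto)
 moreover have "f 1 ** f 2 = Id C (P 1)" by (rule 14(5)[of 1]) (use a o Hom_cmp[OF f(3) f(2)] in auto)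
 moreover have "f 3 ** f 0 = f 3 ** f 1" by (rule 14(5)[of 2]) (use a Hom_cmp[OF f(1) f(4)] Hom_cmp[OF f(2) f(4)] in auto)
 ultimately show ?case
  by (intro bexI[of _ "Fk (f 0) (f 1) (f 2) (f 3)"])
   (use f in \<open>auto simp: Fork_Obj is_fork_Hom fk_vertex_def fk_arrow_def Hom_def\<close>)
qed

lemma RGrph_diag: "diag C (RGrph C) {1, 2} {0, 1, 2} (rg_vertex C) rg_arrow rg_component"
proof (unfold_locales, goal_cases)
 case (1 a) then show ?case by (auto simp: src_def)
next
 case (2 a) then show ?case by (auto simp: tgt_def)
next
 case (3 F i) then show ?case by (auto simp: RGrph_Obj is_rgraph_def Hom_def rg_vertex_def)
next
 case (4 F a) then show ?case by (auto simp: RGrph_Obj is_rgraph_def Hom_def rg_vertex_def rg_arrow_def src_def tgt_def)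
next
 case (5 x) then show ?case by (auto simp: RGrph_Mor)
next
 case (6 x) then show ?case by (auto simp: RGrph_Mor)
next
 case (7 x i) then show ?case by (auto simp: RGrph_Mor rg_vertex_def rg_component_def)
next
 case (8 x a) then show ?case by (auto simp: RGrph_Mor rg_component_def rg_arrow_def src_def tgt_def)
next
 case (9 F G y)
 have "RgMor F G (y 2) (y 1) : Mor (RGrph C)"
  unfolding RGrph_Mor using 9(1,2) 9(3)[of 1] 9(3)[of 2] 9(4)[of 0] 9(4)[of 1] 9(4)[of 2]
  by (simp add: rg_vertex_def rg_arrow_def src_def tgt_def)
 then show ?case by (intro bexI[of _ "RgMor F G (y 2) (y 1)"]) (auto simp: Hom_def rg_component_def)
next
 case (10 x y)
 show ?case using 10(1-4) 10(5)[of 1] 10(5)[of 2] by (auto simp: RGrph_Mor rg_component_def)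
next
 case (11 x y)
 then obtain F G x2 x1 H y2 y1 where xy: "x = RgMor F G x2 x1" "y = RgMor G H y2 y1" unfolding RGrph_Mor by auto
 have O: "F : Obj (RGrph C)" "G : Obj (RGrph C)" "H : Obj (RGrph C)" using 11 by (auto simp: RGrph_Mor xy)
 have HH: "rg_d K : Hom C (Dom C (rg_d K)) (Cod C (rg_d K))" "rg_c K : Hom C (Dom C (rg_d K)) (Cod C (rg_d K))"
   "rg_e K : Hom C (Cod C (rg_d K)) (Dom C (rg_d K))" if "K : Obj (RGrph C)" for K
  using that by (auto simp: RGrph_Obj is_rgraph_def Hom_def)
 note F = HH[OF O(1)] and G = HH[OF O(2)] and H = HH[OF O(3)]
 have X: "x2 : Hom C (Dom C (rg_d F)) (Dom C (rg_d G))" "x1 : Hom C (Cod C (rg_d F)) (Cod C (rg_d G))"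
  "x1 ** rg_d F = rg_d G ** x2" "x1 ** rg_c F = rg_c G ** x2" "x2 ** rg_e F = rg_e G ** x1"
  using 11(1) by (auto simp: RGrph_Mor xy)
 have Y: "y2 : Hom C (Dom C (rg_d G)) (Dom C (rg_d H))" "y1 : Hom C (Cod C (rg_d G)) (Cod C (rg_d H))"
  "y1 ** rg_d G = rg_d H ** y2" "y1 ** rg_c G = rg_c H ** y2" "y2 ** rg_e G = rg_e H ** y1"
  using 11(2) by (auto simp: RGrph_Mor xy)
 have N: "rg_d H ** y2 ** x2 = (y1 ** x1) ** rg_d F"
  "rg_c H ** y2 ** x2 = (y1 ** x1) ** rg_c F" "rg_e H ** y1 ** x1 = (y2 ** x2) ** rg_e F"
  using path2[OF F(1) G(1) H(1) X(1) Y(1) X(2) Y(2) X(3)[symmetric] Y(3)[symmetric]]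
   path2[OF F(2) G(2) H(2) X(1) Y(1) X(2) Y(2) X(4)[symmetric] Y(4)[symmetric]]
   path2[OF F(3) G(3) H(3) X(2) Y(2) X(1) Y(1) X(5)[symmetric] Y(5)[symmetric]] by auto
 have "RgMor F H (y2 ** x2) (y1 ** x1) : Mor (RGrph C)"
  unfolding RGrph_Mor using O N Hom_cmp[OF X(1) Y(1)] Hom_cmp[OF X(2) Y(2)] by auto
 then show ?case by (auto simp: xy Hom_def rg_component_def)
next
 case (12 F)
 then obtain d c e v2 v1 where F: "F = Rg d c e" "d : Hom C v2 v1" "c : Hom C v2 v1" "e : Hom C v1 v2"
  unfolding RGrph_Obj is_rgraph_Hom by blast
 have "Id (RGrph C) F : Mor (RGrph C)" unfolding RGrph_Mor
  using 12 F Hom_Id[OF Hom_obj(1)[OF F(2)]] Hom_Id[OF Hom_obj(2)[OF F(2)]] by (simp add: Hom_def)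
 then show ?case by (auto simp: Hom_def rg_component_def rg_vertex_def)
next
 case (13 G H P f p q)
 have f: "f 0 : Hom C (P 2) (P 1)" "f 1 : Hom C (P 2) (P 1)" "f 2 : Hom C (P 1) (P 2)"
  using 13(3)[of 0] 13(3)[of 1] 13(3)[of 2] by (auto simp: src_def tgt_def)
 have rel: "f 0 ** f 2 = Id C (P 1) & f 1 ** f 2 = Id C (P 1)"
 proof -
  have *: "r 1 ** f 0 ** f 2 = r 1 ** Id C (P 1) & r 1 ** f 1 ** f 2 = r 1 ** Id C (P 1)"
   if K: "K : Obj (RGrph C)" and r: "!!i. i : {1, 2} ==> r i : Hom C (P i) (rg_vertex C i K)"
    and n: "!!a. a : {0, 1, 2} ==> r (tgt a) ** f a = rg_arrow a K ** r (src a)" for K r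
  proof -
   obtain d c e v2 v1 where k: "K = Rg d c e" "d : Hom C v2 v1" "c : Hom C v2 v1" "e : Hom C v1 v2"
    "d ** e = Id C v1" "c ** e = Id C v1"
    using K unfolding RGrph_Obj is_rgraph_Hom by blast
   have v: "rg_vertex C 2 K = v2" "rg_vertex C 1 K = v1" using k by (auto simp: rg_vertex_def Hom_def)
   have r': "r 2 : Hom C (P 2) v2" "r 1 : Hom C (P 1) v1" using r[of 1] r[of 2] v by auto
   have n': "r 1 ** f 0 = d ** r 2" "r 1 ** f 1 = c ** r 2" "r 2 ** f 2 = e ** r 1"
    using n[of 0] n[of 1] n[of 2] k(1) by (auto simp: src_def tgt_def rg_arrow_def)
   show ?thesis
    using path2[OF r'(2) r'(1) r'(2) f(3) f(1) k(4) k(2) n'(3) n'(1)] path2[OF r'(2) r'(1) r'(2) f(3) f(2) k(4) k(3) n'(3) n'(2)]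
     k(5-6) Hom_unit[OF r'(2)] by simp
  qed
  note a = *[OF 13(1) 13(4) 13(6)] and b = *[OF 13(2) 13(5) 13(7)]
  have o: "Id C (P 1) : Hom C (P 1) (P 1)" using Hom_Id Hom_obj f(3) by blast
  have "f 0 ** f 2 = Id C (P 1)" by (rule 13(8)[of 1]) (use a b o Hom_cmp[OF f(3) f(1)] in auto)
  moreover have "f 1 ** f 2 = Id C (P 1)" by (rule 13(8)[of 1]) (use a b o Hom_cmp[OF f(3) f(2)] in auto)
  ultimately show ?thesis by blast
 qed
 show ?case
  by (rule bexI[of _ "Rg (f 0) (f 1) (f 2)"])
   (use f rel in \<open>auto simp: RGrph_Obj is_rgraph_Hom rg_vertex_def rg_arrow_def Hom_def\<close>)
next
 case (14 G P f q)
 have f: "f 0 : Hom C (P 2) (P 1)" "f 1 : Hom C (P 2) (P 1)" "f 2 : Hom C (P 1) (P 2)"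
  using 14(2)[of 0] 14(2)[of 1] 14(2)[of 2] by (auto simp: src_def tgt_def)
 obtain d c e v2 v1 where k: "G = Rg d c e" "d : Hom C v2 v1" "c : Hom C v2 v1" "e : Hom C v1 v2"
  "d ** e = Id C v1" "c ** e = Id C v1"
  using 14(1) unfolding RGrph_Obj is_rgraph_Hom by blast
 have v: "rg_vertex C 2 G = v2" "rg_vertex C 1 G = v1" using k by (auto simp: rg_vertex_def Hom_def)
 have r': "q 2 : Hom C v2 (P 2)" "q 1 : Hom C v1 (P 1)" using 14(3)[of 1] 14(3)[of 2] v by auto
 have n': "q 1 ** d = f 0 ** q 2" "q 1 ** c = f 1 ** q 2" "q 2 ** e = f 2 ** q 1"
  using 14(4)[of 0] 14(4)[of 1] 14(4)[of 2] k(1) by (auto simp: src_def tgt_def rg_arrow_def)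
 have a: "(f 0 ** f 2) ** q 1 = Id C (P 1) ** q 1" "(f 1 ** f 2) ** q 1 = Id C (P 1) ** q 1"
  using path2[OF r'(2) r'(1) r'(2) k(4) k(2) f(3) f(1) n'(3) n'(1)] path2[OF r'(2) r'(1) r'(2) k(4) k(3) f(3) f(2) n'(3) n'(2)]
   k(5-6) Hom_unit[OF r'(2)] by auto
 have o: "Id C (P 1) : Hom C (P 1) (P 1)" using Hom_Id Hom_obj f(3) by blast
 have "f 0 ** f 2 = Id C (P 1)" by (rule 14(5)[of 1]) (use a o Hom_cmp[OF f(3) f(1)] in auto)
 moreover have "f 1 ** f 2 = Id C (P 1)" by (rule 14(5)[of 1]) (use a o Hom_cmp[OF f(3) f(2)] in auto)
 ultimately show ?case
  by (intro bexI[of _ "Rg (f 0) (f 1) (f 2)"])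
   (use f in \<open>auto simp: RGrph_Obj is_rgraph_Hom rg_vertex_def rg_arrow_def Hom_def\<close>)
qed

lemma Arr_diag: "diag C (Arr C) {0, 1} {3} (sq_vertex C) (%a f. f) sq_component"
proof (unfold_locales, goal_cases)
 case (9 F G y)
 have "Sq F G (y 1) (y 0) : Mor (Arr C)"
  unfolding Arr_Mor using 9(1,2) 9(3)[of 0] 9(3)[of 1] 9(4)[of 3]
  by (simp add: sq_vertex_def src_def tgt_def)
 then show ?case by (intro bexI[of _ "Sq F G (y 1) (y 0)"]) (auto simp: Hom_def sq_component_def)
next
 case (10 x y)
 show ?case using 10(1-4) 10(5)[of 0] 10(5)[of 1] by (auto simp: Arr_Mor sq_component_def)
next
 case (11 x y)
 then obtain F G x1 x0 H y1 y0 where xy: "x = Sq F G x1 x0" "y = Sq G H y1 y0" unfolding Arr_Mor by auto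
 have X: "F : Hom C (Dom C F) (Cod C F)" "G : Hom C (Dom C G) (Cod C G)" "x1 : Hom C (Dom C F) (Dom C G)" "x0 : Hom C (Cod C F) (Cod C G)" "G ** x1 = x0 ** F"
  using 11(1) by (auto simp: Arr_Mor xy Hom_def)
 have Y: "H : Hom C (Dom C H) (Cod C H)" "y1 : Hom C (Dom C G) (Dom C H)" "y0 : Hom C (Cod C G) (Cod C H)" "H ** y1 = y0 ** G"
  using 11(2) by (auto simp: Arr_Mor xy Hom_def)
 have "H ** y1 ** x1 = (y0 ** x0) ** F" by (rule path2[OF X(1) X(2) Y(1) X(3) Y(2) X(4) Y(3) X(5) Y(4)])
 then have "Sq F H (y1 ** x1) (y0 ** x0) : Mor (Arr C)"
  unfolding Arr_Mor using X Y Hom_cmp[OF X(3) Y(2)] Hom_cmp[OF X(4) Y(3)] by (auto simp: Hom_def)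
 then show ?case by (auto simp: xy Hom_def sq_component_def)
next
 case (12 F)
 then have "Id (Arr C) F : Mor (Arr C)" unfolding Arr_Mor by (simp add: Hom_def)
 then show ?case by (auto simp: Hom_def sq_component_def sq_vertex_def)
next
 case (13 G H P f p q)
 have "f 3 : Hom C (P 1) (P 0)" using 13(3)[of 3] by (simp add: src_def tgt_def)
 then show ?case
  by (intro bexI[of _ "f 3"]) (auto simp: sq_vertex_def Hom_def)
next
 case (14 G P f q)
 have "f 3 : Hom C (P 1) (P 0)" using 14(2)[of 3] by (simp add: src_def tgt_def)
 then show ?case
  by (intro bexI[of _ "f 3"]) (auto simp: sq_vertex_def Hom_def)
qed (auto simp: src_def tgt_def Arr_Mor sq_vertex_def sq_component_def Hom_def)

end

lemma n_Suc: "Fork_n X 0 = base X" "Fork_n X (Suc n) = Fork (Fork_n X n)" "Arr_n X 0 = base X" "Arr_n X (Suc n) = Arr (Arr_n X n)"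
  "RGrph_n X 0 = base X" "RGrph_n X (Suc n) = RGrph (RGrph_n X n)" "ERel_n X 0 = base X" "ERel_n X (Suc n) = ERel (ERel_n X n)"
 by (simp_all add: Fork_n_def Arr_n_def RGrph_n_def ERel_n_def)

section \<open>Exactness on one side as a universal property\<close>

definition is_functor :: "('a, 'b) cat => ('a, 'b) cat => ('a => 'a) => ('b => 'b) => bool" where
 "is_functor C D P Q <-> (ALL a:Obj C. P a : Obj D) &
  (ALL f a b. f : Hom C a b --> Q f : Hom D (P a) (P b)) &
  (ALL a:Obj C. Q (Id C a) = Id D (P a)) &
  (ALL f g a b c. f : Hom C a b --> g : Hom C b c --> Q (Comp C g f) = Comp D (Q g) (Q f))"

lemma functorD: assumes "is_functor C D P Q"
 shows "a : Obj C ==> P a : Obj D" "f : Hom C a b ==> Q f : Hom D (P a) (P b)"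
  "a : Obj C ==> Q (Id C a) = Id D (P a)"
  "f : Hom C a b ==> g : Hom C b c ==> Q (Comp C g f) = Comp D (Q g) (Q f)"
 using assms unfolding is_functor_def by blast+

abbreviation cfunctor :: "('o, 'm) ccat => ('o, 'm) ccat => ('o, 'm) cell func => bool" where
 "cfunctor C D P \<equiv> is_functor C D (fob P) (fmor P)"

lemma comp_func_sel [simp]: "fob (comp_func G F) a = fob G (fob F a)" "fmor (comp_func G F) x = fmor G (fmor F x)"
 by (simp_all add: comp_func_def)

lemma id_func_sel [simp]: "fob id_func a = a" "fmor id_func x = x"
 by (simp_all add: id_func_def)

lemma map_sel [simp]: "fob (Arr_map P) a = fmor P a"
 "fmor (Arr_map P) x = Sq (fmor P (sq_dom x)) (fmor P (sq_cod x)) (fmor P (sq1 x)) (fmor P (sq0 x))"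
 "fob (RGrph_map P) G = Rg (fmor P (rg_d G)) (fmor P (rg_c G)) (fmor P (rg_e G))"
 "fmor (RGrph_map P) y = RgMor (fob (RGrph_map P) (rg_dom y)) (fob (RGrph_map P) (rg_cod y)) (fmor P (rg2 y)) (fmor P (rg1 y))"
 "fob (Fork_map P) F = Fk (fmor P (fk_d F)) (fmor P (fk_c F)) (fmor P (fk_e F)) (fmor P (fk_f F))"
 "fmor (Fork_map P) z = FkMor (fob (Fork_map P) (fk_dom z)) (fob (Fork_map P) (fk_cod z)) (fmor P (fk2 z)) (fmor P (fk1 z)) (fmor P (fk0 z))"
 "fob arr F = fk_f F" "fmor arr z = Sq (fk_f (fk_dom z)) (fk_f (fk_cod z)) (fk1 z) (fk0 z)"
 "fob grph F = Rg (fk_d F) (fk_c F) (fk_e F)"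
 "fmor grph z = RgMor (fob grph (fk_dom z)) (fob grph (fk_cod z)) (fk2 z) (fk1 z)"
 by (simp_all add: Arr_map_def RGrph_map_def Fork_map_def arr_def grph_def Let_def)

definition up :: "('a, 'b) cat => ('a, 'b) cat => ('a => 'a) => ('b => 'b) => 'a => bool" where
 "up C D P Q H <-> (ALL G:Obj C. ALL y:Hom D (P G) (P H). EX! x. x : Hom C G H & Q x = y)"

definition co_up :: "('a, 'b) cat => ('a, 'b) cat => ('a => 'a) => ('b => 'b) => 'a => bool" where
 "co_up C D P Q F <-> (ALL H:Obj C. ALL y:Hom D (P F) (P H). EX! x. x : Hom C F H & Q x = y)"

lemma up_ex: "up C D P Q H ==> G : Obj C ==> y : Hom D (P G) (P H) ==> EX x:Hom C G H. Q x = y"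
 unfolding up_def by blast

lemma co_up_ex: "co_up C D P Q F ==> H : Obj C ==> y : Hom D (P F) (P H) ==> EX x:Hom C F H. Q x = y"
 unfolding co_up_def by blast

lemma up_un: assumes "up C D P Q H" "is_functor C D P Q" "G : Obj C" "x : Hom C G H" "x' : Hom C G H" "Q x = Q x'"
 shows "x = x'"
proof -
 have "Q x' : Hom D (P G) (P H)" using functorD(2)[OF assms(2,5)] .
 then have "EX! z. z : Hom C G H & Q z = Q x'" using assms(1,3) unfolding up_def by blast
 then show ?thesis using assms(4-6) by blast
qed

lemma co_up_un: assumes "co_up C D P Q F" "is_functor C D P Q" "H : Obj C" "x : Hom C F H" "x' : Hom C F H" "Q x = Q x'"
 shows "x = x'"
proof -
 have "Q x' : Hom D (P F) (P H)" using functorD(2)[OF assms(2,5)] .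
 then have "EX! z. z : Hom C F H & Q z = Q x'" using assms(1,3) unfolding co_up_def by blast
 then show ?thesis using assms(4-6) by blast
qed

lemma id_functor: "CCat C ==> cfunctor C C id_func"
 by (simp add: is_functor_def)

lemma id_up: "up C C (fob id_func) (fmor id_func) H" "co_up C C (fob id_func) (fmor id_func) H"
 by (auto simp: up_def co_up_def)

context CCat begin

lemma FkD: assumes "F : Obj (Fork C)"
 shows "F = Fk (fk_d F) (fk_c F) (fk_e F) (fk_f F)"
  "fk_d F : Hom C (Dom C (fk_d F)) (Cod C (fk_d F))" "fk_c F : Hom C (Dom C (fk_d F)) (Cod C (fk_d F))"
  "fk_e F : Hom C (Cod C (fk_d F)) (Dom C (fk_d F))" "fk_f F : Hom C (Cod C (fk_d F)) (Cod C (fk_f F))"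
  "fk_d F ** fk_e F = Id C (Cod C (fk_d F))" "fk_c F ** fk_e F = Id C (Cod C (fk_d F))" "fk_f F ** fk_d F = fk_f F ** fk_c F"
  "Dom C (fk_d F) : Obj C" "Cod C (fk_d F) : Obj C" "Cod C (fk_f F) : Obj C"
 using assms by (auto simp: Fork_Obj is_fork_def is_rgraph_def Hom_def)

lemma FkI: assumes "d : Hom C v2 v1" "c : Hom C v2 v1" "e : Hom C v1 v2" "f : Hom C v1 v0"
  "d ** e = Id C v1" "c ** e = Id C v1" "f ** d = f ** c"
 shows "Fk d c e f : Obj (Fork C)"
 unfolding Fork_Obj is_fork_Hom using assms by blast

lemma RgD: assumes "F : Obj (RGrph C)"
 shows "F = Rg (rg_d F) (rg_c F) (rg_e F)"
  "rg_d F : Hom C (Dom C (rg_d F)) (Cod C (rg_d F))" "rg_c F : Hom C (Dom C (rg_d F)) (Cod C (rg_d F))"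
  "rg_e F : Hom C (Cod C (rg_d F)) (Dom C (rg_d F))"
  "rg_d F ** rg_e F = Id C (Cod C (rg_d F))" "rg_c F ** rg_e F = Id C (Cod C (rg_d F))"
  "Dom C (rg_d F) : Obj C" "Cod C (rg_d F) : Obj C" "is_rgraph C (rg_d F) (rg_c F) (rg_e F)"
 using assms by (auto simp: RGrph_Obj is_rgraph_def Hom_def)

lemma FkMorD: assumes "x : Hom (Fork C) F G"
 shows "F : Obj (Fork C)" "G : Obj (Fork C)" "x = FkMor F G (fk2 x) (fk1 x) (fk0 x)"
  "fk2 x : Hom C (Dom C (fk_d F)) (Dom C (fk_d G))" "fk1 x : Hom C (Cod C (fk_d F)) (Cod C (fk_d G))"
  "fk0 x : Hom C (Cod C (fk_f F)) (Cod C (fk_f G))"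
  "fk_d G ** fk2 x = fk1 x ** fk_d F" "fk_c G ** fk2 x = fk1 x ** fk_c F"
  "fk_e G ** fk1 x = fk2 x ** fk_e F" "fk_f G ** fk1 x = fk0 x ** fk_f F"
 using assms unfolding Hom_def[of "Fork C"] Fork_Mor by auto

lemma FkMorI: assumes "F : Obj (Fork C)" "G : Obj (Fork C)"
  "x2 : Hom C (Dom C (fk_d F)) (Dom C (fk_d G))" "x1 : Hom C (Cod C (fk_d F)) (Cod C (fk_d G))"
  "x0 : Hom C (Cod C (fk_f F)) (Cod C (fk_f G))"
  "fk_d G ** x2 = x1 ** fk_d F" "fk_c G ** x2 = x1 ** fk_c F"
  "fk_e G ** x1 = x2 ** fk_e F" "fk_f G ** x1 = x0 ** fk_f F"
 shows "FkMor F G x2 x1 x0 : Hom (Fork C) F G"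
 unfolding Hom_def[of "Fork C"] Fork_Mor using assms by auto

lemma RgMorD: assumes "x : Hom (RGrph C) F G"
 shows "F : Obj (RGrph C)" "G : Obj (RGrph C)" "x = RgMor F G (rg2 x) (rg1 x)"
  "rg2 x : Hom C (Dom C (rg_d F)) (Dom C (rg_d G))" "rg1 x : Hom C (Cod C (rg_d F)) (Cod C (rg_d G))"
  "rg_d G ** rg2 x = rg1 x ** rg_d F" "rg_c G ** rg2 x = rg1 x ** rg_c F"
  "rg_e G ** rg1 x = rg2 x ** rg_e F"
 using assms unfolding Hom_def[of "RGrph C"] RGrph_Mor by auto

lemma RgMorI: assumes "F : Obj (RGrph C)" "G : Obj (RGrph C)"
  "x2 : Hom C (Dom C (rg_d F)) (Dom C (rg_d G))" "x1 : Hom C (Cod C (rg_d F)) (Cod C (rg_d G))"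
  "rg_d G ** x2 = x1 ** rg_d F" "rg_c G ** x2 = x1 ** rg_c F"
  "rg_e G ** x1 = x2 ** rg_e F"
 shows "RgMor F G x2 x1 : Hom (RGrph C) F G"
 unfolding Hom_def[of "RGrph C"] RGrph_Mor using assms by auto

lemma SqD: assumes "x : Hom (Arr C) f g"
 shows "f : Mor C" "g : Mor C" "x = Sq f g (sq1 x) (sq0 x)"
  "sq1 x : Hom C (Dom C f) (Dom C g)" "sq0 x : Hom C (Cod C f) (Cod C g)" "g ** sq1 x = sq0 x ** f"
 using assms unfolding Hom_def[of "Arr C"] Arr_Mor by auto

lemma SqI: assumes "f : Mor C" "g : Mor C" "x1 : Hom C (Dom C f) (Dom C g)" "x0 : Hom C (Cod C f) (Cod C g)" "g ** x1 = x0 ** f"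
 shows "Sq f g x1 x0 : Hom (Arr C) f g"
 unfolding Hom_def[of "Arr C"] Arr_Mor using assms by auto

lemma Fork_CCat: "CCat (Fork C)"
 unfolding CCat_def Cat_def using diag.D_category[OF Fork_diag] .

lemma RGrph_CCat: "CCat (RGrph C)"
 unfolding CCat_def Cat_def using diag.D_category[OF RGrph_diag] .

lemma Arr_CCat: "CCat (Arr C)"
 unfolding CCat_def Cat_def using diag.D_category[OF Arr_diag] .

end

locale two_cats = C: CCat C + D: CCat D for C D :: "('o, 'm) ccat" +
 fixes P :: "('o, 'm) cell func"
 assumes P: "cfunctor C D P"
begin

lemmas PO = functorD(1)[OF P] and PH = functorD(2)[OF P] and PI = functorD(3)[OF P] and PC = functorD(4)[OF P]

lemma PDom: "f : Hom C a b ==> Dom D (fmor P f) = fob P a" "f : Hom C a b ==> Cod D (fmor P f) = fob P b"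
 "f : Hom C a b ==> fmor P f : Mor D"
 using PH by (auto simp: Hom_def)

abbreviation "Parr \<equiv> comp_func (Arr_map P) arr"
abbreviation "Pgrph \<equiv> comp_func (RGrph_map P) grph"

lemma Parr_H: assumes "x : Hom (Fork C) F G" shows "fmor Parr x : Hom (Arr D) (fob Parr F) (fob Parr G)"
proof -
 note X = C.FkMorD[OF assms]
 note F = C.FkD[OF X(1)] and G = C.FkD[OF X(2)]
 have s: "fk_dom x = F" "fk_cod x = G" using X(3) by (metis cell.sel)+
 have "Comp D (fmor P (fk_f G)) (fmor P (fk1 x)) = Comp D (fmor P (fk0 x)) (fmor P (fk_f F))"
  using PC[OF X(5) G(5)] PC[OF F(5) X(6)] X(10) by simp
 then show ?thesis
  using PDom(3)[OF F(5)] PDom(3)[OF G(5)] PH[OF X(5)] PH[OF X(6)] PDom[OF F(5)] PDom[OF G(5)]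
  by (simp add: s) (rule D.SqI, simp_all)
qed

lemma Parr_functor: "cfunctor (Fork C) (Arr D) Parr"
 unfolding is_functor_def
proof (intro conjI ballI allI impI)
 fix F assume F: "F : Obj (Fork C)"
 note F' = C.FkD[OF F]
 show "fob Parr F : Obj (Arr D)" using PDom(3)[OF F'(5)] by simp
 show "fmor Parr (Id (Fork C) F) = Id (Arr D) (fob Parr F)"
  using PI F' PDom[OF F'(5)] by simp
next
 fix x F G assume "x : Hom (Fork C) F G"
 then show "fmor Parr x : Hom (Arr D) (fob Parr F) (fob Parr G)" by (rule Parr_H)
next
 fix x y F G H assume x: "x : Hom (Fork C) F G" and y: "y : Hom (Fork C) G H"
 note X = C.FkMorD[OF x] and Y = C.FkMorD[OF y]
 show "fmor Parr (Comp (Fork C) y x) = Comp (Arr D) (fmor Parr y) (fmor Parr x)"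
  using PC[OF X(5) Y(5)] PC[OF X(6) Y(6)] by simp
qed

lemma grph_obj: assumes "F : Obj (Fork C)" shows "fob Pgrph F : Obj (RGrph D)"
proof -
 note F = C.FkD[OF assms]
 have "Comp D (fmor P (fk_d F)) (fmor P (fk_e F)) = Id D (fob P (Cod C (fk_d F)))"
  "Comp D (fmor P (fk_c F)) (fmor P (fk_e F)) = Id D (fob P (Cod C (fk_d F)))"
  using PC[OF F(4,2)] PC[OF F(4,3)] F PI by auto
 then show ?thesis using PH[OF F(2)] PH[OF F(3)] PH[OF F(4)] unfolding RGrph_Obj D.is_rgraph_Hom by auto
qed

lemma Pgrph_H: assumes "x : Hom (Fork C) F G" shows "fmor Pgrph x : Hom (RGrph D) (fob Pgrph F) (fob Pgrph G)"
proof -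
 note X = C.FkMorD[OF assms]
 note F = C.FkD[OF X(1)] and G = C.FkD[OF X(2)]
 have s: "fk_dom x = F" "fk_cod x = G" using X(3) by (metis cell.sel)+
 have e: "fmor Pgrph x = RgMor (fob Pgrph F) (fob Pgrph G) (fmor P (fk2 x)) (fmor P (fk1 x))" by (simp add: s)
 show ?thesis unfolding e
  by (rule D.RgMorI[OF grph_obj[OF X(1)] grph_obj[OF X(2)]])
   (use PC[OF X(4) G(2)] PC[OF F(2) X(5)] PC[OF X(4) G(3)] PC[OF F(3) X(5)] PC[OF X(5) G(4)] PC[OF F(4) X(4)] X(7-9)
    PH[OF X(4)] PH[OF X(5)] PDom[OF F(2)] PDom[OF G(2)] in simp_all)
qed

lemma Pgrph_functor: "cfunctor (Fork C) (RGrph D) Pgrph"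
 unfolding is_functor_def
proof (intro conjI ballI allI impI)
 fix F assume F: "F : Obj (Fork C)"
 note F' = C.FkD[OF F]
 show "fob Pgrph F : Obj (RGrph D)" by (rule grph_obj[OF F])
 show "fmor Pgrph (Id (Fork C) F) = Id (RGrph D) (fob Pgrph F)"
  using PI F' PDom[OF F'(2)] by simp
next
 fix x F G assume "x : Hom (Fork C) F G"
 then show "fmor Pgrph x : Hom (RGrph D) (fob Pgrph F) (fob Pgrph G)" by (rule Pgrph_H)
next
 fix x y F G H assume x: "x : Hom (Fork C) F G" and y: "y : Hom (Fork C) G H"
 note X = C.FkMorD[OF x] and Y = C.FkMorD[OF y]
 show "fmor Pgrph (Comp (Fork C) y x) = Comp (RGrph D) (fmor Pgrph y) (fmor Pgrph x)"
  using PC[OF X(4) Y(4)] PC[OF X(5) Y(5)] by simp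
qed

lemma Fork_map_obj: assumes "F : Obj (Fork C)" shows "fob (Fork_map P) F : Obj (Fork D)"
proof -
 note F = C.FkD[OF assms]
 show ?thesis unfolding map_sel
  by (rule D.FkI[OF PH[OF F(2)] PH[OF F(3)] PH[OF F(4)] PH[OF F(5)]])
   (use PC[OF F(4,2)] PC[OF F(4,3)] PC[OF F(2,5)] PC[OF F(3,5)] F PI in auto)
qed

lemma Fork_map_H: assumes "x : Hom (Fork C) F G" shows "fmor (Fork_map P) x : Hom (Fork D) (fob (Fork_map P) F) (fob (Fork_map P) G)"
proof -
 note X = C.FkMorD[OF assms]
 note F = C.FkD[OF X(1)] and G = C.FkD[OF X(2)]
 have s: "fk_dom x = F" "fk_cod x = G" using X(3) by (metis cell.sel)+
 have e: "fmor (Fork_map P) x = FkMor (fob (Fork_map P) F) (fob (Fork_map P) G) (fmor P (fk2 x)) (fmor P (fk1 x)) (fmor P (fk0 x))"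
  unfolding map_sel(6) s ..
 show ?thesis unfolding e
  by (rule D.FkMorI[OF Fork_map_obj[OF X(1)] Fork_map_obj[OF X(2)]])
   (use PC[OF X(4) G(2)] PC[OF F(2) X(5)] PC[OF X(4) G(3)] PC[OF F(3) X(5)] PC[OF X(5) G(4)] PC[OF F(4) X(4)]
    PC[OF X(5) G(5)] PC[OF F(5) X(6)] X(7-10)
    PH[OF X(4)] PH[OF X(5)] PH[OF X(6)] PDom[OF F(2)] PDom[OF G(2)] PDom[OF F(5)] PDom[OF G(5)] in simp_all)
qed

lemma up_step:
 assumes H: "H : Obj (Fork C)" and kp: "kp C (fk_f H) (fk_d H) (fk_c H)"
  and u1: "up C D (fob P) (fmor P) (Cod C (fk_d H))" and u0: "up C D (fob P) (fmor P) (Cod C (fk_f H))"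
 shows "up (Fork C) (Arr D) (fob Parr) (fmor Parr) H"
 unfolding up_def
proof (intro ballI)
 fix G y assume G: "G : Obj (Fork C)" and y: "y : Hom (Arr D) (fob Parr G) (fob Parr H)"
 note H' = C.FkD[OF H] and G' = C.FkD[OF G]
 note pb = kp[unfolded is_kernel_pair_def]
 note Y = D.SqD[OF y]
 have Y1: "sq1 y : Hom D (fob P (Cod C (fk_d G))) (fob P (Cod C (fk_d H)))" "sq0 y : Hom D (fob P (Cod C (fk_f G))) (fob P (Cod C (fk_f H)))"
  "Comp D (fmor P (fk_f H)) (sq1 y) = Comp D (sq0 y) (fmor P (fk_f G))"
  using Y(4-6) PDom[OF H'(5)] PDom[OF G'(5)] by auto
 obtain x1 where x1: "x1 : Hom C (Cod C (fk_d G)) (Cod C (fk_d H))" "fmor P x1 = sq1 y" using up_ex[OF u1 G'(10) Y1(1)] by blast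
 obtain x0 where x0: "x0 : Hom C (Cod C (fk_f G)) (Cod C (fk_f H))" "fmor P x0 = sq0 y" using up_ex[OF u0 G'(11) Y1(2)] by blast
 have f: "Comp C (fk_f H) x1 = Comp C x0 (fk_f G)"
  by (rule up_un[OF u0 P G'(10)]) (use C.Hom_cmp[OF x1(1) H'(5)] C.Hom_cmp[OF G'(5) x0(1)] PC[OF x1(1) H'(5)] PC[OF G'(5) x0(1)] Y1 x1 x0 in auto)
 have "Comp C (fk_f H) (Comp C x1 (fk_d G)) = Comp C (fk_f H) (Comp C x1 (fk_c G))"
  using C.Hom_assoc[OF G'(2) x1(1) H'(5)] C.Hom_assoc[OF G'(3) x1(1) H'(5)] C.Hom_assoc[OF G'(2,5) x0(1)] C.Hom_assoc[OF G'(3,5) x0(1)] f G'(8) by simp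
 then obtain x2 where x2: "x2 : Hom C (Dom C (fk_d G)) (Dom C (fk_d H))" "Comp C (fk_d H) x2 = Comp C x1 (fk_d G)" "Comp C (fk_c H) x2 = Comp C x1 (fk_c G)"
  using C.pb_exH[OF pb, of "Comp C x1 (fk_d G)" "Dom C (fk_d G)" "Comp C x1 (fk_c G)"] C.Hom_cmp[OF G'(2) x1(1)] C.Hom_cmp[OF G'(3) x1(1)] H'(5)
  by (auto simp: Hom_def)
 have e: "Comp C (fk_e H) x1 = Comp C x2 (fk_e G)"
 proof (rule C.pb_uniqueH[OF pb C.Hom_cmp[OF x1(1) H'(4)] C.Hom_cmp[OF G'(4) x2(1)]])
  show "Comp C (fk_d H) (Comp C (fk_e H) x1) = Comp C (fk_d H) (Comp C x2 (fk_e G))"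
   using C.Hom_assoc[OF x1(1) H'(4) H'(2)] C.Hom_assoc[OF G'(4) x2(1) H'(2)] C.Hom_assoc[OF G'(4) G'(2) x1(1)] x2 H'(6) G'(6) C.Hom_unit[OF x1(1)] by simp
  show "Comp C (fk_c H) (Comp C (fk_e H) x1) = Comp C (fk_c H) (Comp C x2 (fk_e G))"
   using C.Hom_assoc[OF x1(1) H'(4) H'(3)] C.Hom_assoc[OF G'(4) x2(1) H'(3)] C.Hom_assoc[OF G'(4) G'(3) x1(1)] x2 H'(7) G'(7) C.Hom_unit[OF x1(1)] by simp
 qed
 let ?x = "FkMor G H x2 x1 x0"
 have x: "?x : Hom (Fork C) G H" by (rule C.FkMorI[OF G H x2(1) x1(1) x0(1) x2(2,3) e f])
 have px: "fmor Parr ?x = y" using Y(3) x1 x0 by simp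
 show "EX! x. x : Hom (Fork C) G H & fmor Parr x = y"
 proof (rule ex1I[of _ ?x])
  show "?x : Hom (Fork C) G H & fmor Parr ?x = y" using x px by blast
  fix z assume z: "z : Hom (Fork C) G H & fmor Parr z = y"
  note Z = C.FkMorD[OF conjunct1[OF z]]
  have e: "fmor P (fk1 z) = sq1 y" "fmor P (fk0 z) = sq0 y" using z by auto
  have z1: "fk1 z = x1" by (rule up_un[OF u1 P G'(10) Z(5) x1(1)]) (use e x1 in simp)
  have z0: "fk0 z = x0" by (rule up_un[OF u0 P G'(11) Z(6) x0(1)]) (use e x0 in simp)
  have z2: "fk2 z = x2" by (rule C.pb_uniqueH[OF pb Z(4) x2(1)]) (use Z z1 x2 in simp_all)
  show "z = ?x" using Z(3) z0 z1 z2 by simp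
 qed
qed

lemma co_up_step:
 assumes F: "F : Obj (Fork C)" and co: "coeq C (fk_d F) (fk_c F) (fk_f F)"
  and u2: "co_up C D (fob P) (fmor P) (Dom C (fk_d F))" and u1: "co_up C D (fob P) (fmor P) (Cod C (fk_d F))"
 shows "co_up (Fork C) (RGrph D) (fob Pgrph) (fmor Pgrph) F"
 unfolding co_up_def
proof (intro ballI)
 fix H y assume H: "H : Obj (Fork C)" and y: "y : Hom (RGrph D) (fob Pgrph F) (fob Pgrph H)"
 note F' = C.FkD[OF F] and H' = C.FkD[OF H]
 note Y = D.RgMorD[OF y]
 have Y1: "rg2 y : Hom D (fob P (Dom C (fk_d F))) (fob P (Dom C (fk_d H)))" "rg1 y : Hom D (fob P (Cod C (fk_d F))) (fob P (Cod C (fk_d H)))"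
  "Comp D (fmor P (fk_d H)) (rg2 y) = Comp D (rg1 y) (fmor P (fk_d F))" "Comp D (fmor P (fk_c H)) (rg2 y) = Comp D (rg1 y) (fmor P (fk_c F))"
  "Comp D (fmor P (fk_e H)) (rg1 y) = Comp D (rg2 y) (fmor P (fk_e F))"
  using Y(4-8) PDom[OF H'(2)] PDom[OF F'(2)] by auto
 obtain x2 where x2: "x2 : Hom C (Dom C (fk_d F)) (Dom C (fk_d H))" "fmor P x2 = rg2 y" using co_up_ex[OF u2 H'(9) Y1(1)] by blast
 obtain x1 where x1: "x1 : Hom C (Cod C (fk_d F)) (Cod C (fk_d H))" "fmor P x1 = rg1 y" using co_up_ex[OF u1 H'(10) Y1(2)] by blast
 have d: "Comp C (fk_d H) x2 = Comp C x1 (fk_d F)"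
  by (rule co_up_un[OF u2 P H'(10)]) (use C.Hom_cmp[OF x2(1) H'(2)] C.Hom_cmp[OF F'(2) x1(1)] PC[OF x2(1) H'(2)] PC[OF F'(2) x1(1)] Y1 x1 x2 in auto)
 have c: "Comp C (fk_c H) x2 = Comp C x1 (fk_c F)"
  by (rule co_up_un[OF u2 P H'(10)]) (use C.Hom_cmp[OF x2(1) H'(3)] C.Hom_cmp[OF F'(3) x1(1)] PC[OF x2(1) H'(3)] PC[OF F'(3) x1(1)] Y1 x1 x2 in auto)
 have e: "Comp C (fk_e H) x1 = Comp C x2 (fk_e F)"
  by (rule co_up_un[OF u1 P H'(9)]) (use C.Hom_cmp[OF x1(1) H'(4)] C.Hom_cmp[OF F'(4) x2(1)] PC[OF x1(1) H'(4)] PC[OF F'(4) x2(1)] Y1 x1 x2 in auto)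
 have "Comp C (Comp C (fk_f H) x1) (fk_d F) = Comp C (Comp C (fk_f H) x1) (fk_c F)"
  using C.Hom_assoc[OF F'(2) x1(1) H'(5)] C.Hom_assoc[OF F'(3) x1(1) H'(5)] C.Hom_assoc[OF x2(1) H'(2,5)] C.Hom_assoc[OF x2(1) H'(3,5)] d c H'(8) by simp
 then obtain x0 where x0: "x0 : Hom C (Cod C (fk_f F)) (Cod C (fk_f H))" "Comp C x0 (fk_f F) = Comp C (fk_f H) x1"
  using C.co_exH[OF co C.Hom_cmp[OF x1(1) H'(5)]] by blast
 let ?x = "FkMor F H x2 x1 x0"
 have x: "?x : Hom (Fork C) F H" by (rule C.FkMorI[OF F H x2(1) x1(1) x0(1) d c e x0(2)[symmetric]])
 have px: "fmor Pgrph ?x = y" using Y(3) x1 x2 by simp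
 show "EX! x. x : Hom (Fork C) F H & fmor Pgrph x = y"
 proof (rule ex1I[of _ ?x])
  show "?x : Hom (Fork C) F H & fmor Pgrph ?x = y" using x px by blast
  fix z assume z: "z : Hom (Fork C) F H & fmor Pgrph z = y"
  note Z = C.FkMorD[OF conjunct1[OF z]]
  have e: "fmor P (fk2 z) = rg2 y" "fmor P (fk1 z) = rg1 y" using z by auto
  have z2: "fk2 z = x2" by (rule co_up_un[OF u2 P H'(9) Z(4) x2(1)]) (use e x2 in simp)
  have z1: "fk1 z = x1" by (rule co_up_un[OF u1 P H'(10) Z(5) x1(1)]) (use e x1 in simp)
  have z0: "fk0 z = x0" by (rule C.co_uniqueH[OF co Z(6) x0(1)]) (use Z z1 x0 in simp)
  show "z = ?x" using Z(3) z0 z1 z2 by simp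
 qed
qed

end

context CCat begin

lemma id_two: "two_cats C C id_func"
 unfolding two_cats_def two_cats_axioms_def using CCat_axioms id_functor by blast

lemma EqFork_ob: assumes "has_pb C" "\<phi> : Mor C"
 shows "fob (EqFork C) \<phi> : Obj (Fork C)" "fk_f (fob (EqFork C) \<phi>) = \<phi>"
  "kp C \<phi> (fk_d (fob (EqFork C) \<phi>)) (fk_c (fob (EqFork C) \<phi>))"
proof -
 obtain d c where pb: "pb C \<phi> \<phi> d c" using assms unfolding has_pb_def by blast
 note H = pb_Hom[OF pb]
 have o: "Id C (Dom C \<phi>) : Hom C (Dom C \<phi>) (Dom C \<phi>)" using assms(2) by (auto simp: Hom_def)
 obtain e where e: "e : Hom C (Dom C \<phi>) (Dom C d)" "d ** e = Id C (Dom C \<phi>)" "c ** e = Id C (Dom C \<phi>)"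
  using pb_exH[OF pb o o] by blast
 have "Fk d c e \<phi> : Obj (Fork C)" by (rule FkI[OF H(3,4) e(1) H(1) e(2,3) H(5)])
 then have "EX F. F : Obj (Fork C) & fk_f F = \<phi> & kp C \<phi> (fk_d F) (fk_c F)"
  using pb unfolding is_kernel_pair_def by (intro exI[of _ "Fk d c e \<phi>"]) simp
 from someI_ex[OF this] show "fob (EqFork C) \<phi> : Obj (Fork C)" "fk_f (fob (EqFork C) \<phi>) = \<phi>"
  "kp C \<phi> (fk_d (fob (EqFork C) \<phi>)) (fk_c (fob (EqFork C) \<phi>))"
  unfolding EqFork_def Let_def by simp_all
qed

lemma EqFork_mor: assumes "has_pb C" "x : Hom (Arr C) f g"
 shows "fmor (EqFork C) x : Hom (Fork C) (fob (EqFork C) f) (fob (EqFork C) g)"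
  "fk1 (fmor (EqFork C) x) = sq1 x" "fk0 (fmor (EqFork C) x) = sq0 x"
proof -
 note X = SqD[OF assms(2)]
 note f = EqFork_ob[OF assms(1) X(1)] and g = EqFork_ob[OF assms(1) X(2)]
 have "up (Fork C) (Arr C) (fob (comp_func (Arr_map id_func) arr)) (fmor (comp_func (Arr_map id_func) arr)) (fob (EqFork C) g)"
  by (rule two_cats.up_step[OF id_two g(1)]) (use g id_up in auto)
 then have ex: "EX! y. y : Hom (Fork C) (fob (EqFork C) f) (fob (EqFork C) g) & fmor (comp_func (Arr_map id_func) arr) y = x"
  unfolding up_def using f(1) assms(2) f(2) g(2) by simp
 have iff: "y : Hom (Fork C) (fob (EqFork C) f) (fob (EqFork C) g) & fmor (comp_func (Arr_map id_func) arr) y = x <->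
   y : Hom (Fork C) (fob (EqFork C) f) (fob (EqFork C) g) & fk1 y = sq1 x & fk0 y = sq0 x" for y
 proof -
  have "fmor (comp_func (Arr_map id_func) arr) y = Sq f g (fk1 y) (fk0 y)" if "y : Hom (Fork C) (fob (EqFork C) f) (fob (EqFork C) g)"
   using arg_cong[OF FkMorD(3)[OF that], of fk_dom] arg_cong[OF FkMorD(3)[OF that], of fk_cod] f(2) g(2) by simp
  moreover have "Sq f g a b = x <-> a = sq1 x & b = sq0 x" for a b using X(3) by (metis cell.inject(3))
  ultimately show ?thesis by auto
 qed
 have s: "sq_dom x = f" "sq_cod x = g" using X(3) by (metis cell.sel)+
 have "fmor (EqFork C) x = (THE y. y : Hom (Fork C) (fob (EqFork C) f) (fob (EqFork C) g) & fk1 y = sq1 x & fk0 y = sq0 x)"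
  unfolding EqFork_def Let_def by (simp add: s)
 then show "fmor (EqFork C) x : Hom (Fork C) (fob (EqFork C) f) (fob (EqFork C) g)"
  "fk1 (fmor (EqFork C) x) = sq1 x" "fk0 (fmor (EqFork C) x) = sq0 x"
  using theI'[OF ex[unfolded iff]] by auto
qed

lemma CoeqFork_ob: assumes "has_rcoeq C" "G : Obj (RGrph C)"
 shows "fob (CoeqFork C) G : Obj (Fork C)" "fob grph (fob (CoeqFork C) G) = G"
  "coeq C (rg_d G) (rg_c G) (fk_f (fob (CoeqFork C) G))"
proof -
 note G = RgD[OF assms(2)]
 obtain q where q: "coeq C (rg_d G) (rg_c G) q" using assms(1) G(9) unfolding has_rcoeq_def by blast
 note H = co_Hom[OF q]
 have "Fk (rg_d G) (rg_c G) (rg_e G) q : Obj (Fork C)" by (rule FkI[OF G(2,3,4) H(3) G(5,6) H(4)])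
 then have "EX F. F : Obj (Fork C) & fob grph F = G & coeq C (rg_d G) (rg_c G) (fk_f F)"
  using q G(1) by (intro exI[of _ "Fk (rg_d G) (rg_c G) (rg_e G) q"]) simp
 from someI_ex[OF this] show "fob (CoeqFork C) G : Obj (Fork C)" "fob grph (fob (CoeqFork C) G) = G"
  "coeq C (rg_d G) (rg_c G) (fk_f (fob (CoeqFork C) G))"
  unfolding CoeqFork_def Let_def by simp_all
qed

lemma CoeqFork_mor: assumes "has_rcoeq C" "x : Hom (RGrph C) f g"
 shows "fmor (CoeqFork C) x : Hom (Fork C) (fob (CoeqFork C) f) (fob (CoeqFork C) g)"
  "fk2 (fmor (CoeqFork C) x) = rg2 x" "fk1 (fmor (CoeqFork C) x) = rg1 x"
proof -
 note X = RgMorD[OF assms(2)]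
 note f = CoeqFork_ob[OF assms(1) X(1)] and g = CoeqFork_ob[OF assms(1) X(2)]
 let ?P = "comp_func (RGrph_map id_func) grph"
 have sel: "fk_d (fob (CoeqFork C) f) = rg_d f" "fk_c (fob (CoeqFork C) f) = rg_c f"
  "fk_d (fob (CoeqFork C) g) = rg_d g" "fk_c (fob (CoeqFork C) g) = rg_c g"
  using f(2) g(2) by (metis cell.sel map_sel(9))+
 have pf: "fob ?P (fob (CoeqFork C) f) = f" "fob ?P (fob (CoeqFork C) g) = g"
  unfolding comp_func_sel f(2) g(2) using RgD(1)[OF X(1)] RgD(1)[OF X(2)] by simp_all
 have "co_up (Fork C) (RGrph C) (fob ?P) (fmor ?P) (fob (CoeqFork C) f)"
  by (rule two_cats.co_up_step[OF id_two f(1)]) (use f sel id_up in auto)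
 then have ex: "EX! y. y : Hom (Fork C) (fob (CoeqFork C) f) (fob (CoeqFork C) g) & fmor ?P y = x"
  unfolding co_up_def using g(1) assms(2) unfolding pf(1) by (metis pf(2))
 have iff: "y : Hom (Fork C) (fob (CoeqFork C) f) (fob (CoeqFork C) g) & fmor ?P y = x <->
   y : Hom (Fork C) (fob (CoeqFork C) f) (fob (CoeqFork C) g) & fk2 y = rg2 x & fk1 y = rg1 x" for y
 proof -
  have "fmor ?P y = RgMor f g (fk2 y) (fk1 y)" if "y : Hom (Fork C) (fob (CoeqFork C) f) (fob (CoeqFork C) g)"
  proof -
   have "fk_dom y = fob (CoeqFork C) f" "fk_cod y = fob (CoeqFork C) g"
    using arg_cong[OF FkMorD(3)[OF that], of fk_dom] arg_cong[OF FkMorD(3)[OF that], of fk_cod] by simp_all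
   then show ?thesis unfolding comp_func_sel map_sel(10) map_sel(4) cell.sel using pf by (simp only: comp_func_sel id_func_sel)
  qed
  moreover have "RgMor f g a b = x <-> a = rg2 x & b = rg1 x" for a b using X(3) by (metis cell.inject(5))
  ultimately show ?thesis by auto
 qed
 have s: "rg_dom x = f" "rg_cod x = g" using X(3) by (metis cell.sel)+
 have "fmor (CoeqFork C) x = (THE y. y : Hom (Fork C) (fob (CoeqFork C) f) (fob (CoeqFork C) g) & fk2 y = rg2 x & fk1 y = rg1 x)"
  unfolding CoeqFork_def Let_def by (simp add: s)
 then show "fmor (CoeqFork C) x : Hom (Fork C) (fob (CoeqFork C) f) (fob (CoeqFork C) g)"
  "fk2 (fmor (CoeqFork C) x) = rg2 x" "fk1 (fmor (CoeqFork C) x) = rg1 x"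
  using theI'[OF ex[unfolded iff]] by auto
qed

end

primrec lex :: "('o, 'm) cat => nat => ('o, 'm) cell => bool" where
 "lex X 0 F = (F : Obj (base X))"
| "lex X (Suc n) F = (F : Obj (Fork (Fork_n X n)) & kp (Fork_n X n) (fk_f F) (fk_d F) (fk_c F) &
  lex X n (Dom (Fork_n X n) (fk_d F)) & lex X n (Cod (Fork_n X n) (fk_d F)) & lex X n (Cod (Fork_n X n) (fk_f F)))"

primrec rex :: "('o, 'm) cat => nat => ('o, 'm) cell => bool" where
 "rex X 0 F = (F : Obj (base X))"
| "rex X (Suc n) F = (F : Obj (Fork (Fork_n X n)) & coeq (Fork_n X n) (fk_d F) (fk_c F) (fk_f F) &
  rex X n (Dom (Fork_n X n) (fk_d F)) & rex X n (Cod (Fork_n X n) (fk_d F)) & rex X n (Cod (Fork_n X n) (fk_f F)))"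

context CCat begin

lemma iso_pb: assumes "iso C u" shows "pb C (Id C (Cod C u)) (Id C (Cod C u)) u u"
proof -
 have u: "u : Mor C" using assms unfolding iso_def by blast
 let ?i = "Id C (Cod C u)"
 have "pb C ?i ?i ?i ?i" by (rule pbI) (use u in auto)
 from pb_iso[OF this assms] show ?thesis using u by simp
qed

lemma iso_co: assumes "iso C u" shows "coeq C (Id C (Dom C u)) (Id C (Dom C u)) u"
proof -
 have u: "u : Mor C" using assms unfolding iso_def by blast
 let ?i = "Id C (Dom C u)"
 have "coeq C ?i ?i ?i" by (rule coI) (use u in auto)
 from co_iso[OF this assms] show ?thesis using u by simp
qed

lemma Id_rgraph: "a : Obj C ==> is_rgraph C (Id C a) (Id C a) (Id C a)"
 by (auto simp: is_rgraph_def Hom_def)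

lemma kp_pullback:
 assumes f: "f : Hom (Fork C) G K" and g: "g : Hom (Fork C) H K" and p: "p : Hom (Fork C) P G" and q: "q : Hom (Fork C) P H"
  and pb2: "pb C (fk2 f) (fk2 g) (fk2 p) (fk2 q)" and pb1: "pb C (fk1 f) (fk1 g) (fk1 p) (fk1 q)"
  and kG: "kp C (fk_f G) (fk_d G) (fk_c G)" and kH: "kp C (fk_f H) (fk_d H) (fk_c H)"
  and kK: "kp C (fk_f K) (fk_d K) (fk_c K)"
 shows "kp C (fk_f P) (fk_d P) (fk_c P)"
 unfolding is_kernel_pair_def
proof -
 note F = FkMorD[OF f] and G = FkMorD[OF g] and Pp = FkMorD[OF p] and Q = FkMorD[OF q]
 note oG = FkD[OF F(1)] and oH = FkD[OF G(1)] and oK = FkD[OF F(2)] and oP = FkD[OF Pp(1)]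
 note kG' = kG[unfolded is_kernel_pair_def] and kH' = kH[unfolded is_kernel_pair_def] and kK' = kK[unfolded is_kernel_pair_def]
 note as = Hom_assoc
 have e1: "fk1 f ** fk1 p = fk1 g ** fk1 q" using pbD(9)[OF pb1] .
 have d2: "Dom C (fk2 p) = Dom C (fk_d P)" "Dom C (fk1 p) = Cod C (fk_d P)" "Dom C (fk2 f) = Dom C (fk_d G)" "Dom C (fk2 g) = Dom C (fk_d H)"
  using Pp(4,5) F(4) G(4) by (auto simp: Hom_def)
 have ker: "EX s:Hom C U (Dom C (fk_d G)). fk_d G ** s = fk1 p ** u & fk_c G ** s = fk1 p ** v"
   "EX s:Hom C U (Dom C (fk_d H)). fk_d H ** s = fk1 q ** u & fk_c H ** s = fk1 q ** v"
  if uv: "u : Hom C U (Cod C (fk_d P))" "v : Hom C U (Cod C (fk_d P))" "fk_f P ** u = fk_f P ** v" for U u v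
 proof -
  have "fk_f G ** fk1 p ** u = fk_f G ** fk1 p ** v"
   using as[OF uv(1) Pp(5) oG(5)] as[OF uv(2) Pp(5) oG(5)] Pp(10) as[OF uv(1) oP(5) Pp(6)] as[OF uv(2) oP(5) Pp(6)] uv(3) by simp
  then show "EX s:Hom C U (Dom C (fk_d G)). fk_d G ** s = fk1 p ** u & fk_c G ** s = fk1 p ** v"
   using pb_exH[OF kG', of "fk1 p ** u" U "fk1 p ** v"] Hom_cmp[OF uv(1) Pp(5)] Hom_cmp[OF uv(2) Pp(5)] oG(5) by (auto simp: Hom_def)
  have "fk_f H ** fk1 q ** u = fk_f H ** fk1 q ** v"
   using as[OF uv(1) Q(5) oH(5)] as[OF uv(2) Q(5) oH(5)] Q(10) as[OF uv(1) oP(5) Q(6)] as[OF uv(2) oP(5) Q(6)] uv(3) by simp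
  then show "EX s:Hom C U (Dom C (fk_d H)). fk_d H ** s = fk1 q ** u & fk_c H ** s = fk1 q ** v"
   using pb_exH[OF kH', of "fk1 q ** u" U "fk1 q ** v"] Hom_cmp[OF uv(1) Q(5)] Hom_cmp[OF uv(2) Q(5)] oH(5) by (auto simp: Hom_def)
 qed
 show "pb C (fk_f P) (fk_f P) (fk_d P) (fk_c P)"
 proof (rule pbI)
  fix u v assume "u : Mor C" "v : Mor C" "Dom C u = Dom C v" "Cod C u = Dom C (fk_f P)" "Cod C v = Dom C (fk_f P)" and uv3: "fk_f P ** u = fk_f P ** v"
  then have uv: "u : Hom C (Dom C u) (Cod C (fk_d P))" "v : Hom C (Dom C u) (Cod C (fk_d P))" using oP(5) by (auto simp: Hom_def)
  obtain s where s: "s : Hom C (Dom C u) (Dom C (fk_d G))" "fk_d G ** s = fk1 p ** u" "fk_c G ** s = fk1 p ** v" using ker(1)[OF uv uv3] by blast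
  obtain t where t: "t : Hom C (Dom C u) (Dom C (fk_d H))" "fk_d H ** t = fk1 q ** u" "fk_c H ** t = fk1 q ** v" using ker(2)[OF uv uv3] by blast
  have "fk2 f ** s = fk2 g ** t"
  proof (rule pb_uniqueH[OF kK' Hom_cmp[OF s(1) F(4)] Hom_cmp[OF t(1) G(4)]])
   show "fk_d K ** fk2 f ** s = fk_d K ** fk2 g ** t"
    using as[OF s(1) F(4) oK(2)] F(7) as[OF s(1) oG(2) F(5)] as[OF t(1) G(4) oK(2)] G(7) as[OF t(1) oH(2) G(5)]
     s(2) t(2) as[OF uv(1) Pp(5) F(5)] as[OF uv(1) Q(5) G(5)] e1 by simp
   show "fk_c K ** fk2 f ** s = fk_c K ** fk2 g ** t"
    using as[OF s(1) F(4) oK(3)] F(8) as[OF s(1) oG(3) F(5)] as[OF t(1) G(4) oK(3)] G(8) as[OF t(1) oH(3) G(5)]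
     s(3) t(3) as[OF uv(2) Pp(5) F(5)] as[OF uv(2) Q(5) G(5)] e1 by simp
  qed
  then obtain r where r: "r : Hom C (Dom C u) (Dom C (fk_d P))" "fk2 p ** r = s" "fk2 q ** r = t"
   using pb_exH[OF pb2, of s "Dom C u" t] s(1) t(1) d2 by auto
  have "fk_d P ** r = u"
  proof (rule pb_uniqueH[OF pb1, unfolded d2, OF Hom_cmp[OF r(1) oP(2)] uv(1)])
   show "fk1 p ** fk_d P ** r = fk1 p ** u" "fk1 q ** fk_d P ** r = fk1 q ** u"
    using as[OF r(1) oP(2) Pp(5)] as[OF r(1) Pp(4) oG(2)] Pp(7) as[OF r(1) oP(2) Q(5)] as[OF r(1) Q(4) oH(2)] Q(7) r s t by simp_all
  qed
  moreover have "fk_c P ** r = v"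
  proof (rule pb_uniqueH[OF pb1, unfolded d2, OF Hom_cmp[OF r(1) oP(3)] uv(2)])
   show "fk1 p ** fk_c P ** r = fk1 p ** v" "fk1 q ** fk_c P ** r = fk1 q ** v"
    using as[OF r(1) oP(3) Pp(5)] as[OF r(1) Pp(4) oG(3)] Pp(8) as[OF r(1) oP(3) Q(5)] as[OF r(1) Q(4) oH(3)] Q(8) r s t by simp_all
  qed
  ultimately show "EX h:Mor C. Dom C h = Dom C u & Cod C h = Dom C (fk_d P) & fk_d P ** h = u & fk_c P ** h = v"
   using r(1) by (auto simp: Hom_def)
 next
  fix u v assume "u : Mor C" "v : Mor C" "Dom C u = Dom C v" "Cod C u = Dom C (fk_d P)" "Cod C v = Dom C (fk_d P)" and e: "fk_d P ** u = fk_d P ** v" "fk_c P ** u = fk_c P ** v"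
  then have uv: "u : Hom C (Dom C u) (Dom C (fk_d P))" "v : Hom C (Dom C u) (Dom C (fk_d P))" by (auto simp: Hom_def)
  show "u = v"
  proof (rule pb_uniqueH[OF pb2, unfolded d2, OF uv])
   show "fk2 p ** u = fk2 p ** v"
   proof (rule pb_uniqueH[OF kG' Hom_cmp[OF uv(1) Pp(4)] Hom_cmp[OF uv(2) Pp(4)]])
    show "fk_d G ** fk2 p ** u = fk_d G ** fk2 p ** v"
     using as[OF uv(1) Pp(4) oG(2)] as[OF uv(2) Pp(4) oG(2)] Pp(7) as[OF uv(1) oP(2) Pp(5)] as[OF uv(2) oP(2) Pp(5)] e by simp
    show "fk_c G ** fk2 p ** u = fk_c G ** fk2 p ** v"
     using as[OF uv(1) Pp(4) oG(3)] as[OF uv(2) Pp(4) oG(3)] Pp(8) as[OF uv(1) oP(3) Pp(5)] as[OF uv(2) oP(3) Pp(5)] e by simp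
   qed
   show "fk2 q ** u = fk2 q ** v"
   proof (rule pb_uniqueH[OF kH' Hom_cmp[OF uv(1) Q(4)] Hom_cmp[OF uv(2) Q(4)]])
    show "fk_d H ** fk2 q ** u = fk_d H ** fk2 q ** v"
     using as[OF uv(1) Q(4) oH(2)] as[OF uv(2) Q(4) oH(2)] Q(7) as[OF uv(1) oP(2) Q(5)] as[OF uv(2) oP(2) Q(5)] e by simp
    show "fk_c H ** fk2 q ** u = fk_c H ** fk2 q ** v"
     using as[OF uv(1) Q(4) oH(3)] as[OF uv(2) Q(4) oH(3)] Q(8) as[OF uv(1) oP(3) Q(5)] as[OF uv(2) oP(3) Q(5)] e by simp
   qed
  qed
 qed (use oP in \<open>auto simp: Hom_def\<close>)
qed

lemma coeq_quotient:
 assumes d: "d : Hom (Fork C) F G" and c: "c : Hom (Fork C) F G" and q: "q : Hom (Fork C) G Q"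
  and co1: "coeq C (fk1 d) (fk1 c) (fk1 q)" and co0: "coeq C (fk0 d) (fk0 c) (fk0 q)"
  and cF: "coeq C (fk_d F) (fk_c F) (fk_f F)" and cG: "coeq C (fk_d G) (fk_c G) (fk_f G)"
 shows "coeq C (fk_d Q) (fk_c Q) (fk_f Q)"
proof -
 note D = FkMorD[OF d] and E = FkMorD[OF c] and K = FkMorD[OF q]
 note oF = FkD[OF D(1)] and oG = FkD[OF D(2)] and oQ = FkD[OF K(2)]
 note as = Hom_assoc
 have cd: "Cod C (fk1 q) = Cod C (fk_d Q)" "Cod C (fk0 q) = Cod C (fk_f Q)" "Cod C (fk0 d) = Cod C (fk_f G)"
  using K(5,6) D(6) by (auto simp: Hom_def)
 show ?thesis
 proof (rule coI)
  fix g assume "g : Mor C" "Dom C g = Cod C (fk_d Q)" and e: "g ** fk_d Q = g ** fk_c Q"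
  then have g: "g : Hom C (Cod C (fk_d Q)) (Cod C g)" by (auto simp: Hom_def)
  have gq: "g ** fk1 q : Hom C (Cod C (fk_d G)) (Cod C g)" by (rule Hom_cmp[OF K(5) g])
  have "(g ** fk1 q) ** fk_d G = (g ** fk1 q) ** fk_c G"
   using as[OF oG(2) K(5) g] as[OF oG(3) K(5) g] K(7,8) as[OF K(4) oQ(2) g] as[OF K(4) oQ(3) g] e by simp
  then obtain h where h: "h : Hom C (Cod C (fk_f G)) (Cod C g)" "h ** fk_f G = g ** fk1 q"
   using co_exH[OF cG gq] by blast
  have "h ** fk0 d = h ** fk0 c"
  proof (rule co_uniqueH[OF cF Hom_cmp[OF D(6) h(1)] Hom_cmp[OF E(6) h(1)]])
   have "(h ** fk0 d) ** fk_f F = (g ** fk1 q) ** fk1 d"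
    using as[OF oF(5) D(6) h(1)] D(10) as[OF D(5) oG(5) h(1)] h(2) by simp
   also have "... = (g ** fk1 q) ** fk1 c"
    using as[OF D(5) K(5) g] as[OF E(5) K(5) g] coD(7)[OF co1] by simp
   also have "... = (h ** fk0 c) ** fk_f F"
    using as[OF oF(5) E(6) h(1)] E(10) as[OF E(5) oG(5) h(1)] h(2) by simp
   finally show "(h ** fk0 d) ** fk_f F = (h ** fk0 c) ** fk_f F" .
  qed
  then obtain k where k: "k : Hom C (Cod C (fk_f Q)) (Cod C g)" "k ** fk0 q = h"
   using co_exH[OF co0, of h "Cod C g"] h(1) cd by auto
  have "k ** fk_f Q = g"
  proof (rule co_uniqueH[OF co1, unfolded cd, OF Hom_cmp[OF oQ(5) k(1)] g])
   show "(k ** fk_f Q) ** fk1 q = g ** fk1 q"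
    using as[OF K(5) oQ(5) k(1)] K(10) as[OF oG(5) K(6) k(1)] k h by simp
  qed
  then show "EX h:Mor C. Dom C h = Cod C (fk_f Q) & Cod C h = Cod C g & h ** fk_f Q = g"
   using k(1) by (auto simp: Hom_def)
 next
  fix u v assume "u : Mor C" "v : Mor C" "Dom C u = Cod C (fk_f Q)" "Dom C v = Cod C (fk_f Q)" "Cod C u = Cod C v" and e: "u ** fk_f Q = v ** fk_f Q"
  then have uv: "u : Hom C (Cod C (fk_f Q)) (Cod C u)" "v : Hom C (Cod C (fk_f Q)) (Cod C u)" by (auto simp: Hom_def)
  show "u = v"
  proof (rule co_uniqueH[OF co0, unfolded cd, OF uv])
   show "u ** fk0 q = v ** fk0 q"
   proof (rule co_uniqueH[OF cG Hom_cmp[OF K(6) uv(1)] Hom_cmp[OF K(6) uv(2)]])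
    show "(u ** fk0 q) ** fk_f G = (v ** fk0 q) ** fk_f G"
     using as[OF oG(5) K(6) uv(1)] as[OF oG(5) K(6) uv(2)] K(10) as[OF K(5) oQ(5) uv(1)] as[OF K(5) oQ(5) uv(2)] e by simp
   qed
  qed
 qed (use oQ in \<open>auto simp: Hom_def\<close>)
qed

end

locale tower =
 fixes X :: "('o, 'm) cat"
 assumes base_cat: "category (base X)" and base_pb: "has_pb (base X)" and base_co: "has_rcoeq (base X)"
begin

abbreviation "FK \<equiv> Fork_n X"
abbreviation "AR \<equiv> Arr_n X"
abbreviation "RG \<equiv> RGrph_n X"
abbreviation "BX \<equiv> base X"

lemma FK: "CCat (FK n)" "has_pb (FK n)" "has_rcoeq (FK n)"
proof (induction n)
 case 0
 show "CCat (FK 0)" "has_pb (FK 0)" "has_rcoeq (FK 0)" using base_cat base_pb base_co by (auto simp: n_Suc CCat_def Cat_def)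
next
 case (Suc n)
 note d = CCat.Fork_diag[OF Suc(1)]
 show "CCat (FK (Suc n))" "has_pb (FK (Suc n))" "has_rcoeq (FK (Suc n))"
  using CCat.Fork_CCat[OF Suc(1)] diag.has_pb_D[OF d Suc(2)] diag.has_rcoeq_D[OF d Suc(3)] by (auto simp: n_Suc)
qed

lemma RG: "CCat (RG n)" "has_pb (RG n)" "has_rcoeq (RG n)"
proof (induction n)
 case 0
 show "CCat (RG 0)" "has_pb (RG 0)" "has_rcoeq (RG 0)" using base_cat base_pb base_co by (auto simp: n_Suc CCat_def Cat_def)
next
 case (Suc n)
 note d = CCat.RGrph_diag[OF Suc(1)]
 show "CCat (RG (Suc n))" "has_pb (RG (Suc n))" "has_rcoeq (RG (Suc n))"
  using CCat.RGrph_CCat[OF Suc(1)] diag.has_pb_D[OF d Suc(2)] diag.has_rcoeq_D[OF d Suc(3)] by (auto simp: n_Suc)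
qed

lemma AR: "CCat (AR n)" "has_pb (AR n)"
proof (induction n)
 case 0
 show "CCat (AR 0)" "has_pb (AR 0)" using base_cat base_pb by (auto simp: n_Suc CCat_def Cat_def)
next
 case (Suc n)
 note d = CCat.Arr_diag[OF Suc(1)]
 show "CCat (AR (Suc n))" "has_pb (AR (Suc n))"
  using CCat.Arr_CCat[OF Suc(1)] diag.has_pb_D[OF d Suc(2)] by (auto simp: n_Suc)
qed

lemma arr_two: "two_cats (FK n) (AR n) (arr_n n)"
proof (induction n)
 case 0
 then show ?case using CCat.id_two[OF FK(1)[of 0]] by (simp add: n_Suc)
next
 case (Suc n)
 show ?case using two_cats.Parr_functor[OF Suc] FK(1)[of "Suc n"] AR(1)[of "Suc n"]
  unfolding two_cats_def two_cats_axioms_def by (simp add: n_Suc)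
qed

lemma grph_two: "two_cats (FK n) (RG n) (grph_n n)"
proof (induction n)
 case 0
 then show ?case using CCat.id_two[OF FK(1)[of 0]] by (simp add: n_Suc)
next
 case (Suc n)
 show ?case using two_cats.Pgrph_functor[OF Suc] FK(1)[of "Suc n"] RG(1)[of "Suc n"]
  unfolding two_cats_def two_cats_axioms_def by (simp add: n_Suc)
qed

lemma arr_functor: "cfunctor (FK n) (AR n) (arr_n n)"
 and grph_functor: "cfunctor (FK n) (RG n) (grph_n n)"
 using arr_two grph_two unfolding two_cats_def two_cats_axioms_def by blast+

lemma lex_obj: "lex X n F ==> F : Obj (FK n)" and rex_obj: "rex X n F ==> F : Obj (FK n)"
 by (cases n; simp add: n_Suc)+

lemma lex_up: "lex X n H ==> up (FK n) (AR n) (fob (arr_n n)) (fmor (arr_n n)) H"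
proof (induction n arbitrary: H)
 case 0
 show ?case unfolding n_Suc arr_n.simps by (rule id_up)
next
 case (Suc n)
 show ?case unfolding n_Suc arr_n.simps
  by (rule two_cats.up_step[OF arr_two]) (use Suc in simp_all)
qed

lemma rex_up: "rex X n F ==> co_up (FK n) (RG n) (fob (grph_n n)) (fmor (grph_n n)) F"
proof (induction n arbitrary: F)
 case 0
 show ?case unfolding n_Suc grph_n.simps by (rule id_up)
next
 case (Suc n)
 show ?case unfolding n_Suc grph_n.simps
  by (rule two_cats.co_up_step[OF grph_two]) (use Suc in simp_all)
qed

lemma lex_pb: "[|pb (FK n) f g p q; lex X n (Dom (FK n) f); lex X n (Dom (FK n) g); lex X n (Cod (FK n) f)|] ==> lex X n (Dom (FK n) p)"
proof (induction n arbitrary: f g p q)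
 case 0
 interpret C: CCat "FK 0" by (rule FK)
 show ?case using C.pbD(3)[OF 0(1)] C.Dom_obj by (simp add: n_Suc)
next
 case (Suc n)
 interpret C: CCat "FK n" by (rule FK)
 note dg = C.Fork_diag
 have FC: "Cat (Fork (FK n))" using C.Fork_CCat unfolding CCat_def .
 note pb = Suc.prems(1)[unfolded n_Suc]
 note H = Cat.pb_Hom[OF FC pb]
 note lx = Suc.prems(2-4)[unfolded n_Suc lex.simps]
 have pw: "pb (FK n) (fk_component i f) (fk_component i g) (fk_component i p) (fk_component i q)" if "i : {0, 1, 2}" for i
  by (rule diag.pb_pointwise[OF dg FK(2) pb that])
 have pw': "pb (FK n) (fk2 f) (fk2 g) (fk2 p) (fk2 q)" "pb (FK n) (fk1 f) (fk1 g) (fk1 p) (fk1 q)" "pb (FK n) (fk0 f) (fk0 g) (fk0 p) (fk0 q)"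
  using pw[of 2] pw[of 1] pw[of 0] by (simp_all add: fk_component_def)
 note f = C.FkMorD[OF H(1)] and g = C.FkMorD[OF H(2)] and p = C.FkMorD[OF H(3)]
 let ?P = "Dom (Fork (FK n)) p"
 have "kp (FK n) (fk_f ?P) (fk_d ?P) (fk_c ?P)"
  by (rule C.kp_pullback[OF H(1-4) pw'(1,2)]) (use lx in blast)+
 moreover have "lex X n (Dom (FK n) (fk_d ?P))" "lex X n (Cod (FK n) (fk_d ?P))" "lex X n (Cod (FK n) (fk_f ?P))"
  using Suc.IH[OF pw'(1)] Suc.IH[OF pw'(2)] Suc.IH[OF pw'(3)] f(4-6) g(4-6) p(4-6) lx unfolding Hom_def by auto
 ultimately show ?case using p(1) by (simp add: n_Suc del: Fork_sel)
qed

lemma rex_co: "[|is_rgraph (FK n) d c e; coeq (FK n) d c q; rex X n (Dom (FK n) d); rex X n (Cod (FK n) d)|] ==> rex X n (Cod (FK n) q)"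
proof (induction n arbitrary: d c e q)
 case 0
 interpret C: CCat "FK 0" by (rule FK)
 show ?case using C.coD(3)[OF 0(2)] C.Cod_obj by (simp add: n_Suc)
next
 case (Suc n)
 interpret C: CCat "FK n" by (rule FK)
 note dg = C.Fork_diag
 have FC: "Cat (Fork (FK n))" using C.Fork_CCat unfolding CCat_def .
 note rg = Suc.prems(1)[unfolded n_Suc] and co = Suc.prems(2)[unfolded n_Suc]
 note H = Cat.co_Hom[OF FC co]
 note rx = Suc.prems(3,4)[unfolded n_Suc rex.simps]
 have pw: "coeq (FK n) (fk_component i d) (fk_component i c) (fk_component i q)"
  "is_rgraph (FK n) (fk_component i d) (fk_component i c) (fk_component i e)" if "i : {0, 1, 2}" for i
  using diag.co_pointwise[OF dg FK(3) rg co that] diag.comp_rgraph[OF dg rg that] by auto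
 have pw': "coeq (FK n) (fk2 d) (fk2 c) (fk2 q)" "coeq (FK n) (fk1 d) (fk1 c) (fk1 q)" "coeq (FK n) (fk0 d) (fk0 c) (fk0 q)"
   "is_rgraph (FK n) (fk2 d) (fk2 c) (fk2 e)" "is_rgraph (FK n) (fk1 d) (fk1 c) (fk1 e)" "is_rgraph (FK n) (fk0 d) (fk0 c) (fk0 e)"
  using pw[of 2] pw[of 1] pw[of 0] by (simp_all add: fk_component_def)
 note d = C.FkMorD[OF H(1)] and q = C.FkMorD[OF H(3)]
 let ?Q = "Cod (Fork (FK n)) q"
 have "coeq (FK n) (fk_d ?Q) (fk_c ?Q) (fk_f ?Q)"
  by (rule C.coeq_quotient[OF H(1-3) pw'(2,3)]) (use rx in blast)+
 moreover have "rex X n (Dom (FK n) (fk_d ?Q))" "rex X n (Cod (FK n) (fk_d ?Q))" "rex X n (Cod (FK n) (fk_f ?Q))"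
  using Suc.IH[OF pw'(4,1)] Suc.IH[OF pw'(5,2)] Suc.IH[OF pw'(6,3)] d(4-6) q(4-6) rx unfolding Hom_def by auto
 ultimately show ?case using q(2) by (simp add: n_Suc del: Fork_sel)
qed

lemma lex_iso: assumes "iso (FK n) u" "lex X n (Cod (FK n) u)" shows "lex X n (Dom (FK n) u)"
proof -
 interpret C: CCat "FK n" by (rule FK)
 have o: "Cod (FK n) u : Obj (FK n)" using assms(1) C.Cod_obj unfolding iso_def by blast
 show ?thesis by (rule lex_pb[OF C.iso_pb[OF assms(1)]]) (use assms(2) o in simp_all)
qed

lemma rex_iso: assumes "iso (FK n) u" "rex X n (Dom (FK n) u)" shows "rex X n (Cod (FK n) u)"
proof -
 interpret C: CCat "FK n" by (rule FK)
 have o: "Dom (FK n) u : Obj (FK n)" using assms(1) C.Dom_obj unfolding iso_def by blast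
 show ?thesis by (rule rex_co[OF C.Id_rgraph[OF o] C.iso_co[OF assms(1)]]) (use assms(2) o in simp_all)
qed

lemma Eq_n: "(ALL A:Obj (AR n). lex X n (fob (EqFork_n X n) A) & fob (arr_n n) (fob (EqFork_n X n) A) = A) &
  (ALL x A B. x : Hom (AR n) A B --> fmor (EqFork_n X n) x : Hom (FK n) (fob (EqFork_n X n) A) (fob (EqFork_n X n) B) &
   fmor (arr_n n) (fmor (EqFork_n X n) x) = x)"
proof (induction n)
 case 0
 then show ?case by (simp add: n_Suc)
next
 case (Suc n)
 interpret C: CCat "FK n" by (rule FK)
 interpret D: CCat "AR n" by (rule AR)
 let ?E = "EqFork_n X n" and ?P = "arr_n n"
 have EO: "lex X n (fob ?E A)" "fob ?P (fob ?E A) = A" "fob ?E A : Obj (FK n)" if "A : Obj (AR n)" for A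
  using Suc that lex_obj by blast+
 have EH: "fmor ?E x : Hom (FK n) (fob ?E A) (fob ?E B)" "fmor ?P (fmor ?E x) = x" if "x : Hom (AR n) A B" for x A B
  using Suc that by blast+
 note PF = arr_functor[of n]
 have EC: "fmor ?E (Comp (AR n) y x) = Comp (FK n) (fmor ?E y) (fmor ?E x)" if xy: "x : Hom (AR n) A B" "y : Hom (AR n) B B'" for x y A B B'
 proof -
  have oA: "A : Obj (AR n)" and oB: "B' : Obj (AR n)" using D.Hom_obj xy by blast+
  show ?thesis
  proof (rule up_un[OF lex_up[OF EO(1)[OF oB]] PF EO(3)[OF oA]])
  show "fmor ?E (Comp (AR n) y x) : Hom (FK n) (fob ?E A) (fob ?E B')" by (rule EH(1)[OF D.Hom_cmp[OF xy]])
  show "Comp (FK n) (fmor ?E y) (fmor ?E x) : Hom (FK n) (fob ?E A) (fob ?E B')" by (rule C.Hom_cmp[OF EH(1)[OF xy(1)] EH(1)[OF xy(2)]])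
  show "fmor ?P (fmor ?E (Comp (AR n) y x)) = fmor ?P (Comp (FK n) (fmor ?E y) (fmor ?E x))"
   using EH(2)[OF D.Hom_cmp[OF xy]] functorD(4)[OF PF EH(1)[OF xy(1)] EH(1)[OF xy(2)]] EH(2)[OF xy(1)] EH(2)[OF xy(2)] by simp
  qed
 qed
 have EM: "fmor ?E A : Hom (FK n) (fob ?E (Dom (AR n) A)) (fob ?E (Cod (AR n) A))" "fmor ?E A : Mor (FK n)" "fmor ?P (fmor ?E A) = A" if "A : Mor (AR n)" for A
  using EH[of A "Dom (AR n) A" "Cod (AR n) A"] that by (auto simp: Hom_def)
 note ob = C.EqFork_ob[OF FK(2)] and mo = C.EqFork_mor[OF FK(2)]
 show ?case
 proof (intro conjI ballI allI impI)
  fix A assume "A : Obj (AR (Suc n))"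
  then have A: "A : Mor (AR n)" by (simp add: n_Suc)
  note em = EM[OF A]
  note o = ob[OF em(2)]
  let ?F = "fob (EqFork (FK n)) (fmor ?E A)"
  have F: "fob (EqFork_n X (Suc n)) A = ?F" by simp
  note kD = C.pb_Hom[OF o(3)[unfolded is_kernel_pair_def]] and fD = C.FkD[OF o(1)]
  have v: "Cod (FK n) (fk_d ?F) = fob ?E (Dom (AR n) A)" "Cod (FK n) (fk_f ?F) = fob ?E (Cod (AR n) A)"
   using kD em o(2) by (auto simp: Hom_def)
  have l: "lex X n (fob ?E (Dom (AR n) A))" "lex X n (fob ?E (Cod (AR n) A))" using EO(1) A D.Dom_obj D.Cod_obj by blast+
  have "lex X n (Dom (FK n) (fk_d ?F))"
   by (rule lex_pb[OF o(3)[unfolded is_kernel_pair_def]]) (use em(1) l in \<open>auto simp: Hom_def\<close>)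
  then show "lex X (Suc n) (fob (EqFork_n X (Suc n)) A)" unfolding F lex.simps using o v l by simp
  show "fob (arr_n (Suc n)) (fob (EqFork_n X (Suc n)) A) = A" unfolding F using o em by simp
 next
  fix x A B assume "x : Hom (AR (Suc n)) A B"
  then have x: "x : Hom (Arr (AR n)) A B" by (simp add: n_Suc)
  note S = D.SqD[OF x]
  have HH: "A : Hom (AR n) (Dom (AR n) A) (Cod (AR n) A)" "B : Hom (AR n) (Dom (AR n) B) (Cod (AR n) B)" using S by (auto simp: Hom_def)
  let ?x = "fmor (Arr_map ?E) x"
  have e: "?x = Sq (fmor ?E A) (fmor ?E B) (fmor ?E (sq1 x)) (fmor ?E (sq0 x))"
   using arg_cong[OF S(3), of sq_dom] arg_cong[OF S(3), of sq_cod] by simp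
  have x': "?x : Hom (Arr (FK n)) (fmor ?E A) (fmor ?E B)" unfolding e
  proof (rule C.SqI)
   show "Comp (FK n) (fmor ?E B) (fmor ?E (sq1 x)) = Comp (FK n) (fmor ?E (sq0 x)) (fmor ?E A)"
    using EC[OF S(4) HH(2)] EC[OF HH(1) S(5)] S(6) by simp
  qed (use EM[OF S(1)] EM[OF S(2)] EH(1)[OF S(4)] EH(1)[OF S(5)] in \<open>auto simp: Hom_def\<close>)
  note m = mo[OF x']
  show "fmor (EqFork_n X (Suc n)) x : Hom (FK (Suc n)) (fob (EqFork_n X (Suc n)) A) (fob (EqFork_n X (Suc n)) B)"
   using m(1) by (simp add: n_Suc)
  have sel: "sq1 ?x = fmor ?E (sq1 x)" "sq0 ?x = fmor ?E (sq0 x)" by simp_all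
  have d: "fk_dom (fmor (EqFork (FK n)) ?x) = fob (EqFork (FK n)) (fmor ?E A)" "fk_cod (fmor (EqFork (FK n)) ?x) = fob (EqFork (FK n)) (fmor ?E B)"
   using m(1) by (auto simp: Hom_def)
  have "fmor (arr_n (Suc n)) (fmor (EqFork_n X (Suc n)) x) = Sq (fmor ?P (fmor ?E A)) (fmor ?P (fmor ?E B)) (fmor ?P (fmor ?E (sq1 x))) (fmor ?P (fmor ?E (sq0 x)))"
   unfolding arr_n.simps EqFork_n.simps comp_func_sel map_sel(8) map_sel(2) cell.sel d m(2,3) ob(2)[OF EM(2)[OF S(1)]] ob(2)[OF EM(2)[OF S(2)]]
   using d m(2,3) ob(2)[OF EM(2)[OF S(1)]] ob(2)[OF EM(2)[OF S(2)]] by simp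
  also have "... = x" using EM(3)[OF S(1)] EM(3)[OF S(2)] EH(2)[OF S(4)] EH(2)[OF S(5)] S(3) by simp
  finally show "fmor (arr_n (Suc n)) (fmor (EqFork_n X (Suc n)) x) = x" .
 qed
qed

lemma Coeq_n: "(ALL A:Obj (RG n). rex X n (fob (CoeqFork_n X n) A) & fob (grph_n n) (fob (CoeqFork_n X n) A) = A) &
  (ALL x A B. x : Hom (RG n) A B --> fmor (CoeqFork_n X n) x : Hom (FK n) (fob (CoeqFork_n X n) A) (fob (CoeqFork_n X n) B) &
   fmor (grph_n n) (fmor (CoeqFork_n X n) x) = x)"
proof (induction n)
 case 0
 then show ?case by (simp add: n_Suc)
next
 case (Suc n)
 interpret C: CCat "FK n" by (rule FK)
 interpret D: CCat "RG n" by (rule RG)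
 let ?L = "CoeqFork_n X n" and ?P = "grph_n n"
 have LO: "rex X n (fob ?L A)" "fob ?P (fob ?L A) = A" "fob ?L A : Obj (FK n)" if "A : Obj (RG n)" for A
  using Suc that rex_obj by blast+
 have LH: "fmor ?L x : Hom (FK n) (fob ?L A) (fob ?L B)" "fmor ?P (fmor ?L x) = x" if "x : Hom (RG n) A B" for x A B
  using Suc that by blast+
 note PF = grph_functor[of n]
 have LF: "cfunctor (RG n) (FK n) ?L" unfolding is_functor_def
 proof (intro conjI ballI allI impI)
  fix a assume a: "a : Obj (RG n)"
  show "fmor ?L (Id (RG n) a) = Id (FK n) (fob ?L a)"
   by (rule co_up_un[OF rex_up[OF LO(1)[OF a]] PF LO(3)[OF a] LH(1)[OF D.Hom_Id[OF a]] C.Hom_Id[OF LO(3)[OF a]]])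
    (use LH(2)[OF D.Hom_Id[OF a]] functorD(3)[OF PF LO(3)[OF a]] LO(2)[OF a] in simp)
 next
  fix x y A B B' assume xy: "x : Hom (RG n) A B" "y : Hom (RG n) B B'"
  have o: "A : Obj (RG n)" "B' : Obj (RG n)" using D.Hom_obj xy by blast+
  show "fmor ?L (Comp (RG n) y x) = Comp (FK n) (fmor ?L y) (fmor ?L x)"
   by (rule co_up_un[OF rex_up[OF LO(1)[OF o(1)]] PF LO(3)[OF o(2)] LH(1)[OF D.Hom_cmp[OF xy]] C.Hom_cmp[OF LH(1)[OF xy(1)] LH(1)[OF xy(2)]]])
    (use LH(2)[OF D.Hom_cmp[OF xy]] functorD(4)[OF PF LH(1)[OF xy(1)] LH(1)[OF xy(2)]] LH(2)[OF xy(1)] LH(2)[OF xy(2)] in simp)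
 qed (use LO LH in auto)
 have two: "two_cats (RG n) (FK n) ?L" unfolding two_cats_def two_cats_axioms_def using LF FK(1) RG(1) by blast
 note ob = D.CoeqFork_ob[OF RG(3)] and mo = D.CoeqFork_mor[OF RG(3)]
 have grob: "fob (grph_n (Suc n)) (fob (CoeqFork_n X (Suc n)) A) = A" if A: "A : Obj (RGrph (RG n))" for A
 proof -
  let ?Q = "fob (CoeqFork (RG n)) A"
  note o = ob[OF A] and R = D.RgD[OF A]
  have q: "fk_d ?Q = rg_d A" "fk_c ?Q = rg_c A" "fk_e ?Q = rg_e A"
   using arg_cong[OF o(2), of rg_d] arg_cong[OF o(2), of rg_c] arg_cong[OF o(2), of rg_e] by simp_all
  show ?thesis using LH(2)[OF R(2)] LH(2)[OF R(3)] LH(2)[OF R(4)] R(1) by (simp add: q)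
 qed
 show ?case
 proof (intro conjI ballI allI impI)
  fix A assume "A : Obj (RG (Suc n))"
  then have A: "A : Obj (RGrph (RG n))" by (simp add: n_Suc)
  note o = ob[OF A] and R = D.RgD[OF A]
  let ?Q = "fob (CoeqFork (RG n)) A"
  note Q = D.FkD[OF o(1)]
  have q: "fk_d ?Q = rg_d A" "fk_c ?Q = rg_c A" "fk_e ?Q = rg_e A"
   using arg_cong[OF o(2), of rg_d] arg_cong[OF o(2), of rg_c] arg_cong[OF o(2), of rg_e] by simp_all
  note Qq = Q[unfolded q]
  let ?F = "fob (Fork_map ?L) ?Q"
  have F: "fob (CoeqFork_n X (Suc n)) A = ?F" by simp
  have Fs: "fk_d ?F = fmor ?L (rg_d A)" "fk_c ?F = fmor ?L (rg_c A)" "fk_f ?F = fmor ?L (fk_f ?Q)" by (simp_all add: q)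
  have FO: "?F : Obj (Fork (FK n))" by (rule two_cats.Fork_map_obj[OF two o(1)])
  let ?q = "fk_f ?Q"
  note Ld = LH[OF R(2)] and Lc = LH[OF R(3)] and Lq = LH[OF Qq(5)]
  have co: "coeq (FK n) (fmor ?L (rg_d A)) (fmor ?L (rg_c A)) (fmor ?L ?q)"
  proof (rule C.coI)
   show "Comp (FK n) (fmor ?L ?q) (fmor ?L (rg_d A)) = Comp (FK n) (fmor ?L ?q) (fmor ?L (rg_c A))"
    using functorD(4)[OF LF R(2) Qq(5)] functorD(4)[OF LF R(3) Qq(5)] Qq(8) by simp
   fix h assume "h : Mor (FK n)" "Dom (FK n) h = Cod (FK n) (fmor ?L (rg_d A))" and e: "Comp (FK n) h (fmor ?L (rg_d A)) = Comp (FK n) h (fmor ?L (rg_c A))"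
   then have h: "h : Hom (FK n) (fob ?L (Cod (RG n) (rg_d A))) (Cod (FK n) h)" using Ld by (auto simp: Hom_def)
   have hW: "Cod (FK n) h : Obj (FK n)" using h C.Hom_obj by blast
   have Ph: "fmor ?P h : Hom (RG n) (Cod (RG n) (rg_d A)) (fob ?P (Cod (FK n) h))" using functorD(2)[OF PF h] LO(2)[OF R(8)] by simp
   have "Comp (RG n) (fmor ?P h) (rg_d A) = Comp (RG n) (fmor ?P h) (rg_c A)"
    using functorD(4)[OF PF Ld(1) h] functorD(4)[OF PF Lc(1) h] Ld(2) Lc(2) e by simp
   then obtain k where k: "k : Hom (RG n) (Cod (RG n) ?q) (fob ?P (Cod (FK n) h))" "Comp (RG n) k ?q = fmor ?P h"
    using D.co_exH[OF o(3) Ph] by blast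
   have "k : Hom (RG n) (fob ?P (fob ?L (Cod (RG n) ?q))) (fob ?P (Cod (FK n) h))" using k LO(2)[OF Qq(11)] by simp
   then obtain x where x: "x : Hom (FK n) (fob ?L (Cod (RG n) ?q)) (Cod (FK n) h)" "fmor ?P x = k"
    using co_up_ex[OF rex_up[OF LO(1)[OF Qq(11)]] hW] by blast
   have "Comp (FK n) x (fmor ?L ?q) = h"
    by (rule co_up_un[OF rex_up[OF LO(1)[OF R(8)]] PF hW C.Hom_cmp[OF Lq(1) x(1)] h])
     (use functorD(4)[OF PF Lq(1) x(1)] Lq(2) x k in simp)
   then show "EX k:Mor (FK n). Dom (FK n) k = Cod (FK n) (fmor ?L ?q) & Cod (FK n) k = Cod (FK n) h & Comp (FK n) k (fmor ?L ?q) = h"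
    using x Lq(1) by (auto simp: Hom_def)
  next
   fix u v assume "u : Mor (FK n)" "v : Mor (FK n)" "Dom (FK n) u = Cod (FK n) (fmor ?L ?q)" "Dom (FK n) v = Cod (FK n) (fmor ?L ?q)" "Cod (FK n) u = Cod (FK n) v"
    and e: "Comp (FK n) u (fmor ?L ?q) = Comp (FK n) v (fmor ?L ?q)"
   then have uv: "u : Hom (FK n) (fob ?L (Cod (RG n) ?q)) (Cod (FK n) u)" "v : Hom (FK n) (fob ?L (Cod (RG n) ?q)) (Cod (FK n) u)"
    using Lq(1) by (auto simp: Hom_def)
   have W: "Cod (FK n) u : Obj (FK n)" using uv C.Hom_obj by blast
   have Puv: "fmor ?P u : Hom (RG n) (Cod (RG n) ?q) (fob ?P (Cod (FK n) u))" "fmor ?P v : Hom (RG n) (Cod (RG n) ?q) (fob ?P (Cod (FK n) u))"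
    using functorD(2)[OF PF uv(1)] functorD(2)[OF PF uv(2)] LO(2)[OF Qq(11)] by simp_all
   have "fmor ?P u = fmor ?P v"
    by (rule D.co_uniqueH[OF o(3) Puv]) (use functorD(4)[OF PF Lq(1) uv(1)] functorD(4)[OF PF Lq(1) uv(2)] Lq(2) e in simp)
   then show "u = v" by (rule co_up_un[OF rex_up[OF LO(1)[OF Qq(11)]] PF W uv])
  qed (use Ld Lc Lq in \<open>auto simp: Hom_def\<close>)
  have v: "Dom (FK n) (fmor ?L (rg_d A)) = fob ?L (Dom (RG n) (rg_d A))" "Cod (FK n) (fmor ?L (rg_d A)) = fob ?L (Cod (RG n) (rg_d A))"
    "Cod (FK n) (fmor ?L ?q) = fob ?L (Cod (RG n) ?q)" using Ld Lq by (auto simp: Hom_def)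
  show "rex X (Suc n) (fob (CoeqFork_n X (Suc n)) A)"
   unfolding F rex.simps Fs using FO co v LO(1)[OF R(7)] LO(1)[OF R(8)] LO(1)[OF Qq(11)] by simp
  show "fob (grph_n (Suc n)) (fob (CoeqFork_n X (Suc n)) A) = A" by (rule grob[OF A])
 next
  fix x A B assume "x : Hom (RG (Suc n)) A B"
  then have x: "x : Hom (RGrph (RG n)) A B" by (simp add: n_Suc)
  note S = D.RgMorD[OF x]
  note m = mo[OF x]
  let ?z = "fmor (CoeqFork (RG n)) x"
  show "fmor (CoeqFork_n X (Suc n)) x : Hom (FK (Suc n)) (fob (CoeqFork_n X (Suc n)) A) (fob (CoeqFork_n X (Suc n)) B)"
   using two_cats.Fork_map_H[OF two m(1)] by (simp add: n_Suc del: map_sel)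
  have d: "fk_dom ?z = fob (CoeqFork (RG n)) A" "fk_cod ?z = fob (CoeqFork (RG n)) B"
   using m(1) by (auto simp: Hom_def)
  have g: "fob (RGrph_map ?P) (fob grph (fob (Fork_map ?L) (fob (CoeqFork (RG n)) A))) = A"
    "fob (RGrph_map ?P) (fob grph (fob (Fork_map ?L) (fob (CoeqFork (RG n)) B))) = B"
   using grob[OF S(1)] grob[OF S(2)] by (simp_all del: map_sel)
  have "fmor (grph_n (Suc n)) (fmor (CoeqFork_n X (Suc n)) x) = RgMor A B (fmor ?P (fmor ?L (fk2 ?z))) (fmor ?P (fmor ?L (fk1 ?z)))"
   unfolding grph_n.simps CoeqFork_n.simps comp_func_sel map_sel(6) d map_sel(10) cell.sel map_sel(4) g ..
  also have "... = x" using LH(2)[OF S(4)] LH(2)[OF S(5)] S(3) m(2,3) by simp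
  finally show "fmor (grph_n (Suc n)) (fmor (CoeqFork_n X (Suc n)) x) = x" .
 qed
qed

lemma is_EqFork_iff: assumes F: "F : Obj (FK n)"
 shows "is_EqFork_n X n F <-> lex X n F"
proof
 interpret C: CCat "FK n" by (rule FK)
 interpret D: CCat "AR n" by (rule AR)
 note PF = arr_functor[of n]
 let ?A = "fob (arr_n n) F" and ?P = "arr_n n"
 let ?E = "fob (EqFork_n X n) ?A"
 have A: "?A : Obj (AR n)" by (rule functorD(1)[OF PF F])
 have E: "lex X n ?E" "fob ?P ?E = ?A" using Eq_n[of n] A by blast+
 have Eo: "?E : Obj (FK n)" by (rule lex_obj[OF E(1)])
 show "lex X n F" if e: "is_EqFork_n X n F"
 proof -
  obtain u where "u : Hom (FK n) F ?E" "iso (FK n) u" using e unfolding is_EqFork_n_def EqFork_unit_def by blast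
  then show ?thesis using lex_iso[of n u] E by (auto simp: Hom_def)
 qed
 show "is_EqFork_n X n F" if l: "lex X n F"
 proof -
  have i: "Id (AR n) ?A : Hom (AR n) ?A ?A" by (rule D.Hom_Id[OF A])
  obtain u where u: "u : Hom (FK n) F ?E" "fmor ?P u = Id (AR n) ?A" using up_ex[OF lex_up[OF E(1)] F] i E(2) by force
  obtain v where v: "v : Hom (FK n) ?E F" "fmor ?P v = Id (AR n) ?A" using up_ex[OF lex_up[OF l] Eo] i E(2) by force
  have ii: "Comp (AR n) (Id (AR n) ?A) (Id (AR n) ?A) = Id (AR n) ?A" using D.Hom_unit(1)[OF i] .
  have "Comp (FK n) v u = Id (FK n) F"
   by (rule up_un[OF lex_up[OF l] PF F C.Hom_cmp[OF u(1) v(1)] C.Hom_Id[OF F]])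
    (use functorD(4)[OF PF u(1) v(1)] functorD(3)[OF PF F] u v ii in simp)
  moreover have "Comp (FK n) u v = Id (FK n) ?E"
   by (rule up_un[OF lex_up[OF E(1)] PF Eo C.Hom_cmp[OF v(1) u(1)] C.Hom_Id[OF Eo]])
    (use functorD(4)[OF PF v(1) u(1)] functorD(3)[OF PF Eo] u v ii E(2) in simp)
  ultimately have "iso (FK n) u" using u(1) v(1) by (intro C.isoI[of u v]) (auto simp: Hom_def)
  then show ?thesis unfolding is_EqFork_n_def EqFork_unit_def using u by blast
 qed
qed

lemma rex_reflect_iso: assumes F: "rex X n F" and G: "rex X n G" and u: "u : Hom (FK n) F G"
  and v: "v : Hom (RG n) (fob (grph_n n) G) (fob (grph_n n) F)"
  and uv: "Comp (RG n) v (fmor (grph_n n) u) = Id (RG n) (fob (grph_n n) F)" "Comp (RG n) (fmor (grph_n n) u) v = Id (RG n) (fob (grph_n n) G)"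
 shows "iso (FK n) u"
proof -
 interpret C: CCat "FK n" by (rule FK)
 note PF = grph_functor[of n]
 note oF = rex_obj[OF F] and oG = rex_obj[OF G]
 obtain w where w: "w : Hom (FK n) G F" "fmor (grph_n n) w = v" using co_up_ex[OF rex_up[OF G] oF v] by blast
 have "Comp (FK n) w u = Id (FK n) F"
  by (rule co_up_un[OF rex_up[OF F] PF oF C.Hom_cmp[OF u w(1)] C.Hom_Id[OF oF]])
   (use functorD(4)[OF PF u w(1)] functorD(3)[OF PF oF] uv w in simp)
 moreover have "Comp (FK n) u w = Id (FK n) G"
  by (rule co_up_un[OF rex_up[OF G] PF oG C.Hom_cmp[OF w(1) u] C.Hom_Id[OF oG]])
   (use functorD(4)[OF PF w(1) u] functorD(3)[OF PF oG] uv w in simp)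
 ultimately show ?thesis using u w(1) by (intro C.isoI[of u w]) (auto simp: Hom_def)
qed

lemma is_CoeqFork_iff: assumes F: "F : Obj (FK n)"
 shows "is_CoeqFork_n X n F <-> rex X n F"
proof
 interpret D: CCat "RG n" by (rule RG)
 note PF = grph_functor[of n]
 let ?A = "fob (grph_n n) F" and ?P = "grph_n n"
 let ?E = "fob (CoeqFork_n X n) ?A"
 have A: "?A : Obj (RG n)" by (rule functorD(1)[OF PF F])
 have E: "rex X n ?E" "fob ?P ?E = ?A" using Coeq_n[of n] A by blast+
 show "rex X n F" if e: "is_CoeqFork_n X n F"
 proof -
  obtain u where "u : Hom (FK n) ?E F" "iso (FK n) u" using e unfolding is_CoeqFork_n_def CoeqFork_counit_def by blast
  then show ?thesis using rex_iso[of n u] E by (auto simp: Hom_def)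
 qed
 show "is_CoeqFork_n X n F" if l: "rex X n F"
 proof -
  have i: "Id (RG n) ?A : Hom (RG n) ?A ?A" by (rule D.Hom_Id[OF A])
  obtain u where u: "u : Hom (FK n) ?E F" "fmor ?P u = Id (RG n) ?A" using co_up_ex[OF rex_up[OF E(1)] F] i E(2) by force
  have "iso (FK n) u"
   by (rule rex_reflect_iso[OF E(1) l u(1), of "Id (RG n) ?A"]) (use i u E(2) D.Hom_unit[OF i] in auto)
  then show ?thesis unfolding is_CoeqFork_n_def CoeqFork_counit_def using u by blast
 qed
qed

end

section \<open>The base category and the vertices of an n-fork\<close>

lemma base_sel [simp]: "Obj (base X) = BOb ` Obj X" "Mor (base X) = BMor ` Mor X"
  "Dom (base X) (BMor f) = BOb (Dom X f)" "Cod (base X) (BMor f) = BOb (Cod X f)"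
  "Id (base X) (BOb a) = BMor (Id X a)" "Comp (base X) (BMor g) (BMor f) = BMor (Comp X g f)"
 by (simp_all add: base_def)

lemma base_mem [simp]: "BMor f : BMor ` S <-> f : S" "BOb a : BOb ` T <-> a : T"
 by auto

lemma base_Hom: "Hom (base X) (BOb a) (BOb b) = BMor ` Hom X a b"
 by (auto simp: Hom_def)

lemma ex1_BMor: "(EX! h. h : BMor ` S & Q h) <-> (EX! h. h : S & Q (BMor h))"
proof
 assume a: "EX! h. h : BMor ` S & Q h"
 then obtain h where h: "h : S" "Q (BMor h)" by blast
 show "EX! h. h : S & Q (BMor h)"
 proof (intro ex1I conjI)
  fix k assume k: "k : S & Q (BMor k)"
  have "BMor k = BMor h" by (rule ex1E[OF a]) (use h k in blast)
  then show "k = h" by (rule cell.inject(2)[THEN iffD1])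
 qed (use h in blast)+
next
 assume a: "EX! h. h : S & Q (BMor h)"
 then obtain h where h: "h : S" "Q (BMor h)" by blast
 show "EX! h. h : BMor ` S & Q h"
 proof (intro ex1I conjI)
  fix k assume k: "k : BMor ` S & Q k"
  then obtain k' where k': "k = BMor k'" "k' : S" "Q (BMor k')" by blast
  have "k' = h" by (rule ex1E[OF a]) (use h k' in blast)
  then show "k = BMor h" using k' by blast
 qed (use h in blast)+
qed

lemma bex_Hom_base: "(EX h:Hom (base X) (BOb a) (BOb b). Q h) <-> (EX h:Hom X a b. Q (BMor h))"
 by (auto simp: base_Hom)

lemma base_pullback: "pb (base X) (BMor f) (BMor g) (BMor p) (BMor q) <-> pb X f g p q"
 unfolding is_pullback_def by (simp add: base_Hom ex1_BMor cong: conj_cong)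

lemma base_coequaliser: "coeq (base X) (BMor d) (BMor c) (BMor q) <-> coeq X d c q"
 unfolding is_coequaliser_def by (simp add: base_Hom ex1_BMor cong: conj_cong)

lemma base_coequaliser_ex: assumes "coeq (base X) d c q"
 shows "EX d' c' q'. d = BMor d' & c = BMor c' & q = BMor q' & coeq X d' c' q'"
proof -
 have "d : BMor ` Mor X" "c : BMor ` Mor X" "q : BMor ` Mor X" using assms unfolding is_coequaliser_def base_sel(2) by simp_all
 then obtain d' c' q' where "d = BMor d'" "c = BMor c'" "q = BMor q'" by (elim imageE)
 then show ?thesis using base_coequaliser[of X d' c' q'] assms by blast
qed

lemma base_pullback_ex: assumes "pb (base X) f g p q"
 shows "EX f' g' p' q'. f = BMor f' & g = BMor g' & p = BMor p' & q = BMor q' & pb X f' g' p' q'"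
proof -
 have "f : BMor ` Mor X" "g : BMor ` Mor X" "p : BMor ` Mor X" "q : BMor ` Mor X" using assms unfolding is_pullback_def base_sel(2) by simp_all
 then obtain f' g' p' q' where "f = BMor f'" "g = BMor g'" "p = BMor p'" "q = BMor q'" by (elim imageE)
 then show ?thesis using base_pullback[of X f' g' p' q'] assms by blast
qed

lemma base_regular_epi: "re (base X) (BMor f) <-> re X f"
proof
 assume "re (base X) (BMor f)"
 then show "re X f" unfolding regular_epi_def using base_coequaliser_ex by blast
next
 assume "re X f"
 then obtain d c where "coeq X d c f" unfolding regular_epi_def by blast
 then have "coeq (base X) (BMor d) (BMor c) (BMor f)" by (rule base_coequaliser[THEN iffD2])
 then show "re (base X) (BMor f)" unfolding regular_epi_def by blast
qed

lemma base_relation: "relation (base X) (BMor d) (BMor c) <-> relation X d c"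
 unfolding relation_def by simp

lemma base_reflexive: "reflexive_relation (base X) (BMor d) (BMor c) <-> reflexive_relation X d c"
 unfolding reflexive_relation_def by (simp add: base_relation bex_Hom_base)

lemma base_equivalence: shows "equivalence_relation (base X) (BMor d) (BMor c) <-> equivalence_relation X d c"
 unfolding equivalence_relation_def by (simp add: base_reflexive bex_Hom_base)

lemma base_category: "category X ==> category (base X)"
 unfolding category_def by (auto simp: base_Hom Hom_def)

lemma base_exact_Maltsev: assumes "exact_Maltsev X" shows "exact_Maltsev (base X)"
proof -
 have X: "category X" "has_finite_limits X" and k: "!!f d c. kp X f d c ==> EX q. coeq X d c q"
   and r: "!!f g p q. pb X f g p q ==> re X f ==> re X q"
   and e: "!!d c. equivalence_relation X d c ==> EX f. kp X f d c"
   and m: "!!d c. reflexive_relation X d c ==> equivalence_relation X d c"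
  using assms unfolding exact_Maltsev_def exact_category_def regular_category_def by blast+
 have t: "EX t. terminal (base X) t"
 proof -
  obtain t where t: "terminal X t" using X(2) unfolding has_finite_limits_def by blast
  have "EX! f. f : Hom (base X) a (BOb t)" if a: "a : Obj (base X)" for a
  proof -
   obtain a' where a': "a = BOb a'" "a' : Obj X" using a by auto
   then have "EX! f. f : Hom X a' t" using t unfolding terminal_def by blast
   then show ?thesis using ex1_BMor[of "Hom X a' t" "%_. True"] a' by (simp add: base_Hom)
  qed
  moreover have "BOb t : Obj (base X)" using t unfolding terminal_def by simp
  ultimately show ?thesis unfolding terminal_def by blast
 qed
 have p: "EX p q. pb (base X) f g p q" if fg: "f : Mor (base X)" "g : Mor (base X)" "Cod (base X) f = Cod (base X) g" for f g
 proof -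
  obtain f' g' where f': "f = BMor f'" "g = BMor g'" "f' : Mor X" "g' : Mor X" using fg(1,2) by auto
  moreover have "Cod X f' = Cod X g'" using fg(3) f' by simp
  ultimately obtain p q where "pb X f' g' p q" using X(2) unfolding has_finite_limits_def by blast
  then have "pb (base X) f g (BMor p) (BMor q)" unfolding f'(1,2) by (rule base_pullback[THEN iffD2])
  then show ?thesis by blast
 qed
 have "regular_category (base X)" unfolding regular_category_def has_finite_limits_def
 proof (intro conjI allI impI ballI)
  fix f d c assume "kp (base X) f d c"
  then obtain f' d' c' where "d = BMor d'" "c = BMor c'" "kp X f' d' c'"
   unfolding is_kernel_pair_def using base_pullback_ex by blast
  moreover from this(3) obtain q where "coeq X d' c' q" using k by blast
  then have "coeq (base X) (BMor d') (BMor c') (BMor q)" by (rule base_coequaliser[THEN iffD2])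
  ultimately show "EX q. coeq (base X) d c q" by blast
 next
  fix f g p q assume a: "pb (base X) f g p q & re (base X) f"
  then obtain f' g' p' q' where "f = BMor f'" "g = BMor g'" "p = BMor p'" "q = BMor q'" "pb X f' g' p' q'"
   using base_pullback_ex by blast
  then show "re (base X) q" using a r base_regular_epi by metis
 qed (use base_category[OF X(1)] t p in auto)
 moreover have "EX f. kp (base X) f d c" if er: "equivalence_relation (base X) d c" for d c
 proof -
  obtain d' c' where dc: "d = BMor d'" "c = BMor c'"
   using er unfolding equivalence_relation_def reflexive_relation_def relation_def by auto
  then have "equivalence_relation X d' c'" using base_equivalence[of X d' c'] er by blast
  then obtain f where "pb X f f d' c'" using e unfolding is_kernel_pair_def by blast
  then have "pb (base X) (BMor f) (BMor f) d c" unfolding dc by (rule base_pullback[THEN iffD2])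
  then show ?thesis unfolding is_kernel_pair_def by blast
 qed
 moreover have "equivalence_relation (base X) d c" if er: "reflexive_relation (base X) d c" for d c
 proof -
  obtain d' c' where dc: "d = BMor d'" "c = BMor c'"
   using er unfolding reflexive_relation_def relation_def by auto
  then show ?thesis using m base_reflexive[of X d' c'] base_equivalence[of X d' c'] er by blast
 qed
 ultimately show ?thesis unfolding exact_Maltsev_def exact_category_def by blast
qed

primrec vtx :: "('o, 'm) cat => nat => (nat => nat) => ('o, 'm) cell => ('o, 'm) cell" where
 "vtx X 0 a F = F"
| "vtx X (Suc n) a F = vtx X n (%j. a (Suc j)) (fk_vertex (Fork_n X n) (a 0) F)"

abbreviation "fid \<equiv> fork_in_direction"

lemma upd_0 [simp]: "(%j. (a(0 := k)) (Suc j)) = (%j. a (Suc j))"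
 and upd_Suc [simp]: "(%j. (a(Suc i := k)) (Suc j)) = (%j. a (Suc j))(i := k)"
 by (auto simp: fun_eq_iff)

lemma pos_Suc: "pos a ==> pos (%j. a (Suc j))" "pos a ==> a 0 : {0, 1, 2}"
 by (auto simp: pos_def)

lemma fid_0: "fid X (Suc n) 0 a F = Fk (component_at n (%j. a (Suc j)) (fk_d F)) (component_at n (%j. a (Suc j)) (fk_c F))
   (component_at n (%j. a (Suc j)) (fk_e F)) (component_at n (%j. a (Suc j)) (fk_f F))"
 and fid_Suc: "fid X (Suc n) (Suc i) a F = fid X n i (%j. a (Suc j)) (fk_vertex (Fork_n X n) (a 0) F)"
 by (simp_all add: Let_def)

declare fork_in_direction.simps(2) [simp del]

lemma component_indep: "(!!j. j < n ==> a j = b j) ==> component_at n a x = component_at n b x"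
proof (induction n arbitrary: a b x)
 case (Suc n)
 have "a 0 = b 0" using Suc.prems[of 0] by simp
 moreover have "component_at n (%j. a (Suc j)) (fk_component (a 0) x) = component_at n (%j. b (Suc j)) (fk_component (a 0) x)"
  by (rule Suc.IH) (use Suc.prems in auto)
 ultimately show ?case by simp
qed simp

lemma vtx_indep: "(!!j. j < n ==> a j = b j) ==> vtx X n a F = vtx X n b F"
proof (induction n arbitrary: a b F)
 case (Suc n)
 have "a 0 = b 0" using Suc.prems[of 0] by simp
 moreover have "vtx X n (%j. a (Suc j)) (fk_vertex (Fork_n X n) (a 0) F) = vtx X n (%j. b (Suc j)) (fk_vertex (Fork_n X n) (a 0) F)"
  by (rule Suc.IH) (use Suc.prems in auto)
 ultimately show ?case by simp
qed simp

lemma fid_indep: "(!!j. j < n ==> a j = b j) ==> fid X n i a F = fid X n i b F"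
proof (induction n arbitrary: a b F i)
 case (Suc n)
 have a0: "a 0 = b 0" using Suc.prems[of 0] by simp
 show ?case
 proof (cases i)
  case 0
  have c: "component_at n (%j. a (Suc j)) = component_at n (%j. b (Suc j))"
   by (rule ext, rule component_indep) (use Suc.prems in auto)
  show ?thesis unfolding 0 fid_0 c by (rule refl)
 next
  case (Suc i')
  have "fid X n i' (%j. a (Suc j)) (fk_vertex (Fork_n X n) (a 0) F) = fid X n i' (%j. b (Suc j)) (fk_vertex (Fork_n X n) (a 0) F)"
   by (rule Suc.IH) (use Suc.prems in auto)
  then show ?thesis using Suc a0 by (simp add: fid_Suc)
 qed
qed simp

lemma fid_upd: "i < n ==> fid X n i (a(i := k)) F = fid X n i a F"
proof (induction n arbitrary: a F i)
 case (Suc n)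
 show ?case
 proof (cases i)
  case 0
  then show ?thesis by (simp add: fid_0 del: fun_upd_apply)
 next
  case (Suc i')
  then show ?thesis using Suc.IH[of i' "%j. a (Suc j)" "fk_vertex (Fork_n X n) (a 0) F"] Suc.prems
   by (simp add: fid_Suc del: fun_upd_apply) simp
 qed
qed simp

context tower begin

lemma fk_vertex_obj: "F : Obj (FK (Suc n)) ==> fk_vertex (FK n) k F : Obj (FK n)"
 using CCat.FkD[OF FK(1)[of n], of F] by (auto simp: n_Suc fk_vertex_def)

lemma fk_component_Hom: "x : Hom (FK (Suc n)) F G ==> fk_component k x : Hom (FK n) (fk_vertex (FK n) k F) (fk_vertex (FK n) k G)"
 using CCat.FkMorD[OF FK(1)[of n], of x F G] by (auto simp: n_Suc fk_vertex_def fk_component_def)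

lemma component_Hom: "x : Hom (FK n) F G ==> component_at n a x : Hom BX (vtx X n a F) (vtx X n a G)"
proof (induction n arbitrary: a x F G)
 case (Suc n)
 then show ?case using fk_component_Hom[of x n F G "a 0"] by simp
qed (simp add: n_Suc)

lemma component_Comp: "x : Hom (FK n) F G ==> y : Hom (FK n) G H ==>
  component_at n a (Comp (FK n) y x) = Comp BX (component_at n a y) (component_at n a x)"
proof (induction n arbitrary: a x y F G H)
 case (Suc n)
 have "fk_component (a 0) (Comp (FK (Suc n)) y x) = Comp (FK n) (fk_component (a 0) y) (fk_component (a 0) x)"
  by (simp add: n_Suc fk_component_def)
 then show ?case using Suc.IH[OF fk_component_Hom[OF Suc.prems(1)] fk_component_Hom[OF Suc.prems(2)]] by simp
qed (simp add: n_Suc)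

lemma component_Id: "F : Obj (FK n) ==> component_at n a (Id (FK n) F) = Id BX (vtx X n a F)"
proof (induction n arbitrary: a F)
 case (Suc n)
 have "fk_component (a 0) (Id (FK (Suc n)) F) = Id (FK n) (fk_vertex (FK n) (a 0) F)"
  by (simp add: n_Suc fk_component_def fk_vertex_def)
 then show ?case using Suc.IH[OF fk_vertex_obj[OF Suc.prems]] by simp
qed (simp add: n_Suc)

lemma component_eq: "[|x : Hom (FK n) F G; y : Hom (FK n) G H; x' : Hom (FK n) F G'; y' : Hom (FK n) G' H;
  Comp (FK n) y x = Comp (FK n) y' x'|] ==>
  Comp BX (component_at n a y) (component_at n a x) = Comp BX (component_at n a y') (component_at n a x')"
 using component_Comp[of x n F G y H a] component_Comp[of x' n F G' y' H a] by simp

lemma fid_fork: "F : Obj (FK n) ==> i < n ==>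
  fid X n i a F : Obj (Fork BX) & Dom BX (fk_d (fid X n i a F)) = vtx X n (a(i := 2)) F &
  Cod BX (fk_d (fid X n i a F)) = vtx X n (a(i := 1)) F & Cod BX (fk_f (fid X n i a F)) = vtx X n (a(i := 0)) F"
proof (induction n arbitrary: i a F)
 case (Suc n)
 interpret C: CCat "FK n" by (rule FK)
 interpret B: CCat "base X" using FK(1)[of 0] by (simp add: n_Suc)
 show ?case
 proof (cases i)
  case 0
  let ?a = "%j. a (Suc j)"
  note F = C.FkD[OF Suc.prems(1)[unfolded n_Suc]]
  note c = component_Hom[where a = ?a]
  have "fid X (Suc n) 0 a F : Obj (Fork BX)" unfolding fid_0
   by (rule B.FkI[OF c[OF F(2)] c[OF F(3)] c[OF F(4)] c[OF F(5)]])
    (use component_Comp[OF F(4,2), of ?a] component_Comp[OF F(4,3), of ?a] component_Id[OF F(10), of ?a] F(6,7) component_eq[OF F(2,5) F(3,5) F(8), of ?a] in simp_all)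
  then show ?thesis using 0 c[OF F(2)] c[OF F(5)] by (simp add: fid_0 fk_vertex_def Hom_def)
 next
  case (Suc i')
  have i': "i' < n" using Suc.prems(2) Suc by simp
  show ?thesis using Suc.IH[OF fk_vertex_obj[OF Suc.prems(1)] i', of "%j. a (Suc j)" "a 0"] Suc
   by (simp add: fid_Suc del: fun_upd_apply) (simp del: upd_Suc)
 qed
qed simp

lemma fid_natural: "x : Hom (FK n) F G ==> i < n ==>
  Comp BX (fk_f (fid X n i a G)) (component_at n (a(i := 1)) x) = Comp BX (component_at n (a(i := 0)) x) (fk_f (fid X n i a F)) &
  Comp BX (fk_d (fid X n i a G)) (component_at n (a(i := 2)) x) = Comp BX (component_at n (a(i := 1)) x) (fk_d (fid X n i a F)) &
  Comp BX (fk_c (fid X n i a G)) (component_at n (a(i := 2)) x) = Comp BX (component_at n (a(i := 1)) x) (fk_c (fid X n i a F))"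
proof (induction n arbitrary: i a x F G)
 case (Suc n)
 interpret C: CCat "FK n" by (rule FK)
 show ?case
 proof (cases i)
  case 0
  note x = C.FkMorD[OF Suc.prems(1)[unfolded n_Suc]]
  note F = C.FkD[OF x(1)] and G = C.FkD[OF x(2)]
  show ?thesis using 0 component_eq[OF x(5) G(5) F(5) x(6) x(10)] component_eq[OF x(4) G(2) F(2) x(5) x(7)] component_eq[OF x(4) G(3) F(3) x(5) x(8)]
   by (simp add: fid_0 fk_component_def)
 next
  case (Suc i')
  have i': "i' < n" using Suc.prems(2) Suc by simp
  have c: "component_at (Suc n) (a(i := k)) x = component_at n ((%j. a (Suc j))(i' := k)) (fk_component (a 0) x)" for k
   using Suc by (simp del: fun_upd_apply) simp
  have f: "fid X (Suc n) i a H = fid X n i' (%j. a (Suc j)) (fk_vertex (FK n) (a 0) H)" for H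
   using Suc by (simp only: fid_Suc)
  show ?thesis unfolding c f by (rule Suc.IH[OF fk_component_Hom[OF Suc.prems(1)] i'])
 qed
qed simp

lemma fid_squares: "F : Obj (FK n) ==> i < n ==> j < n ==> i ~= j ==>
  Comp BX (fk_f (fid X n j (a(i := 0)) F)) (fk_f (fid X n i (a(j := 1)) F)) = Comp BX (fk_f (fid X n i (a(j := 0)) F)) (fk_f (fid X n j (a(i := 1)) F)) &
  Comp BX (fk_d (fid X n i (a(j := 0)) F)) (fk_f (fid X n j (a(i := 2)) F)) = Comp BX (fk_f (fid X n j (a(i := 1)) F)) (fk_d (fid X n i (a(j := 1)) F)) &
  Comp BX (fk_c (fid X n i (a(j := 0)) F)) (fk_f (fid X n j (a(i := 2)) F)) = Comp BX (fk_f (fid X n j (a(i := 1)) F)) (fk_c (fid X n i (a(j := 1)) F))"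
proof (induction n arbitrary: i j a F)
 case (Suc n)
 interpret C: CCat "FK n" by (rule FK)
 note F = C.FkD[OF Suc.prems(1)[unfolded n_Suc]]
 let ?a = "%j. a (Suc j)"
 have v: "fk_vertex (FK n) 0 F = Cod (FK n) (fk_f F)" "fk_vertex (FK n) 1 F = Cod (FK n) (fk_d F)" "fk_vertex (FK n) (Suc 0) F = Cod (FK n) (fk_d F)" "fk_vertex (FK n) 2 F = Dom (FK n) (fk_d F)"
  by (simp_all add: fk_vertex_def)
 consider "i = 0" "j = 0" | j' where "i = 0" "j = Suc j'" "j' < n" | i' where "i = Suc i'" "j = 0" "i' < n" | i' j' where "i = Suc i'" "j = Suc j'" "i' < n" "j' < n"
  using Suc.prems by (cases i; cases j) auto
 then show ?case
 proof cases
  case 1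
  then show ?thesis using Suc.prems by simp
 next
  case 2
  then show ?thesis
   using fid_natural[OF F(5) 2(3), of ?a] fid_natural[OF F(2) 2(3), of ?a] fid_natural[OF F(3) 2(3), of ?a]
   by (simp add: fid_0 fid_Suc v del: fun_upd_apply) (simp add: v del: upd_Suc)
 next
  case 3
  then show ?thesis
   using fid_natural[OF F(5) 3(3), of ?a]
   by (simp add: fid_0 fid_Suc v del: fun_upd_apply) (simp add: v del: upd_Suc)
 next
  case 4
  then show ?thesis
   using Suc.IH[OF fk_vertex_obj[OF Suc.prems(1)] 4(3,4), of ?a "a 0"] Suc.prems
   by (simp add: fid_Suc del: fun_upd_apply) (simp del: upd_Suc)
 qed
qed simp

lemma component_pb: "pb (FK n) f g p q ==> pos a ==>
  pb BX (component_at n a f) (component_at n a g) (component_at n a p) (component_at n a q)"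
proof (induction n arbitrary: a f g p q)
 case (Suc n)
 have "pb (FK n) (fk_component (a 0) f) (fk_component (a 0) g) (fk_component (a 0) p) (fk_component (a 0) q)"
  by (rule diag.pb_pointwise[OF CCat.Fork_diag[OF FK(1)] FK(2) Suc.prems(1)[unfolded n_Suc]]) (use pos_Suc[OF Suc.prems(2)] in auto)
 then show ?case using Suc.IH pos_Suc[OF Suc.prems(2)] by simp
qed (simp add: n_Suc)

lemma case_pos: "pos a ==> k : {0, 1, 2} ==> pos (case_nat k a)"
 by (auto simp: pos_def split: nat.split)

lemma pb_components: assumes "f : Hom (FK n) G K" "g : Hom (FK n) H K" "p : Hom (FK n) P G" "q : Hom (FK n) P H"
  and "!!a. pos a ==> pb BX (component_at n a f) (component_at n a g) (component_at n a p) (component_at n a q)"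
 shows "pb (FK n) f g p q"
 using assms
proof (induction n arbitrary: f g p q G H K P)
 case 0
 have "pos (%_. 0)" by (simp add: pos_def)
 from 0(5)[OF this] show ?case by (simp add: n_Suc)
next
 case (Suc n)
 have "pb (FK n) (fk_component i f) (fk_component i g) (fk_component i p) (fk_component i q)" if i: "i : {0, 1, 2}" for i
 proof (rule Suc.IH[OF fk_component_Hom[OF Suc.prems(1)] fk_component_Hom[OF Suc.prems(2)] fk_component_Hom[OF Suc.prems(3)] fk_component_Hom[OF Suc.prems(4)]])
  fix a assume "pos a"
  then show "pb BX (component_at n a (fk_component i f)) (component_at n a (fk_component i g)) (component_at n a (fk_component i p)) (component_at n a (fk_component i q))"
   using Suc.prems(5)[OF case_pos[OF _ i]] by simp
 qed
 then show ?case unfolding n_Suc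
  by (intro diag.pb_reflect[OF CCat.Fork_diag[OF FK(1)]]) (use Suc.prems(1-4) in \<open>auto simp: Hom_def n_Suc\<close>)
qed

lemma component_co: "is_rgraph (FK n) d c e ==> coeq (FK n) d c q ==> pos a ==>
  coeq BX (component_at n a d) (component_at n a c) (component_at n a q)"
proof (induction n arbitrary: a d c e q)
 case (Suc n)
 note dg = CCat.Fork_diag[OF FK(1)]
 have a0: "a 0 : {0, 1, 2}" by (rule pos_Suc(2)[OF Suc.prems(3)])
 have "coeq (FK n) (fk_component (a 0) d) (fk_component (a 0) c) (fk_component (a 0) q)"
  by (rule diag.co_pointwise[OF dg FK(3) Suc.prems(1,2)[unfolded n_Suc] a0])
 moreover have "is_rgraph (FK n) (fk_component (a 0) d) (fk_component (a 0) c) (fk_component (a 0) e)"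
  by (rule diag.comp_rgraph[OF dg Suc.prems(1)[unfolded n_Suc] a0])
 ultimately show ?case using Suc.IH pos_Suc[OF Suc.prems(3)] by simp
qed (simp add: n_Suc)

lemma co_components: assumes "d : Hom (FK n) F G" "c : Hom (FK n) F G" "q : Hom (FK n) G H"
  and "!!a. pos a ==> coeq BX (component_at n a d) (component_at n a c) (component_at n a q)"
 shows "coeq (FK n) d c q"
 using assms
proof (induction n arbitrary: d c q F G H)
 case 0
 have "pos (%_. 0)" by (simp add: pos_def)
 from 0(4)[OF this] show ?case by (simp add: n_Suc)
next
 case (Suc n)
 have "coeq (FK n) (fk_component i d) (fk_component i c) (fk_component i q)" if i: "i : {0, 1, 2}" for i
 proof (rule Suc.IH[OF fk_component_Hom[OF Suc.prems(1)] fk_component_Hom[OF Suc.prems(2)] fk_component_Hom[OF Suc.prems(3)]])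
  fix a assume "pos a"
  then show "coeq BX (component_at n a (fk_component i d)) (component_at n a (fk_component i c)) (component_at n a (fk_component i q))"
   using Suc.prems(4)[OF case_pos[OF _ i]] by simp
 qed
 then show ?case unfolding n_Suc
  by (intro diag.co_reflect[OF CCat.Fork_diag[OF FK(1)]]) (use Suc.prems(1-3) in \<open>auto simp: Hom_def n_Suc\<close>)
qed

lemma lex_fid: assumes "F : Obj (FK n)"
 shows "lex X n F <-> (ALL i<n. ALL a. pos a --> kp BX (fk_f (fid X n i a F)) (fk_d (fid X n i a F)) (fk_c (fid X n i a F)))"
 using assms
proof (induction n arbitrary: F)
 case 0
 then show ?case by (simp add: n_Suc)
next
 case (Suc n)
 interpret C: CCat "FK n" by (rule FK)
 note F = C.FkD[OF Suc.prems[unfolded n_Suc]]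
 have v: "lex X n (fk_vertex (FK n) k F) <-> (ALL i<n. ALL a. pos a --> kp BX (fk_f (fid X n i a (fk_vertex (FK n) k F)))
   (fk_d (fid X n i a (fk_vertex (FK n) k F))) (fk_c (fid X n i a (fk_vertex (FK n) k F))))" for k
  by (rule Suc.IH[OF fk_vertex_obj[OF Suc.prems]])
 have k: "kp (FK n) (fk_f F) (fk_d F) (fk_c F) <-> (ALL a. pos a --> kp BX (component_at n a (fk_f F)) (component_at n a (fk_d F)) (component_at n a (fk_c F)))"
  unfolding is_kernel_pair_def using component_pb pb_components[OF F(5,5,2,3)] by blast
 have lx: "lex X (Suc n) F <-> kp (FK n) (fk_f F) (fk_d F) (fk_c F) & (ALL k:{0, 1, 2}. lex X n (fk_vertex (FK n) k F))"
  using Suc.prems by (auto simp: n_Suc fk_vertex_def)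
 show ?case
 proof
  assume l: "lex X (Suc n) F"
  show "ALL i<Suc n. ALL a. pos a --> kp BX (fk_f (fid X (Suc n) i a F)) (fk_d (fid X (Suc n) i a F)) (fk_c (fid X (Suc n) i a F))"
  proof (intro allI impI)
   fix i a assume i: "i < Suc n" and a: "pos a"
   show "kp BX (fk_f (fid X (Suc n) i a F)) (fk_d (fid X (Suc n) i a F)) (fk_c (fid X (Suc n) i a F))"
    using l[unfolded lx k] i pos_Suc[OF a] v by (cases i) (auto simp: fid_0 fid_Suc)
  qed
 next
  assume r: "ALL i<Suc n. ALL a. pos a --> kp BX (fk_f (fid X (Suc n) i a F)) (fk_d (fid X (Suc n) i a F)) (fk_c (fid X (Suc n) i a F))"
  have "kp BX (component_at n a (fk_f F)) (component_at n a (fk_d F)) (component_at n a (fk_c F))" if "pos a" for a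
   using r[rule_format, of 0 "case_nat 0 a"] case_pos[OF that, of 0] by (simp add: fid_0)
  moreover have "lex X n (fk_vertex (FK n) k F)" if k: "k : {0, 1, 2}" for k
   unfolding v
  proof (intro allI impI)
   fix i a assume "i < n" "pos a"
   then show "kp BX (fk_f (fid X n i a (fk_vertex (FK n) k F))) (fk_d (fid X n i a (fk_vertex (FK n) k F))) (fk_c (fid X n i a (fk_vertex (FK n) k F)))"
    using r[rule_format, of "Suc i" "case_nat k a"] case_pos[of a k] k by (simp add: fid_Suc)
  qed
  ultimately show "lex X (Suc n) F" unfolding lx k by blast
 qed
qed

lemma rex_fid: assumes "F : Obj (FK n)"
 shows "rex X n F <-> (ALL i<n. ALL a. pos a --> coeq BX (fk_d (fid X n i a F)) (fk_c (fid X n i a F)) (fk_f (fid X n i a F)))"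
 using assms
proof (induction n arbitrary: F)
 case 0
 then show ?case by (simp add: n_Suc)
next
 case (Suc n)
 interpret C: CCat "FK n" by (rule FK)
 note F = C.FkD[OF Suc.prems[unfolded n_Suc]]
 have v: "rex X n (fk_vertex (FK n) k F) <-> (ALL i<n. ALL a. pos a --> coeq BX
   (fk_d (fid X n i a (fk_vertex (FK n) k F))) (fk_c (fid X n i a (fk_vertex (FK n) k F))) (fk_f (fid X n i a (fk_vertex (FK n) k F))))" for k
  by (rule Suc.IH[OF fk_vertex_obj[OF Suc.prems]])
 have rg: "is_rgraph (FK n) (fk_d F) (fk_c F) (fk_e F)" unfolding C.is_rgraph_Hom using F by blast
 have k: "coeq (FK n) (fk_d F) (fk_c F) (fk_f F) <-> (ALL a. pos a --> coeq BX (component_at n a (fk_d F)) (component_at n a (fk_c F)) (component_at n a (fk_f F)))"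
  using component_co[OF rg] co_components[OF F(2,3,5)] by blast
 have lx: "rex X (Suc n) F <-> coeq (FK n) (fk_d F) (fk_c F) (fk_f F) & (ALL k:{0, 1, 2}. rex X n (fk_vertex (FK n) k F))"
  using Suc.prems by (auto simp: n_Suc fk_vertex_def)
 show ?case
 proof
  assume l: "rex X (Suc n) F"
  show "ALL i<Suc n. ALL a. pos a --> coeq BX (fk_d (fid X (Suc n) i a F)) (fk_c (fid X (Suc n) i a F)) (fk_f (fid X (Suc n) i a F))"
  proof (intro allI impI)
   fix i a assume i: "i < Suc n" and a: "pos a"
   show "coeq BX (fk_d (fid X (Suc n) i a F)) (fk_c (fid X (Suc n) i a F)) (fk_f (fid X (Suc n) i a F))"
    using l[unfolded lx k] i pos_Suc[OF a] v by (cases i) (auto simp: fid_0 fid_Suc)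
  qed
 next
  assume r: "ALL i<Suc n. ALL a. pos a --> coeq BX (fk_d (fid X (Suc n) i a F)) (fk_c (fid X (Suc n) i a F)) (fk_f (fid X (Suc n) i a F))"
  have "coeq BX (component_at n a (fk_d F)) (component_at n a (fk_c F)) (component_at n a (fk_f F))" if "pos a" for a
   using r[rule_format, of 0 "case_nat 0 a"] case_pos[OF that, of 0] by (simp add: fid_0)
  moreover have "rex X n (fk_vertex (FK n) k F)" if k: "k : {0, 1, 2}" for k
   unfolding v
  proof (intro allI impI)
   fix i a assume "i < n" "pos a"
   then show "coeq BX (fk_d (fid X n i a (fk_vertex (FK n) k F))) (fk_c (fid X n i a (fk_vertex (FK n) k F))) (fk_f (fid X n i a (fk_vertex (FK n) k F)))"
    using r[rule_format, of "Suc i" "case_nat k a"] case_pos[of a k] k by (simp add: fid_Suc)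
  qed
  ultimately show "rex X (Suc n) F" unfolding lx k by blast
 qed
qed

lemma exact_iff: assumes F: "F : Obj (FK n)" shows "exact_n_fork X n F <-> lex X n F & rex X n F"
 unfolding exact_n_fork_def lex_fid[OF F] rex_fid[OF F] exact_fork_def
 using fid_fork[OF F] F unfolding pos_def by blast

end

locale EM_tower =
 fixes X :: "('o, 'm) cat"
 assumes X: "exact_Maltsev X"
begin

lemma EM_base: "EM (base X)"
 by (rule EM_I[OF base_exact_Maltsev[OF X]])

sublocale E: EM "base X" by (rule EM_base)

sublocale tower X
proof
 show "category (base X)" by (rule E.cat)
 show "has_pb (base X)" unfolding has_pb_def using E.pullbacks by blast
 show "has_rcoeq (base X)" unfolding has_rcoeq_def using E.rgraph_coeq(1) by blast
qed

lemma nfork_fid: assumes F: "F : Obj (FK n)"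
 shows "nfork (base X) n (%a. vtx X n a F) (%i a. fk_f (fid X n i a F)) (%i a. fk_d (fid X n i a F)) (%i a. fk_c (fid X n i a F)) (%i a. fk_e (fid X n i a F))"
proof (intro nfork.intro EM_base nfork_axioms.intro, goal_cases)
 case (1 a b i)
 then show ?case using vtx_indep[of n a b X F] fid_indep[of n a b X i F] by auto
next
 case (5 a i)
 interpret B: CCat "base X" using FK(1)[of 0] by (simp add: n_Suc)
 show ?case using fid_fork[OF F 5(1), of a] unfolding Fork_Obj by auto
next
 case (6 a i)
 interpret B: CCat "base X" using FK(1)[of 0] by (simp add: n_Suc)
 show ?case using fid_fork[OF F 6(1), of a] B.FkD(5)[of "fid X n i a F"] by (auto simp: Hom_def)
next
 case (2 a i k)
 then show ?case by (simp only: fid_upd)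
next
 case (3 a i k)
 then show ?case by (simp only: fid_upd)
next
 case (4 a i k)
 then show ?case by (simp only: fid_upd)
next
 case (7 a i)
 then show ?case using fid_fork[OF F 7(1), of a] by blast
next
 case (8 a i)
 then show ?case using fid_fork[OF F 8(1), of a] by blast
next
 case (9 a i j)
 then show ?case using fid_squares[OF F, of i j a] by blast
next
 case (10 a i j)
 then show ?case using fid_squares[OF F, of i j a] by blast
next
 case (11 a i j)
 then show ?case using fid_squares[OF F, of i j a] by blast
qed

end

section \<open>Cubic extensions and liftings\<close>

lemma liftable_image: assumes "inj_on h S"
 shows "liftable C W (h ` S) f g <-> liftable C W S (%i. f (h i)) (%i j. g (h i) (h j))"
proof
 assume L: "liftable C W (h ` S) f g"
 show "liftable C W S (%i. f (h i)) (%i j. g (h i) (h j))"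
 proof (rule liftableI)
  fix U x assume U: "U : Obj C" and x: "!!i. i : S ==> x i : Mor C" "!!i. i : S ==> Dom C (x i) = U" "!!i. i : S ==> Cod C (x i) = Cod C (f (h i))"
   and c: "!!i j. [|i : S; j : S; i ~= j|] ==> Comp C (g (h i) (h j)) (x i) = Comp C (g (h j) (h i)) (x j)"
  let ?y = "%k. x (the_inv_into S h k)"
  have y: "?y (h i) = x i" if "i : S" for i using the_inv_into_f_f[OF assms that] by simp
  have A: "?y k : Mor C" "Dom C (?y k) = U" "Cod C (?y k) = Cod C (f k)" if "k : h ` S" for k
   using that x y by auto
  have B: "Comp C (g k l) (?y k) = Comp C (g l k) (?y l)" if kl: "k : h ` S" "l : h ` S" "k ~= l" for k l
  proof -
   obtain i j where ij: "k = h i" "i : S" "l = h j" "j : S" using kl by blast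
   then have "i ~= j" using kl by blast
   from c[OF ij(2,4) this] show ?thesis unfolding ij(1,3) y[OF ij(2)] y[OF ij(4)] .
  qed
  obtain p w where "re C p" "Cod C p = U" "w : Mor C" "Dom C w = Dom C p" "Cod C w = W" and
   e: "!!k. k : h ` S ==> Comp C (f k) w = Comp C (?y k) p"
   using liftableD[of C W "h ` S" f g U ?y, OF L U A B] by blast
  moreover have "Comp C (f (h i)) w = Comp C (x i) p" if "i : S" for i using e[of "h i"] y that by simp
  ultimately show "EX p w. re C p & Cod C p = U & w : Mor C & Dom C w = Dom C p & Cod C w = W &
    (ALL i:S. Comp C (f (h i)) w = Comp C (x i) p)" by blast
 qed
next
 assume L: "liftable C W S (%i. f (h i)) (%i j. g (h i) (h j))"
 show "liftable C W (h ` S) f g"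
 proof (rule liftableI)
  fix U x assume U: "U : Obj C" and x: "!!k. k : h ` S ==> x k : Mor C" "!!k. k : h ` S ==> Dom C (x k) = U" "!!k. k : h ` S ==> Cod C (x k) = Cod C (f k)"
   and c: "!!k l. [|k : h ` S; l : h ` S; k ~= l|] ==> Comp C (g k l) (x k) = Comp C (g l k) (x l)"
  have B: "Comp C (g (h i) (h j)) (x (h i)) = Comp C (g (h j) (h i)) (x (h j))" if "i : S" "j : S" "i ~= j" for i j
   by (rule c) (use that assms in \<open>auto simp: inj_on_def\<close>)
  obtain p w where "re C p" "Cod C p = U" "w : Mor C" "Dom C w = Dom C p" "Cod C w = W"
   "!!i. i : S ==> Comp C (f (h i)) w = Comp C (x (h i)) p"
   using liftableD[of C W S "%i. f (h i)" "%i j. g (h i) (h j)" U "%i. x (h i)", OF L U x(1)[OF imageI] x(2)[OF imageI] x(3)[OF imageI] B] by blast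
  then show "EX p w. re C p & Cod C p = U & w : Mor C & Dom C w = Dom C p & Cod C w = W &
    (ALL k:h ` S. Comp C (f k) w = Comp C (x k) p)" by blast
 qed
qed

lemma liftable_cong: assumes "W = W'" "!!i. i : S ==> f i = f' i" "!!i j. i : S ==> j : S ==> i ~= j ==> g i j = g' i j"
 shows "liftable C W S f g <-> liftable C W' S f' g'"
 unfolding liftable_def using assms by simp

primrec avtx :: "('o, 'm) cat => nat => (nat => nat) => ('o, 'm) cell => ('o, 'm) cell" where
 "avtx X 0 a A = A"
| "avtx X (Suc n) a A = avtx X n (%j. a (Suc j)) (sq_vertex (Arr_n X n) (a 0) A)"

primrec acomp :: "nat => (nat => nat) => ('o, 'm) cell => ('o, 'm) cell" where
 "acomp 0 a x = x"
| "acomp (Suc n) a x = acomp n (%j. a (Suc j)) (sq_component (a 0) x)"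

primrec adir :: "('o, 'm) cat => nat => nat => (nat => nat) => ('o, 'm) cell => ('o, 'm) cell" where
 "adir X 0 i a A = A"
| "adir X (Suc n) i a A = (case i of 0 => acomp n (%j. a (Suc j)) A
   | Suc i' => adir X n i' (%j. a (Suc j)) (sq_vertex (Arr_n X n) (a 0) A))"

lemma avtx_case [simp]: "avtx X (Suc n) (case_nat k b) A = avtx X n b (sq_vertex (Arr_n X n) k A)"
 and acomp_case [simp]: "acomp (Suc n) (case_nat k b) x = acomp n b (sq_component k x)"
 and adir_case [simp]: "adir X (Suc n) 0 (case_nat k b) A = acomp n b A"
  "adir X (Suc n) (Suc i) (case_nat k b) A = adir X n i b (sq_vertex (Arr_n X n) k A)"
 by simp_all

lemma case_upd [simp]: "(case_nat k b)(0 := m) = case_nat m b" "(case_nat k b)(Suc i := m) = case_nat k (b(i := m))"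
 by (auto simp: fun_eq_iff split: nat.split)

lemma case_eta: "a = case_nat (a 0) (%j. a (Suc j))"
 by (auto simp: fun_eq_iff split: nat.split)

declare avtx.simps(2) [simp del] acomp.simps(2) [simp del] adir.simps(2) [simp del]

lemma sq_vertex_simps [simp]: "sq_vertex C 0 f = Cod C f" "sq_vertex C 1 f = Dom C f" "sq_vertex C (Suc 0) f = Dom C f"
  "sq_component 0 x = sq0 x" "sq_component 1 x = sq1 x" "sq_component (Suc 0) x = sq1 x"
 by (simp_all add: sq_vertex_def sq_component_def)

definition lifts_at :: "('o, 'm) cat => nat => ('o, 'm) cell => nat set => (nat => nat) => bool" where
 "lifts_at X n A S a <-> liftable (base X) (avtx X n a A) S (%t. adir X n t a A) (%t s. adir X n s (a(t := 0)) A)"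

definition all_lifts :: "('o, 'm) cat => nat => ('o, 'm) cell => bool" where
 "all_lifts X n A <-> (ALL S a. S <= {..<n} & S ~= {} & (ALL j. a j : {0, 1}) & (ALL t:S. a t = 1) --> lifts_at X n A S a)"

lemma lifts_Suc: "lifts_at X (Suc n) A (Suc ` S) (case_nat k b) <-> lifts_at X n (sq_vertex (Arr_n X n) k A) S b"
 unfolding lifts_at_def liftable_image[OF inj_Suc[THEN inj_on_subset[OF _ subset_UNIV]]] by simp

definition transp :: "('o, 'm) cell => ('o, 'm) cell" where
 "transp A = Sq (sq1 A) (sq0 A) (sq_dom A) (sq_cod A)"

definition swap :: "nat => nat" where "swap i = (if i = 0 then 1 else if i = 1 then 0 else i)"

lemma swap_simps [simp]: "swap 0 = 1" "swap (Suc 0) = 0" "swap (Suc (Suc i)) = Suc (Suc i)" "swap (swap i) = i"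
 by (simp_all add: swap_def)

lemma inj_swap: "inj_on swap S"
 by (rule inj_on_inverseI[of _ swap]) simp

context tower begin

lemma sq_vertex_obj: "A : Obj (AR (Suc n)) ==> sq_vertex (AR n) k A : Obj (AR n)"
 using AR(1)[of n] Cat.cat unfolding CCat_def category_def by (auto simp: n_Suc sq_vertex_def Cat_def category_def)

lemma sq_component_Hom: "x : Hom (AR (Suc n)) A B ==> sq_component k x : Hom (AR n) (sq_vertex (AR n) k A) (sq_vertex (AR n) k B)"
 using CCat.SqD[OF AR(1)[of n], of x A B] by (auto simp: n_Suc sq_vertex_def sq_component_def)

lemma acomp_Hom: "x : Hom (AR n) A B ==> acomp n a x : Hom BX (avtx X n a A) (avtx X n a B)"
proof (induction n arbitrary: a x A B)
 case (Suc n)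
 then show ?case using sq_component_Hom[of x n A B "a 0"] by (simp add: avtx.simps acomp.simps)
qed (simp add: n_Suc)

lemma acomp_Comp: "x : Hom (AR n) A B ==> y : Hom (AR n) B D ==>
  acomp n a (Comp (AR n) y x) = Comp BX (acomp n a y) (acomp n a x)"
proof (induction n arbitrary: a x y A B D)
 case (Suc n)
 have "sq_component (a 0) (Comp (AR (Suc n)) y x) = Comp (AR n) (sq_component (a 0) y) (sq_component (a 0) x)"
  by (simp add: n_Suc sq_component_def)
 then show ?case using Suc.IH[OF sq_component_Hom[OF Suc.prems(1)] sq_component_Hom[OF Suc.prems(2)]] by (simp add: acomp.simps)
qed (simp add: n_Suc)

lemma acomp_eq: "[|x : Hom (AR n) A B; y : Hom (AR n) B D; x' : Hom (AR n) A B'; y' : Hom (AR n) B' D;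
  Comp (AR n) y x = Comp (AR n) y' x'|] ==>
  Comp BX (acomp n a y) (acomp n a x) = Comp BX (acomp n a y') (acomp n a x')"
 using acomp_Comp[of x n A B y D a] acomp_Comp[of x' n A B' y' D a] by simp

lemma AR_mor: "A : Obj (AR (Suc n)) ==> A : Hom (AR n) (Dom (AR n) A) (Cod (AR n) A)"
 by (simp add: n_Suc Hom_def)

lemma adir_Hom: "A : Obj (AR n) ==> i < n ==> adir X n i a A : Hom BX (avtx X n (a(i := 1)) A) (avtx X n (a(i := 0)) A)"
proof (induction n arbitrary: a i A)
 case (Suc n)
 obtain k b where a: "a = case_nat k b" using case_eta by blast
 show ?case
 proof (cases i)
  case 0
  show ?thesis unfolding 0 a using acomp_Hom[OF AR_mor[OF Suc.prems(1)], of b] by simp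
 next
  case (Suc i')
  then have i': "i' < n" using Suc.prems(2) by simp
  show ?thesis unfolding a Suc case_upd avtx_case adir_case by (rule Suc.IH[OF sq_vertex_obj[OF Suc.prems(1)] i'])
 qed
qed simp

lemma adir_natural: "x : Hom (AR n) A B ==> i < n ==>
  Comp BX (adir X n i a B) (acomp n (a(i := 1)) x) = Comp BX (acomp n (a(i := 0)) x) (adir X n i a A)"
proof (induction n arbitrary: a i A B x)
 case (Suc n)
 obtain k b where a: "a = case_nat k b" using case_eta by blast
 show ?case
 proof (cases i)
  case 0
  interpret C: CCat "AR n" by (rule AR)
  note x = C.SqD[OF Suc.prems(1)[unfolded n_Suc]]
  have A: "A : Hom (AR n) (Dom (AR n) A) (Cod (AR n) A)" "B : Hom (AR n) (Dom (AR n) B) (Cod (AR n) B)"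
   using x(1,2) by (auto simp: Hom_def)
  show ?thesis unfolding 0 a using acomp_eq[OF x(4) A(2) A(1) x(5) x(6), of b] by simp
 next
  case (Suc i')
  then have i': "i' < n" using Suc.prems(2) by simp
  show ?thesis unfolding a Suc case_upd acomp_case adir_case by (rule Suc.IH[OF sq_component_Hom[OF Suc.prems(1)] i'])
 qed
qed simp

lemma acomp_pb: "pb (AR n) f g p q ==>
  pb BX (acomp n a f) (acomp n a g) (acomp n a p) (acomp n a q)"
proof (induction n arbitrary: a f g p q)
 case (Suc n)
 obtain k b where a: "a = case_nat k b" using case_eta by blast
 let ?k = "if k = 0 then 0 else 1::nat"
 have "pb (AR n) (sq_component ?k f) (sq_component ?k g) (sq_component ?k p) (sq_component ?k q)"
  by (rule diag.pb_pointwise[OF CCat.Arr_diag[OF AR(1)] AR(2) Suc.prems[unfolded n_Suc]]) auto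
 moreover have "sq_component ?k x = sq_component k x" for x :: "('o, 'm) cell" by (simp add: sq_component_def)
 ultimately have "pb (AR n) (sq_component k f) (sq_component k g) (sq_component k p) (sq_component k q)"
  by simp
 from Suc.IH[OF this] show ?case unfolding a by simp
qed (simp add: n_Suc)

lemma arr_vertex: assumes "F : Obj (FK (Suc n))" "k : {0, 1}"
 shows "sq_vertex (AR n) k (fob (arr_n (Suc n)) F) = fob (arr_n n) (fk_vertex (FK n) k F)"
proof -
 interpret C: CCat "FK n" by (rule FK)
 note F = C.FkD[OF assms(1)[unfolded n_Suc]]
 show ?thesis using two_cats.PDom[OF arr_two F(5)] assms(2) by (auto simp: arr_def fk_vertex_def)
qed

lemma arr_comp: "x : Hom (FK n) F G ==> (ALL j. a j : {0, 1}) ==> acomp n a (fmor (arr_n n) x) = component_at n a x"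
proof (induction n arbitrary: a x F G)
 case (Suc n)
 obtain k b where a: "a = case_nat k b" using case_eta by blast
 have k: "k : {0, 1}" and b: "ALL j. b j : {0, 1}" using Suc.prems(2)[rule_format, of 0] Suc.prems(2)[rule_format, of "Suc _"] unfolding a by auto
 have "sq_component k (fmor (arr_n (Suc n)) x) = fmor (arr_n n) (fk_component k x)"
  using k by (auto simp: arr_def fk_component_def)
 then show ?case unfolding a using Suc.IH[OF fk_component_Hom[OF Suc.prems(1)] b, of k] by (simp del: arr_n.simps)
qed simp

lemma arr_vtx: "F : Obj (FK n) ==> (ALL j. a j : {0, 1}) ==> avtx X n a (fob (arr_n n) F) = vtx X n a F"
proof (induction n arbitrary: a F)
 case (Suc n)
 obtain k b where a: "a = case_nat k b" using case_eta by blast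
 have k: "k : {0, 1}" and b: "ALL j. b j : {0, 1}" using Suc.prems(2)[rule_format, of 0] Suc.prems(2)[rule_format, of "Suc _"] unfolding a by auto
 show ?case unfolding a avtx_case arr_vertex[OF Suc.prems(1) k] using Suc.IH[OF fk_vertex_obj[OF Suc.prems(1)] b] by simp
qed simp

lemma arr_dir: "F : Obj (FK n) ==> i < n ==> (ALL j. a j : {0, 1}) ==> adir X n i a (fob (arr_n n) F) = fk_f (fid X n i a F)"
proof (induction n arbitrary: a F i)
 case (Suc n)
 obtain k b where a: "a = case_nat k b" using case_eta by blast
 have k: "k : {0, 1}" and b: "ALL j. b j : {0, 1}" using Suc.prems(3)[rule_format, of 0] Suc.prems(3)[rule_format, of "Suc _"] unfolding a by auto
 show ?case
 proof (cases i)
  case 0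
  interpret C: CCat "FK n" by (rule FK)
  note F = C.FkD[OF Suc.prems(1)[unfolded n_Suc]]
  show ?thesis unfolding 0 a using arr_comp[OF F(5) b] by (simp add: fid_0 arr_def)
 next
  case (Suc i')
  then have i': "i' < n" using Suc.prems(2) by simp
  show ?thesis unfolding a Suc adir_case arr_vertex[OF Suc.prems(1) k]
   using Suc.IH[OF fk_vertex_obj[OF Suc.prems(1)] i' b] by (simp add: fid_Suc)
 qed
qed simp

lemma transp_vertex: assumes "A : Obj (AR (Suc (Suc n)))"
 shows "sq_vertex (AR n) l (sq_vertex (AR (Suc n)) k (transp A)) = sq_vertex (AR n) k (sq_vertex (AR (Suc n)) l A)"
  "sq_component k (transp A) = sq_vertex (AR (Suc n)) k A" "sq_vertex (AR (Suc n)) k (transp A) = sq_component k A"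
 using assms by (auto simp: n_Suc Arr_Mor Hom_def transp_def sq_vertex_def sq_component_def)

lemma lifts_transp: assumes A: "A : Obj (AR (Suc (Suc n)))"
 shows "lifts_at X (Suc (Suc n)) (transp A) (swap ` S) (case_nat k (case_nat l b)) <-> lifts_at X (Suc (Suc n)) A S (case_nat l (case_nat k b))"
proof -
 have d: "adir X (Suc (Suc n)) (swap i) (case_nat k (case_nat l b)) (transp A) = adir X (Suc (Suc n)) i (case_nat l (case_nat k b)) A" for i k l b
 proof -
  consider "i = 0" | "i = Suc 0" | j where "i = Suc (Suc j)" by (metis nat.exhaust)
  then show ?thesis using transp_vertex[OF A] by cases (simp_all)
 qed
 have u: "(case_nat k (case_nat l b))(swap i := 0) = case_nat k' (case_nat l' b') <-> (case_nat l (case_nat k b))(i := 0) = case_nat l' (case_nat k' b')" for i k' l' b'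
 proof -
  consider "i = 0" | "i = Suc 0" | j where "i = Suc (Suc j)" by (metis nat.exhaust)
  then show ?thesis by cases (auto simp: fun_eq_iff split: nat.splits)
 qed
 have e: "adir X (Suc (Suc n)) (swap j) ((case_nat k (case_nat l b))(swap i := 0)) (transp A) = adir X (Suc (Suc n)) j ((case_nat l (case_nat k b))(i := 0)) A" for i j
 proof -
  obtain k' l' b' where c: "(case_nat l (case_nat k b))(i := 0) = case_nat l' (case_nat k' b')" using case_eta by metis
  show ?thesis unfolding c c[folded u] by (rule d)
 qed
 have "avtx X (Suc (Suc n)) (case_nat k (case_nat l b)) (transp A) = avtx X (Suc (Suc n)) (case_nat l (case_nat k b)) A"
  using transp_vertex[OF A] by simp
 then show ?thesis unfolding lifts_at_def liftable_image[OF inj_swap] d e by simp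
qed

end

lemma liftable_0Suc: "liftable C W (insert 0 (Suc ` S)) F G <->
 (ALL U h z. U : Obj C & h : Hom C U (Cod C (F 0)) & (ALL i:S. z i : Hom C U (Cod C (F (Suc i)))) &
   (ALL i:S. Comp C (G 0 (Suc i)) h = Comp C (G (Suc i) 0) (z i)) &
   (ALL i:S. ALL j:S. i ~= j --> Comp C (G (Suc i) (Suc j)) (z i) = Comp C (G (Suc j) (Suc i)) (z j)) -->
   (EX p w. re C p & Cod C p = U & w : Hom C (Dom C p) W & Comp C (F 0) w = Comp C h p &
    (ALL i:S. Comp C (F (Suc i)) w = Comp C (z i) p)))" (is "?L <-> ?R")
proof
 assume L: ?L
 show ?R
 proof (intro allI impI, elim conjE)
  fix U h z assume U: "U : Obj C" "h : Hom C U (Cod C (F 0))" "ALL i:S. z i : Hom C U (Cod C (F (Suc i)))"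
   "ALL i:S. Comp C (G 0 (Suc i)) h = Comp C (G (Suc i) 0) (z i)"
   "ALL i:S. ALL j:S. i ~= j --> Comp C (G (Suc i) (Suc j)) (z i) = Comp C (G (Suc j) (Suc i)) (z j)"
  let ?x = "case_nat h z"
  obtain p w where p: "re C p" "Cod C p = U" "w : Mor C" "Dom C w = Dom C p" "Cod C w = W"
   and e: "!!i. i : insert 0 (Suc ` S) ==> Comp C (F i) w = Comp C (?x i) p"
  proof (rule liftableD[of C W "insert 0 (Suc ` S)" F G U ?x, OF L U(1)])
   show "?x i : Mor C" "Dom C (?x i) = U" "Cod C (?x i) = Cod C (F i)" if "i : insert 0 (Suc ` S)" for i
    using that U(2,3) by (auto simp: Hom_def)
   show "Comp C (G i j) (?x i) = Comp C (G j i) (?x j)" if ij: "i : insert 0 (Suc ` S)" "j : insert 0 (Suc ` S)" "i ~= j" for i j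
   proof -
    consider (a) l where "i = 0" "j = Suc l" "l : S" | (b) l where "i = Suc l" "j = 0" "l : S"
     | (c) l m where "i = Suc l" "j = Suc m" "l : S" "m : S" "l ~= m" using ij by blast
    then show ?thesis
    proof cases
     case a from U(4)[rule_format, OF a(3)] show ?thesis unfolding a(1,2) nat.case .
    next
     case b from U(4)[rule_format, OF b(3)] show ?thesis unfolding b(1,2) nat.case by (rule sym)
    next
     case c from U(5)[rule_format, OF c(3-5)] show ?thesis unfolding c(1,2) nat.case .
    qed
   qed
  qed blast
  have "w : Hom C (Dom C p) W" using p by (simp add: Hom_def)
  moreover have "Comp C (F 0) w = Comp C h p" using e[of 0] by simp
  moreover have "ALL i:S. Comp C (F (Suc i)) w = Comp C (z i) p" using e[of "Suc _"] by simp
  ultimately show "EX p w. re C p & Cod C p = U & w : Hom C (Dom C p) W & Comp C (F 0) w = Comp C h p &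
    (ALL i:S. Comp C (F (Suc i)) w = Comp C (z i) p)" using p(1,2) by blast
 qed
next
 assume R: ?R
 show ?L
 proof (rule liftableI)
  fix U x assume U: "U : Obj C" and x: "!!i. i : insert 0 (Suc ` S) ==> x i : Mor C" "!!i. i : insert 0 (Suc ` S) ==> Dom C (x i) = U"
    "!!i. i : insert 0 (Suc ` S) ==> Cod C (x i) = Cod C (F i)"
   and c: "!!i j. [|i : insert 0 (Suc ` S); j : insert 0 (Suc ` S); i ~= j|] ==> Comp C (G i j) (x i) = Comp C (G j i) (x j)"
  have "EX p w. re C p & Cod C p = U & w : Hom C (Dom C p) W & Comp C (F 0) w = Comp C (x 0) p &
    (ALL i:S. Comp C (F (Suc i)) w = Comp C (x (Suc i)) p)"
  proof (rule R[rule_format], intro conjI ballI impI)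
   show "Comp C (G 0 (Suc i)) (x 0) = Comp C (G (Suc i) 0) (x (Suc i))" if "i : S" for i by (rule c) (use that in auto)
   show "Comp C (G (Suc i) (Suc j)) (x (Suc i)) = Comp C (G (Suc j) (Suc i)) (x (Suc j))" if "i : S" "j : S" "i ~= j" for i j
    by (rule c) (use that in auto)
  qed (use U x in \<open>auto simp: Hom_def\<close>)
  then show "EX p w. re C p & Cod C p = U & w : Mor C & Dom C w = Dom C p & Cod C w = W &
    (ALL i:insert 0 (Suc ` S). Comp C (F i) w = Comp C (x i) p)" by (auto simp: Hom_def)
 qed
qed

context EM_tower begin

abbreviation bcomp (infixr "***" 70) where "g *** f \<equiv> Comp BX g f"
abbreviation H where "H \<equiv> Hom BX"

lemma acomp_H: "x : Hom (AR n) A B ==> acomp n b x : H (avtx X n b A) (avtx X n b B)"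
 by (rule acomp_Hom)

lemma adir_H: assumes "A : Obj (AR n)" "i < n" "b i = 1"
 shows "adir X n i b A : H (avtx X n b A) (avtx X n (b(i := 0)) A)"
 using adir_Hom[OF assms(1,2), of b] assms(3) by (simp add: fun_upd_idem)

lemma adir_nat: assumes "x : Hom (AR n) A B" "i < n" "b i = 1"
 shows "adir X n i b B *** acomp n b x = acomp n (b(i := 0)) x *** adir X n i b A"
 using adir_natural[OF assms(1,2), of b] assms(3) by (simp add: fun_upd_idem)

lemma adir_nat_el: assumes "x : Hom (AR n) A B" "i < n" "b i = 1" "w : H U (avtx X n b A)"
 shows "adir X n i b B *** acomp n b x *** w = acomp n (b(i := 0)) x *** adir X n i b A *** w"
proof -
 interpret A: CCat "AR n" by (rule AR)
 note O = A.Hom_obj[OF assms(1)]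
 have "adir X n i b B *** acomp n b x *** w = (adir X n i b B *** acomp n b x) *** w"
  by (rule E.Hom_assoc[OF assms(4) acomp_H[OF assms(1)] adir_H[of B n i b, OF O(2) assms(2,3)], symmetric])
 also have "... = acomp n (b(i := 0)) x *** adir X n i b A *** w"
  unfolding adir_nat[of x n A B i b, OF assms(1-3)] by (rule E.Hom_assoc[OF assms(4) adir_H[of A n i b, OF O(1) assms(2,3)] acomp_H[OF assms(1)]])
 finally show ?thesis .
qed


lemma acomp_cmp_el: assumes "x : Hom (AR n) A B" "y : Hom (AR n) B D" "w : H U (avtx X n b A)"
 shows "acomp n b y *** acomp n b x *** w = acomp n b (Comp (AR n) y x) *** w"
 unfolding acomp_Comp[OF assms(1,2)] by (rule E.Hom_assoc[OF assms(3) acomp_H[OF assms(1)] acomp_H[OF assms(2)], symmetric])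

lemma lifts_one: assumes A: "A : Mor BX" shows "liftable BX (Dom BX A) {i} (%_. A) g <-> re BX A"
proof
 assume L: "liftable BX (Dom BX A) {i} (%_. A) g"
 have O: "Cod BX A : Obj BX" using E.Hom_obj(2)[OF E.HomI[OF A refl refl]] .
 note I = E.HomD[OF E.Hom_Id[OF O]]
 obtain p w where "re BX p" "Cod BX p = Cod BX A" "w : Mor BX" "Dom BX w = Dom BX p" "Cod BX w = Dom BX A"
   and "A *** w = Id BX (Cod BX A) *** p"
  using liftableD[OF L O, of "%_. Id BX (Cod BX A)"] I by auto
 moreover have "Id BX (Cod BX A) *** p = p" using E.Hom_unit(2)[OF E.HomI[OF E.re_mor]] calculation(1,2) by simp
 ultimately show "re BX A" by (intro E.re_local[OF A, of p w]) auto
next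
 assume r: "re BX A"
 show "liftable BX (Dom BX A) {i} (%_. A) g"
 proof (rule liftableI)
  fix U x assume U: "U : Obj BX" and x: "!!j. j : {i} ==> x j : Mor BX" "!!j. j : {i} ==> Dom BX (x j) = U"
   "!!j. j : {i} ==> Cod BX (x j) = Cod BX A"
  obtain p q where "re BX q" "p : Mor BX" "q : Mor BX" "Cod BX q = Dom BX (x i)" "Cod BX p = Dom BX A"
   "Dom BX p = Dom BX q" "A *** p = x i *** q" by (rule E.re_lift[OF r, of "x i"]) (use x in auto)
  then show "EX p w. re BX p & Cod BX p = U & w : Mor BX & Dom BX w = Dom BX p & Cod BX w = Dom BX A &
    (ALL j:{i}. A *** w = x j *** p)" using x(2)[of i] by (intro exI[of _ q] exI[of _ p]) (simp del: base_sel)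
 qed
qed

end

locale cube = EM_tower X for X :: "('o, 'm) cat" +
 fixes n :: nat and f g x1 x0 p q k D M N Z P :: "('o, 'm) cell"
 assumes f: "f : Hom (AR n) D N" and g: "g : Hom (AR n) M Z" and x1: "x1 : Hom (AR n) D M" and x0: "x0 : Hom (AR n) N Z"
  and sq: "Comp (AR n) g x1 = Comp (AR n) x0 f" and pb: "pb (AR n) g x0 p q"
  and p: "p : Hom (AR n) P M" and q: "q : Hom (AR n) P N" and k: "k : Hom (AR n) D P"
  and pk: "Comp (AR n) p k = x1" and qk: "Comp (AR n) q k = f"
begin

abbreviation Q where "Q \<equiv> Sq f g x1 x0"

lemma obs: "D : Obj (AR n)" "N : Obj (AR n)" "M : Obj (AR n)" "Z : Obj (AR n)" "P : Obj (AR n)"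
proof -
 interpret A: CCat "AR n" by (rule AR)
 show "D : Obj (AR n)" "N : Obj (AR n)" "M : Obj (AR n)" "Z : Obj (AR n)" "P : Obj (AR n)"
  using A.Hom_obj f g p by blast+
qed

lemma Dom_Cod [simp]: "Dom (AR n) f = D" "Cod (AR n) f = N" "Dom (AR n) g = M" "Cod (AR n) g = Z" "Dom (AR n) x1 = D" "Cod (AR n) x1 = M"
  "Dom (AR n) x0 = N" "Cod (AR n) x0 = Z" "Dom (AR n) k = D" "Cod (AR n) k = P" "Dom (AR (Suc n)) Q = f" "Cod (AR (Suc n)) Q = g"
  "Dom (AR n) p = P"
 using f g x1 x0 k p by (auto simp: Hom_def n_Suc)

lemma H_Cod: "u : H a b ==> Cod BX u = b" "u : H a b ==> Dom BX u = a" by (auto simp: Hom_def)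

lemma joint: assumes "u : H U (avtx X n b P)" "v : H U (avtx X n b P)" "acomp n b p *** u = acomp n b p *** v" "acomp n b q *** u = acomp n b q *** v"
 shows "u = v"
 by (rule E.pb_uniqueH[OF acomp_pb[OF pb, of b]]) (use assms H_Cod[OF acomp_H[OF p, of b]] in auto)

lemma pair: assumes "u : H U (avtx X n b M)" "v : H U (avtx X n b N)" "acomp n b g *** u = acomp n b x0 *** v"
 obtains h where "h : H U (avtx X n b P)" "acomp n b p *** h = u" "acomp n b q *** h = v"
 using E.pb_exH[OF acomp_pb[OF pb, of b], of u U v] assms H_Cod[OF acomp_H[OF p, of b]] H_Cod[OF acomp_H[OF g, of b]] H_Cod[OF acomp_H[OF x0, of b]] by auto

context
 fixes S and b :: "nat => nat"
 assumes S: "S <= {..<n}" and b: "ALL t:S. b t = 1"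
begin

lemma Sb: "i : S ==> i < n" "i : S ==> b i = 1" using S b by auto

lemma adir_S: "A : Obj (AR n) ==> i : S ==> adir X n i b A : H (avtx X n b A) (avtx X n (b(i := 0)) A)"
 by (rule adir_H) (use Sb in auto)

abbreviation "ad \<equiv> adir X n"
abbreviation "av \<equiv> avtx X n"

lemma lifts_k: "lifts_at X (Suc n) k (insert 0 (Suc ` S)) (case_nat 1 b) <->
 (ALL U h z. U : Obj BX & h : H U (av b P) & (ALL i:S. z i : H U (av (b(i := 0)) D)) &
   (ALL i:S. ad i b P *** h = acomp n (b(i := 0)) k *** z i) &
   (ALL i:S. ALL j:S. i ~= j --> ad j (b(i := 0)) D *** z i = ad i (b(j := 0)) D *** z j) -->
   (EX r w. re BX r & Cod BX r = U & w : H (Dom BX r) (av b D) & acomp n b k *** w = h *** r &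
    (ALL i:S. ad i b D *** w = z i *** r)))"
 unfolding lifts_at_def liftable_0Suc
 using H_Cod[OF acomp_H[OF k]] H_Cod[OF adir_S[OF obs(1)]] by (simp cong: conj_cong)

lemma lifts_x0: "lifts_at X (Suc n) x0 (insert 0 (Suc ` S)) (case_nat 1 b) <->
 (ALL U h z. U : Obj BX & h : H U (av b Z) & (ALL i:S. z i : H U (av (b(i := 0)) N)) &
   (ALL i:S. ad i b Z *** h = acomp n (b(i := 0)) x0 *** z i) &
   (ALL i:S. ALL j:S. i ~= j --> ad j (b(i := 0)) N *** z i = ad i (b(j := 0)) N *** z j) -->
   (EX r w. re BX r & Cod BX r = U & w : H (Dom BX r) (av b N) & acomp n b x0 *** w = h *** r &
    (ALL i:S. ad i b N *** w = z i *** r)))"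
 unfolding lifts_at_def liftable_0Suc
 using H_Cod[OF acomp_H[OF x0]] H_Cod[OF adir_S[OF obs(2)]] by (simp cong: conj_cong)

lemma lifts_Q: "lifts_at X (Suc (Suc n)) Q (insert 0 (Suc ` insert 0 (Suc ` S))) (case_nat 1 (case_nat 1 b)) <->
 (ALL U y z. U : Obj BX & y : H U (av b M) & z 0 : H U (av b N) & (ALL i:S. z (Suc i) : H U (av (b(i := 0)) D)) &
   acomp n b g *** y = acomp n b x0 *** z 0 &
   (ALL i:S. ad i b M *** y = acomp n (b(i := 0)) x1 *** z (Suc i)) &
   (ALL i:S. ad i b N *** z 0 = acomp n (b(i := 0)) f *** z (Suc i)) &
   (ALL i:S. ALL j:S. i ~= j --> ad j (b(i := 0)) D *** z (Suc i) = ad i (b(j := 0)) D *** z (Suc j)) -->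
   (EX r w. re BX r & Cod BX r = U & w : H (Dom BX r) (av b D) & acomp n b x1 *** w = y *** r &
    acomp n b f *** w = z 0 *** r & (ALL i:S. ad i b D *** w = z (Suc i) *** r)))" (is "_ <-> ?R")
proof -
 have a: "(ALL i:insert 0 (Suc ` S). ALL j:insert 0 (Suc ` S). i ~= j --> B i j = B j i) <->
   (ALL i:S. B 0 (Suc i) = B (Suc i) 0) & (ALL i:S. ALL j:S. i ~= j --> B (Suc i) (Suc j) = B (Suc j) (Suc i))" for B :: "nat => nat => ('o, 'm) cell"
  by auto
 show ?thesis
  unfolding lifts_at_def liftable_0Suc a
  using H_Cod[OF acomp_H[OF f]] H_Cod[OF acomp_H[OF x1]] H_Cod[OF adir_S[OF obs(1)]]
  by (simp add: conj_ac cong: conj_cong)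
qed

lemma pbc: "Comp (AR n) g p = Comp (AR n) x0 q"
 using pb unfolding is_pullback_def by blast

lemma lifts_both: "lifts_at X (Suc (Suc n)) Q (insert 0 (Suc ` insert 0 (Suc ` S))) (case_nat 1 (case_nat 1 b)) <->
  lifts_at X (Suc n) k (insert 0 (Suc ` S)) (case_nat 1 b)"
proof
 assume LQ: "lifts_at X (Suc (Suc n)) Q (insert 0 (Suc ` insert 0 (Suc ` S))) (case_nat 1 (case_nat 1 b))"
 show "lifts_at X (Suc n) k (insert 0 (Suc ` S)) (case_nat 1 b)"
  unfolding lifts_k
 proof (intro allI impI, elim conjE)
  fix U h z assume U: "U : Obj BX" and h: "h : H U (av b P)" and z: "ALL i:S. z i : H U (av (b(i := 0)) D)"
   and hz: "ALL i:S. ad i b P *** h = acomp n (b(i := 0)) k *** z i"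
   and zz: "ALL i:S. ALL j:S. i ~= j --> ad j (b(i := 0)) D *** z i = ad i (b(j := 0)) D *** z j"
  let ?y = "acomp n b p *** h" and ?v = "acomp n b q *** h"
  have y: "?y : H U (av b M)" and v: "?v : H U (av b N)" by (rule E.Hom_cmp[OF h acomp_H] p q)+
  have yv: "acomp n b g *** ?y = acomp n b x0 *** ?v"
   unfolding acomp_cmp_el[OF p g h] acomp_cmp_el[OF q x0 h] pbc ..
  have yz: "ad i b M *** ?y = acomp n (b(i := 0)) x1 *** z i" if i: "i : S" for i
   unfolding adir_nat_el[OF p Sb(1)[OF i] Sb(2)[OF i] h] hz[rule_format, OF i] acomp_cmp_el[OF k p z[rule_format, OF i]] pk ..
  have vz: "ad i b N *** ?v = acomp n (b(i := 0)) f *** z i" if i: "i : S" for i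
   unfolding adir_nat_el[OF q Sb(1)[OF i] Sb(2)[OF i] h] hz[rule_format, OF i] acomp_cmp_el[OF k q z[rule_format, OF i]] qk ..
  have "EX r w. re BX r & Cod BX r = U & w : H (Dom BX r) (av b D) & acomp n b x1 *** w = ?y *** r &
    acomp n b f *** w = ?v *** r & (ALL i:S. ad i b D *** w = z i *** r)"
   by (rule mp[OF LQ[unfolded lifts_Q, THEN spec, of U, THEN spec, of ?y, THEN spec, of "case_nat ?v z", unfolded nat.case]])
    (use U y v z yv yz vz zz in blast)
  then obtain r w where r: "re BX r" "Cod BX r = U" and w: "w : H (Dom BX r) (av b D)"
   and e: "acomp n b x1 *** w = ?y *** r" "acomp n b f *** w = ?v *** r" "ALL i:S. ad i b D *** w = z i *** r" by blast
  have r': "r : H (Dom BX r) U" using E.HomI[OF E.re_mor[OF r(1)] refl r(2)] .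
  have "acomp n b k *** w = h *** r"
  proof (rule joint)
   show "acomp n b k *** w : H (Dom BX r) (av b P)" by (rule E.Hom_cmp[OF w acomp_H[OF k]])
   show "h *** r : H (Dom BX r) (av b P)" by (rule E.Hom_cmp[OF r' h])
   show "acomp n b p *** acomp n b k *** w = acomp n b p *** h *** r"
    unfolding acomp_cmp_el[OF k p w] pk e(1) by (rule E.Hom_assoc[OF r' h acomp_H[OF p]])
   show "acomp n b q *** acomp n b k *** w = acomp n b q *** h *** r"
    unfolding acomp_cmp_el[OF k q w] qk e(2) by (rule E.Hom_assoc[OF r' h acomp_H[OF q]])
  qed
  then show "EX r w. re BX r & Cod BX r = U & w : H (Dom BX r) (av b D) & acomp n b k *** w = h *** r &
    (ALL i:S. ad i b D *** w = z i *** r)" using r w e(3) by blast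
 qed
next
 assume Lk: "lifts_at X (Suc n) k (insert 0 (Suc ` S)) (case_nat 1 b)"
 show "lifts_at X (Suc (Suc n)) Q (insert 0 (Suc ` insert 0 (Suc ` S))) (case_nat 1 (case_nat 1 b))"
  unfolding lifts_Q
 proof (intro allI impI, elim conjE)
  fix U y z assume U: "U : Obj BX" and y: "y : H U (av b M)" and v: "z 0 : H U (av b N)" and z: "ALL i:S. z (Suc i) : H U (av (b(i := 0)) D)"
   and yv: "acomp n b g *** y = acomp n b x0 *** z 0"
   and yz: "ALL i:S. ad i b M *** y = acomp n (b(i := 0)) x1 *** z (Suc i)"
   and vz: "ALL i:S. ad i b N *** z 0 = acomp n (b(i := 0)) f *** z (Suc i)"
   and zz: "ALL i:S. ALL j:S. i ~= j --> ad j (b(i := 0)) D *** z (Suc i) = ad i (b(j := 0)) D *** z (Suc j)"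
  obtain h where h: "h : H U (av b P)" and ph: "acomp n b p *** h = y" and qh: "acomp n b q *** h = z 0"
   by (rule pair[OF y v yv])
  have hz: "ad i b P *** h = acomp n (b(i := 0)) k *** z (Suc i)" if i: "i : S" for i
  proof (rule joint)
   note zi = z[rule_format, OF i]
   show "ad i b P *** h : H U (av (b(i := 0)) P)" by (rule E.Hom_cmp[OF h adir_S[OF obs(5) i]])
   show "acomp n (b(i := 0)) k *** z (Suc i) : H U (av (b(i := 0)) P)" by (rule E.Hom_cmp[OF zi acomp_H[OF k]])
   show "acomp n (b(i := 0)) p *** ad i b P *** h = acomp n (b(i := 0)) p *** acomp n (b(i := 0)) k *** z (Suc i)"
    unfolding adir_nat_el[OF p Sb(1)[OF i] Sb(2)[OF i] h, symmetric] ph acomp_cmp_el[OF k p zi] pk by (rule yz[rule_format, OF i])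
   show "acomp n (b(i := 0)) q *** ad i b P *** h = acomp n (b(i := 0)) q *** acomp n (b(i := 0)) k *** z (Suc i)"
    unfolding adir_nat_el[OF q Sb(1)[OF i] Sb(2)[OF i] h, symmetric] qh acomp_cmp_el[OF k q zi] qk by (rule vz[rule_format, OF i])
  qed
  have "EX r w. re BX r & Cod BX r = U & w : H (Dom BX r) (av b D) & acomp n b k *** w = h *** r &
    (ALL i:S. ad i b D *** w = z (Suc i) *** r)"
   by (rule mp[OF Lk[unfolded lifts_k, THEN spec, of U, THEN spec, of h, THEN spec, of "%i. z (Suc i)"]])
    (use U h z hz zz in blast)
  then obtain r w where r: "re BX r" "Cod BX r = U" and w: "w : H (Dom BX r) (av b D)"
   and e: "acomp n b k *** w = h *** r" "ALL i:S. ad i b D *** w = z (Suc i) *** r" by blast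
  have r': "r : H (Dom BX r) U" using E.HomI[OF E.re_mor[OF r(1)] refl r(2)] .
  have "acomp n b x1 *** w = y *** r"
   unfolding pk[symmetric] acomp_cmp_el[OF k p w, symmetric] e(1) ph[symmetric] by (rule E.Hom_assoc[OF r' h acomp_H[OF p], symmetric])
  moreover have "acomp n b f *** w = z 0 *** r"
   unfolding qk[symmetric] acomp_cmp_el[OF k q w, symmetric] e(1) qh[symmetric] by (rule E.Hom_assoc[OF r' h acomp_H[OF q], symmetric])
  ultimately show "EX r w. re BX r & Cod BX r = U & w : H (Dom BX r) (av b D) & acomp n b x1 *** w = y *** r &
    acomp n b f *** w = z 0 *** r & (ALL i:S. ad i b D *** w = z (Suc i) *** r)" using r w e(2) by blast
 qed
qed

lemma lifts_P: assumes LM: "lifts_at X n M S b" and Lx: "lifts_at X (Suc n) x0 (insert 0 (Suc ` S)) (case_nat 1 b)"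
 shows "lifts_at X n P S b"
 unfolding lifts_at_def
proof (rule liftableI)
 fix U z assume U: "U : Obj BX" and z: "!!i. i : S ==> z i : Mor BX" "!!i. i : S ==> Dom BX (z i) = U"
   "!!i. i : S ==> Cod BX (z i) = Cod BX (ad i b P)"
  and zz: "!!i j. [|i : S; j : S; i ~= j|] ==> ad j (b(i := 0)) P *** z i = ad i (b(j := 0)) P *** z j"
 have zH: "z i : H U (av (b(i := 0)) P)" if i: "i : S" for i
  using z[OF i] H_Cod[OF adir_S[OF obs(5) i]] by (intro E.HomI) auto
 have nz: "ad j (b(i := 0)) B *** acomp n (b(i := 0)) x *** z i = acomp n (b(i := 0, j := 0)) x *** ad j (b(i := 0)) P *** z i"
  if x: "x : Hom (AR n) P B" and ij: "i : S" "j : S" "i ~= j" for x B i j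
  by (rule adir_nat_el[OF x Sb(1)[OF ij(2)] _ zH[OF ij(1)]]) (use ij Sb(2)[OF ij(2)] in simp)
 have cz: "ad j (b(i := 0)) B *** acomp n (b(i := 0)) x *** z i = ad i (b(j := 0)) B *** acomp n (b(j := 0)) x *** z j"
  if x: "x : Hom (AR n) P B" and ij: "i : S" "j : S" "i ~= j" for x B i j
  unfolding nz[OF x ij] nz[OF x ij(2,1) ij(3)[symmetric]] zz[OF ij] fun_upd_twist[OF ij(3)] ..
 obtain r1 w1 where r1: "re BX r1" "Cod BX r1 = U" and w1: "w1 : Mor BX" "Dom BX w1 = Dom BX r1" "Cod BX w1 = av b M"
   and e1: "!!i. i : S ==> ad i b M *** w1 = (acomp n (b(i := 0)) p *** z i) *** r1"
 proof (rule liftableD[OF LM[unfolded lifts_at_def] U, of "%i. acomp n (b(i := 0)) p *** z i"])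
  fix i assume i: "i : S"
  have "acomp n (b(i := 0)) p *** z i : H U (av (b(i := 0)) M)" by (rule E.Hom_cmp[OF zH[OF i] acomp_H[OF p]])
  from E.HomD[OF this] show "acomp n (b(i := 0)) p *** z i : Mor BX" "Dom BX (acomp n (b(i := 0)) p *** z i) = U"
   "Cod BX (acomp n (b(i := 0)) p *** z i) = Cod BX (ad i b M)" using H_Cod[OF adir_S[OF obs(3) i]] by auto
 qed (use cz[OF p] in blast)+
 let ?U1 = "Dom BX r1"
 have r1': "r1 : H ?U1 U" using E.HomI[OF E.re_mor[OF r1(1)] refl r1(2)] .
 have w1': "w1 : H ?U1 (av b M)" using E.HomI[OF w1] .
 let ?y = "%i. (acomp n (b(i := 0)) q *** z i) *** r1"
 have qz: "acomp n (b(i := 0)) q *** z i : H U (av (b(i := 0)) N)" if i: "i : S" for i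
  by (rule E.Hom_cmp[OF zH[OF i] acomp_H[OF q]])
 have yH: "?y i : H ?U1 (av (b(i := 0)) N)" if i: "i : S" for i
  by (rule E.Hom_cmp[OF r1' qz[OF i]])
 have zr: "z i *** r1 : H ?U1 (av (b(i := 0)) P)" if i: "i : S" for i by (rule E.Hom_cmp[OF r1' zH[OF i]])
 have as: "(acomp n (b(i := 0)) x *** z i) *** r1 = acomp n (b(i := 0)) x *** z i *** r1" if "i : S" "x : Hom (AR n) P B" for i x B
  by (rule E.Hom_assoc[OF r1' zH[OF that(1)] acomp_H[OF that(2)]])
 have gy: "ad i b Z *** acomp n b g *** w1 = acomp n (b(i := 0)) x0 *** ?y i" if i: "i : S" for i
  unfolding adir_nat_el[OF g Sb(1)[OF i] Sb(2)[OF i] w1'] e1[OF i] as[OF i p] as[OF i q]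
   acomp_cmp_el[OF p g zr[OF i]] acomp_cmp_el[OF q x0 zr[OF i]] pbc ..
 have O1: "?U1 : Obj BX" using E.Hom_obj[OF r1'] by blast
 have yy: "ad j (b(i := 0)) N *** ?y i = ad i (b(j := 0)) N *** ?y j" if ij: "i : S" "j : S" "i ~= j" for i j
 proof -
  have J: "ad j (b(i := 0)) N : H (av (b(i := 0)) N) (av (b(i := 0, j := 0)) N)" "ad i (b(j := 0)) N : H (av (b(j := 0)) N) (av (b(j := 0, i := 0)) N)"
   by (rule adir_H; use obs(2) ij Sb in simp)+
  show ?thesis
   unfolding E.Hom_assoc[OF r1' qz[OF ij(1)] J(1), symmetric] E.Hom_assoc[OF r1' qz[OF ij(2)] J(2), symmetric] cz[OF q ij] ..
 qed
 have "EX r w. re BX r & Cod BX r = ?U1 & w : H (Dom BX r) (av b N) & acomp n b x0 *** w = (acomp n b g *** w1) *** r &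
    (ALL i:S. ad i b N *** w = ?y i *** r)"
  by (rule mp[OF Lx[unfolded lifts_x0, THEN spec, of ?U1, THEN spec, of "acomp n b g *** w1", THEN spec, of ?y]])
   (use O1 E.Hom_cmp[OF w1' acomp_H[OF g]] yH gy yy in blast)
 then obtain r w where r: "re BX r" "Cod BX r = ?U1" and w: "w : H (Dom BX r) (av b N)"
  and e: "acomp n b x0 *** w = (acomp n b g *** w1) *** r" "ALL i:S. ad i b N *** w = ?y i *** r" by blast
 have r': "r : H (Dom BX r) ?U1" using E.HomI[OF E.re_mor[OF r(1)] refl r(2)] .
 have wr: "w1 *** r : H (Dom BX r) (av b M)" by (rule E.Hom_cmp[OF r' w1'])
 obtain h where h: "h : H (Dom BX r) (av b P)" and ph: "acomp n b p *** h = w1 *** r" and qh: "acomp n b q *** h = w"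
  by (rule pair[OF wr w]) (use e(1) E.Hom_assoc[OF r' w1' acomp_H[OF g]] in auto)
 have rr: "r1 *** r : H (Dom BX r) U" by (rule E.Hom_cmp[OF r' r1'])
 have "ad i b P *** h = z i *** r1 *** r" if i: "i : S" for i
 proof (rule joint)
  have zrr: "z i *** r1 *** r = (z i *** r1) *** r" by (rule E.Hom_assoc[OF r' r1' zH[OF i], symmetric])
  show "ad i b P *** h : H (Dom BX r) (av (b(i := 0)) P)" by (rule E.Hom_cmp[OF h adir_S[OF obs(5) i]])
  show "z i *** r1 *** r : H (Dom BX r) (av (b(i := 0)) P)" by (rule E.Hom_cmp[OF rr zH[OF i]])
  show "acomp n (b(i := 0)) p *** ad i b P *** h = acomp n (b(i := 0)) p *** z i *** r1 *** r"
   unfolding adir_nat_el[OF p Sb(1)[OF i] Sb(2)[OF i] h, symmetric] ph E.Hom_assoc[OF r' w1' adir_S[OF obs(3) i], symmetric] e1[OF i] as[OF i p] zrr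
   by (rule E.Hom_assoc[OF r' zr[OF i] acomp_H[OF p]])
  show "acomp n (b(i := 0)) q *** ad i b P *** h = acomp n (b(i := 0)) q *** z i *** r1 *** r"
   unfolding adir_nat_el[OF q Sb(1)[OF i] Sb(2)[OF i] h, symmetric] qh e(2)[rule_format, OF i] as[OF i q] zrr
   by (rule E.Hom_assoc[OF r' zr[OF i] acomp_H[OF q]])
 qed
 moreover have "re BX (r1 *** r)" by (rule E.re_cmp[OF r(1) r1(1) r(2)])
 moreover have "Cod BX (r1 *** r) = U" "Dom BX (r1 *** r) = Dom BX r" using E.HomD[OF rr] by auto
 ultimately show "EX p w. re BX p & Cod BX p = U & w : Mor BX & Dom BX w = Dom BX p & Cod BX w = av b P &
    (ALL i:S. ad i b P *** w = z i *** p)"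
  using E.HomD[OF h] by (intro exI[of _ "r1 *** r"] exI[of _ h]) (simp del: base_sel)
qed

end

end

definition top_lifts :: "('o, 'm) cat => nat => ('o, 'm) cell => bool" where
 "top_lifts X n A <-> (ALL S b. S <= {..<n} & (ALL j. b j : {0, 1}) & (ALL t:S. b t = 1) -->
   lifts_at X (Suc n) A (insert 0 (Suc ` S)) (case_nat 1 b))"

lemma nat_set_cases: obtains "0 ~: T" "T = Suc ` {i. Suc i : T}" | "0 : T" "T = insert 0 (Suc ` {i. Suc i : T})"
proof (cases "0 : T")
 case True
 have "T = insert 0 (Suc ` {i. Suc i : T})" (is "_ = ?R")
 proof (rule set_eqI)
  fix i show "i : T <-> i : ?R" by (cases i) (use True in auto)
 qed
 with that True show ?thesis by blast
next
 case False
 have "T = Suc ` {i. Suc i : T}" (is "_ = ?R")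
 proof (rule set_eqI)
  fix i show "i : T <-> i : ?R" by (cases i) (use False in auto)
 qed
 with that False show ?thesis by blast
qed

lemma case_bin: "(ALL j. case_nat k b j : {0, 1}) <-> k : {0, 1} & (ALL j. b j : {0, 1})" for k :: nat
 by (auto split: nat.splits dest: spec[of _ "Suc _"] spec[of _ 0])

lemma all_lifts_Suc: "all_lifts X (Suc n) A <->
 all_lifts X n (Dom (Arr_n X n) A) & all_lifts X n (Cod (Arr_n X n) A) & top_lifts X n A" (is "?L <-> ?R")
proof
 assume L: ?L
 have v: "all_lifts X n (sq_vertex (Arr_n X n) k A)" if k: "k : {0, 1}" for k
  unfolding all_lifts_def
 proof (intro allI impI, elim conjE)
  fix S and b :: "nat => nat" assume S: "S <= {..<n}" "S ~= {}" and b: "ALL j. b j : {0, 1}" "ALL t:S. b t = 1"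
  have "lifts_at X (Suc n) A (Suc ` S) (case_nat k b)"
   by (rule L[unfolded all_lifts_def, rule_format]) (use S b k case_bin[of k b] in auto)
  then show "lifts_at X n (sq_vertex (Arr_n X n) k A) S b" unfolding lifts_Suc .
 qed
 have "top_lifts X n A" unfolding top_lifts_def
 proof (intro allI impI, elim conjE)
  fix S and b :: "nat => nat" assume S: "S <= {..<n}" and b: "ALL j. b j : {0, 1}" "ALL t:S. b t = 1"
  show "lifts_at X (Suc n) A (insert 0 (Suc ` S)) (case_nat 1 b)"
   by (rule L[unfolded all_lifts_def, rule_format]) (use S b case_bin[of 1 b] in auto)
 qed
 then show ?R using v[of 0] v[of 1] by simp
next
 assume R: ?R
 show ?L unfolding all_lifts_def
 proof (intro allI impI, elim conjE)
  fix T and a :: "nat => nat" assume T: "T <= {..<Suc n}" "T ~= {}" and a: "ALL j. a j : {0, 1}" "ALL t:T. a t = 1"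
  obtain k b where ab: "a = case_nat k b" using case_eta by blast
  have kb: "k : {0, 1}" "ALL j. b j : {0, 1}" using a(1)[unfolded ab case_bin] by auto
  let ?S = "{i. Suc i : T}"
  have S: "?S <= {..<n}" "ALL t:?S. b t = 1" using T bspec[OF a(2), of "Suc _"] unfolding ab by auto
  show "lifts_at X (Suc n) A T a"
  proof (cases rule: nat_set_cases[of T])
   case 1
   have "?S ~= {}" using T(2) 1 by auto
   moreover have "all_lifts X n (sq_vertex (Arr_n X n) k A)" using R kb(1) by auto
   ultimately have "lifts_at X n (sq_vertex (Arr_n X n) k A) ?S b"
    using S kb(2) unfolding all_lifts_def by blast
   then have "lifts_at X (Suc n) A (Suc ` ?S) (case_nat k b)" unfolding lifts_Suc .
   then show ?thesis unfolding ab using 1(2) by argo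
  next
   case 2
   have k: "k = 1" using bspec[OF a(2) 2(1)] unfolding ab by simp
   have "lifts_at X (Suc n) A (insert 0 (Suc ` ?S)) (case_nat 1 b)"
    using R S kb(2) unfolding top_lifts_def by blast
   then show ?thesis unfolding ab k using 2(2) by argo
  qed
 qed
qed

context cube begin

lemma Q_obj: "Q : Obj (AR (Suc (Suc n)))"
proof -
 interpret A: CCat "AR n" by (rule AR)
 have "f : Mor (AR n)" "g : Mor (AR n)" using A.HomD f g by blast+
 from A.SqI[OF this, of x1 x0] show ?thesis using x1 x0 sq by (simp add: n_Suc Hom_def)
qed

lemma top_lifts_Q: "top_lifts X (Suc n) Q <-> top_lifts X n x1 & top_lifts X n x0 & top_lifts X n k"
proof -
 have t: "lifts_at X (Suc (Suc n)) Q (insert 0 (Suc ` Suc ` S)) (case_nat 1 (case_nat l b)) <->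
   lifts_at X (Suc n) (sq_component l Q) (insert 0 (Suc ` S)) (case_nat 1 b)" for S l b
 proof -
  have s: "swap ` insert 0 (Suc ` Suc ` S) = Suc ` insert 0 (Suc ` S)" by (auto simp: image_image)
  show ?thesis unfolding lifts_transp[OF Q_obj, symmetric] s lifts_Suc transp_vertex[OF Q_obj] ..
 qed
 show ?thesis
 proof
  assume L: "top_lifts X (Suc n) Q"
  have "top_lifts X n (sq_component l Q)" if l: "l : {0, 1}" for l unfolding top_lifts_def
  proof (intro allI impI, elim conjE)
   fix S and b :: "nat => nat" assume "S <= {..<n}" "ALL j. b j : {0, 1}" "ALL t:S. b t = 1"
   then show "lifts_at X (Suc n) (sq_component l Q) (insert 0 (Suc ` S)) (case_nat 1 b)"
    unfolding t[symmetric] by (intro L[unfolded top_lifts_def, rule_format]) (use l case_bin[of l b] in auto)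
  qed
  from this[of 0] this[of 1] have "top_lifts X n x0" "top_lifts X n x1" by simp_all
  moreover have "top_lifts X n k" unfolding top_lifts_def
  proof (intro allI impI, elim conjE)
   fix S and b :: "nat => nat" assume S: "S <= {..<n}" "ALL j. b j : {0, 1}" "ALL t:S. b t = 1"
   show "lifts_at X (Suc n) k (insert 0 (Suc ` S)) (case_nat 1 b)"
    unfolding lifts_both[OF S(1,3), symmetric] by (intro L[unfolded top_lifts_def, rule_format]) (use S case_bin[of 1 b] in auto)
  qed
  ultimately show "top_lifts X n x1 & top_lifts X n x0 & top_lifts X n k" by blast
 next
  assume R: "top_lifts X n x1 & top_lifts X n x0 & top_lifts X n k"
  show "top_lifts X (Suc n) Q" unfolding top_lifts_def
  proof (intro allI impI, elim conjE)
   fix T and a :: "nat => nat" assume T: "T <= {..<Suc n}" and a: "ALL j. a j : {0, 1}" "ALL t:T. a t = 1"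
   obtain l b where ab: "a = case_nat l b" using case_eta by blast
   have kb: "l : {0, 1}" "ALL j. b j : {0, 1}" using a(1)[unfolded ab case_bin] by auto
   let ?S = "{i. Suc i : T}"
   have S: "?S <= {..<n}" "ALL t:?S. b t = 1" using T bspec[OF a(2), of "Suc _"] unfolding ab by auto
   show "lifts_at X (Suc (Suc n)) Q (insert 0 (Suc ` T)) (case_nat 1 a)"
   proof (cases rule: nat_set_cases[of T])
    case 1
    have "top_lifts X n (sq_component l Q)" using R kb(1) by auto
    then have "lifts_at X (Suc n) (sq_component l Q) (insert 0 (Suc ` ?S)) (case_nat 1 b)"
     using S kb(2) unfolding top_lifts_def by blast
    then have "lifts_at X (Suc (Suc n)) Q (insert 0 (Suc ` Suc ` ?S)) (case_nat 1 (case_nat l b))" unfolding t .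
    then show ?thesis unfolding ab using 1(2) by argo
   next
    case 2
    have l: "l = 1" using bspec[OF a(2) 2(1)] unfolding ab by simp
    have "lifts_at X (Suc n) k (insert 0 (Suc ` ?S)) (case_nat 1 b)"
     using R S kb(2) unfolding top_lifts_def by blast
    then have "lifts_at X (Suc (Suc n)) Q (insert 0 (Suc ` insert 0 (Suc ` ?S))) (case_nat 1 (case_nat 1 b))" unfolding lifts_both[OF S] .
    then show ?thesis unfolding ab l using 2(2) by argo
   qed
  qed
 qed
qed

lemma all_lifts_P: assumes M: "all_lifts X n M" and x0: "top_lifts X n x0" shows "all_lifts X n P"
 unfolding all_lifts_def
proof (intro allI impI, elim conjE)
 fix S and b :: "nat => nat" assume S: "S <= {..<n}" "S ~= {}" "ALL j. b j : {0, 1}" "ALL t:S. b t = 1"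
 show "lifts_at X n P S b"
  by (rule lifts_P[OF S(1,4)]) (use M x0 S in \<open>auto simp: all_lifts_def top_lifts_def\<close>)
qed

lemma all_lifts_Q: "all_lifts X (Suc (Suc n)) Q <-> all_lifts X (Suc n) f & all_lifts X (Suc n) g & all_lifts X (Suc n) x1 &
  all_lifts X (Suc n) x0 & all_lifts X (Suc n) k"
 unfolding all_lifts_Suc[of X "Suc n" Q] Dom_Cod all_lifts_Suc[of X n] top_lifts_Q using all_lifts_P by blast

end

context EM_tower begin

lemma cubic_iff: "A : Obj (AR (Suc n)) ==> cubic_extension X (Suc n) A <-> all_lifts X (Suc n) A"
proof (induction n arbitrary: A)
 case 0
 have A: "A : Mor BX" using 0 by (simp add: n_Suc)
 have "all_lifts X 0 B" for B unfolding all_lifts_def by auto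
 then have "all_lifts X (Suc 0) A <-> top_lifts X 0 A" unfolding all_lifts_Suc by blast
 also have "... <-> (ALL b. (ALL j. b j : {0, 1}) --> lifts_at X (Suc 0) A {0} (case_nat 1 b))"
  unfolding top_lifts_def by auto
 also have "... <-> (ALL b :: nat => nat. (ALL j. b j : {0, 1}) --> re BX A)"
 proof -
  have "lifts_at X (Suc 0) A {0} (case_nat 1 b) <-> liftable BX (Dom BX A) {0 :: nat} (%_. A) (%_ _. A)" for b
   unfolding lifts_at_def by (rule liftable_cong) (simp_all add: n_Suc del: base_sel)
  then show ?thesis unfolding lifts_one[OF A] by blast
 qed
 also have "... <-> re BX A" by (auto intro: exI[of _ "%_. 0 :: nat"])
 also have "... <-> cubic_extension X (Suc 0) A" using A base_regular_epi[of X "the_mor A"] by auto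
 finally show ?case ..
next
 case (Suc n)
 interpret A: CCat "AR n" by (rule AR)
 obtain f g x1 x0 where A: "A = Sq f g x1 x0" and fg: "f : Mor (AR n)" "g : Mor (AR n)"
   "x1 : Hom (AR n) (Dom (AR n) f) (Dom (AR n) g)" "x0 : Hom (AR n) (Cod (AR n) f) (Cod (AR n) g)" and sq: "Comp (AR n) g x1 = Comp (AR n) x0 f"
  using Suc.prems by (auto simp: n_Suc Arr_Mor)
 have ar: "z : Obj (AR (Suc n)) <-> z : Mor (AR n)" for z by (simp add: n_Suc)
 have C: "cube X n f g x1 x0 p q k (Dom (AR n) f) (Dom (AR n) g) (Cod (AR n) f) (Cod (AR n) g) (Dom (AR n) p)"
  if "pb (AR n) g x0 p q" "k : Hom (AR n) (Dom (AR n) f) (Dom (AR n) p)" "Comp (AR n) p k = x1" "Comp (AR n) q k = f" for p q k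
 proof (unfold_locales)
  show "p : Hom (AR n) (Dom (AR n) p) (Dom (AR n) g)" "q : Hom (AR n) (Dom (AR n) p) (Cod (AR n) f)"
   using A.pb_Hom[OF that(1)] A.HomD[OF fg(4)] by auto
 qed (use that fg sq in \<open>auto intro: A.HomI\<close>)
 show ?case
 proof
  assume c: "cubic_extension X (Suc (Suc n)) A"
  then obtain p q k where pb: "pb (AR n) g x0 p q" and k: "k : Hom (AR n) (Dom (AR n) f) (Dom (AR n) p)" "Comp (AR n) p k = x1" "Comp (AR n) q k = f"
   and cs: "cubic_extension X (Suc n) f" "cubic_extension X (Suc n) g" "cubic_extension X (Suc n) x1" "cubic_extension X (Suc n) x0" "cubic_extension X (Suc n) k"
   unfolding A by auto
  have "all_lifts X (Suc n) f" "all_lifts X (Suc n) g" "all_lifts X (Suc n) x1" "all_lifts X (Suc n) x0" "all_lifts X (Suc n) k"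
   using cs Suc.IH ar fg(1,2) A.HomD(1)[OF fg(3)] A.HomD(1)[OF fg(4)] A.HomD(1)[OF k(1)] by blast+
  then show "all_lifts X (Suc (Suc n)) A" unfolding A cube.all_lifts_Q[OF C[OF pb k]] by blast
 next
  assume l: "all_lifts X (Suc (Suc n)) A"
  have "EX p q. pb (AR n) g x0 p q"
   by (rule AR(2)[unfolded has_pb_def, rule_format]) (use fg(2) A.HomD[OF fg(4)] in auto)
  then obtain p q where pb: "pb (AR n) g x0 p q" by blast
  obtain k where k: "k : Hom (AR n) (Dom (AR n) f) (Dom (AR n) p)" "Comp (AR n) p k = x1" "Comp (AR n) q k = f"
   using A.pb_exH[OF pb, of x1 "Dom (AR n) f" f] fg sq A.HomD[OF fg(4)] A.HomI[OF fg(1)] by auto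
  have "all_lifts X (Suc n) f" "all_lifts X (Suc n) g" "all_lifts X (Suc n) x1" "all_lifts X (Suc n) x0" "all_lifts X (Suc n) k"
   using l unfolding A cube.all_lifts_Q[OF C[OF pb k]] by blast+
  then have "cubic_extension X (Suc n) f" "cubic_extension X (Suc n) g" "cubic_extension X (Suc n) x1" "cubic_extension X (Suc n) x0" "cubic_extension X (Suc n) k"
   using Suc.IH ar fg(1,2) A.HomD(1)[OF fg(3)] A.HomD(1)[OF fg(4)] A.HomD(1)[OF k(1)] by blast+
  then show "cubic_extension X (Suc (Suc n)) A" using pb k Suc.prems unfolding A by auto
 qed
qed

lemma CRT_all_lifts: assumes F: "F : Obj (FK n)"
 shows "nfork.CRT BX n (%a. vtx X n a F) (%i a. fk_f (fid X n i a F)) <-> all_lifts X n (fob (arr_n n) F)"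
proof -
 interpret N: nfork "base X" n "%a. vtx X n a F" "%i a. fk_f (fid X n i a F)" "%i a. fk_d (fid X n i a F)" "%i a. fk_c (fid X n i a F)" "%i a. fk_e (fid X n i a F)"
  by (rule nfork_fid[OF F])
 have "N.lifts S a <-> lifts_at X n (fob (arr_n n) F) S a" if S: "S <= {..<n}" and a: "ALL j. a j : {0, 1}" for S a
  unfolding N.lifts_def lifts_at_def
 proof (rule liftable_cong)
  show "vtx X n a F = avtx X n a (fob (arr_n n) F)" using arr_vtx[OF F a] ..
  show "fk_f (fid X n i a F) = adir X n i a (fob (arr_n n) F)" if "i : S" for i using arr_dir[OF F _ a, of i] that S by auto
  show "fk_f (fid X n j (a(i := 0)) F) = adir X n j (a(i := 0)) (fob (arr_n n) F)" if "j : S" for i j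
   using arr_dir[OF F, of j "a(i := 0)"] that S a by auto
 qed
 then show ?thesis unfolding N.CRT_def all_lifts_def by blast
qed

lemma exact_iff_CRT: assumes F: "F : Obj (FK n)" and l: "lex X n F"
 shows "exact_n_fork X n F <-> nfork.CRT BX n (%a. vtx X n a F) (%i a. fk_f (fid X n i a F))"
proof -
 interpret N: nfork "base X" n "%a. vtx X n a F" "%i a. fk_f (fid X n i a F)" "%i a. fk_d (fid X n i a F)" "%i a. fk_c (fid X n i a F)" "%i a. fk_e (fid X n i a F)"
  by (rule nfork_fid[OF F])
 have LE: "N.LE" using l unfolding lex_fid[OF F] N.LE_def .
 have "rex X n F <-> N.RE" unfolding rex_fid[OF F] N.RE_def ..
 also have "... <-> N.epis" using N.RE_epis N.LE_epis_RE LE by blast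
 also have "... <-> N.CRT" using N.epis_CRT[OF LE] N.CRT_epis[OF LE] by blast
 finally show ?thesis using exact_iff[OF F] l by blast
qed

lemma exact_iff_cubic: assumes F: "F : Obj (FK n)" and n: "n \<ge> 1"
 shows "exact_n_fork X n F <-> is_EqFork_n X n F & cubic_extension X n (fob (arr_n n) F)"
proof -
 obtain m where m: "n = Suc m" using n by (cases n) auto
 have "fob (arr_n n) F : Obj (AR n)" by (rule functorD(1)[OF arr_functor F])
 then show ?thesis unfolding is_EqFork_iff[OF F] using exact_iff_CRT[OF F] CRT_all_lifts[OF F] exact_iff[OF F] cubic_iff[of "fob (arr_n n) F" m] m by blast
qed

lemma exact_iff_both: assumes F: "F : Obj (FK n)"
 shows "exact_n_fork X n F <-> is_EqFork_n X n F & is_CoeqFork_n X n F"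
 unfolding is_EqFork_iff[OF F] is_CoeqFork_iff[OF F] by (rule exact_iff[OF F])

end

section \<open>n-fold equivalence relations\<close>

definition full_sub :: "('a, 'b) cat => ('a, 'b) cat => bool" where
 "full_sub C D <-> Dom D = Dom C & Cod D = Cod C & Id D = Id C & Comp D = Comp C & Obj D <= Obj C &
   Mor D = {x : Mor C. Dom C x : Obj D & Cod C x : Obj D}"

lemma full_subD: assumes "full_sub C D"
 shows "Dom D = Dom C" "Cod D = Cod C" "Id D = Id C" "Comp D = Comp C" "a : Obj D ==> a : Obj C"
  "x : Mor D <-> x : Mor C & Dom C x : Obj D & Cod C x : Obj D"
 using assms unfolding full_sub_def by auto

lemma full_sub_Hom: "full_sub C D ==> x : Hom D a b <-> x : Hom C a b & a : Obj D & b : Obj D"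
 unfolding full_sub_def Hom_def by auto

lemma full_sub_category: assumes C: "category C" and D: "full_sub C D" shows "category D"
proof -
 interpret Cat C by (unfold_locales, rule C)
 note d = full_subD[OF D]
 show ?thesis unfolding category_def full_sub_Hom[OF D] d(1-4)
  using C unfolding category_def by (auto simp: d(5,6))
qed

lemma full_sub_CCat: "CCat C ==> full_sub C D ==> CCat D"
 unfolding CCat_def Cat_def using full_sub_category by blast

lemma full_sub_pullback: assumes D: "full_sub C D" and pb: "pb C f g p q" and "f : Mor D" "g : Mor D" "p : Mor D" "q : Mor D"
 shows "pb D f g p q"
proof -
 note d = full_subD[OF D]
 have "EX! h. h : Hom D (Dom C u) (Dom C p) & Comp C p h = u & Comp C q h = v"
  if u: "u : Mor D" "v : Mor D" "Dom C u = Dom C v" "Cod C u = Dom C f" "Cod C v = Dom C g" "Comp C f u = Comp C g v" for u v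
 proof -
  have uC: "u : Mor C" "v : Mor C" using u(1,2) unfolding d(6) by blast+
  have "EX! h. h : Hom C (Dom C u) (Dom C p) & Comp C p h = u & Comp C q h = v"
   using pb uC u(3-6) unfolding is_pullback_def by blast
  moreover have "h : Hom D (Dom C u) (Dom C p) <-> h : Hom C (Dom C u) (Dom C p)" for h
   unfolding full_sub_Hom[OF D] using u assms(5) unfolding d(6) by blast
  ultimately show ?thesis by simp
 qed
 then show ?thesis using pb assms(3-6) unfolding is_pullback_def d(1-4) by blast
qed

lemma ERel_sel [simp]: "Dom (ERel C) = rg_dom" "Cod (ERel C) = rg_cod" "Id (ERel C) = Id (RGrph C)" "Comp (ERel C) = Comp (RGrph C)"
 by (simp_all add: ERel_def)

lemma ERel_Obj: "G : Obj (ERel C) <-> G : Obj (RGrph C) & equivalence_relation C (rg_d G) (rg_c G)"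
 by (auto simp: ERel_def RGrph_Obj)

lemma ERel_Mor: "x : Mor (ERel C) <-> x : Mor (RGrph C) & rg_dom x : Obj (ERel C) & rg_cod x : Obj (ERel C)"
 by (auto simp: ERel_def Let_def)

lemma full_sub_rgraph: assumes D: "full_sub C D"
 shows "is_rgraph D d c e <-> is_rgraph C d c e & Dom C d : Obj D & Cod C d : Obj D"
 unfolding is_rgraph_def full_sub_Hom[OF D] full_subD(1-4)[OF D] by (auto simp: full_subD(6)[OF D])

lemma full_sub_ERel: assumes D: "full_sub C D" shows "full_sub (RGrph C) (ERel D)"
proof -
 note d = full_subD[OF D]
 have O: "G : Obj (RGrph D) <-> G : Obj (RGrph C) & Dom C (rg_d G) : Obj D & Cod C (rg_d G) : Obj D" for G
  unfolding RGrph_Obj full_sub_rgraph[OF D] by auto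
 have "Id (RGrph D) = Id (RGrph C)" "Comp (RGrph D) = Comp (RGrph C)" by (intro ext; simp add: d)+
 moreover have "x : Mor (ERel D) <-> x : Mor (RGrph C) & rg_dom x : Obj (ERel D) & rg_cod x : Obj (ERel D)" for x
  unfolding ERel_Mor ERel_Obj RGrph_Mor O full_sub_Hom[OF D] d(1-4) by auto
 ultimately show ?thesis unfolding full_sub_def by (auto simp: ERel_Obj O)
qed

primrec rvtx :: "('o, 'm) cat => nat => (nat => nat) => ('o, 'm) cell => ('o, 'm) cell" where
 "rvtx X 0 a G = G"
| "rvtx X (Suc n) a G = rvtx X n (%j. a (Suc j)) (rg_vertex (RGrph_n X n) (a 0) G)"

primrec rgc :: "nat => (nat => nat) => ('o, 'm) cell => ('o, 'm) cell" where
 "rgc 0 a x = x"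
| "rgc (Suc n) a x = rgc n (%j. a (Suc j)) (rg_component (a 0) x)"

abbreviation one1 :: "nat => nat" where "one1 \<equiv> %_. 1"

definition sp :: "nat => nat => nat" where "sp i = (%_. 1)(i := 2)"

lemma sp_simps [simp]: "sp 0 0 = 2" "(%j. sp 0 (Suc j)) = one1" "sp (Suc i) 0 = 1" "(%j. sp (Suc i) (Suc j)) = sp i"
 by (auto simp: sp_def fun_eq_iff)

lemma sp_range: "sp i j : {1, 2}"
 by (simp add: sp_def)

lemma rg_base_rgc: "rg_base_mor n x = rgc n one1 x"
 by (induction n arbitrary: x) (simp_all add: rg_component_def)

lemma rg_edge_0: "rg_edge X (Suc n) 0 G = Rg (rgc n one1 (rg_d G)) (rgc n one1 (rg_c G)) (rgc n one1 (rg_e G))"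
 and rg_edge_Suc: "rg_edge X (Suc n) (Suc i) G = rg_edge X n i (Cod (RGrph_n X n) (rg_d G))"
 by (simp_all add: rg_base_rgc)

declare rg_edge.simps(2) [simp del]

context tower begin

abbreviation "ER \<equiv> ERel_n X"

lemma ER_full: "full_sub (RG n) (ER n)"
proof (induction n)
 case 0
 show ?case using base_cat unfolding full_sub_def category_def by (auto simp: n_Suc)
next
 case (Suc n)
 from full_sub_ERel[OF this] show ?case by (simp add: n_Suc)
qed

lemma ER_CCat: "CCat (ER n)"
 by (rule full_sub_CCat[OF RG(1) ER_full])

lemma ER_obj: "G : Obj (ER (Suc n)) <-> G : Obj (RG (Suc n)) & Dom (RG n) (rg_d G) : Obj (ER n) & Cod (RG n) (rg_d G) : Obj (ER n) &
  equivalence_relation (ER n) (rg_d G) (rg_c G)"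
 unfolding n_Suc ERel_Obj RGrph_Obj full_sub_rgraph[OF ER_full] by auto

lemma ER_RG: "G : Obj (ER n) ==> G : Obj (RG n)"
 using full_subD(5)[OF ER_full] .

lemma rg_vertex_obj: "G : Obj (RG (Suc n)) ==> rg_vertex (RG n) k G : Obj (RG n)"
 using CCat.RgD[OF RG(1)[of n], of G] by (auto simp: n_Suc rg_vertex_def)

lemma rg_component_Hom: "x : Hom (RG (Suc n)) F G ==> rg_component k x : Hom (RG n) (rg_vertex (RG n) k F) (rg_vertex (RG n) k G)"
 using CCat.RgMorD[OF RG(1)[of n], of x F G] by (auto simp: n_Suc rg_vertex_def rg_component_def)

lemma rgc_Hom: "x : Hom (RG n) F G ==> rgc n a x : Hom BX (rvtx X n a F) (rvtx X n a G)"
proof (induction n arbitrary: a x F G)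
 case (Suc n)
 then show ?case using rg_component_Hom[of x n F G "a 0"] by simp
qed (simp add: n_Suc)

lemma rgc_Comp: "x : Hom (RG n) F G ==> y : Hom (RG n) G H ==>
  rgc n a (Comp (RG n) y x) = Comp BX (rgc n a y) (rgc n a x)"
proof (induction n arbitrary: a x y F G H)
 case (Suc n)
 have "rg_component (a 0) (Comp (RG (Suc n)) y x) = Comp (RG n) (rg_component (a 0) y) (rg_component (a 0) x)"
  by (simp add: n_Suc rg_component_def)
 then show ?case using Suc.IH[OF rg_component_Hom[OF Suc.prems(1)] rg_component_Hom[OF Suc.prems(2)]] by simp
qed (simp add: n_Suc)

lemma rgc_Id: "F : Obj (RG n) ==> rgc n a (Id (RG n) F) = Id BX (rvtx X n a F)"
proof (induction n arbitrary: a F)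
 case (Suc n)
 have "rg_component (a 0) (Id (RG (Suc n)) F) = Id (RG n) (rg_vertex (RG n) (a 0) F)"
  by (simp add: n_Suc rg_component_def rg_vertex_def)
 then show ?case using Suc.IH[OF rg_vertex_obj[OF Suc.prems]] by simp
qed (simp add: n_Suc)

lemma rgc_eq: "[|x : Hom (RG n) F G; y : Hom (RG n) G H; x' : Hom (RG n) F G'; y' : Hom (RG n) G' H;
  Comp (RG n) y x = Comp (RG n) y' x'|] ==>
  Comp BX (rgc n a y) (rgc n a x) = Comp BX (rgc n a y') (rgc n a x')"
 using rgc_Comp[of x n F G y H a] rgc_Comp[of x' n F G' y' H a] by simp

lemma edge_Hom: "G : Obj (RG n) ==> i < n ==>
  rg_d (rg_edge X n i G) : Hom BX (rvtx X n (sp i) G) (rvtx X n one1 G) & rg_c (rg_edge X n i G) : Hom BX (rvtx X n (sp i) G) (rvtx X n one1 G)"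
proof (induction n arbitrary: i G)
 case (Suc n)
 interpret C: CCat "RG n" by (rule RG)
 note G = C.RgD[OF Suc.prems(1)[unfolded n_Suc]]
 show ?case
 proof (cases i)
  case 0
  then show ?thesis using rgc_Hom[OF G(2), of one1] rgc_Hom[OF G(3), of one1] by (simp add: rg_edge_0 rg_vertex_def)
 next
  case (Suc i')
  then show ?thesis using Suc.IH[OF G(8), of i'] Suc.prems(2) by (simp add: rg_edge_Suc rg_vertex_def)
 qed
qed simp

lemma edge_natural: "x : Hom (RG n) G K ==> i < n ==>
  Comp BX (rg_d (rg_edge X n i K)) (rgc n (sp i) x) = Comp BX (rgc n one1 x) (rg_d (rg_edge X n i G)) &
  Comp BX (rg_c (rg_edge X n i K)) (rgc n (sp i) x) = Comp BX (rgc n one1 x) (rg_c (rg_edge X n i G))"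
proof (induction n arbitrary: i G K x)
 case (Suc n)
 interpret C: CCat "RG n" by (rule RG)
 note x = C.RgMorD[OF Suc.prems(1)[unfolded n_Suc]]
 note G = C.RgD[OF x(1)] and K = C.RgD[OF x(2)]
 show ?case
 proof (cases i)
  case 0
  show ?thesis unfolding 0 using rgc_eq[OF x(4) K(2) G(2) x(5) x(6), of one1] rgc_eq[OF x(4) K(3) G(3) x(5) x(7), of one1]
   by (simp add: rg_edge_0 rg_component_def)
 next
  case (Suc i')
  then show ?thesis using Suc.IH[OF x(5), of i'] Suc.prems(2) by (simp add: rg_edge_Suc rg_component_def)
 qed
qed simp

lemma grph_vertex: assumes "F : Obj (FK (Suc n))" "k : {1, 2}"
 shows "rg_vertex (RG n) k (fob (grph_n (Suc n)) F) = fob (grph_n n) (fk_vertex (FK n) k F)"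
proof -
 interpret C: CCat "FK n" by (rule FK)
 note F = C.FkD[OF assms(1)[unfolded n_Suc]]
 show ?thesis using two_cats.PDom[OF grph_two F(2)] assms(2) by (auto simp: grph_def Let_def fk_vertex_def rg_vertex_def RGrph_map_def)
qed

lemma grph_comp: "x : Hom (FK n) F G ==> (ALL j. a j : {1, 2}) ==> rgc n a (fmor (grph_n n) x) = component_at n a x"
proof (induction n arbitrary: a x F G)
 case (Suc n)
 have "rg_component (a 0) (fmor (grph_n (Suc n)) x) = fmor (grph_n n) (fk_component (a 0) x)"
  using Suc.prems(2)[rule_format, of 0] by (auto simp: grph_def Let_def fk_component_def rg_component_def RGrph_map_def)
 then show ?case using Suc.IH[OF fk_component_Hom[OF Suc.prems(1)], of "%j. a (Suc j)" "a 0"] Suc.prems(2) by (simp del: grph_n.simps)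
qed simp

lemma grph_vtx: "F : Obj (FK n) ==> (ALL j. a j : {1, 2}) ==> rvtx X n a (fob (grph_n n) F) = vtx X n a F"
proof (induction n arbitrary: a F)
 case (Suc n)
 have "rg_vertex (RG n) (a 0) (fob (grph_n (Suc n)) F) = fob (grph_n n) (fk_vertex (FK n) (a 0) F)"
  by (rule grph_vertex[OF Suc.prems(1)]) (use Suc.prems(2) in blast)
 then show ?case using Suc.IH[OF fk_vertex_obj[OF Suc.prems(1)], of "%j. a (Suc j)" "a 0"] Suc.prems(2) by (simp del: grph_n.simps)
qed simp

lemma grph_edge: "F : Obj (FK n) ==> i < n ==> rg_edge X n i (fob (grph_n n) F) =
  Rg (fk_d (fid X n i one1 F)) (fk_c (fid X n i one1 F)) (fk_e (fid X n i one1 F))"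
proof (induction n arbitrary: F i)
 case (Suc n)
 show ?case
 proof (cases i)
  case 0
  interpret C: CCat "FK n" by (rule FK)
  note F = C.FkD[OF Suc.prems(1)[unfolded n_Suc]]
  show ?thesis unfolding 0 rg_edge_0 fid_0 using grph_comp[OF F(2), of one1] grph_comp[OF F(3), of one1] grph_comp[OF F(4), of one1]
   by (simp add: grph_def Let_def RGrph_map_def)
 next
  case (Suc i')
  then have i': "i' < n" using Suc.prems(2) by simp
  have "Cod (RG n) (rg_d (fob (grph_n (Suc n)) F)) = fob (grph_n n) (fk_vertex (FK n) 1 F)"
   using grph_vertex[OF Suc.prems(1), of 1] by (simp add: rg_vertex_def)
  then show ?thesis unfolding Suc rg_edge_Suc fid_Suc using Suc.IH[OF fk_vertex_obj[OF Suc.prems(1)] i', of 1] by (simp del: grph_n.simps)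
 qed
qed simp

lemma ER_faithful: "[|x : Hom (RG n) G E; y : Hom (RG n) G E; G : Obj (ER n); E : Obj (ER n); rgc n one1 x = rgc n one1 y|] ==> x = y"
proof (induction n arbitrary: x y G E)
 case (Suc n)
 interpret C: CCat "RG n" by (rule RG)
 note x = C.RgMorD[OF Suc.prems(1)[unfolded n_Suc]] and y = C.RgMorD[OF Suc.prems(2)[unfolded n_Suc]]
 note G = Suc.prems(3)[unfolded ER_obj] and E = Suc.prems(4)[unfolded ER_obj]
 have 1: "rg1 x = rg1 y" by (rule Suc.IH[OF x(5) y(5)]) (use G E Suc.prems(5) in \<open>auto simp: rg_component_def\<close>)
 have "relation (ER n) (rg_d E) (rg_c E)" using E unfolding equivalence_relation_def reflexive_relation_def by blast
 moreover have "rg2 x : Hom (ER n) (Dom (RG n) (rg_d G)) (Dom (RG n) (rg_d E))" "rg2 y : Hom (ER n) (Dom (RG n) (rg_d G)) (Dom (RG n) (rg_d E))"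
  using x(4) y(4) G E unfolding full_sub_Hom[OF ER_full] by blast+
 moreover have "Comp (ER n) (rg_d E) (rg2 x) = Comp (ER n) (rg_d E) (rg2 y)" "Comp (ER n) (rg_c E) (rg2 x) = Comp (ER n) (rg_c E) (rg2 y)"
  using x(6,7) y(6,7) 1 unfolding full_subD(4)[OF ER_full] by simp_all
 moreover have "Dom (ER n) (rg_d E) = Dom (RG n) (rg_d E)" unfolding full_subD(1)[OF ER_full] ..
 ultimately have "rg2 x = rg2 y" unfolding relation_def Hom_def[of "ER n"] by (elim conjE) (auto)
 then show ?case using x(3) y(3) 1 by simp
qed simp

lemma grph_pb: "pb (FK n) f g p q ==>
  pb (RG n) (fmor (grph_n n) f) (fmor (grph_n n) g) (fmor (grph_n n) p) (fmor (grph_n n) q)"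
proof (induction n arbitrary: f g p q)
 case (Suc n)
 interpret C: CCat "FK (Suc n)" by (rule FK)
 have c: "rg_component k (fmor (grph_n (Suc n)) x) = fmor (grph_n n) (fk_component k x)" if "k : {1, 2}" for x k
  using that by (auto simp: grph_def Let_def fk_component_def rg_component_def RGrph_map_def)
 have pb: "pb (RG n) (rg_component k (fmor (grph_n (Suc n)) f)) (rg_component k (fmor (grph_n (Suc n)) g))
   (rg_component k (fmor (grph_n (Suc n)) p)) (rg_component k (fmor (grph_n (Suc n)) q))" if k: "k : {1, 2}" for k
  unfolding c[OF k]
  by (rule Suc.IH, rule diag.pb_pointwise[OF CCat.Fork_diag[OF FK(1)] FK(2) Suc.prems[unfolded n_Suc]]) (use k in auto)
 note P = C.pb_Hom[OF Suc.prems]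
 note h = functorD(2)[OF grph_functor P(1)] functorD(2)[OF grph_functor P(2)] functorD(2)[OF grph_functor P(3)] functorD(2)[OF grph_functor P(4)]
 show ?case unfolding n_Suc
  by (rule diag.pb_reflect[OF CCat.RGrph_diag[OF RG(1)[of n]]])
   (use h pb in \<open>auto simp: Hom_def n_Suc simp del: grph_n.simps RGrph_sel\<close>)
qed (simp add: n_Suc)

end

context tower begin

lemma grph_ER: "lex X n F ==> fob (grph_n n) F : Obj (ER n)"
proof (induction n arbitrary: F)
 case (Suc n)
 interpret C: CCat "FK n" by (rule FK)
 interpret R: CCat "RG n" by (rule RG)
 interpret E: CCat "ER n" by (rule ER_CCat)
 have oF: "F : Obj (FK (Suc n))" by (rule lex_obj[OF Suc.prems])
 note F = C.FkD[OF oF[unfolded n_Suc]]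
 have l: "pb (FK n) (fk_f F) (fk_f F) (fk_d F) (fk_c F)" "lex X n (Dom (FK n) (fk_d F))" "lex X n (Cod (FK n) (fk_d F))" "lex X n (Cod (FK n) (fk_f F))"
  using Suc.prems[unfolded lex.simps is_kernel_pair_def] by blast+
 note o = Suc.IH[OF l(2)] Suc.IH[OF l(3)] Suc.IH[OF l(4)]
 note h = functorD(2)[OF grph_functor F(2)] functorD(2)[OF grph_functor F(3)] functorD(2)[OF grph_functor F(5)]
 have m: "fmor (grph_n n) (fk_d F) : Hom (ER n) (fob (grph_n n) (Dom (FK n) (fk_d F))) (fob (grph_n n) (Cod (FK n) (fk_d F)))"
  "fmor (grph_n n) (fk_c F) : Hom (ER n) (fob (grph_n n) (Dom (FK n) (fk_d F))) (fob (grph_n n) (Cod (FK n) (fk_d F)))"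
  "fmor (grph_n n) (fk_f F) : Hom (ER n) (fob (grph_n n) (Cod (FK n) (fk_d F))) (fob (grph_n n) (Cod (FK n) (fk_f F)))"
  unfolding full_sub_Hom[OF ER_full] using h o by blast+
 have "pb (ER n) (fmor (grph_n n) (fk_f F)) (fmor (grph_n n) (fk_f F)) (fmor (grph_n n) (fk_d F)) (fmor (grph_n n) (fk_c F))"
  by (rule full_sub_pullback[OF ER_full grph_pb[OF l(1)]]) (rule E.HomD[OF m(1)] E.HomD[OF m(2)] E.HomD[OF m(3)])+
 from E.kp_eqrel[OF this[folded is_kernel_pair_def]]
 have "equivalence_relation (ER n) (rg_d (fob (grph_n (Suc n)) F)) (rg_c (fob (grph_n (Suc n)) F))"
  by (simp add: grph_def Let_def RGrph_map_def)
 moreover have "fob (grph_n (Suc n)) F : Obj (RG (Suc n))" by (rule functorD(1)[OF grph_functor oF])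
 moreover have "Dom (RG n) (rg_d (fob (grph_n (Suc n)) F)) = fob (grph_n n) (Dom (FK n) (fk_d F))" "Cod (RG n) (rg_d (fob (grph_n (Suc n)) F)) = fob (grph_n n) (Cod (FK n) (fk_d F))"
  using h(1) by (simp_all add: grph_def Let_def RGrph_map_def Hom_def)
 ultimately show ?case unfolding ER_obj using o by simp
qed (simp add: n_Suc)

text \<open>A comparison arrow is found at coordinate 1 first; at coordinate 2 it comes from the universal property
 of the kernel pair, whose hypothesis can be checked on base objects because \<open>ER n\<close> is faithful over them.\<close>

lemma grph_largest: "[|lex X n F; E : Obj (ER n); rvtx X n one1 E = rvtx X n one1 (fob (grph_n n) F);
  !!i. i < n ==> rg_edge X n i E = rg_edge X n i (fob (grph_n n) F)|] ==>
  EX x:Hom (RG n) E (fob (grph_n n) F). rgc n one1 x = Id BX (rvtx X n one1 E)"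
proof (induction n arbitrary: F E)
 case 0
 interpret B: CCat "base X" using RG(1)[of 0] by (simp add: n_Suc)
 show ?case using 0 B.Hom_Id[of E] by (auto simp: n_Suc)
next
 case (Suc n)
 interpret C: CCat "FK n" by (rule FK)
 interpret R: CCat "RG n" by (rule RG)
 interpret B: CCat "base X" using RG(1)[of 0] by (simp add: n_Suc)
 have oF: "F : Obj (FK (Suc n))" by (rule lex_obj[OF Suc.prems(1)])
 note F = C.FkD[OF oF[unfolded n_Suc]]
 have l: "pb (FK n) (fk_f F) (fk_f F) (fk_d F) (fk_c F)" "lex X n (Cod (FK n) (fk_d F))" "lex X n (Cod (FK n) (fk_f F))"
  using Suc.prems(1)[unfolded lex.simps is_kernel_pair_def] by blast+
 let ?K = "fob (grph_n (Suc n)) F" and ?d = "fmor (grph_n n) (fk_d F)" and ?c = "fmor (grph_n n) (fk_c F)" and ?f = "fmor (grph_n n) (fk_f F)"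
  and ?G1 = "fob (grph_n n) (Cod (FK n) (fk_d F))" and ?G0 = "fob (grph_n n) (Cod (FK n) (fk_f F))" and ?G2 = "fob (grph_n n) (Dom (FK n) (fk_d F))"
 note h = functorD(2)[OF grph_functor F(2)] functorD(2)[OF grph_functor F(3)] functorD(2)[OF grph_functor F(5)]
 have G: "rg_d ?K = ?d" "rg_c ?K = ?c" by (simp_all add: grph_def Let_def RGrph_map_def)
 have oG: "?K : Obj (RG (Suc n))" by (rule functorD(1)[OF grph_functor oF])
 note GD = R.RgD[OF oG[unfolded n_Suc]]
 have GV: "Cod (RG n) ?d = ?G1" "Dom (RG n) ?d = ?G2" using h(1) by (simp_all add: Hom_def)
 have E: "E : Obj (RG (Suc n))" "Dom (RG n) (rg_d E) : Obj (ER n)" "Cod (RG n) (rg_d E) : Obj (ER n)" using Suc.prems(2) unfolding ER_obj by blast+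
 note ED = R.RgD[OF E(1)[unfolded n_Suc]]
 let ?E1 = "Cod (RG n) (rg_d E)" and ?E2 = "Dom (RG n) (rg_d E)"
 have rv: "rvtx X n one1 ?E1 = rvtx X n one1 ?G1" using Suc.prems(3) G GV by (simp add: rg_vertex_def del: grph_n.simps)
 have re: "rg_edge X n i ?E1 = rg_edge X n i ?G1" if "i < n" for i
  using Suc.prems(4)[of "Suc i"] that G GV by (simp add: rg_edge_Suc del: grph_n.simps)
 obtain x1 where x1: "x1 : Hom (RG n) ?E1 ?G1" "rgc n one1 x1 = Id BX (rvtx X n one1 ?E1)"
  using Suc.IH[OF l(2) E(3) rv re] by blast
 have bd: "rgc n one1 (rg_d E) = rgc n one1 ?d" "rgc n one1 (rg_c E) = rgc n one1 ?c"
  using Suc.prems(4)[of 0] G unfolding rg_edge_0 by simp_all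
 note xd = R.Hom_cmp[OF ED(2) x1(1)] and xc = R.Hom_cmp[OF ED(3) x1(1)]
 have rx: "rgc n one1 (Comp (RG n) x1 (rg_d E)) = rgc n one1 ?d" "rgc n one1 (Comp (RG n) x1 (rg_c E)) = rgc n one1 ?c"
  unfolding rgc_Comp[OF ED(2) x1(1)] rgc_Comp[OF ED(3) x1(1)] x1(2) bd[symmetric]
  using B.Hom_unit(2)[OF rgc_Hom[OF ED(2)]] B.Hom_unit(2)[OF rgc_Hom[OF ED(3)]] by blast+
 have fx: "Comp (RG n) ?f (Comp (RG n) x1 (rg_d E)) = Comp (RG n) ?f (Comp (RG n) x1 (rg_c E))"
 proof (rule ER_faithful[OF R.Hom_cmp[OF xd h(3)] R.Hom_cmp[OF xc h(3)] E(2) grph_ER[OF l(3)]])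
  show "rgc n one1 (Comp (RG n) ?f (Comp (RG n) x1 (rg_d E))) = rgc n one1 (Comp (RG n) ?f (Comp (RG n) x1 (rg_c E)))"
   unfolding rgc_Comp[OF xd h(3)] rgc_Comp[OF xc h(3)] rx
   by (rule rgc_eq[OF h(1) h(3) h(2) h(3)]) (use functorD(4)[OF grph_functor F(2) F(5)] functorD(4)[OF grph_functor F(3) F(5)] F(8) in simp)
 qed
 obtain x2 where x2: "x2 : Hom (RG n) ?E2 ?G2" "Comp (RG n) ?d x2 = Comp (RG n) x1 (rg_d E)" "Comp (RG n) ?c x2 = Comp (RG n) x1 (rg_c E)"
  using R.pb_exH[OF grph_pb[OF l(1)] _ _ fx, of ?E2] xd xc GV R.HomD[OF h(3)] by auto
 have eG: "rg_e ?K : Hom (RG n) ?G1 ?G2" using GD(4) unfolding G GV .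
 have "Comp (RG n) (rg_e ?K) x1 = Comp (RG n) x2 (rg_e E)"
 proof (rule R.pb_uniqueH[OF grph_pb[OF l(1)], of _ ?E1])
  show "Comp (RG n) (rg_e ?K) x1 : Hom (RG n) ?E1 (Dom (RG n) ?d)" unfolding GV by (rule R.Hom_cmp[OF x1(1) eG])
  show "Comp (RG n) x2 (rg_e E) : Hom (RG n) ?E1 (Dom (RG n) ?d)" unfolding GV by (rule R.Hom_cmp[OF ED(4) x2(1)])
  have a: "Comp (RG n) ?d (Comp (RG n) (rg_e ?K) x1) = x1" "Comp (RG n) ?c (Comp (RG n) (rg_e ?K) x1) = x1"
   unfolding R.Hom_assoc[OF x1(1) eG h(1), symmetric] R.Hom_assoc[OF x1(1) eG h(2), symmetric] GD(5,6)[unfolded G GV]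
   by (rule R.Hom_unit(2)[OF x1(1)])+
  have b: "Comp (RG n) ?d (Comp (RG n) x2 (rg_e E)) = x1" "Comp (RG n) ?c (Comp (RG n) x2 (rg_e E)) = x1"
   using R.Hom_assoc[OF ED(4) x2(1) h(1)] R.Hom_assoc[OF ED(4) x2(1) h(2)] x2(2,3) R.Hom_assoc[OF ED(4) ED(2) x1(1)] R.Hom_assoc[OF ED(4) ED(3) x1(1)]
    ED(5,6) R.Hom_unit(1)[OF x1(1)] by simp_all
  show "Comp (RG n) ?d (Comp (RG n) (rg_e ?K) x1) = Comp (RG n) ?d (Comp (RG n) x2 (rg_e E))"
   "Comp (RG n) ?c (Comp (RG n) (rg_e ?K) x1) = Comp (RG n) ?c (Comp (RG n) x2 (rg_e E))" unfolding a b by (rule refl)+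
 qed
 then have "RgMor E ?K x2 x1 : Hom (RG (Suc n)) E ?K"
  unfolding n_Suc by (intro R.RgMorI) (use E(1) oG x1(1) x2 G GV in \<open>simp_all add: n_Suc del: grph_n.simps\<close>)
 moreover have "rgc (Suc n) one1 (RgMor E ?K x2 x1) = Id BX (rvtx X (Suc n) one1 E)"
  using x1(2) by (simp add: rg_component_def rg_vertex_def del: grph_n.simps)
 ultimately show ?case by blast
qed

end

context Cat begin

lemma cancel_mid: assumes "y : Hom C a b" "u : Hom C b c" "v : Hom C c b" "x : Hom C b d" "v ** u = Id C b"
 shows "(x ** v) ** (u ** y) = x ** y"
proof -
 have "(x ** v) ** (u ** y) = x ** (v ** (u ** y))" by (rule Hom_assoc[OF Hom_cmp[OF assms(1,2)] assms(3,4)])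
 also have "v ** (u ** y) = y" using Hom_assoc[OF assms(1-3)] assms(5) Hom_unit(2)[OF assms(1)] by simp
 finally show ?thesis .
qed

lemma iso_Id: "a : Obj C ==> iso C (Id C a)"
 using Hom_Id[of a] Hom_unit(1)[OF Hom_Id[of a]] by (intro isoI[of _ "Id C a"]) (auto simp: Hom_def)

lemma iso_inverse: "iso C u ==> u : Hom C a b ==> EX v:Hom C b a. v ** u = Id C a & u ** v = Id C b"
 unfolding iso_def Hom_def by blast

lemma cancel_right: assumes "u : Hom C b c" "v : Hom C c b" "x : Hom C b d" "v ** u = Id C b"
 shows "(x ** v) ** u = x"
 using Hom_assoc[OF assms(1-3)] assms(4) Hom_unit(1)[OF assms(3)] by simp

end

context tower begin

lemma fork_transport: "[|F : Obj (FK n); iso BX \<phi>; Dom BX \<phi> = vtx X n one1 F;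
  !!i. i < n ==> iso BX (\<theta> i); !!i. i < n ==> Dom BX (\<theta> i) = vtx X n (sp i) F|] ==>
  EX G u. u : Hom (FK n) F G & iso (FK n) u & component_at n one1 u = \<phi> & (ALL i<n. component_at n (sp i) u = \<theta> i)"
proof (induction n arbitrary: F \<phi> \<theta>)
 case 0
 then show ?case by (auto simp: n_Suc Hom_def iso_def)
next
 case (Suc n)
 interpret C: CCat "FK n" by (rule FK)
 interpret B: CCat "base X" using RG(1)[of 0] by (simp add: n_Suc)
 note F = C.FkD[OF Suc.prems(1)[unfolded n_Suc]]
 let ?F1 = "Cod (FK n) (fk_d F)" and ?F2 = "Dom (FK n) (fk_d F)" and ?F0 = "Cod (FK n) (fk_f F)"
 have o: "?F2 : Obj (FK n)" "?F1 : Obj (FK n)" "?F0 : Obj (FK n)" using C.Hom_obj F(2,5) by blast+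
 have "EX G u. u : Hom (FK n) ?F1 G & iso (FK n) u & component_at n one1 u = \<phi> & (ALL i<n. component_at n (sp i) u = \<theta> (Suc i))"
  by (rule Suc.IH[OF o(2) Suc.prems(2)]) (use Suc.prems(3) Suc.prems(4)[of "Suc _"] Suc.prems(5)[of "Suc _"] in \<open>simp_all add: fk_vertex_def\<close>)
 then obtain G1 u1 where u1: "u1 : Hom (FK n) ?F1 G1" "iso (FK n) u1" "component_at n one1 u1 = \<phi>" "ALL i<n. component_at n (sp i) u1 = \<theta> (Suc i)" by blast
 have "EX G u. u : Hom (FK n) ?F2 G & iso (FK n) u & component_at n one1 u = \<theta> 0 & (ALL i<n. component_at n (sp i) u = Id BX (vtx X n (sp i) ?F2))"
 proof (rule Suc.IH[OF o(1)])
  fix i assume "i < n"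
  have v: "vtx X n (sp i) ?F2 : Obj BX"
   using B.Hom_obj[OF component_Hom[OF C.Hom_Id[OF o(1)], of "sp i"]] by blast
  show "iso BX (Id BX (vtx X n (sp i) ?F2))" "Dom BX (Id BX (vtx X n (sp i) ?F2)) = vtx X n (sp i) ?F2"
   using B.HomD(2)[OF B.Hom_Id[OF v]] B.iso_Id[OF v] by blast+
 qed (use Suc.prems(4)[of 0] Suc.prems(5)[of 0] in \<open>simp_all add: fk_vertex_def\<close>)
 then obtain G2 u2 where u2: "u2 : Hom (FK n) ?F2 G2" "iso (FK n) u2" "component_at n one1 u2 = \<theta> 0" by blast
 obtain v1 where v1: "v1 : Hom (FK n) G1 ?F1" "Comp (FK n) v1 u1 = Id (FK n) ?F1" "Comp (FK n) u1 v1 = Id (FK n) G1"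
  using C.iso_inverse[OF u1(2,1)] by blast
 obtain v2 where v2: "v2 : Hom (FK n) G2 ?F2" "Comp (FK n) v2 u2 = Id (FK n) ?F2" "Comp (FK n) u2 v2 = Id (FK n) G2"
  using C.iso_inverse[OF u2(2,1)] by blast
 define d where "d = Comp (FK n) (Comp (FK n) u1 (fk_d F)) v2"
 define c where "c = Comp (FK n) (Comp (FK n) u1 (fk_c F)) v2"
 define e where "e = Comp (FK n) (Comp (FK n) u2 (fk_e F)) v1"
 define f where "f = Comp (FK n) (fk_f F) v1"
 note ud = C.Hom_cmp[OF F(2) u1(1)] and uc = C.Hom_cmp[OF F(3) u1(1)] and ue = C.Hom_cmp[OF F(4) u2(1)]
 have h: "d : Hom (FK n) G2 G1" "c : Hom (FK n) G2 G1" "e : Hom (FK n) G1 G2" "f : Hom (FK n) G1 ?F0"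
  unfolding d_def c_def e_def f_def by (rule C.Hom_cmp[OF v2(1) ud] C.Hom_cmp[OF v2(1) uc] C.Hom_cmp[OF v1(1) ue] C.Hom_cmp[OF v1(1) F(5)])+
 have r: "Comp (FK n) d e = Id (FK n) G1" "Comp (FK n) c e = Id (FK n) G1"
 proof -
  note ev = C.Hom_cmp[OF v1(1) F(4)]
  have e': "e = Comp (FK n) u2 (Comp (FK n) (fk_e F) v1)" unfolding e_def by (rule C.Hom_assoc[OF v1(1) F(4) u2(1)])
  have *: "Comp (FK n) (Comp (FK n) u1 k) (Comp (FK n) (fk_e F) v1) = Id (FK n) G1"
   if k: "k : Hom (FK n) ?F2 ?F1" "Comp (FK n) k (fk_e F) = Id (FK n) ?F1" for k
   using C.Hom_assoc[OF ev k(1) u1(1)] C.Hom_assoc[OF v1(1) F(4) k(1)] k(2) C.Hom_unit(2)[OF v1(1)] v1(3) by simp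
  show "Comp (FK n) d e = Id (FK n) G1" unfolding d_def e' C.cancel_mid[OF ev u2(1) v2(1) ud v2(2)] by (rule *[OF F(2,6)])
  show "Comp (FK n) c e = Id (FK n) G1" unfolding c_def e' C.cancel_mid[OF ev u2(1) v2(1) uc v2(2)] by (rule *[OF F(3,7)])
 qed
 have fd: "Comp (FK n) f d = Comp (FK n) f c"
 proof -
  have *: "Comp (FK n) f (Comp (FK n) (Comp (FK n) u1 k) v2) = Comp (FK n) (Comp (FK n) (fk_f F) k) v2" if k: "k : Hom (FK n) ?F2 ?F1" for k
   unfolding C.Hom_assoc[OF v2(1) k u1(1)] f_def C.cancel_mid[OF C.Hom_cmp[OF v2(1) k] u1(1) v1(1) F(5) v1(2)]
   by (rule C.Hom_assoc[OF v2(1) k F(5), symmetric])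
  show ?thesis unfolding d_def c_def *[OF F(2)] *[OF F(3)] F(8) ..
 qed
 let ?G = "Fk d c e f" and ?u = "FkMor F (Fk d c e f) u2 u1 (Id (FK n) ?F0)"
 have oG: "?G : Obj (Fork (FK n))" by (rule C.FkI[OF h r fd])
 note I0 = C.Hom_Id[OF o(3)]
 have u: "?u : Hom (FK (Suc n)) F ?G" unfolding n_Suc
 proof (rule C.FkMorI[OF Suc.prems(1)[unfolded n_Suc] oG])
  show "Comp (FK n) (fk_d ?G) u2 = Comp (FK n) u1 (fk_d F)" "Comp (FK n) (fk_c ?G) u2 = Comp (FK n) u1 (fk_c F)"
   "Comp (FK n) (fk_e ?G) u1 = Comp (FK n) u2 (fk_e F)" "Comp (FK n) (fk_f ?G) u1 = Comp (FK n) (Id (FK n) ?F0) (fk_f F)"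
   using C.cancel_right[OF u2(1) v2(1) ud v2(2)] C.cancel_right[OF u2(1) v2(1) uc v2(2)] C.cancel_right[OF u1(1) v1(1) ue v1(2)]
    C.cancel_right[OF u1(1) v1(1) F(5) v1(2)] C.Hom_unit(2)[OF F(5)] by (simp_all add: d_def c_def e_def f_def)
 qed (use u1(1) u2(1) I0 h in \<open>simp_all add: Hom_def\<close>)
 have "iso (FK n) (Id (FK n) ?F0)" by (rule C.iso_Id[OF o(3)])
 then have "iso (FK (Suc n)) ?u" unfolding n_Suc
  by (intro diag.iso_reflect[OF C.Fork_diag]) (use u u1(2) u2(2) in \<open>auto simp: Hom_def n_Suc fk_component_def\<close>)
 moreover have "component_at (Suc n) one1 ?u = \<phi>" using u1(3) by (simp add: fk_component_def)
 moreover have "component_at (Suc n) (sp i) ?u = \<theta> i" if "i < Suc n" for i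
  using that u1(4) u2(3) by (cases i) (simp_all add: fk_component_def)
 ultimately show ?case using u by blast
qed

lemma edge_transport:
 assumes F: "F : Obj (FK n)" and n: "n ~= 0" and \<phi>: "\<phi> : Hom BX (vtx X n one1 F) x" "iso BX \<phi>"
  and R: "!!i. i < n ==> R i : ERel_on BX x"
  and \<theta>: "!!i. i < n ==> \<theta> i : Hom BX (vtx X n (sp i) F) (Dom BX (rg_d (R i)))" "!!i. i < n ==> iso BX (\<theta> i)"
   "!!i. i < n ==> Comp BX (rg_d (R i)) (\<theta> i) = Comp BX \<phi> (fk_d (fid X n i one1 F))"
   "!!i. i < n ==> Comp BX (rg_c (R i)) (\<theta> i) = Comp BX \<phi> (fk_c (fid X n i one1 F))"
 obtains G u where "u : Hom (FK n) F G" "iso (FK n) u" "component_at n one1 u = \<phi>"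
  "!!i. i < n ==> rg_edge X n i (fob (grph_n n) G) = R i" "vtx X n one1 G = x"
proof -
 interpret C: CCat "FK n" by (rule FK)
 interpret B: CCat "base X" using RG(1)[of 0] by (simp add: n_Suc)
 have "EX G u. u : Hom (FK n) F G & iso (FK n) u & component_at n one1 u = \<phi> & (ALL i<n. component_at n (sp i) u = \<theta> i)"
  by (rule fork_transport[OF F \<phi>(2)]) (use \<phi>(1) \<theta>(1,2) in \<open>auto simp: Hom_def\<close>)
 then obtain G u where u: "u : Hom (FK n) F G" "iso (FK n) u" "component_at n one1 u = \<phi>" "!!i. i < n ==> component_at n (sp i) u = \<theta> i" by blast
 have oG: "G : Obj (FK n)" using C.Hom_obj u(1) by blast
 have xG: "vtx X n one1 G = x" using B.HomD(3)[OF component_Hom[OF u(1), of one1]] B.HomD(3)[OF \<phi>(1)] u(3) by simp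
 have e: "rg_edge X n i (fob (grph_n n) G) = R i" if i: "i < n" for i
 proof -
  let ?d = "fk_d (fid X n i one1 G)" and ?c = "fk_c (fid X n i one1 G)" and ?e = "fk_e (fid X n i one1 G)"
  have o1: "one1(i := 1) = one1" "one1(i := 2) = sp i" by (auto simp: sp_def)
  have fG: "fid X n i one1 G : Obj (Fork BX)" "Dom BX ?d = vtx X n (sp i) G" "Cod BX ?d = x"
   using fid_fork[OF oG i, of one1] unfolding o1 xG by blast+
  note D = B.FkD[OF fG(1)]
  note th = \<theta>(1)[OF i]
  have vG: "vtx X n (sp i) G = Dom BX (rg_d (R i))"
   using B.HomD(3)[OF component_Hom[OF u(1), of "sp i"]] B.HomD(3)[OF th] u(4)[OF i] by simp
  have RO: "R i : Obj (RGrph BX)" "relation BX (rg_d (R i)) (rg_c (R i))" "Cod BX (rg_d (R i)) = x"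
   using R[OF i] unfolding ERel_on_def ERel_Obj equivalence_relation_def reflexive_relation_def by auto
  note RD = B.RgD[OF RO(1)]
  obtain v where v: "v : Hom BX (Dom BX (rg_d (R i))) (vtx X n (sp i) F)" "Comp BX (\<theta> i) v = Id BX (Dom BX (rg_d (R i)))"
   using B.iso_inverse[OF \<theta>(2)[OF i] th] by blast
  have cancel: "a = b" if ab: "a : Hom BX (Dom BX (rg_d (R i))) x" "b : Hom BX (Dom BX (rg_d (R i))) x"
   "Comp BX a (\<theta> i) = Comp BX b (\<theta> i)" for a b
  proof -
   have "a = Comp BX (Comp BX a (\<theta> i)) v" by (rule B.cancel_right[OF v(1) th ab(1) v(2), symmetric])
   also have "... = b" unfolding ab(3) by (rule B.cancel_right[OF v(1) th ab(2) v(2)])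
   finally show ?thesis .
  qed
  have nat: "Comp BX ?d (\<theta> i) = Comp BX \<phi> (fk_d (fid X n i one1 F))" "Comp BX ?c (\<theta> i) = Comp BX \<phi> (fk_c (fid X n i one1 F))"
   using fid_natural[OF u(1) i, of one1] u(3) u(4)[OF i] unfolding o1 by simp_all
  note dH = D(2)[unfolded fG(2,3) vG] and cH = D(3)[unfolded fG(2,3) vG] and eH = D(4)[unfolded fG(2,3) vG]
  have d: "?d = rg_d (R i)"
   by (rule cancel[OF dH RD(2)[unfolded RO(3)]]) (use nat(1) \<theta>(3)[OF i] in simp)
  have c: "?c = rg_c (R i)"
   by (rule cancel[OF cH RD(3)[unfolded RO(3)]]) (use nat(2) \<theta>(4)[OF i] in simp)
  have "?e = rg_e (R i)"
  proof -
   have m: "?e : Mor BX" "rg_e (R i) : Mor BX" "Dom BX ?e = Dom BX (rg_e (R i))"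
    "Cod BX ?e = Dom BX (rg_d (R i))" "Cod BX (rg_e (R i)) = Dom BX (rg_d (R i))"
    using B.HomD[OF eH] B.HomD[OF RD(4)[unfolded RO(3)]] by auto
   moreover have "Comp BX (rg_d (R i)) ?e = Comp BX (rg_d (R i)) (rg_e (R i))" "Comp BX (rg_c (R i)) ?e = Comp BX (rg_c (R i)) (rg_e (R i))"
    using D(6,7) RD(5,6) unfolding d[symmetric] c[symmetric] by simp_all
   ultimately show ?thesis using RO(2) unfolding relation_def by blast
  qed
  then show ?thesis unfolding grph_edge[OF oG i] d c using RD(1) by simp
 qed
 show ?thesis by (rule that[OF u(1-3) e xG])
qed

end

section \<open>Distributive families of equivalence relations\<close>

locale EM_cell = EM C for C :: "('o, 'm) ccat"
begin

abbreviation xt :: "('o, 'm) cell => (('o, 'm) cell \<times> ('o, 'm) cell) set" where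
 "xt R \<equiv> ext C (rg_d R) (rg_c R)"

lemma ERel_onD: assumes "R : ERel_on C x"
 shows "equivalence_relation C (rg_d R) (rg_c R)" "Cod C (rg_d R) = x" "xt R : Rels C x"
 using assms unfolding ERel_on_def ERel_Obj Rels_def by auto

lemma Rels_ERel: assumes "a : Rels C x" shows "EX M:ERel_on C x. xt M = a"
proof -
 obtain d c where dc: "equivalence_relation C d c" "Cod C d = x" "a = ext C d c" using assms unfolding Rels_def by blast
 obtain e where "e : Hom C (Cod C d) (Dom C d)" "d ** e = Id C (Cod C d)" "c ** e = Id C (Cod C d)"
  using dc(1) unfolding equivalence_relation_def reflexive_relation_def by blast
 then have "is_rgraph C d c e" using eqrelD(1-4)[OF dc(1)] unfolding is_rgraph_def Hom_def by auto
 then have "Rg d c e : ERel_on C x" using dc unfolding ERel_on_def ERel_Obj RGrph_Obj by auto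
 then show ?thesis using dc(3) by (intro bexI[of _ "Rg d c e"]) auto
qed

lemma er_le_iff: assumes R: "R : ERel_on C x" and S: "S : ERel_on C x" shows "er_le C R S <-> xt R <= xt S"
proof
 assume "er_le C R S"
 then obtain h where h: "h : Mor C" "Cod C h = Dom C (rg_d S)" "rg_d S ** h = rg_d R" "rg_c S ** h = rg_c R"
  unfolding er_le_def Hom_def by blast
 then have m: "(rg_d R, rg_c R) : xt S" unfolding ext_def by (intro CollectI exI[of _ h]) simp
 show "xt R <= xt S"
 proof (intro subrelI)
  fix u v assume "(u, v) : xt R"
  then obtain k where "k : Mor C" "Cod C k = Dom C (rg_d R)" "u = rg_d R ** k" "v = rg_c R ** k" unfolding ext_def by blast
  then show "(u, v) : xt S" using ext_cong[OF ERel_onD(1)[OF S] m] by blast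
 qed
next
 assume "xt R <= xt S"
 then have "(rg_d R, rg_c R) : xt S" using ext_self[OF ERel_onD(1)[OF R]] by blast
 then obtain h where h: "h : Mor C" "Cod C h = Dom C (rg_d S)" "rg_d R = rg_d S ** h" "rg_c R = rg_c S ** h"
  unfolding ext_def by auto
 then have "h : Hom C (Dom C (rg_d R)) (Dom C (rg_d S))" using eqrelD(1-4)[OF ERel_onD(1)[OF S]] by (simp add: Hom_def)
 then show "er_le C R S" unfolding er_le_def using h by auto
qed

lemma er_eq_iff: "R : ERel_on C x ==> S : ERel_on C x ==> er_eq C R S <-> xt R = xt S"
 unfolding er_eq_def using er_le_iff by blast

context
 fixes x assumes x: "x : Obj C"
begin

interpretation L: modlat "Rels C x" "pairs C x" "{(u, u) | u. u : Mor C & Cod C u = x}" "rcomp C x"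
 by (rule Rels_modlat[OF x])

lemma xt_Meet: assumes A: "finite A" "A <= ERel_on C x"
 shows "er_Meet C x A : ERel_on C x" "xt (er_Meet C x A) = L.mt xt A"
proof -
 let ?P = "%M. M : ERel_on C x & (ALL S:A. er_le C M S) & (ALL T:ERel_on C x. (ALL S:A. er_le C T S) --> er_le C T M)"
 have "L.mt xt A : Rels C x" by (rule L.mt_in) (use A ERel_onD in auto)
 then obtain M0 where M0: "M0 : ERel_on C x" "xt M0 = L.mt xt A" using Rels_ERel by blast
 have low: "er_le C T M0" if T: "T : ERel_on C x" "ALL S:A. er_le C T S" for T
 proof -
  have "xt T <= xt S" if "S : A" for S using T er_le_iff that A(2) by blast
  then have "xt T <= L.mt xt A" using Rels_pairs[OF ERel_onD(3)[OF T(1)]] unfolding L.mt_def by blast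
  then show ?thesis using er_le_iff[OF T(1) M0(1)] M0(2) by simp
 qed
 have up: "er_le C M0 S" if S: "S : A" for S
  using er_le_iff[OF M0(1), of S] S A(2) M0(2) L.mt_le[OF S, of xt] by auto
 have "?P M0" using M0(1) low up by blast
 then have P: "?P (er_Meet C x A)" unfolding er_Meet_def by (rule someI)
 then show m: "er_Meet C x A : ERel_on C x" by blast
 have "er_le C (er_Meet C x A) M0" by (rule low) (use P in blast)+
 moreover have "er_le C M0 (er_Meet C x A)" using P M0(1) up by blast
 ultimately show "xt (er_Meet C x A) = L.mt xt A" using er_le_iff[OF m M0(1)] er_le_iff[OF M0(1) m] M0(2) by simp
qed

lemma xt_Join: assumes A: "finite A" "A <= ERel_on C x"
 shows "er_Join C x A : ERel_on C x" "xt (er_Join C x A) = L.jn xt A"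
proof -
 let ?P = "%M. M : ERel_on C x & (ALL S:A. er_le C S M) & (ALL T:ERel_on C x. (ALL S:A. er_le C S T) --> er_le C M T)"
 have "L.jn xt A : Rels C x" by (rule L.jn_in) (use A ERel_onD in auto)
 then obtain M0 where M0: "M0 : ERel_on C x" "xt M0 = L.jn xt A" using Rels_ERel by blast
 have low: "er_le C M0 T" if T: "T : ERel_on C x" "ALL S:A. er_le C S T" for T
 proof -
  have "L.jn xt A <= xt T" by (rule L.jn_lub[OF ERel_onD(3)[OF T(1)]]) (use T er_le_iff A(2) in blast)
  then show ?thesis using er_le_iff[OF M0(1) T(1)] M0(2) by simp
 qed
 have up: "er_le C S M0" if S: "S : A" for S
 proof -
  have "S : ERel_on C x" using S A(2) by blast
  then show ?thesis using er_le_iff[OF _ M0(1), of S] M0(2) L.jn_ub[OF S, of xt] by simp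
 qed
 have "?P M0" using M0(1) low up by blast
 then have P: "?P (er_Join C x A)" unfolding er_Join_def by (rule someI)
 then show m: "er_Join C x A : ERel_on C x" by blast
 have "er_le C M0 (er_Join C x A)" by (rule low) (use P in blast)+
 moreover have "er_le C (er_Join C x A) M0" using P M0(1) up by blast
 ultimately show "xt (er_Join C x A) = L.jn xt A" using er_le_iff[OF m M0(1)] er_le_iff[OF M0(1) m] M0(2) by simp
qed

lemma jn_image: "L.jn f (g ` A) = L.jn (%i. f (g i)) A"
 unfolding L.jn_def by simp

lemma mt_image: "L.mt f (g ` A) = L.mt (%i. f (g i)) A"
 unfolding L.mt_def by simp

lemma jn_cong: "(!!i. i : A ==> f i = g i) ==> L.jn f A = L.jn g A"
 unfolding L.jn_def by simp

context
 fixes R :: "nat => ('o, 'm) cell" and n :: nat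
 assumes R: "!!i. i < n ==> R i : ERel_on C x"
begin

abbreviation r where "r i \<equiv> xt (R i)"

lemma r_in: "i : {..<n} ==> r i : Rels C x" using ERel_onD(3)[OF R] by simp

lemma J_finite: "K <= {..<n} ==> finite (R ` K)" "K <= {..<n} ==> R ` K <= ERel_on C x"
 using finite_subset R by blast+

lemma Meet_J: "K <= {..<n} ==> er_Meet C x (R ` K) : ERel_on C x" "K <= {..<n} ==> xt (er_Meet C x (R ` K)) = L.mt r K"
 using xt_Meet[OF J_finite] mt_image[of xt R K] by simp_all

lemma Join_J: assumes "ALL i:A. J i <= {..<n}" "finite A"
 shows "er_Join C x ((%i. er_Meet C x (R ` J i)) ` A) : ERel_on C x"
  "xt (er_Join C x ((%i. er_Meet C x (R ` J i)) ` A)) = L.jn (%i. L.mt r (J i)) A"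
proof -
 have f: "finite ((%i. er_Meet C x (R ` J i)) ` A)" "(%i. er_Meet C x (R ` J i)) ` A <= ERel_on C x"
  using assms Meet_J(1) by auto
 show "er_Join C x ((%i. er_Meet C x (R ` J i)) ` A) : ERel_on C x" by (rule xt_Join(1)[OF f])
 show "xt (er_Join C x ((%i. er_Meet C x (R ` J i)) ` A)) = L.jn (%i. L.mt r (J i)) A"
  unfolding xt_Join(2)[OF f] jn_image by (rule jn_cong) (rule Meet_J(2)[OF bspec[OF assms(1)]])
qed

lemma distributive_eq: fixes k :: nat assumes J: "ALL i<=k. J i <= {..<n}"
 shows "er_eq C
    (er_Meet C x {er_Meet C x (R ` J 0), er_Join C x ((%i. er_Meet C x (R ` J i)) ` {1..k})})
    (er_Join C x ((%i. er_Meet C x (R ` (J 0 Un J i))) ` {1..k})) <->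
   L.mt r (J 0) Int L.jn (%i. L.mt r (J i)) {1..k} <= L.jn (%i. L.mt r (J 0 Un J i)) {1..k}" (is "?E <-> ?A Int ?B <= ?D")
proof -
 have J0: "J 0 <= {..<n}" by (rule J[rule_format]) simp
 have Ji: "ALL i:{1..k}. J i <= {..<n}" using J by simp
 have Jj: "ALL i:{1..k}. J 0 Un J i <= {..<n}" using J0 Ji by blast
 note a = Meet_J[OF J0] and b = Join_J[of "{1..k}" J, OF Ji finite_atLeastAtMost] and d = Join_J[of "{1..k}" "%i. J 0 Un J i", OF Jj finite_atLeastAtMost]
 let ?T = "{er_Meet C x (R ` J 0), er_Join C x ((%i. er_Meet C x (R ` J i)) ` {1..k})}"
 have T: "finite ?T" "?T <= ERel_on C x" using a(1) b(1) by auto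
 have m: "xt (er_Meet C x ?T) = ?A Int ?B"
  unfolding xt_Meet(2)[OF T] using Rels_pairs[OF ERel_onD(3)[OF a(1)]] a(2) b(2) unfolding L.mt_def[of xt] by auto
 have "?E <-> ?A Int ?B = ?D" unfolding er_eq_iff[OF xt_Meet(1)[OF T] d(1)] d(2) m by (rule refl)
 moreover have "?D <= ?A Int ?B"
 proof (rule L.jn_lub)
  show "?A Int ?B : Rels C x" using ERel_onD(3)[OF a(1)] ERel_onD(3)[OF b(1)] a(2) b(2) by simp
  fix i assume i: "i : {1..k}"
  have "L.mt r (J 0 Un J i) <= L.mt r (J i)" unfolding L.mt_def by auto
  then show "L.mt r (J 0 Un J i) <= ?A Int ?B" using L.jn_ub[OF i, of "%i. L.mt r (J i)"] unfolding L.mt_def by auto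
 qed
 ultimately show ?thesis by blast
qed

lemma jm_jn: assumes "ALL K:set Ks. K <= {..<n}" shows "L.jm r Ks {} = L.jn (L.mt r) (set Ks)"
 using assms
proof (induction Ks)
 case (Cons K Ks)
 have m: "L.mt r Z : Rels C x" if "Z : set (K # Ks)" for Z
  by (rule L.mt_in) (use bspec[OF Cons.prems that] r_in finite_subset in auto)
 have "L.jn (L.mt r) (insert K (set Ks)) = rcomp C x (L.mt r K) (L.jn (L.mt r) (set Ks))"
  by (rule L.jn_insert) (use m in \<open>auto intro!: L.jn_in\<close>)
 then show ?case using Cons by simp
qed (simp add: L.jn_empty)

lemma apart_map: "L.apart I (map J js) U <-> (ALL j:set js. J j <= I & J j Int U = {}) & (ALL p q. p < q & q < length js --> J (js ! p) Int J (js ! q) = {})"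
proof (induction js arbitrary: U)
 case (Cons j js)
 have s: "(ALL p q. p < q & q < length (j # js) --> J ((j # js) ! p) Int J ((j # js) ! q) = {}) <->
   (ALL q<length js. J j Int J (js ! q) = {}) & (ALL p q. p < q & q < length js --> J (js ! p) Int J (js ! q) = {})" (is "?L <-> ?R")
 proof
  assume L: ?L
  show ?R
  proof (intro conjI allI impI)
   fix q assume "q < length js" then show "J j Int J (js ! q) = {}" using L[rule_format, of 0 "Suc q"] by simp
  next
   fix p q assume "p < q & q < length js" then show "J (js ! p) Int J (js ! q) = {}" using L[rule_format, of "Suc p" "Suc q"] by simp
  qed
 next
  assume ?R
  then show ?L by (auto simp: nth_Cons split: nat.splits)
 qed
 have "(ALL q<length js. J j Int J (js ! q) = {}) <-> (ALL l:set js. J l Int J j = {})" by (metis Int_commute in_set_conv_nth)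
 then show ?case unfolding list.map L.apart.simps Cons.IH s by auto
qed simp

lemma distributive_codistr: "distributive C x n R <-> L.codistr r {..<n}"
proof
 assume D: "distributive C x n R"
 show "L.codistr r {..<n}"
 proof (rule L.distr_imp_codistr[OF r_in finite_lessThan])
  fix Q Ks c assume Q: "Q <= {..<n}" and Ks: "Ks ~= []" "L.apart {..<n} Ks Q" and c: "c : Rels C x" "!!K. K : set Ks ==> L.mt r (Q Un K) <= c"
  let ?k = "length Ks"
  define J where "J i = (if i = 0 then Q else if i <= ?k then Ks ! (i - 1) else {})" for i
  have J0: "J 0 = Q" by (simp add: J_def)
  have Ksm: "Ks = map J [1..<Suc ?k]" by (rule nth_equalityI) (auto simp: J_def simp del: upt_Suc)
  have sub: "K <= {..<n}" if "K : set Ks" for K by (rule L.apart_sub[OF Ks(2) that])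
  have sJ: "ALL i<=?k. J i <= {..<n}" using Q sub by (auto simp: J_def)
  have "L.apart {..<n} (map J [1..<Suc ?k]) Q" using Ks(2) Ksm by argo
  note ap = this[unfolded apart_map]
  have a: "ALL j:set [1..<Suc ?k]. J j <= {..<n} & J j Int Q = {}" by (rule ap[THEN conjunct1])
  have a': "J (Suc p) Int J (Suc q) = {}" if "p < q" "q < ?k" for p q
   using ap[THEN conjunct2, rule_format, of p q] that by (simp del: upt_Suc)
  have dl: "J i Int J j = {}" if ij: "i < j" "j <= ?k" for i j
  proof (cases i)
   case 0
   then show ?thesis using a ij unfolding J0[symmetric] by (auto simp del: upt_Suc)
  next
   case (Suc p)
   then obtain q where "j = Suc q" using ij(1) by (cases j) auto
   then show ?thesis using a'[of p q] Suc ij by simp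
  qed
  have dj: "ALL i<=?k. ALL j<=?k. i ~= j --> J i Int J j = {}"
  proof (intro allI impI)
   fix i j assume "i <= ?k" "j <= ?k" "i ~= j"
   then show "J i Int J j = {}" using dl[of i j] dl[of j i] by (cases "i < j") auto
  qed
  have "?k \<ge> 1" using Ks(1) by (cases Ks) auto
  then have "L.mt r (J 0) Int L.jn (%i. L.mt r (J i)) {1..?k} <= L.jn (%i. L.mt r (J 0 Un J i)) {1..?k}"
   using D sJ dj unfolding distributive_def distributive_eq[OF sJ, symmetric] by blast
  moreover have "L.jn (%i. L.mt r (J 0 Un J i)) {1..?k} <= c"
  proof (rule L.jn_lub[OF c(1)])
   fix i assume "i : {1..?k}"
   then have "J i : set Ks" by (auto simp: J_def)
   from c(2)[OF this] show "L.mt r (J 0 Un J i) <= c" unfolding J0 .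
  qed
  moreover have "L.jm r Ks {} = L.jn (%i. L.mt r (J i)) {1..?k}"
  proof -
   have "set Ks = J ` {1..?k}" using arg_cong[OF Ksm, of set] by (simp add: atLeastLessThanSuc_atLeastAtMost del: upt_Suc)
   moreover have "L.jm r Ks {} = L.jn (L.mt r) (set Ks)" by (rule jm_jn) (use sub in blast)
   ultimately have "L.jm r Ks {} = L.jn (L.mt r) (J ` {1..?k})" by (simp only:)
   then show ?thesis unfolding jn_image .
  qed
  ultimately show "L.mt r Q Int L.jm r Ks {} <= c" unfolding J0 by blast
 qed
next
 assume D: "L.codistr r {..<n}"
 show "distributive C x n R" unfolding distributive_def
 proof (intro allI impI, elim conjE)
  fix k and J :: "nat => nat set" assume k: "1 <= k" and J: "ALL i<=k. J i <= {..<n}" and dj: "ALL i<=k. ALL j<=k. i ~= j --> J i Int J j = {}"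
  let ?Ks = "map J [1..<Suc k]"
  have s: "set ?Ks = J ` {1..k}" by (simp add: atLeastLessThanSuc_atLeastAtMost del: upt_Suc)
  have "L.mt r (J 0) Int L.jm r ?Ks {} <= L.jn (%i. L.mt r (J 0 Un J i)) {1..k}"
  proof (rule L.codistr_imp_distr[OF r_in finite_lessThan D])
   show "J 0 <= {..<n}" using J by blast
   show "L.apart {..<n} ?Ks (J 0)" unfolding apart_map using J dj by (auto simp del: upt_Suc)
   show "L.jn (%i. L.mt r (J 0 Un J i)) {1..k} : Rels C x"
    by (rule L.jn_in) (use J r_in finite_subset[of _ "{..<n}"] in \<open>auto intro!: L.mt_in\<close>)
   show "L.mt r (J 0 Un K) <= L.jn (%i. L.mt r (J 0 Un J i)) {1..k}" if K: "K : set ?Ks" for K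
   proof -
    obtain i where i: "i : {1..k}" "K = J i" using K unfolding s by blast
    show ?thesis unfolding i(2) by (rule L.jn_ub[OF i(1)])
   qed
  qed
  moreover have "L.jm r ?Ks {} = L.jn (%i. L.mt r (J i)) {1..k}"
  proof -
   have "ALL K:set ?Ks. K <= {..<n}" using J unfolding s by auto
   from jm_jn[OF this] show ?thesis unfolding s jn_image .
  qed
  ultimately show "er_eq C
    (er_Meet C x {er_Meet C x (R ` J 0), er_Join C x ((%i. er_Meet C x (R ` J i)) ` {1..k})})
    (er_Join C x ((%i. er_Meet C x (R ` (J 0 Un J i))) ` {1..k}))" unfolding distributive_eq[OF J] by simp
 qed
qed

end

end

end

context EM begin

lemma eqrel_coeq_ker: assumes eq: "equivalence_relation C d c" and rg: "is_rgraph C d c e" and co: "coeq C d c q"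
 shows "ker C q = ext C d c"
proof
 have r: "ext C d c : Rels C (Cod C d)" using eq unfolding Rels_def by blast
 show "ker C q <= ext C d c" unfolding rgraph_coeq(2)[OF rg co]
 proof (intro subrelI)
  fix u v assume "(u, v) : gen_rel C d c"
  then obtain p h where uv: "(u, v) : pairs C (Cod C d)" and p: "re C p" "Cod C p = Dom C u"
   and h: "h : Mor C" "Cod C h = Dom C d" "d ** h = u ** p" "c ** h = v ** p" unfolding gen_rel_def by blast
  have "(u ** p, v ** p) : ext C d c" unfolding ext_def using h(1,2) h(3,4)[symmetric] by blast
  then show "(u, v) : ext C d c" by (rule Rels_local[OF r uv p])
 qed
 have "(d, c) : ker C q" using co_Hom[OF co] unfolding ker_def pairs_iff by (auto simp: Hom_def)
 then show "ext C d c <= ker C q"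
  using Rels_cong[OF ker_Rels[OF HomD(1)[OF co_Hom(3)[OF co]]]] unfolding ext_def by blast
qed

end

context EM_cell begin

lemma er_iso: assumes R: "R : ERel_on C x" and S: "S : ERel_on C x" and e: "xt R = xt S"
 obtains h where "h : Hom C (Dom C (rg_d R)) (Dom C (rg_d S))" "iso C h" "rg_d S ** h = rg_d R" "rg_c S ** h = rg_c R"
proof -
 have "er_le C R S" "er_le C S R" using er_le_iff[OF R S] er_le_iff[OF S R] e by blast+
 then obtain h k where h: "h : Hom C (Dom C (rg_d R)) (Dom C (rg_d S))" "rg_d S ** h = rg_d R" "rg_c S ** h = rg_c R"
  and k: "k : Hom C (Dom C (rg_d S)) (Dom C (rg_d R))" "rg_d R ** k = rg_d S" "rg_c R ** k = rg_c S" unfolding er_le_def by blast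
 have inv: "k' ** h' = Id C (Dom C (rg_d R'))" if R': "R' : ERel_on C x"
  and h': "h' : Hom C (Dom C (rg_d R')) (Dom C (rg_d S'))" "rg_d S' ** h' = rg_d R'" "rg_c S' ** h' = rg_c R'"
  and k': "k' : Hom C (Dom C (rg_d S')) (Dom C (rg_d R'))" "rg_d R' ** k' = rg_d S'" "rg_c R' ** k' = rg_c S'" for R' S' h' k'
 proof -
  note q = ERel_onD(1)[OF R']
  have d: "rg_d R' : Hom C (Dom C (rg_d R')) (Cod C (rg_d R'))" "rg_c R' : Hom C (Dom C (rg_d R')) (Cod C (rg_d R'))"
   using eqrelD(1-4)[OF q] by (auto simp: Hom_def)
  have r: "relation C (rg_d R') (rg_c R')" using q unfolding equivalence_relation_def reflexive_relation_def by blast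
  note kh = HomD[OF Hom_cmp[OF h'(1) k'(1)]] and i = HomD[OF Hom_Id[OF Hom_obj(1)[OF d(1)]]]
  have "rg_d R' ** k' ** h' = rg_d R' ** Id C (Dom C (rg_d R'))" "rg_c R' ** k' ** h' = rg_c R' ** Id C (Dom C (rg_d R'))"
   unfolding Hom_assoc[OF h'(1) k'(1) d(1), symmetric] Hom_assoc[OF h'(1) k'(1) d(2), symmetric] k'(2,3) h'(2,3) Hom_unit(1)[OF d(1)] Hom_unit(1)[OF d(2)]
   by (rule refl)+
  then show ?thesis using r kh i unfolding relation_def by metis
 qed
 have "iso C h" by (rule isoI[of h k]) (use inv[OF R h k] inv[OF S k h] h(1) k(1) in \<open>auto simp: Hom_def\<close>)
 then show thesis using that h by blast
qed

end

context modlat begin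

lemma codistr_cong: assumes "!!i. i : I ==> R i = R' i" shows "codistr R I <-> codistr R' I"
proof -
 have j: "jn R Z = jn R' Z" "mt R Z = mt R' Z" if "Z <= I" for Z
 proof -
  have "R i = R' i" if "i : Z" for i using that \<open>Z <= I\<close> assms by blast
  then show "jn R Z = jn R' Z" "mt R Z = mt R' Z" unfolding jn_def mt_def by simp_all
 qed
 have "(\<Inter>i\<in>P. J (jn R Z) (R i)) = (\<Inter>i\<in>P. J (jn R' Z) (R' i))" if P: "P <= I" "Z <= I" for P Z
 proof -
  have "R i = R' i" if "i : P" for i using that P(1) assms by blast
  then show ?thesis unfolding j(1)[OF P(2)] by simp
 qed
 then show ?thesis unfolding codistr_def using j by auto
qed

end

context EM_tower begin

sublocale EC: EM_cell "base X" by (simp add: EM_cell_def EM_base)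

lemma rgc_iso: assumes "x : Hom (RG n) G K" "y : Hom (RG n) K G" "Comp (RG n) y x = Id (RG n) G" "Comp (RG n) x y = Id (RG n) K"
 shows "iso BX (rgc n a x)"
proof -
 interpret R: CCat "RG n" by (rule RG)
 note O = R.Hom_obj[OF assms(1)]
 note x = rgc_Hom[OF assms(1), of a] and y = rgc_Hom[OF assms(2), of a]
 have "rgc n a y *** rgc n a x = Id BX (rvtx X n a G)" "rgc n a x *** rgc n a y = Id BX (rvtx X n a K)"
  using rgc_Comp[OF assms(1,2), of a] rgc_Comp[OF assms(2,1), of a] assms(3,4) rgc_Id[OF O(1)] rgc_Id[OF O(2)] by simp_all
 then show ?thesis using E.HomD[OF x] E.HomD[OF y] by (intro E.isoI[of "rgc n a x" "rgc n a y"]) simp_all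
qed

lemma acomp_Id: "A : Obj (AR n) ==> acomp n a (Id (AR n) A) = Id BX (avtx X n a A)"
proof (induction n arbitrary: a A)
 case (Suc n)
 obtain k b where a: "a = case_nat k b" using case_eta by blast
 have "sq_component k (Id (AR (Suc n)) A) = Id (AR n) (sq_vertex (AR n) k A)"
  by (simp add: n_Suc sq_component_def sq_vertex_def)
 then show ?case unfolding a using Suc.IH[OF sq_vertex_obj[OF Suc.prems], of b k] by simp
qed (simp add: n_Suc)

lemma edge_ERel: assumes F: "F : Obj (FK n)" and l: "lex X n F" and i: "i < n"
 shows "rg_edge X n i (fob (grph_n n) F) : ERel_on BX (vtx X n one1 F)"
  "EC.xt (rg_edge X n i (fob (grph_n n) F)) = ker BX (fk_f (fid X n i one1 F))"
proof -
 interpret B: CCat "base X" using RG(1)[of 0] by (simp add: n_Suc)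
 have "pos one1" by (simp add: pos_def)
 then have k: "kp BX (fk_f (fid X n i one1 F)) (fk_d (fid X n i one1 F)) (fk_c (fid X n i one1 F))"
  using l i unfolding lex_fid[OF F] by blast
 have o1: "one1(i := 1) = one1" by auto
 have f: "fid X n i one1 F : Obj (Fork BX)" "Cod BX (fk_d (fid X n i one1 F)) = vtx X n one1 F"
  using fid_fork[OF F i, of one1] unfolding o1 by blast+
 note D = B.FkD[OF f(1)]
 have rg: "is_rgraph BX (fk_d (fid X n i one1 F)) (fk_c (fid X n i one1 F)) (fk_e (fid X n i one1 F))"
  unfolding E.is_rgraph_Hom using D by blast
 have "Rg (fk_d (fid X n i one1 F)) (fk_c (fid X n i one1 F)) (fk_e (fid X n i one1 F)) : Obj (RGrph BX)"
  unfolding RGrph_Obj using rg by blast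
 then show "rg_edge X n i (fob (grph_n n) F) : ERel_on BX (vtx X n one1 F)"
  unfolding grph_edge[OF F i] ERel_on_def ERel_Obj using E.kp_eqrel[OF k] f(2) by simp
 show "EC.xt (rg_edge X n i (fob (grph_n n) F)) = ker BX (fk_f (fid X n i one1 F))"
  unfolding grph_edge[OF F i] using E.kp_ker[OF k] by simp
qed

lemma edge_vertex: assumes G: "G : Obj (RG n)" and "n ~= 0" "rg_edge X n 0 G : ERel_on BX x"
 shows "rvtx X n one1 G = x"
 using edge_Hom[OF G, of 0] assms(2,3) unfolding ERel_on_def Hom_def by auto

lemma exact_imp_box: assumes F: "F : Obj (FK n)" and n: "n ~= 0" and ex: "exact_n_fork X n F"
 shows "distributive_parallelistic X n (fob (grph_n n) F)"
proof -
 interpret N: nfork "base X" n "%a. vtx X n a F" "%i a. fk_f (fid X n i a F)" "%i a. fk_d (fid X n i a F)" "%i a. fk_c (fid X n i a F)" "%i a. fk_e (fid X n i a F)"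
  by (rule nfork_fid[OF F])
 interpret R: CCat "ER n" by (rule ER_CCat)
 have l: "lex X n F" and r: "rex X n F" using ex exact_iff[OF F] by blast+
 let ?G = "fob (grph_n n) F" and ?x = "vtx X n one1 F"
 define R where "R i = rg_edge X n i ?G" for i
 have RE: "N.RE" using r unfolding rex_fid[OF F] N.RE_def .
 have x: "?x : Obj BX" by (rule N.x0[OF n RE, unfolded N.ones_def])
 have G: "?G : Obj (ER n)" by (rule grph_ER[OF l])
 have Ri: "R i : ERel_on BX ?x" if "i < n" for i unfolding R_def by (rule edge_ERel(1)[OF F l that])
 have rG: "rvtx X n one1 ?G = ?x" by (rule edge_vertex[OF ER_RG[OF G] n]) (use Ri[of 0] n in \<open>simp add: R_def\<close>)
 have "is_box X ?x n R ?G" unfolding is_box_def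
 proof (intro conjI ballI)
  show "ALL i<n. R i : ERel_on BX ?x" using Ri by blast
  show "?G : n_fold_erel_on X n R" unfolding n_fold_erel_on_def R_def using G by blast
  fix K assume "K : n_fold_erel_on X n R"
  then have K: "K : Obj (ER n)" "!!i. i < n ==> rg_edge X n i K = rg_edge X n i ?G" unfolding n_fold_erel_on_def R_def by blast+
  have rK: "rvtx X n one1 K = ?x" by (rule edge_vertex[OF ER_RG[OF K(1)] n]) (use Ri[of 0] n K(2)[of 0] in \<open>simp add: R_def\<close>)
  obtain h where "h : Hom (RG n) K ?G" "rgc n one1 h = Id BX ?x"
   using grph_largest[OF l K(1) _ K(2)] rK rG by auto
  then show "EX h:Hom (ER n) K ?G. rg_base_mor n h = Id BX ?x"
   unfolding rg_base_rgc using full_sub_Hom[OF ER_full] K(1) G by blast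
 qed
 moreover have "distributive BX ?x n R"
 proof -
  interpret L: modlat "Rels BX ?x" "pairs BX ?x" "{(u, u) | u. u : Mor BX & Cod BX u = ?x}" "rcomp BX ?x"
   by (rule E.Rels_modlat[OF x])
  have CRT: "N.CRT" using exact_iff_CRT[OF F l] ex by blast
  have "L.codistr (%i. ker BX (fk_f (fid X n i one1 F))) {..<n}"
   using N.CRT_codistr[OF n RE CRT] unfolding N.ones_def .
  moreover have "L.codistr (%i. ker BX (fk_f (fid X n i one1 F))) {..<n} <-> L.codistr (%i. EC.xt (R i)) {..<n}"
   by (rule L.codistr_cong) (use edge_ERel(2)[OF F l] in \<open>simp add: R_def\<close>)
  moreover have "distributive BX ?x n R <-> L.codistr (%i. EC.xt (R i)) {..<n}"
   by (rule EC.distributive_codistr[OF x]) (rule Ri)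
  ultimately show ?thesis by blast
 qed
 moreover have "isomorphic (ER n) ?G ?G" unfolding isomorphic_def using R.Hom_Id[OF G] R.iso_Id[OF G] by blast
 ultimately show ?thesis unfolding distributive_parallelistic_def using G x by blast
qed

lemma component_arr_Id: assumes F: "F : Obj (FK n)" and w: "w : Hom (FK n) F G" "fmor (arr_n n) w = Id (AR n) (fob (arr_n n) F)"
 shows "component_at n one1 w = Id BX (vtx X n one1 F)"
proof -
 have o: "ALL j. one1 j : {0, 1}" by simp
 have A: "fob (arr_n n) F : Obj (AR n)" by (rule functorD(1)[OF arr_functor F])
 show ?thesis using arr_comp[OF w(1) o] unfolding w(2) acomp_Id[OF A] arr_vtx[OF F o] by (rule sym)
qed

lemma rgc_inverse: assumes "x : Hom (RG n) G K" "y : Hom (RG n) K G" "Comp (RG n) x y = Id (RG n) K"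
 shows "rgc n a x *** rgc n a y = Id BX (rvtx X n a K)"
proof -
 interpret R: CCat "RG n" by (rule RG)
 show ?thesis using rgc_Comp[OF assms(2,1), of a] assms(3) rgc_Id[OF R.Hom_obj(2)[OF assms(1)]] by simp
qed

text \<open>\<open>K\<close> is the fork completed from \<open>arr_n F\<close>, with vertices moved so that its relations are exactly the \<open>R i\<close>.
 The box \<open>B\<close> and the graph of \<open>K\<close> are compared by arrows that are the identity on \<open>x\<close>, hence mutually inverse
 by faithfulness.\<close>

lemma box_imp_lex:
 assumes F: "F : Obj (FK n)" and n: "n ~= 0" and r: "rex X n F" and x: "vtx X n one1 F = x"
  and e: "!!i. i < n ==> rg_edge X n i (fob (grph_n n) F) = R i" and B: "is_box X x n R B" and d: "distributive BX x n R"
  and \<chi>: "\<chi> : Hom (RG n) B (fob (grph_n n) F)" "\<chi>' : Hom (RG n) (fob (grph_n n) F) B" "Comp (RG n) \<chi> \<chi>' = Id (RG n) (fob (grph_n n) F)"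
   "rgc n one1 \<chi> = Id BX x"
 shows "lex X n F"
proof -
 interpret N: nfork "base X" n "%a. vtx X n a F" "%i a. fk_f (fid X n i a F)" "%i a. fk_d (fid X n i a F)" "%i a. fk_c (fid X n i a F)" "%i a. fk_e (fid X n i a F)"
  by (rule nfork_fid[OF F])
 interpret C: CCat "FK n" by (rule FK)
 interpret R: CCat "RG n" by (rule RG)
 let ?G = "fob (grph_n n) F"
 have RE: "N.RE" using r unfolding rex_fid[OF F] N.RE_def .
 have xO: "x : Obj BX" using N.x0[OF n RE] x unfolding N.ones_def by simp
 have Ri: "R i : ERel_on BX x" if "i < n" for i using B that unfolding is_box_def by blast
 have p1: "pos one1" by (simp add: pos_def)
 have kerR: "ker BX (fk_f (fid X n i one1 F)) = EC.xt (R i)" if i: "i < n" for i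
 proof -
  have R: "R i = Rg (fk_d (fid X n i one1 F)) (fk_c (fid X n i one1 F)) (fk_e (fid X n i one1 F))"
   using e[OF i] unfolding grph_edge[OF F i] by simp
  have "coeq BX (rg_d (R i)) (rg_c (R i)) (fk_f (fid X n i one1 F))"
   using r i p1 unfolding rex_fid[OF F] R by simp
  moreover have "is_rgraph BX (rg_d (R i)) (rg_c (R i)) (rg_e (R i))"
   using Ri[OF i] unfolding ERel_on_def ERel_Obj RGrph_Obj by auto
  ultimately show ?thesis using E.eqrel_coeq_ker EC.ERel_onD(1)[OF Ri[OF i]] by blast
 qed
 have CRT: "N.CRT"
 proof -
  interpret L: modlat "Rels BX x" "pairs BX x" "{(u, u) | u. u : Mor BX & Cod BX u = x}" "rcomp BX x"
   by (rule E.Rels_modlat[OF xO])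
  have "distributive BX x n R <-> L.codistr (%i. EC.xt (R i)) {..<n}"
   by (rule EC.distributive_codistr[OF xO]) (rule Ri)
  moreover have "L.codistr (%i. ker BX (fk_f (fid X n i one1 F))) {..<n} <-> L.codistr (%i. EC.xt (R i)) {..<n}"
   by (rule L.codistr_cong, rule kerR) simp
  ultimately have "L.codistr (%i. ker BX (fk_f (fid X n i one1 F))) {..<n}" using d by blast
  then show ?thesis by (rule N.codistr_CRT[OF n RE, unfolded N.ones_def x])
 qed
 let ?A = "fob (arr_n n) F"
 have A: "?A : Obj (AR n)" by (rule functorD(1)[OF arr_functor F])
 define F2 where "F2 = fob (EqFork_n X n) ?A"
 have F2: "lex X n F2" "fob (arr_n n) F2 = ?A" using Eq_n A unfolding F2_def by blast+
 have oF2: "F2 : Obj (FK n)" by (rule lex_obj[OF F2(1)])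
 have "exact_n_fork X n F2"
  using exact_iff_CRT[OF oF2 F2(1)] CRT_all_lifts[OF oF2] CRT_all_lifts[OF F] CRT unfolding F2(2) by blast
 then have rF2: "rex X n F2" using exact_iff[OF oF2] by blast
 have "Id (AR n) ?A : Hom (AR n) ?A (fob (arr_n n) F2)" unfolding F2(2)
  using Cat.Hom_Id[of "AR n" ?A] AR(1)[of n] A unfolding CCat_def by blast
 then obtain w where w: "w : Hom (FK n) F F2" "fmor (arr_n n) w = Id (AR n) ?A" using up_ex[OF lex_up[OF F2(1)] F] by blast
 have w1: "component_at n one1 w = Id BX x" using component_arr_Id[OF F w] x by simp
 have x2: "vtx X n one1 F2 = x" using E.HomD(3)[OF component_Hom[OF w(1), of one1]] E.HomD(3)[OF E.Hom_Id[OF xO]] w1 by simp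
 have f2: "fk_f (fid X n i one1 F2) = fk_f (fid X n i one1 F)" if i: "i < n" for i
  using arr_dir[OF oF2 i, of one1] arr_dir[OF F i, of one1] F2(2) by simp
 have "EX h. h : Hom BX (vtx X n (sp i) F2) (Dom BX (rg_d (R i))) & iso BX h &
   rg_d (R i) *** h = fk_d (fid X n i one1 F2) & rg_c (R i) *** h = fk_c (fid X n i one1 F2)" if i: "i < n" for i
 proof -
  let ?R = "rg_edge X n i (fob (grph_n n) F2)"
  have o: "?R : ERel_on BX x" using edge_ERel(1)[OF oF2 F2(1) i] x2 by simp
  have "EC.xt ?R = EC.xt (R i)" using edge_ERel(2)[OF oF2 F2(1) i] f2[OF i] kerR[OF i] by simp
  then obtain h where h: "h : Hom BX (Dom BX (rg_d ?R)) (Dom BX (rg_d (R i)))" "iso BX h" "rg_d (R i) *** h = rg_d ?R" "rg_c (R i) *** h = rg_c ?R"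
   using EC.er_iso[OF o Ri[OF i]] by blast
  have "Dom BX (rg_d ?R) = vtx X n (sp i) F2" using fid_fork[OF oF2 i, of one1] unfolding grph_edge[OF oF2 i] sp_def by simp
  then show ?thesis using h unfolding grph_edge[OF oF2 i] by auto
 qed
 then obtain \<theta> where \<theta>: "!!i. i < n ==> \<theta> i : Hom BX (vtx X n (sp i) F2) (Dom BX (rg_d (R i)))" "!!i. i < n ==> iso BX (\<theta> i)"
   "!!i. i < n ==> rg_d (R i) *** \<theta> i = fk_d (fid X n i one1 F2)" "!!i. i < n ==> rg_c (R i) *** \<theta> i = fk_c (fid X n i one1 F2)" by metis
 have unit: "Id BX x *** fk_d (fid X n i one1 F2) = fk_d (fid X n i one1 F2)" "Id BX x *** fk_c (fid X n i one1 F2) = fk_c (fid X n i one1 F2)" if i: "i < n" for i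
 proof -
  have "rg_d (R i) : Hom BX (Dom BX (rg_d (R i))) x" "rg_c (R i) : Hom BX (Dom BX (rg_d (R i))) x"
   using E.eqrelD(1-4)[OF EC.ERel_onD(1)[OF Ri[OF i]]] EC.ERel_onD(2)[OF Ri[OF i]] by (auto simp: Hom_def)
  from E.Hom_unit(2)[OF E.Hom_cmp[OF \<theta>(1)[OF i] this(1)]] E.Hom_unit(2)[OF E.Hom_cmp[OF \<theta>(1)[OF i] this(2)]]
  show "Id BX x *** fk_d (fid X n i one1 F2) = fk_d (fid X n i one1 F2)" "Id BX x *** fk_c (fid X n i one1 F2) = fk_c (fid X n i one1 F2)"
   unfolding \<theta>(3,4)[OF i] .
 qed
 obtain K u where u: "u : Hom (FK n) F2 K" "iso (FK n) u" "component_at n one1 u = Id BX x"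
  "!!i. i < n ==> rg_edge X n i (fob (grph_n n) K) = R i" "vtx X n one1 K = x"
 proof (rule edge_transport[OF oF2 n, where \<phi> = "Id BX x" and x = x and R = R and \<theta> = \<theta>])
  show "Id BX x : Hom BX (vtx X n one1 F2) x" unfolding x2 by (rule E.Hom_Id[OF xO])
  show "iso BX (Id BX x)" by (rule E.iso_Id[OF xO])
  show "rg_d (R i) *** \<theta> i = Id BX x *** fk_d (fid X n i one1 F2)" "rg_c (R i) *** \<theta> i = Id BX x *** fk_c (fid X n i one1 F2)" if "i < n" for i
   unfolding unit[OF that] \<theta>(3,4)[OF that] by (rule refl)+
 qed (use Ri \<theta>(1,2) in blast)+
 obtain u' where u': "u' : Hom (FK n) K F2" "Comp (FK n) u' u = Id (FK n) F2" "Comp (FK n) u u' = Id (FK n) K"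
  using C.iso_inverse[OF u(2,1)] by blast
 have "iso (FK n) u'" by (rule C.isoI[of u' u]) (use u u' in \<open>auto simp: Hom_def\<close>)
 from lex_iso[OF this] have lK: "lex X n K" using F2(1) C.HomD[OF u'(1)] by simp
 have rK: "rex X n K" using rex_iso[OF u(2)] rF2 C.HomD[OF u(1)] by simp
 let ?E = "fob (grph_n n) K"
 have E: "?E : Obj (ER n)" by (rule grph_ER[OF lK])
 then have "?E : n_fold_erel_on X n R" unfolding n_fold_erel_on_def using u(4) by blast
 then obtain b where b: "b : Hom (ER n) ?E B" "rg_base_mor n b = Id BX x" using B unfolding is_box_def by blast
 have BO: "B : Obj (ER n)" using B unfolding is_box_def n_fold_erel_on_def by blast
 have bH: "b : Hom (RG n) ?E B" using b(1) full_sub_Hom[OF ER_full] by blast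
 have b1: "rgc n one1 b = Id BX x" using b(2) unfolding rg_base_rgc .
 define v where "v = Comp (FK n) u w"
 have v: "v : Hom (FK n) F K" unfolding v_def by (rule C.Hom_cmp[OF w(1) u(1)])
 define g where "g = fmor (grph_n n) v"
 have g: "g : Hom (RG n) ?G ?E" unfolding g_def by (rule functorD(2)[OF grph_functor v])
 have II: "Id BX x *** Id BX x = Id BX x" by (rule E.Hom_unit(1)[OF E.Hom_Id[OF xO]])
 have o: "ALL j. one1 j : {1, 2}" by simp
 have g1: "rgc n one1 g = Id BX x"
  unfolding g_def grph_comp[OF v o] unfolding v_def component_Comp[OF w(1) u(1)] u(3) w1 by (rule II)
 have \<chi>b: "Comp (RG n) \<chi> b : Hom (RG n) ?E ?G" by (rule R.Hom_cmp[OF bH \<chi>(1)])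
 have g\<chi>: "Comp (RG n) g \<chi> : Hom (RG n) B ?E" by (rule R.Hom_cmp[OF \<chi>(1) g])
 have rvE: "rvtx X n one1 ?E = x"
  using E.HomD(3)[OF rgc_Hom[OF g, of one1]] g1 E.HomD(3)[OF E.Hom_Id[OF xO]] by simp
 have rvB: "rvtx X n one1 B = x"
  using E.HomD(3)[OF rgc_Hom[OF bH, of one1]] b1 E.HomD(3)[OF E.Hom_Id[OF xO]] by simp
 have 1: "Comp (RG n) (Comp (RG n) g \<chi>) b = Id (RG n) ?E"
  by (rule ER_faithful[OF R.Hom_cmp[OF bH g\<chi>] R.Hom_Id[OF ER_RG[OF E]] E E])
   (simp only: rgc_Comp[OF bH g\<chi>] rgc_Comp[OF \<chi>(1) g] b1 g1 \<chi>(4) II rgc_Id[OF ER_RG[OF E]] rvE)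
 have 2: "Comp (RG n) b (Comp (RG n) g \<chi>) = Id (RG n) B"
  by (rule ER_faithful[OF R.Hom_cmp[OF g\<chi> bH] R.Hom_Id[OF ER_RG[OF BO]] BO BO])
   (simp only: rgc_Comp[OF g\<chi> bH] rgc_Comp[OF \<chi>(1) g] b1 g1 \<chi>(4) II rgc_Id[OF ER_RG[OF BO]] rvB)
 have gv: "Comp (RG n) g (Comp (RG n) \<chi> b) = Id (RG n) ?E"
  using 1 R.Hom_assoc[OF bH \<chi>(1) g] by simp
 have vg: "Comp (RG n) (Comp (RG n) \<chi> b) g = Id (RG n) ?G"
 proof -
  have bg: "Comp (RG n) b g : Hom (RG n) ?G B" by (rule R.Hom_cmp[OF g bH])
  have "Comp (RG n) b g = Comp (RG n) (Comp (RG n) b g) (Comp (RG n) \<chi> \<chi>')" unfolding \<chi>(3) by (rule R.Hom_unit(1)[OF bg, symmetric])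
  also have "... = Comp (RG n) (Comp (RG n) (Comp (RG n) b g) \<chi>) \<chi>'" by (rule R.Hom_assoc[OF \<chi>(2,1) bg, symmetric])
  also have "... = \<chi>'" unfolding R.Hom_assoc[OF \<chi>(1) g bH] 2 by (rule R.Hom_unit(2)[OF \<chi>(2)])
  finally show ?thesis unfolding R.Hom_assoc[OF g bH \<chi>(1)] using \<chi>(3) by simp
 qed
 have "iso (FK n) v" by (rule rex_reflect_iso[OF r rK v \<chi>b vg[unfolded g_def] gv[unfolded g_def]])
 from lex_iso[OF this] show ?thesis using lK C.HomD[OF v] by simp
qed

lemma box_imp_exact: assumes F: "F : Obj (FK n)" and n: "n ~= 0" and r: "rex X n F" and dp: "distributive_parallelistic X n (fob (grph_n n) F)"
 shows "lex X n F"
proof -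
 interpret C: CCat "FK n" by (rule FK)
 interpret R: CCat "RG n" by (rule RG)
 interpret ER: CCat "ER n" by (rule ER_CCat)
 let ?G = "fob (grph_n n) F"
 obtain x R B \<psi> where B: "is_box X x n R B" "distributive BX x n R" and \<psi>: "\<psi> : Hom (ER n) ?G B" "iso (ER n) \<psi>"
  using dp unfolding distributive_parallelistic_def isomorphic_def by blast
 obtain \<psi>' where \<psi>': "\<psi>' : Hom (ER n) B ?G" "Comp (ER n) \<psi>' \<psi> = Id (ER n) ?G" "Comp (ER n) \<psi> \<psi>' = Id (ER n) B"
  using ER.iso_inverse[OF \<psi>(2,1)] by blast
 have p: "\<psi> : Hom (RG n) ?G B" "\<psi>' : Hom (RG n) B ?G" using \<psi>(1) \<psi>'(1) full_sub_Hom[OF ER_full] by blast+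
 have i: "Comp (RG n) \<psi>' \<psi> = Id (RG n) ?G" "Comp (RG n) \<psi> \<psi>' = Id (RG n) B" using \<psi>'(2,3) unfolding full_subD(3,4)[OF ER_full] .
 have Ri: "R i : ERel_on BX x" if "i < n" for i using B that unfolding is_box_def by blast
 have eB: "rg_edge X n i B = R i" if "i < n" for i using B that unfolding is_box_def n_fold_erel_on_def by blast
 note O = R.Hom_obj[OF p(1)]
 have rB: "rvtx X n one1 B = x" by (rule edge_vertex[OF O(2) n]) (use eB[of 0] Ri[of 0] n in simp)
 have s: "ALL j. one1 j : {1, 2}" "ALL j. sp i j : {1, 2}" for i using sp_range by auto
 have rG: "rvtx X n one1 ?G = vtx X n one1 F" "rvtx X n (sp i) ?G = vtx X n (sp i) F" for i
  by (rule grph_vtx[OF F s(1)], rule grph_vtx[OF F s(2)])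
 let ?\<phi> = "rgc n one1 \<psi>"
 have \<phi>: "?\<phi> : Hom BX (vtx X n one1 F) x" "iso BX ?\<phi>"
  using rgc_Hom[OF p(1), of one1] rgc_iso[OF p i, of one1] unfolding rG(1) rB by blast+
 obtain F1 u where u: "u : Hom (FK n) F F1" "iso (FK n) u" "component_at n one1 u = ?\<phi>"
  "!!i. i < n ==> rg_edge X n i (fob (grph_n n) F1) = R i" "vtx X n one1 F1 = x"
 proof (rule edge_transport[OF F n \<phi>, where R = R and \<theta> = "%i. rgc n (sp i) \<psi>"])
  fix i assume i': "i < n"
  show "R i : ERel_on BX x" by (rule Ri[OF i'])
  have "Dom BX (rg_d (R i)) = rvtx X n (sp i) B" using edge_Hom[OF O(2) i'] unfolding eB[OF i'] Hom_def by blast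
  then show "rgc n (sp i) \<psi> : Hom BX (vtx X n (sp i) F) (Dom BX (rg_d (R i)))" using rgc_Hom[OF p(1), of "sp i"] rG(2) by simp
  show "iso BX (rgc n (sp i) \<psi>)" by (rule rgc_iso[OF p i])
  show "rg_d (R i) *** rgc n (sp i) \<psi> = ?\<phi> *** fk_d (fid X n i one1 F)" "rg_c (R i) *** rgc n (sp i) \<psi> = ?\<phi> *** fk_c (fid X n i one1 F)"
   using edge_natural[OF p(1) i'] unfolding eB[OF i'] grph_edge[OF F i'] by simp_all
 qed blast
 obtain u' where u': "u' : Hom (FK n) F1 F" "Comp (FK n) u' u = Id (FK n) F" "Comp (FK n) u u' = Id (FK n) F1"
  using C.iso_inverse[OF u(2,1)] by blast
 have F1: "F1 : Obj (FK n)" using C.Hom_obj u(1) by blast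
 have r1: "rex X n F1" using rex_iso[OF u(2)] r C.HomD[OF u(1)] by simp
 let ?u = "fmor (grph_n n) u" and ?u' = "fmor (grph_n n) u'" and ?G1 = "fob (grph_n n) F1"
 note gu = functorD(2)[OF grph_functor u(1)] and gu' = functorD(2)[OF grph_functor u'(1)]
 have uu: "Comp (RG n) ?u ?u' = Id (RG n) ?G1"
  using functorD(4)[OF grph_functor u'(1) u(1)] functorD(3)[OF grph_functor F1] u'(3) by simp
 have "lex X n F1"
 proof (rule box_imp_lex[OF F1 n r1 u(5) u(4) B])
  show "Comp (RG n) ?u \<psi>' : Hom (RG n) B ?G1" by (rule R.Hom_cmp[OF p(2) gu])
  show "Comp (RG n) \<psi> ?u' : Hom (RG n) ?G1 B" by (rule R.Hom_cmp[OF gu' p(1)])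
  have "Comp (RG n) (Comp (RG n) ?u \<psi>') (Comp (RG n) \<psi> ?u') = Comp (RG n) ?u ?u'" by (rule R.cancel_mid[OF gu' p(1,2) gu i(1)])
  then show "Comp (RG n) (Comp (RG n) ?u \<psi>') (Comp (RG n) \<psi> ?u') = Id (RG n) ?G1" unfolding uu .
  have "rgc n one1 (Comp (RG n) ?u \<psi>') = ?\<phi> *** rgc n one1 \<psi>'"
   unfolding rgc_Comp[OF p(2) gu] grph_comp[OF u(1) s(1)] u(3) ..
  then show "rgc n one1 (Comp (RG n) ?u \<psi>') = Id BX x" unfolding rgc_inverse[OF p i(2)] rB .
 qed
 then show ?thesis using lex_iso[OF u(2)] C.HomD[OF u(1)] by simp
qed

lemma exact_iff_box: assumes F: "F : Obj (FK n)" and n: "n ~= 0"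
 shows "exact_n_fork X n F <-> is_CoeqFork_n X n F & distributive_parallelistic X n (fob (grph_n n) F)"
 unfolding is_CoeqFork_iff[OF F] using exact_imp_box[OF F n] box_imp_exact[OF F n] exact_iff[OF F] by blast

end

theorem theorem3p23:
  fixes X :: "('o, 'm) cat" and n :: nat and F :: "('o, 'm) cell"
  assumes "exact_Maltsev X"
    and "n \<ge> 1"
    and "F \<in> Obj (Fork_n X n)"
  shows "(exact_n_fork X n F \<longleftrightarrow>
            is_EqFork_n X n F \<and> cubic_extension X n (fob (arr_n n) F)) \<and>
         (exact_n_fork X n F \<longleftrightarrow>
            is_CoeqFork_n X n F \<and> distributive_parallelistic X n (fob (grph_n n) F)) \<and>
         (exact_n_fork X n F \<longleftrightarrow>
            is_EqFork_n X n F \<and> is_CoeqFork_n X n F)"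
proof -
 interpret EM_tower X by unfold_locales (rule assms(1))
 have "n ~= 0" using assms(2) by simp
 from exact_iff_cubic[OF assms(3,2)] exact_iff_box[OF assms(3) this] exact_iff_both[OF assms(3)]
 show ?thesis by blast
qed

end
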